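(* Let $n\ge2$, let $\tau$ be a triangulation of $\Sigma_n$, the $(n+1)$-gon with one orbifold point of order three, and let $\Lambda=\Lambda(\tau)$. Let $N$ be an indecomposable representation of $\Lambda(\tau)$. Then $N$ is $E_\Lambda$-rigid if and only if $N\cong M(j,\tau)$ for some arc $j$ of $\Sigma_n$.
   Context: $\Sigma_n$ is a closed disk with $n+1$ marked points $v_0,\dots,v_n$ on its boundary (in counterclockwise order) and one orbifold point of order 3 in its interior. An arc is a curve with endpoints at marked points, with no self-intersections except that its endpoints may coincide, which otherwise avoids the marked points and the orbifold point, is not isotopic to a boundary segment, and such that, if it cuts out a monogon, this monogon contains the orbifold point (the arc is then called pending). Arcs are taken up to isotopy relative to marked points and orbifold point, and up to orientation. A triangulation $\tau$ is a maximal collection of arcs pairwise non-crossing outside marked points; it has $n$ arcs, exactly one pending. Cutting along $\tau$ yields the monogon enclosed by the pending arc and three-sided triangles (sides being arcs of $\tau$ or boundary segments); a triangle is internal if its three sides are arcs of $\tau$. The quiver $Q(\tau)$ has the arcs of $\tau$ as vertices; for each three-sided triangle and each two of its sides $i,j\in\tau$ there is an arrow $j\to i$ if $i$ follows $j$ clockwise in the triangle; moreover there is a loop $\varepsilon$ at the pending arc. $\Lambda(\tau)$ is the Jacobian algebra of $Q(\tau)$ with potential $\sum_\Delta c_\Delta b_\Delta a_\Delta+\varepsilon^3$ (sum of the 3-cycles of internal triangles), i.e. the complex path algebra modulo $b_\Delta a_\Delta, c_\Delta b_\Delta,a_\Delta c_\Delta,\varepsilon^2$. Representations $M$ are finite-dimensional,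 with maps $M_a:M_{t(a)}\to M_{h(a)}$. For a representation $N$ of $\Lambda$, $E_\Lambda(N)=\dim\mathrm{Hom}_\Lambda(N,N)+\sum_i\dim(N_i)g_i(N)$ with $g_i(N)=-\dim\mathrm{Hom}_\Lambda(S_i,N)+\dim\mathrm{Ext}^1_\Lambda(S_i,N)$, $S_i$ the simple at vertex $i$; $N$ is $E_\Lambda$-rigid if $E_\Lambda(N)=0$. A decorated representation is a pair $(M,V)$ with $V$ a tuple of vector spaces indexed by vertices; $N$ is identified with $(N,0)$, and $\mathcal S_i^-=(0,S_i)$. Arc representations. Let $\widetilde\Sigma_n$ be the regular $(3n+3)$-gon and $G=\mathbb Z_3$ generated by its rotation by $120^\circ$; $\Sigma_n=\widetilde\Sigma_n/G$, the orbifold point being the image of the center. Let $T$ be the $G$-invariant triangulation of $\widetilde\Sigma_n$ lifting $\tau$, and $Q(T)$ its quiver (vertices the diagonals in $T$, arrows by the same clockwise rule, no loops); then $Q(\tau)=Q(T)/G$, $\varepsilon$ being the orbit of the arrows in the $G$-invariant triangle. For an arc $j\notin\tau$, pick a lift $\alpha$ (a diagonal of $\widetilde\Sigma_n$), orient it, and let $s_0,\dots,s_r$ be the diagonals of $T$ crossed by $\alpha$, in order. For $1\le k\le r$ let $\gamma_k$ be the arrow of $Q(T)$ between $s_{k-1}$ and $s_k$ in the triangle containing both; put $l_k=G\gamma_k$ if $\gamma_k:s_{k-1}\to s_k$ and $l_k=(G\gamma_k)^{-1}$ otherwise. $M(j,\tau)$ has basis $z_0,\dots,z_r$ with $z_k$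 at vertex $Gs_k$; if $l_k=a$ is an arrow then $a z_{k-1}=z_k$, if $l_k=a^{-1}$ then $a z_k=z_{k-1}$, and all other actions of arrows on basis vectors are zero. For $j\in\tau$, $M(j,\tau)=\mathcal S_j^-$. *)

theory Defs
  imports
    "HOL-Analysis.Analysis"
    "HOL-Library.Function_Algebras"
    "Graph_Theory.Digraph"
begin

section \<open>Representations of quivers with relations\<close>

text \<open>
  A relation \<open>(b, a)\<close> stands for the path \<open>b a\<close> (first \<open>a\<close>, then \<open>b\<close>). A representation assigns
  to each vertex a finite-dimensional subspace of an ambient complex vector space, whose scalar
  multiplication is the component \<open>scl\<close>. The values of \<open>spc\<close> at non-vertices, of \<open>mp\<close> at
  non-arrows, and of \<open>mp a\<close> outside \<open>spc (tail a)\<close> carry no information.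
\<close>

type_synonym ('i, 'e) quiver = "('i, 'e) pre_digraph"

record ('i, 'e, 'v) rep =
  scl :: "complex \<Rightarrow> 'v \<Rightarrow> 'v"
  spc :: "'i \<Rightarrow> 'v set"
  mp :: "'e \<Rightarrow> 'v \<Rightarrow> 'v"

definition linear_between ::
  "(complex \<Rightarrow> 'v::ab_group_add \<Rightarrow> 'v) \<Rightarrow> (complex \<Rightarrow> 'w::ab_group_add \<Rightarrow> 'w)
    \<Rightarrow> 'v set \<Rightarrow> 'w set \<Rightarrow> ('v \<Rightarrow> 'w) \<Rightarrow> bool" where
  "linear_between s t V W f \<longleftrightarrow>
     (\<forall>x\<in>V. f x \<in> W) \<and>
     (\<forall>x\<in>V. \<forall>y\<in>V. f (x + y) = f x + f y) \<and>
     (\<forall>c. \<forall>x\<in>V. f (s c x) = t c (f x))"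

definition is_rep ::
  "('i, 'e) quiver \<Rightarrow> ('e \<times> 'e) set \<Rightarrow> ('i, 'e, 'v::ab_group_add) rep \<Rightarrow> bool" where
  "is_rep Q R N \<longleftrightarrow>
     vector_space (scl N) \<and>
     (\<forall>i\<in>verts Q. module.subspace (scl N) (spc N i) \<and>
        (\<exists>B. finite B \<and> spc N i = module.span (scl N) B)) \<and>
     (\<forall>a\<in>arcs Q. linear_between (scl N) (scl N) (spc N (tail Q a)) (spc N (head Q a)) (mp N a)) \<and>
     (\<forall>(b, a)\<in>R. \<forall>x\<in>spc N (tail Q a). mp N b (mp N a x) = 0)"

definition rep_iso ::
  "('i, 'e) quiver \<Rightarrow> ('i, 'e, 'v::ab_group_add) rep \<Rightarrow> ('i, 'e, 'w::ab_group_add) rep \<Rightarrow> bool" where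
  "rep_iso Q M N \<longleftrightarrow>
     (\<exists>\<phi>. (\<forall>i\<in>verts Q. linear_between (scl M) (scl N) (spc M i) (spc N i) (\<phi> i) \<and>
                         bij_betw (\<phi> i) (spc M i) (spc N i)) \<and>
          (\<forall>a\<in>arcs Q. \<forall>x\<in>spc M (tail Q a).
              \<phi> (head Q a) (mp M a x) = mp N a (\<phi> (tail Q a) x)))"

definition zero_rep :: "('i, 'e) quiver \<Rightarrow> ('i, 'e, 'v::ab_group_add) rep \<Rightarrow> bool" where
  "zero_rep Q N \<longleftrightarrow> (\<forall>i\<in>verts Q. spc N i = {0})"

definition subrep ::
  "('i, 'e) quiver \<Rightarrow> ('e \<times> 'e) set \<Rightarrow> ('i, 'e, 'v::ab_group_add) rep
    \<Rightarrow> ('i, 'e, 'v) rep \<Rightarrow> bool" where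
  "subrep Q R U N \<longleftrightarrow>
     (\<exists>S. U = N\<lparr>spc := S\<rparr>) \<and> (\<forall>i\<in>verts Q. spc U i \<subseteq> spc N i) \<and> is_rep Q R U"

definition indecomposable ::
  "('i, 'e) quiver \<Rightarrow> ('e \<times> 'e) set \<Rightarrow> ('i, 'e, 'v::ab_group_add) rep \<Rightarrow> bool" where
  "indecomposable Q R N \<longleftrightarrow>
     \<not> zero_rep Q N \<and>
     (\<forall>U W. subrep Q R U N \<and> subrep Q R W N \<and>
        (\<forall>i\<in>verts Q. spc N i = {u + w |u w. u \<in> spc U i \<and> w \<in> spc W i} \<and>
                      spc U i \<inter> spc W i = {0})
        \<longrightarrow> zero_rep Q U \<or> zero_rep Q W)"

text \<open>
  Families of linear maps are normalised to vanish outside the relevant spaces, so that distinct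
  functions represent distinct families and \<open>vector_space.dim\<close> measures the right dimension.
\<close>

definition linear_family ::
  "('i, 'e) quiver \<Rightarrow> ('i, 'e, 'v::ab_group_add) rep \<Rightarrow> ('i, 'e, 'w::ab_group_add) rep
    \<Rightarrow> ('i \<Rightarrow> 'v \<Rightarrow> 'w) set" where
  "linear_family Q M N =
     {\<phi>. (\<forall>i\<in>verts Q. linear_between (scl M) (scl N) (spc M i) (spc N i) (\<phi> i)) \<and>
         (\<forall>i x. i \<notin> verts Q \<or> x \<notin> spc M i \<longrightarrow> \<phi> i x = 0)}"

definition Hom ::
  "('i, 'e) quiver \<Rightarrow> ('i, 'e, 'v::ab_group_add) rep \<Rightarrow> ('i, 'e, 'w::ab_group_add) rep
    \<Rightarrow> ('i \<Rightarrow> 'v \<Rightarrow> 'w) set" where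
  "Hom Q M N =
     {\<phi> \<in> linear_family Q M N. \<forall>a\<in>arcs Q. \<forall>x\<in>spc M (tail Q a).
         \<phi> (head Q a) (mp M a x) = mp N a (\<phi> (tail Q a) x)}"

definition fam_dim :: "(complex \<Rightarrow> 'w::ab_group_add \<Rightarrow> 'w) \<Rightarrow> ('k \<Rightarrow> 'v \<Rightarrow> 'w) set \<Rightarrow> nat" where
  "fam_dim s F = vector_space.dim (\<lambda>c \<phi> i x. s c (\<phi> i x)) F"

definition dim_Hom ::
  "('i, 'e) quiver \<Rightarrow> ('i, 'e, 'v::ab_group_add) rep \<Rightarrow> ('i, 'e, 'w::ab_group_add) rep \<Rightarrow> nat" where
  "dim_Hom Q M N = fam_dim (scl N) (Hom Q M N)"

text \<open>
  Every short exact sequence \<open>0 \<rightarrow> N \<rightarrow> E \<rightarrow> M \<rightarrow> 0\<close> splits vertexwise, hence is equivalent to one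
  with \<open>E\<close> of the following form, where \<open>f a\<close> maps \<open>M\<close> at the tail of \<open>a\<close> to \<open>N\<close> at the head of \<open>a\<close>.
\<close>

definition ext_rep ::
  "('i, 'e, 'v::ab_group_add) rep \<Rightarrow> ('i, 'e, 'w::ab_group_add) rep \<Rightarrow> ('e \<Rightarrow> 'v \<Rightarrow> 'w)
    \<Rightarrow> ('i, 'e, 'w \<times> 'v) rep" where
  "ext_rep M N f =
     \<lparr>scl = (\<lambda>c (y, x). (scl N c y, scl M c x)),
      spc = (\<lambda>i. spc N i \<times> spc M i),
      mp = (\<lambda>a (y, x). (mp N a y + f a x, mp M a x))\<rparr>"

definition ext_cocycles ::
  "('i, 'e) quiver \<Rightarrow> ('e \<times> 'e) set \<Rightarrow> ('i, 'e, 'v::ab_group_add) rep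
    \<Rightarrow> ('i, 'e, 'w::ab_group_add) rep \<Rightarrow> ('e \<Rightarrow> 'v \<Rightarrow> 'w) set" where
  "ext_cocycles Q R M N =
     {f. (\<forall>a\<in>arcs Q. linear_between (scl M) (scl N) (spc M (tail Q a)) (spc N (head Q a)) (f a)) \<and>
         (\<forall>a x. a \<notin> arcs Q \<or> x \<notin> spc M (tail Q a) \<longrightarrow> f a x = 0) \<and>
         is_rep Q R (ext_rep M N f)}"

text \<open>
  The extensions given by \<open>f\<close> and \<open>f'\<close> are equivalent iff \<open>(y, x) \<mapsto> (y + h i x, x)\<close> is an isomorphism
  between them for some family \<open>h\<close>, i.e. iff \<open>f - f'\<close> is a coboundary.
\<close>

definition ext_coboundaries ::
  "('i, 'e) quiver \<Rightarrow> ('i, 'e, 'v::ab_group_add) rep \<Rightarrow> ('i, 'e, 'w::ab_group_add) rep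
    \<Rightarrow> ('e \<Rightarrow> 'v \<Rightarrow> 'w) set" where
  "ext_coboundaries Q M N =
     {f. \<exists>h\<in>linear_family Q M N. f = (\<lambda>a x.
           if a \<in> arcs Q \<and> x \<in> spc M (tail Q a)
           then h (head Q a) (mp M a x) - mp N a (h (tail Q a) x) else 0)}"

definition dim_Ext1 ::
  "('i, 'e) quiver \<Rightarrow> ('e \<times> 'e) set \<Rightarrow> ('i, 'e, 'v::ab_group_add) rep
    \<Rightarrow> ('i, 'e, 'w::ab_group_add) rep \<Rightarrow> int" where
  "dim_Ext1 Q R M N =
     int (fam_dim (scl N) (ext_cocycles Q R M N)) - int (fam_dim (scl N) (ext_coboundaries Q M N))"

definition simple_rep :: "'i \<Rightarrow> ('i, 'e, complex) rep" where
  "simple_rep i = \<lparr>scl = (*), spc = (\<lambda>k. if k = i then UNIV else {0}), mp = (\<lambda>_ _. 0)\<rparr>"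

definition g_inv ::
  "('i, 'e) quiver \<Rightarrow> ('e \<times> 'e) set \<Rightarrow> ('i, 'e, 'v::ab_group_add) rep \<Rightarrow> 'i \<Rightarrow> int" where
  "g_inv Q R N i = - int (dim_Hom Q (simple_rep i) N) + dim_Ext1 Q R (simple_rep i) N"

definition E_inv ::
  "('i, 'e) quiver \<Rightarrow> ('e \<times> 'e) set \<Rightarrow> ('i, 'e, 'v::ab_group_add) rep \<Rightarrow> int" where
  "E_inv Q R N =
     int (dim_Hom Q N N) + (\<Sum>i\<in>verts Q. int (vector_space.dim (scl N) (spc N i)) * g_inv Q R N i)"

definition E_rigid ::
  "('i, 'e) quiver \<Rightarrow> ('e \<times> 'e) set \<Rightarrow> ('i, 'e, 'v::ab_group_add) rep \<Rightarrow> bool" where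
  "E_rigid Q R N \<longleftrightarrow> E_inv Q R N = 0"

text \<open>In a decorated representation \<open>(M, V)\<close> the spaces \<open>V i\<close> live in the ambient space of \<open>M\<close>.\<close>

type_synonym ('i, 'e, 'v) dec_rep = "('i, 'e, 'v) rep \<times> ('i \<Rightarrow> 'v set)"

definition dec_iso ::
  "('i, 'e) quiver \<Rightarrow> ('i, 'e, 'v::ab_group_add) dec_rep
    \<Rightarrow> ('i, 'e, 'w::ab_group_add) dec_rep \<Rightarrow> bool" where
  "dec_iso Q X Y \<longleftrightarrow>
     rep_iso Q (fst X) (fst Y) \<and>
     (\<forall>i\<in>verts Q. \<exists>f. linear_between (scl (fst X)) (scl (fst Y)) (snd X i) (snd Y i) f \<and>
                      bij_betw f (snd X i) (snd Y i))"

definition undecorated :: "('i, 'e, 'v::ab_group_add) rep \<Rightarrow> ('i, 'e, 'v) dec_rep" where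
  "undecorated N = (N, \<lambda>_. {0})"


section \<open>Arcs and triangulations of the orbifold\<close>

text \<open>
  The surface is the closed unit disk, with orbifold point \<open>0\<close> and with the \<open>(n + 1)\<close>-st roots of
  unity as marked points. A curve is a path \<open>{0..1} \<rightarrow> cball 0 1\<close>; \<open>simple_path\<close> allows the two
  endpoints to coincide.
\<close>

definition marked :: "nat \<Rightarrow> complex set" where
  "marked n = {z. z ^ (n + 1) = 1}"

definition curve :: "nat \<Rightarrow> (real \<Rightarrow> complex) \<Rightarrow> bool" where
  "curve n \<gamma> \<longleftrightarrow>
     simple_path \<gamma> \<and> path_image \<gamma> \<subseteq> cball 0 1 \<and> pathstart \<gamma> \<in> marked n \<and> pathfinish \<gamma> \<in> marked n \<and>
     (\<forall>t\<in>{0<..<1}. \<gamma> t \<notin> marked n \<and> \<gamma> t \<noteq> 0)"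

text \<open>
  Isotopy relative to the marked points and the orbifold point, expressed as a homotopy with fixed
  endpoints whose intermediate paths avoid these points for \<open>0 < t < 1\<close>. The intermediate paths are
  not required to be simple: for simple curves on a surface the two relations coincide (Baer,
  Epstein), and \<open>isotopic\<close> is only used to compare simple curves. The sole other use, in \<open>project\<close>
  below, has a path on the left that may fail to be simple.
\<close>

definition isotopic :: "nat \<Rightarrow> (real \<Rightarrow> complex) \<Rightarrow> (real \<Rightarrow> complex) \<Rightarrow> bool" where
  "isotopic n \<gamma> \<delta> \<longleftrightarrow>
     homotopic_with_canon
       (\<lambda>\<eta>. pathstart \<eta> = pathstart \<gamma> \<and> pathfinish \<eta> = pathfinish \<gamma> \<and>
            (\<forall>t\<in>{0<..<1}. \<eta> t \<notin> marked n \<and> \<eta> t \<noteq> 0))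
       {0..1} (cball 0 1) \<gamma> \<delta>"

definition boundary_segment :: "nat \<Rightarrow> nat \<Rightarrow> real \<Rightarrow> complex" where
  "boundary_segment n k = (\<lambda>t. cis (2 * pi * (real k + t) / (real n + 1)))"

text \<open>
  Only a closed curve cuts out a monogon, and this monogon is the inside of the Jordan curve.
\<close>

definition is_arc :: "nat \<Rightarrow> (real \<Rightarrow> complex) \<Rightarrow> bool" where
  "is_arc n \<gamma> \<longleftrightarrow>
     curve n \<gamma> \<and>
     (\<forall>k. \<not> isotopic n (boundary_segment n k) \<gamma> \<and>
          \<not> isotopic n (boundary_segment n k) (reversepath \<gamma>)) \<and>
     (pathstart \<gamma> = pathfinish \<gamma> \<longrightarrow> 0 \<in> inside (path_image \<gamma>))"

type_synonym arc_class = "(real \<Rightarrow> complex) set"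

definition class_of :: "nat \<Rightarrow> (real \<Rightarrow> complex) \<Rightarrow> arc_class" where
  "class_of n \<gamma> = {\<delta>. curve n \<delta> \<and> (isotopic n \<gamma> \<delta> \<or> isotopic n (reversepath \<gamma>) \<delta>)}"

definition arc_classes :: "nat \<Rightarrow> arc_class set" where
  "arc_classes n = {class_of n \<gamma> |\<gamma>. is_arc n \<gamma>}"

definition noncrossing :: "nat \<Rightarrow> arc_class \<Rightarrow> arc_class \<Rightarrow> bool" where
  "noncrossing n A B \<longleftrightarrow> (\<exists>\<gamma>\<in>A. \<exists>\<delta>\<in>B. path_image \<gamma> \<inter> path_image \<delta> \<subseteq> marked n)"

definition orbifold_triangulation :: "nat \<Rightarrow> arc_class set \<Rightarrow> bool" where
  "orbifold_triangulation n \<tau> \<longleftrightarrow>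
     \<tau> \<subseteq> arc_classes n \<and> pairwise (noncrossing n) \<tau> \<and>
     (\<forall>\<sigma>. \<tau> \<subseteq> \<sigma> \<and> \<sigma> \<subseteq> arc_classes n \<and> pairwise (noncrossing n) \<sigma> \<longrightarrow> \<sigma> = \<tau>)"


section \<open>The covering polygon\<close>

text \<open>
  The regular \<open>(3 n + 3)\<close>-gon has the \<open>(3 n + 3)\<close>-rd roots of unity as vertices, the group
  \<open>\<int>\<^sub>3\<close> acts by multiplication with cube roots of unity, and the quotient map is \<open>z \<mapsto> z ^ 3\<close>.
  A diagonal is the set of its two endpoints. (The image of the polygon under \<open>z ^ 3\<close> is the disk
  up to its boundary segments being pushed inwards; this does not affect isotopy classes.)
\<close>

definition vertices :: "nat \<Rightarrow> complex set" where
  "vertices n = {z. z ^ (3 * n + 3) = 1}"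

definition polygon_sides :: "nat \<Rightarrow> complex set set" where
  "polygon_sides n = {{x, x * cis (2 * pi / (3 * real n + 3))} |x. x \<in> vertices n}"

definition diagonals :: "nat \<Rightarrow> complex set set" where
  "diagonals n = {{x, y} |x y. x \<in> vertices n \<and> y \<in> vertices n \<and> x \<noteq> y} - polygon_sides n"

text \<open>
  The arc whose lifts include the given diagonal; both orientations of the diagonal are allowed for.
  If the diagonal crosses one of its rotated copies or passes through the centre, there is no such
  arc and \<open>project\<close> yields the empty set, which is not an element of \<open>arc_classes\<close>.
\<close>

definition project :: "nat \<Rightarrow> complex set \<Rightarrow> arc_class" where
  "project n d = {\<delta>. \<exists>x y. d = {x, y} \<and> curve n \<delta> \<and> isotopic n (\<lambda>t. linepath x y t ^ 3) \<delta>}"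

definition lifted :: "nat \<Rightarrow> arc_class set \<Rightarrow> complex set set" where
  "lifted n \<tau> = {d \<in> diagonals n. project n d \<in> \<tau>}"

definition ccw :: "complex \<Rightarrow> complex \<Rightarrow> complex \<Rightarrow> bool" where
  "ccw x y z \<longleftrightarrow> Im (cnj (y - x) * (z - x)) > 0"

text \<open>Triangles of the lifted triangulation, with vertices listed counterclockwise.\<close>

definition triangle :: "nat \<Rightarrow> arc_class set \<Rightarrow> complex \<Rightarrow> complex \<Rightarrow> complex \<Rightarrow> bool" where
  "triangle n \<tau> x y z \<longleftrightarrow>
     x \<in> vertices n \<and> y \<in> vertices n \<and> z \<in> vertices n \<and> ccw x y z \<and>
     {{x, y}, {y, z}, {z, x}} \<subseteq> lifted n \<tau> \<union> polygon_sides n"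

text \<open>
  Arrows of the quiver of the lifted triangulation, as pairs (tail, head): in a counterclockwise
  triangle \<open>x, y, z\<close> the side \<open>{x, y}\<close> follows \<open>{y, z}\<close> clockwise.
\<close>

type_synonym lifted_arrow = "complex set \<times> complex set"

definition lifted_arrows :: "nat \<Rightarrow> arc_class set \<Rightarrow> lifted_arrow set" where
  "lifted_arrows n \<tau> =
     {({y, z}, {x, y}) |x y z.
        triangle n \<tau> x y z \<and> {y, z} \<in> lifted n \<tau> \<and> {x, y} \<in> lifted n \<tau>}"

definition orbit :: "lifted_arrow \<Rightarrow> lifted_arrow set" where
  "orbit e = {((*) g ` fst e, (*) g ` snd e) |g. g ^ 3 = 1}"

text \<open>
  The quiver of \<open>\<tau>\<close>, as the quotient of the lifted quiver by \<open>\<int>\<^sub>3\<close>. The orbits of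
  diagonals correspond to the arcs of \<open>\<tau>\<close> via \<open>project\<close>. The triangles cut out by \<open>\<tau>\<close> are the images of the
  triangles that do not contain the centre; the three arrows in the \<open>\<int>\<^sub>3\<close>-invariant triangle form
  a single orbit, which is the loop \<open>\<epsilon>\<close> at the pending arc.
\<close>

definition quiver_of :: "nat \<Rightarrow> arc_class set \<Rightarrow> (arc_class, lifted_arrow set) quiver" where
  "quiver_of n \<tau> =
     \<lparr>verts = \<tau>,
      arcs = orbit ` lifted_arrows n \<tau>,
      tail = (\<lambda>a. the_elem (project n ` fst ` a)),
      head = (\<lambda>a. the_elem (project n ` snd ` a))\<rparr>"

text \<open>
  The Jacobian relations: consecutive arrows in an internal triangle compose to \<open>0\<close>. For the
  \<open>\<int>\<^sub>3\<close>-invariant triangle this is the relation \<open>\<epsilon>\<^sup>2 = 0\<close>; for the others these are the relations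
  \<open>b a\<close>, \<open>c b\<close>, \<open>a c\<close>.
\<close>

definition jacobian_relations ::
  "nat \<Rightarrow> arc_class set \<Rightarrow> (lifted_arrow set \<times> lifted_arrow set) set" where
  "jacobian_relations n \<tau> =
     {(orbit ({x, y}, {z, x}), orbit ({y, z}, {x, y})) |x y z.
        triangle n \<tau> x y z \<and> {{x, y}, {y, z}, {z, x}} \<subseteq> lifted n \<tau>}"


section \<open>Arc representations\<close>

text \<open>
  \<open>crossings n \<tau> x y\<close> lists the diagonals crossed by the diagonal from \<open>x\<close> to \<open>y\<close>, in the
  order of the crossing points along it.
\<close>

definition crossing_time :: "complex \<Rightarrow> complex \<Rightarrow> complex set \<Rightarrow> real" where
  "crossing_time x y s = (THE t. t \<in> {0<..<1} \<and> linepath x y t \<in> convex hull s)"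

definition crossings :: "nat \<Rightarrow> arc_class set \<Rightarrow> complex \<Rightarrow> complex \<Rightarrow> complex set list" where
  "crossings n \<tau> x y =
     sorted_key_list_of_set (crossing_time x y)
       {s \<in> lifted n \<tau>. open_segment x y \<inter> convex hull s \<noteq> {}}"

text \<open>
  The basis vector \<open>z\<^sub>k\<close> is the indicator function of \<open>k\<close>, so \<open>f\<close> below stands for the vector with
  coordinates \<open>f k\<close>. The first summand in \<open>mp\<close> comes from the letters \<open>l\<^sub>k = a\<close>
  (\<open>a z\<^sub>k\<^sub>-\<^sub>1 = z\<^sub>k\<close>), the second one from the letters \<open>l\<^sub>k\<^sub>+\<^sub>1 = a\<^sup>-\<^sup>1\<close> (\<open>a z\<^sub>k\<^sub>+\<^sub>1 = z\<^sub>k\<close>).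
\<close>

definition string_rep ::
  "nat \<Rightarrow> arc_class set \<Rightarrow> complex set list
    \<Rightarrow> (arc_class, lifted_arrow set, nat \<Rightarrow> complex) rep" where
  "string_rep n \<tau> s =
     \<lparr>scl = (\<lambda>c f k. c * f k),
      spc = (\<lambda>i. {f. \<forall>k. f k \<noteq> 0 \<longrightarrow> k < length s \<and> project n (s ! k) = i}),
      mp = (\<lambda>a f k.
        (if 0 < k \<and> k < length s \<and> (s ! (k - 1), s ! k) \<in> lifted_arrows n \<tau> \<and>
            a = orbit (s ! (k - 1), s ! k)
         then f (k - 1) else 0) +
        (if k + 1 < length s \<and> (s ! (k + 1), s ! k) \<in> lifted_arrows n \<tau> \<and>
            a = orbit (s ! (k + 1), s ! k)
         then f (k + 1) else 0))\<rparr>"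

definition negative_simple ::
  "'i \<Rightarrow> ('i, 'e, nat \<Rightarrow> complex) dec_rep" where
  "negative_simple j =
     (\<lparr>scl = (\<lambda>c f k. c * f k), spc = (\<lambda>_. {0}), mp = (\<lambda>_ _. 0)\<rparr>,
      \<lambda>i. {f. \<forall>k. f k \<noteq> 0 \<longrightarrow> k = 0 \<and> i = j})"

definition arc_rep ::
  "nat \<Rightarrow> arc_class set \<Rightarrow> arc_class
    \<Rightarrow> (arc_class, lifted_arrow set, nat \<Rightarrow> complex) dec_rep" where
  "arc_rep n \<tau> j =
     (if j \<in> \<tau> then negative_simple j
      else let (x, y) = (SOME (x, y). {x, y} \<in> diagonals n \<and> project n {x, y} = j)
           in undecorated (string_rep n \<tau> (crossings n \<tau> x y)))"

end

theory Submission
 imports Defs "HOL-Complex_Analysis.Winding_Numbers"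
begin

text \<open>
  An arc lifts along \<open>exp\<close> to a path in a half-plane whose end points \<open>a < b\<close>, counted in marked
  points, determine its class up to a common shift by \<open>n + 1\<close>. Simplicity forces \<open>b - a \<le> n + 1\<close>, and
  two classes can be realised disjointly iff no shifts of their end points interlace. Hence \<open>\<tau>\<close> becomes
  a triangulated polygon whose longest side \<open>root\<close> is the pending arc, i.e. a binary tree.

  Descending this tree, every representation of \<open>\<Lambda>\<close> gets a basis on which each arrow acts as a partial
  injection: in a triangle with \<open>ba = cb = ac = 0\<close> and at the loop with \<open>\<epsilon>\<^sup>2 = 0\<close> one can choose bases
  adapted to the chains of subspaces coming from the triangles already treated. So indecomposables
  are strings: they are given by the diagonals crossing a chord \<open>(k, l)\<close> of the polygon, or by those passing over
  \<open>k\<close> together with a second copy of those passing over \<open>l\<close>, joined by \<open>\<epsilon>\<close>. On a string basis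
  \<open>E\<close> is a count: it vanishes in the first case, and in the second one iff \<open>lo < l \<le> k\<close>, which
  says precisely that the chord from \<open>k\<close> to \<open>l + n + 1\<close> projects to an arc.
\<close>

subsection \<open>Bases adapted to chains of subspaces\<close>

text \<open>Bases at different vertices have to be chosen together, and three lines in a plane show
  that three subspaces may have no common basis. Two chains of subspaces always have one. The
  relations keep the demands within this limit: in the triangle below a chord, a c = 0 puts every
  image under c inside the kernel of a, hence inside every preimage under a, so the conditions
  rising from the two lower sides concatenate into a single chain at the upper side. This one chain
  is all that the triangle above, or the loop, has to respect; the loop needs only this chain and
  its image.

  The count for E is local: one term for each triangle and one for the loop. With a closed form for
  the sum over a subtree, the identity to be checked concerns a single triangle and the positions of
  k and l in it, and the sums telescope. The order of k and l enters through a nilpotent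
  endomorphism that moves one half of the string onto the other; on the topological side the same
  inequality bounds the angle swept by a simple curve.\<close>

lemma (in Vector_Spaces.linear) independent_if_image:
 assumes "vs2.independent (f ` Z)" "inj_on f Z" shows "vs1.independent Z"
proof
 assume "vs1.dependent Z"
 then obtain a where a: "a \<in> Z" "a \<in> vs1.span (Z - {a})" by (auto simp: vs1.dependent_def)
 then have "f a \<in> vs2.span (f ` (Z - {a}))" by (simp add: span_image)
 moreover have "f ` (Z - {a}) = f ` Z - {f a}" using assms(2) a(1) by (auto simp: inj_on_def)
 ultimately show False using assms(1) a(1) by (auto simp: vs2.dependent_def)
qed

locale complex_vector_space = vector_space scl for scl :: "complex \<Rightarrow> 'v::ab_group_add \<Rightarrow> 'v"
begin

text \<open>In a relation on the union the part outside A lies in both spans, hence in the span of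
  the intersection; rewriting it there gives a relation on B alone.\<close>

lemma independent_union:
 assumes "independent A" "independent B" "span A \<inter> span B \<subseteq> span (A \<inter> B)" shows "independent (A \<union> B)"
 unfolding independent_explicit_module
proof (intro allI impI)
 fix t u v
 assume t: "finite t" "t \<subseteq> A \<union> B" "(\<Sum>v\<in>t. scl (u v) v) = 0" "v \<in> t"
 let ?s1 = "\<Sum>v\<in>t \<inter> A. scl (u v) v" and ?s2 = "\<Sum>v\<in>t - A. scl (u v) v"
 have s: "?s1 + ?s2 = 0" using t(3) sum.Int_Diff[OF t(1), of "\<lambda>v. scl (u v) v" A] by simp
 have "?s2 \<in> span B" using t(2) by (intro span_sum span_scale span_base) auto
 moreover have "?s1 \<in> span A" by (intro span_sum span_scale span_base) auto
 moreover have "?s2 = - ?s1" using s by (simp add: eq_neg_iff_add_eq_0 add.commute)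
 ultimately have "?s2 \<in> span (A \<inter> B)" using assms(3) span_neg by auto
 then obtain t3 w where t3: "finite t3" "t3 \<subseteq> A \<inter> B" "?s2 = (\<Sum>v\<in>t3. scl (w v) v)"
  unfolding span_explicit by blast
 \<comment> \<open>\<open>t3\<close> lies in A and \<open>t - A\<close> avoids A, so one coefficient
   function describes both expansions of the second sum, and their difference is a relation in
   B.\<close>
 define c where "c = (\<lambda>v. if v \<in> A then - w v else u v)"
 have "(\<Sum>v\<in>(t - A) \<union> t3. scl (c v) v)
   = (\<Sum>v\<in>t - A. scl (c v) v) + (\<Sum>v\<in>t3. scl (c v) v)" using t t3 by (intro sum.union_disjoint) auto
 also have "(\<Sum>v\<in>t - A. scl (c v) v) = ?s2" by (intro sum.cong) (auto simp: c_def)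
 also have "(\<Sum>v\<in>t3. scl (c v) v) = - (\<Sum>v\<in>t3. scl (w v) v)"
  unfolding sum_negf[symmetric] using t3 by (intro sum.cong) (auto simp: c_def)
 finally have "(\<Sum>v\<in>(t - A) \<union> t3. scl (c v) v) = 0" using t3 by simp
 then have c0: "c v = 0" if "v \<in> t - A" for v
  using independentD[OF assms(2), of "(t - A) \<union> t3" c v] t t3 that by auto
 then have "u v = 0" if "v \<in> t - A" for v using that by (auto simp: c_def)
 moreover from this have "?s2 = 0" by (intro sum.neutral) auto
 then have "?s1 = 0" using s by simp
 then have "u v = 0" if "v \<in> t \<inter> A" for v using independentD[OF assms(1), of "t \<inter> A" u v] t that by auto
 ultimately show "u v = 0" using t(4) by blast
qed

definition chain_of_subspaces :: "'v set set \<Rightarrow> bool" where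
 "chain_of_subspaces \<F> \<longleftrightarrow>
   finite \<F> \<and> (\<forall>F\<in>\<F>. subspace F) \<and> (\<forall>F\<in>\<F>. \<forall>G\<in>\<F>. F \<subseteq> G \<or> G \<subseteq> F)"

text \<open>For a subspace F the reverse inclusion is automatic, so X contains a basis of
  \<open>F \<inter> V\<close> for every member F at once.\<close>

definition adapted :: "'v set set \<Rightarrow> 'v set \<Rightarrow> 'v set \<Rightarrow> bool" where
 "adapted \<F> V X \<longleftrightarrow> independent X \<and> span X = V \<and> (\<forall>F\<in>\<F>. F \<inter> V \<subseteq> span (X \<inter> F))"

lemma adaptedD:
 assumes "adapted \<F> V X"
 shows "independent X" "span X = V" "X \<subseteq> V" "subspace V" "\<And>F. F \<in> \<F> \<Longrightarrow> F \<inter> V \<subseteq> span (X \<inter> F)"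
 using assms span_superset by (auto simp: adapted_def)

lemma adapted_mono: "adapted \<F> V X \<Longrightarrow> \<G> \<subseteq> \<F> \<Longrightarrow> adapted \<G> V X" by (auto simp: adapted_def)

lemma chain_of_subspaces_subset:
 "chain_of_subspaces \<F> \<Longrightarrow> \<G> \<subseteq> \<F> \<Longrightarrow> chain_of_subspaces \<G>"
 unfolding chain_of_subspaces_def by (meson finite_subset subsetD)

lemma chain_of_subspaces_maximal:
 assumes "chain_of_subspaces \<F>" "\<F> \<noteq> {}"
 obtains G where "G \<in> \<F>" "\<And>F. F \<in> \<F> \<Longrightarrow> F \<subseteq> G" "subspace G"
 by (metis finite_has_maximal[of \<F>] assms chain_of_subspaces_def)

lemma chain_of_subspaces_minimal:
 assumes "chain_of_subspaces \<F>" "\<F> \<noteq> {}"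
 obtains G where "G \<in> \<F>" "\<And>F. F \<in> \<F> \<Longrightarrow> G \<subseteq> F" by (metis finite_has_minimal[of \<F>] assms chain_of_subspaces_def)

lemma extend_to_basis:
 assumes "subspace V" "independent Y" "Y \<subseteq> V"
 obtains X where "Y \<subseteq> X" "independent X" "span X = V"
 by (metis maximal_independent_subset_extend assms span_subspace)

text \<open>Every other member lies in the largest one, G, so it is dealt with inside
  \<open>V \<inter> G\<close>. The union with Y stays independent because the two spans meet only in
  \<open>U \<inter> G\<close>, which \<open>Y \<inter> G\<close> spans; completing to a basis of V
  then keeps all inclusions.\<close>

lemma extend_adapted:
 assumes "chain_of_subspaces \<F>" "subspace V" "U \<subseteq> V" "adapted \<F> U Y" shows "\<exists>X. Y \<subseteq> X \<and> adapted \<F> V X"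
 using assms
proof (induction "card \<F>" arbitrary: \<F> U V Y)
 case 0
 then have "\<F> = {}" by (simp add: chain_of_subspaces_def)
 moreover obtain X where "Y \<subseteq> X" "independent X" "span X = V"
  using extend_to_basis[of V Y] 0 adaptedD[OF 0(5)] by (metis order_trans)
 ultimately show ?case by (auto simp: adapted_def)
next
 case (Suc k)
 then have "\<F> \<noteq> {}" by auto
 then obtain G where G: "G \<in> \<F>" "\<And>F. F \<in> \<F> \<Longrightarrow> F \<subseteq> G" "subspace G"
  using chain_of_subspaces_maximal Suc by metis
 let ?F = "\<F> - {G}"
 note Y = adaptedD[OF Suc.prems(4)]
 have Y': "span (Y \<inter> G) = U \<inter> G"
  using Y(5)[OF G(1)] span_mono[of "Y \<inter> G" Y] span_minimal[of "Y \<inter> G" G] G(3) Y(2) by auto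
 have "adapted ?F (U \<inter> G) (Y \<inter> G)" unfolding adapted_def
 proof (intro conjI ballI)
  show "independent (Y \<inter> G)" using Y(1) independent_mono by blast
  fix F assume F: "F \<in> ?F"
  then have "Y \<inter> G \<inter> F = Y \<inter> F" using G by blast
  then show "F \<inter> (U \<inter> G) \<subseteq> span (Y \<inter> G \<inter> F)" using Y(5)[of F] F by auto
 qed (fact Y')
 moreover have "k = card ?F" "chain_of_subspaces ?F" "subspace (V \<inter> G)"
  using Suc G by (auto simp: chain_of_subspaces_subset subspace_inter)
 ultimately obtain X' where X': "Y \<inter> G \<subseteq> X'" "adapted ?F (V \<inter> G) X'"
  using Suc.hyps(1)[of ?F "V \<inter> G" "U \<inter> G" "Y \<inter> G"] Suc.prems(3) by blast
 note X'' = adaptedD[OF X'(2)]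
 have "span X' \<inter> span Y \<subseteq> span (X' \<inter> Y)"
 proof -
  have "span X' \<inter> span Y \<subseteq> span (Y \<inter> G)" using X''(2) Y(2) Y' by auto
  also have "\<dots> \<subseteq> span (X' \<inter> Y)" using X'(1) by (intro span_mono) auto
  finally show ?thesis .
 qed
 then have "independent (X' \<union> Y)" using independent_union X''(1) Y(1) by blast
 moreover have "X' \<union> Y \<subseteq> V" using X''(3) Y(3) Suc.prems(3) by auto
 ultimately obtain X where X: "X' \<union> Y \<subseteq> X" "independent X" "span X = V"
  using extend_to_basis[OF Suc.prems(2)] by metis
 have "F \<inter> V \<subseteq> span (X \<inter> F)" if F: "F \<in> \<F>" for F
 proof (cases "F = G")
  case True
  have "F \<inter> V = span X'" using X'' True by auto
  also have "\<dots> \<subseteq> span (X \<inter> F)" using X''(3) X True by (intro span_mono) auto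
  finally show ?thesis .
 next
  case False
  have "F \<inter> V = F \<inter> (V \<inter> G)" using G F by auto
  also have "\<dots> \<subseteq> span (X' \<inter> F)" using X''(5) F False by auto
  also have "\<dots> \<subseteq> span (X \<inter> F)" using X by (intro span_mono) auto
  finally show ?thesis .
 qed
 then show ?case using X by (auto simp: adapted_def)
qed

lemma adapted_exists:
 assumes "chain_of_subspaces \<F>" "subspace V" shows "\<exists>X. adapted \<F> V X"
proof -
 have "adapted \<F> {0} {}" using assms by (auto simp: adapted_def independent_empty)
 then show ?thesis using extend_adapted[OF assms, of "{0}" "{}"] subspace_0[OF assms(2)] by auto
qed

text \<open>With the largest member G of the second chain removed, the induction hypothesis serves
  \<open>V \<inter> G\<close> for both chains. The extension from there to V has only the first
  chain to respect, since all members of the second lie in G.\<close>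

lemma adapted_two_chains:
 assumes "chain_of_subspaces \<F>" "chain_of_subspaces \<G>" "subspace V" shows "\<exists>X. adapted (\<F> \<union> \<G>) V X"
 using assms
proof (induction "card \<G>" arbitrary: \<G> V)
 case 0
 then have "\<G> = {}" by (simp add: chain_of_subspaces_def)
 then show ?case using adapted_exists 0 by auto
next
 case (Suc k)
 then have "\<G> \<noteq> {}" by auto
 then obtain G where G: "G \<in> \<G>" "\<And>F. F \<in> \<G> \<Longrightarrow> F \<subseteq> G" "subspace G"
  using chain_of_subspaces_maximal Suc by metis
 have "k = card (\<G> - {G})" "chain_of_subspaces (\<G> - {G})" "subspace (V \<inter> G)"
  using Suc G by (auto simp: chain_of_subspaces_subset subspace_inter)
 then obtain X' where X': "adapted (\<F> \<union> (\<G> - {G})) (V \<inter> G) X'"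
  using Suc.hyps(1)[of "\<G> - {G}" "V \<inter> G"] Suc.prems by blast
 note X'' = adaptedD[OF X']
 obtain X where X: "X' \<subseteq> X" "adapted \<F> V X"
  using extend_adapted[OF Suc.prems(1,3), of "V \<inter> G" X'] adapted_mono[OF X', of \<F>] by auto
 have "F \<inter> V \<subseteq> span (X \<inter> F)" if F: "F \<in> \<G>" for F
 proof -
  have "F \<inter> V \<subseteq> span (X' \<inter> F)"
  proof (cases "F = G")
   case True
   then have "X' \<inter> F = X'" using X'' by auto
   then show ?thesis using X''(2) True by auto
  next
   case False
   have "F \<inter> V = F \<inter> (V \<inter> G)" using G F by auto
   then show ?thesis using X''(5)[of F] F False by auto
  qed
  also have "\<dots> \<subseteq> span (X \<inter> F)" using X by (intro span_mono) auto
  finally show ?thesis .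
 qed
 then have "adapted (\<F> \<union> \<G>) V X" using X(2) unfolding adapted_def by blast
 then show ?case by blast
qed

lemma chain_of_subspaces_image:
 assumes "chain_of_subspaces \<F>" "Vector_Spaces.linear scl scl f" "subspace V"
 shows "chain_of_subspaces ((\<lambda>F. f ` (F \<inter> V)) ` \<F>)"
proof -
 interpret f: Vector_Spaces.linear scl scl f by fact
 have "\<forall>F\<in>\<F>. subspace (f ` (F \<inter> V))"
  using assms by (auto simp: chain_of_subspaces_def intro!: f.subspace_image subspace_inter)
 moreover have "f ` (F \<inter> V) \<subseteq> f ` (G \<inter> V) \<or> f ` (G \<inter> V) \<subseteq> f ` (F \<inter> V)" if "F \<in> \<F>" "G \<in> \<F>" for F G
  using assms(1) that unfolding chain_of_subspaces_def by (metis Int_mono image_mono order_refl)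
 ultimately show ?thesis using assms(1) by (simp add: chain_of_subspaces_def)
qed

text \<open>A basis of the kernel is joined with preimages of a basis of the image. The preimage of
  w is taken in the smallest member of the chain whose image contains w, so it lies in every member
  that contains a preimage of w at all.\<close>

lemma adapted_lift:
 assumes "Vector_Spaces.linear scl scl f" "subspace V" "chain_of_subspaces \<F>"
  and Y: "adapted \<F> (V \<inter> {x. f x = 0}) Y" and W: "adapted ((\<lambda>F. f ` (F \<inter> V)) ` \<F>) (f ` V) W"
 obtains Z where "Z \<subseteq> V" "f ` Z = W" "inj_on f Z" "adapted \<F> V (Y \<union> Z)"
proof -
 interpret f: Vector_Spaces.linear scl scl f by fact
 note Y' = adaptedD[OF Y] and W' = adaptedD[OF W]
 have "\<exists>z\<in>V. f z = w \<and> (\<forall>F\<in>\<F>. w \<in> f ` (F \<inter> V) \<longrightarrow> z \<in> F)" if "w \<in> W" for w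
 proof (cases "{F\<in>\<F>. w \<in> f ` (F \<inter> V)} = {}")
  case True
  then show ?thesis using W'(3) that by blast
 next
  case False
  have "chain_of_subspaces {F\<in>\<F>. w \<in> f ` (F \<inter> V)}" by (rule chain_of_subspaces_subset[OF assms(3)]) simp
  then obtain G where "G \<in> {F\<in>\<F>. w \<in> f ` (F \<inter> V)}"
    "\<And>F. F \<in> {F\<in>\<F>. w \<in> f ` (F \<inter> V)} \<Longrightarrow> G \<subseteq> F" by (rule chain_of_subspaces_minimal[OF _ False]) (rule that)
  then show ?thesis by blast
 qed
 then obtain g where g: "\<And>w. w \<in> W \<Longrightarrow> g w \<in> V" "\<And>w. w \<in> W \<Longrightarrow> f (g w) = w"
   "\<And>w F. w \<in> W \<Longrightarrow> F \<in> \<F> \<Longrightarrow> w \<in> f ` (F \<inter> V) \<Longrightarrow> g w \<in> F" by metis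
 let ?Z = "g ` W"
 have "f ` ?Z = (\<lambda>w. w) ` W" unfolding image_image using g(2) by (intro image_cong) auto
 then have fZ: "f ` ?Z = W" by simp
 have inj: "inj_on f ?Z" using g(2) by (auto simp: inj_on_def)
 have injs: "inj_on f (span ?Z)" using f.inj_on_span_independent_image[of ?Z] fZ inj W'(1) by auto
 have indZ: "independent ?Z" by (rule f.independent_if_image) (use fZ inj W'(1) in simp_all)
 have "span Y \<inter> span ?Z \<subseteq> span (Y \<inter> ?Z)"
 proof
  fix z assume z: "z \<in> span Y \<inter> span ?Z"
  then have "f z = 0" using Y'(2) by auto
  then have "z = 0" using injs z span_zero[of ?Z] f.zero by (auto simp: inj_on_def)
  then show "z \<in> span (Y \<inter> ?Z)" by (simp add: span_zero)
 qed
 then have ind: "independent (Y \<union> ?Z)" using independent_union Y'(1) indZ by blast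
 \<comment> \<open>Subtracting a combination of the chosen preimages moves v into the kernel;
   \<open>W0\<close> records which preimages are used, so that they can be kept inside a given
   member F.\<close>
 have aux: "\<exists>u\<in>span (g ` W0). v - u \<in> V \<inter> {x. f x = 0}" if "v \<in> V" "f v \<in> span W0" "W0 \<subseteq> W" for v W0
 proof -
  have "f ` g ` W0 = (\<lambda>w. w) ` W0" unfolding image_image using that g(2) by (intro image_cong) auto
  then have "f ` g ` W0 = W0" by simp
  then have "f v \<in> f ` span (g ` W0)" using that f.span_image[of "g ` W0"] by auto
  then obtain u where u: "u \<in> span (g ` W0)" "f v = f u" by auto
  have "span (g ` W0) \<subseteq> V" using g(1) that assms(2) by (intro span_minimal) auto
  then show ?thesis using u that assms(2) by (intro bexI[of _ u]) (auto simp: f.diff subspace_diff)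
 qed
 have "adapted \<F> V (Y \<union> ?Z)" unfolding adapted_def
 proof (intro conjI ballI ind)
  have "span (Y \<union> ?Z) \<subseteq> V" using g(1) Y'(3) assms(2) by (intro span_minimal) auto
  moreover have "v \<in> span (Y \<union> ?Z)" if "v \<in> V" for v
  proof -
   have "f v \<in> span W" unfolding W'(2) using that by simp
   then obtain u where u: "u \<in> span ?Z" "v - u \<in> span Y"
    using aux[of v W] \<open>v \<in> V\<close> unfolding Y'(2) by (metis order_refl)
   have "(v - u) + u \<in> span (Y \<union> ?Z)" using u span_mono[of Y "Y \<union> ?Z"] span_mono[of ?Z "Y \<union> ?Z"]
    by (intro span_add) auto
   then show ?thesis by simp
  qed
  ultimately show "span (Y \<union> ?Z) = V" by blast
 next
  fix F assume F: "F \<in> \<F>"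
  then have sF: "subspace F" using assms by (auto simp: chain_of_subspaces_def)
  show "F \<inter> V \<subseteq> span ((Y \<union> ?Z) \<inter> F)"
  proof
   fix v assume v: "v \<in> F \<inter> V"
   let ?W0 = "W \<inter> f ` (F \<inter> V)"
   have "f ` (F \<inter> V) \<inter> f ` V \<subseteq> span ?W0" by (rule W'(5)) (use F in simp)
   moreover have "f v \<in> f ` (F \<inter> V) \<inter> f ` V" using v by simp
   ultimately have "f v \<in> span ?W0" by (rule subsetD)
   moreover have "v \<in> V" using v by simp
   ultimately obtain u where u: "u \<in> span (g ` ?W0)" "v - u \<in> V \<inter> {x. f x = 0}"
    using aux[of v ?W0] Int_lower1 by metis
   have gF: "g ` ?W0 \<subseteq> F" using g(3) F by auto
   then have "u \<in> F" using u(1) span_minimal[of "g ` ?W0" F] sF by auto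
   then have "v - u \<in> span (Y \<inter> F)" using Y'(5)[OF F] u v sF by (auto simp: subspace_diff)
   moreover have "u \<in> span (?Z \<inter> F)" using u(1) span_mono[of "g ` ?W0" "?Z \<inter> F"] gF by auto
   ultimately have "(v - u) + u \<in> span ((Y \<union> ?Z) \<inter> F)"
    using span_mono[of "Y \<inter> F" "(Y \<union> ?Z) \<inter> F"] span_mono[of "?Z \<inter> F" "(Y \<union> ?Z) \<inter> F"]
    by (intro span_add) auto
   then show "v \<in> span ((Y \<union> ?Z) \<inter> F)" by simp
  qed
 qed
 then show thesis using that[of ?Z] g(1) fZ inj by auto
qed

end

section \<open>Normal forms for a square-zero map and for a triangle of maps\<close>

context complex_vector_space
begin

text \<open>A partial injection between bases, with 0 for "undefined": in this form an arrow is a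
  set of links between basis vectors.\<close>

definition matches :: "('v \<Rightarrow> 'v) \<Rightarrow> 'v set \<Rightarrow> 'v set \<Rightarrow> bool" where
 "matches f X Y \<longleftrightarrow> f ` X \<subseteq> insert 0 Y \<and> inj_on f {x \<in> X. f x \<noteq> 0}"

lemma disjoint_spans:
 assumes "independent X" "A \<subseteq> X" "B \<subseteq> X" "A \<inter> B = {}" "z \<in> span A" "z \<in> span B" shows "z = 0"
proof -
 obtain t r where t: "finite t" "t \<subseteq> A" "z = (\<Sum>a\<in>t. scl (r a) a)"
  using assms(5) unfolding span_explicit by blast
 obtain t' r' where t': "finite t'" "t' \<subseteq> B" "z = (\<Sum>a\<in>t'. scl (r' a) a)"
  using assms(6) unfolding span_explicit by blast
 define c where "c = (\<lambda>a. if a \<in> A then r a else - r' a)"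
 have "(\<Sum>a\<in>t \<union> t'. scl (c a) a) = (\<Sum>a\<in>t. scl (c a) a) + (\<Sum>a\<in>t'. scl (c a) a)"
  using t t' assms(4) by (intro sum.union_disjoint) auto
 also have "(\<Sum>a\<in>t. scl (c a) a) = z" unfolding t(3) using t(2) by (intro sum.cong) (auto simp: c_def)
 also have "(\<Sum>a\<in>t'. scl (c a) a) = - z" unfolding t'(3) sum_negf[symmetric] using t'(2) assms(4)
  by (intro sum.cong) (auto simp: c_def)
 finally have "(\<Sum>a\<in>t \<union> t'. scl (c a) a) = 0" by simp
 then have "c a = 0" if "a \<in> t" for a
  using independentD[OF assms(1), of "t \<union> t'" c a] t t' assms(2,3) that by auto
 then have "r a = 0" if "a \<in> t" for a using that t(2) by (force simp: c_def)
 then show "z = 0" unfolding t(3) by (intro sum.neutral) auto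
qed

text \<open>The preimage of \<open>{0}\<close> is the kernel. Since X contains a basis of its part
  in V, the remaining vectors of X span a complement, on which f is injective.\<close>

lemma adapted_image:
 assumes "Vector_Spaces.linear scl scl f" "subspace V"
  and X: "adapted ((\<lambda>F. {x. f x \<in> F}) ` insert {0} \<F>) V X"
 shows "adapted \<F> (f ` V) (f ` X - {0})" "inj_on f {x \<in> X. f x \<noteq> 0}"
proof -
 interpret f: Vector_Spaces.linear scl scl f by fact
 note X' = adaptedD[OF X]
 let ?X0 = "{x \<in> X. f x \<noteq> 0}" and ?X1 = "{x \<in> X. f x = 0}"
 have img: "f ` ?X0 = f ` X - {0}" by auto
 have ker: "{x. f x = 0} \<inter> V \<subseteq> span ?X1" using X'(5)[of "{x. f x \<in> {0}}"] by (simp add: Collect_conj_eq)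
 have inj: "inj_on f (span ?X0)"
 proof (subst f.inj_on_iff_eq_0)
  show "\<forall>x\<in>span ?X0. f x = 0 \<longrightarrow> x = 0"
  proof (intro ballI impI)
   fix z assume z: "z \<in> span ?X0" "f z = 0"
   have "span ?X0 \<subseteq> V" using X'(2) span_mono[of ?X0 X] by auto
   then have "z \<in> span ?X1" using z ker by auto
   moreover have "?X0 \<subseteq> X" "?X1 \<subseteq> X" "?X0 \<inter> ?X1 = {}" by auto
   ultimately show "z = 0" using disjoint_spans[OF X'(1)] z(1) by metis
  qed
 qed simp
 then show "inj_on f ?X0" using span_superset inj_on_subset by blast
 show "adapted \<F> (f ` V) (f ` X - {0})" unfolding adapted_def
 proof (intro conjI ballI)
  have "independent ?X0" using X'(1) by (rule independent_mono) auto
  then show "independent (f ` X - {0})" using f.independent_injective_image[OF _ inj] img by simp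
  show "span (f ` X - {0}) = f ` V" using X'(2) by (simp add: f.span_image)
 next
  fix F assume F: "F \<in> \<F>"
  show "F \<inter> f ` V \<subseteq> span ((f ` X - {0}) \<inter> F)"
  proof
   fix w assume w: "w \<in> F \<inter> f ` V"
   then obtain v where v: "v \<in> V" "w = f v" by auto
   have "{x. f x \<in> F} \<inter> V \<subseteq> span (X \<inter> {x. f x \<in> F})" by (rule X'(5)) (use F in simp)
   then have "v \<in> span (X \<inter> {x. f x \<in> F})" using v w by auto
   then have "w \<in> span (f ` (X \<inter> {x. f x \<in> F}))" using v(2) by (simp add: f.span_image)
   then have "w \<in> span (f ` (X \<inter> {x. f x \<in> F}) - {0})" by simp
   moreover have "f ` (X \<inter> {x. f x \<in> F}) - {0} \<subseteq> (f ` X - {0}) \<inter> F" by auto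
   ultimately show "w \<in> span ((f ` X - {0}) \<inter> F)" using span_mono by blast
  qed
 qed
qed

text \<open>Two prescriptions meet at one vertex: Y, given inside the kernel of the outgoing map,
  must be part of the basis, and W, given at the head, must be hit by it. They do not interfere, as
  the first concerns the kernel and the second only preimages of a basis of the image.\<close>

lemma adapted_fill:
 assumes f: "Vector_Spaces.linear scl scl f" and V: "subspace V" and \<F>: "chain_of_subspaces \<F>"
  and U: "U \<subseteq> V" "\<And>x. x \<in> U \<Longrightarrow> f x = 0" "adapted \<F> U Y" and W: "adapted ((\<lambda>F. f ` (F \<inter> V)) ` \<F>) (f ` V) W"
 shows "\<exists>X. Y \<subseteq> X \<and> adapted \<F> V X \<and> matches f X W"
proof -
 interpret f: Vector_Spaces.linear scl scl f by fact
 have "subspace (V \<inter> {x. f x = 0})" using V f.subspace_kernel subspace_inter by blast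
 moreover have "U \<subseteq> V \<inter> {x. f x = 0}" using U by auto
 ultimately obtain Y' where Y': "Y \<subseteq> Y'" "adapted \<F> (V \<inter> {x. f x = 0}) Y'"
  using extend_adapted[OF \<F> _ _ U(3)] by blast
 obtain Z where Z: "Z \<subseteq> V" "f ` Z = W" "inj_on f Z" "adapted \<F> V (Y' \<union> Z)"
  using adapted_lift[OF f V \<F> Y'(2) W] by metis
 have f0: "f y = 0" if "y \<in> Y'" for y using adaptedD(3)[OF Y'(2)] that by auto
 have "inj_on f {x \<in> Y' \<union> Z. f x \<noteq> 0}" by (rule inj_on_subset[OF Z(3)]) (use f0 in auto)
 then have "matches f (Y' \<union> Z) W" using f0 Z(2) by (auto simp: matches_def)
 then show ?thesis using Y'(1) Z(4) by blast
qed

text \<open>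
  A square-zero endomorphism and a chain of subspaces are put into normal form simultaneously: a
  basis of the image adapted to the chain and to its image is extended inside the kernel and lifted.
\<close>

lemma loop_adapted:
 assumes e: "Vector_Spaces.linear scl scl e" and V: "subspace V"
  and "e ` V \<subseteq> V" "\<And>x. x \<in> V \<Longrightarrow> e (e x) = 0" and \<F>: "chain_of_subspaces \<F>"
 obtains X where "adapted \<F> V X" "matches e X X"
proof -
 interpret e: Vector_Spaces.linear scl scl e by fact
 have "subspace (e ` V)" using V e.subspace_image by blast
 then obtain W where W: "adapted (\<F> \<union> (\<lambda>F. e ` (F \<inter> V)) ` \<F>) (e ` V) W"
  using adapted_two_chains[OF \<F> chain_of_subspaces_image[OF \<F> e V]] by blast
 have W1: "adapted \<F> (e ` V) W" and W2: "adapted ((\<lambda>F. e ` (F \<inter> V)) ` \<F>) (e ` V) W"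
  using adapted_mono[OF W] by blast+
 have "e x = 0" if "x \<in> e ` V" for x using assms(4) that by auto
 then obtain X where X: "W \<subseteq> X" "adapted \<F> V X" "matches e X W"
  using adapted_fill[OF e V \<F> assms(3) _ W1 W2] by blast
 then show thesis using that[of X] by (auto simp: matches_def)
qed

lemma chain_of_subspaces_vimage:
 assumes "chain_of_subspaces \<F>" "Vector_Spaces.linear scl scl f"
 shows "chain_of_subspaces ((\<lambda>F. {x. f x \<in> F}) ` \<F>)"
proof -
 interpret f: Vector_Spaces.linear scl scl f by fact
 have "\<forall>F\<in>\<F>. subspace {x. f x \<in> F}"
  using assms(1) by (auto simp: chain_of_subspaces_def intro: f.subspace_linear_preimage)
 moreover have "{x. f x \<in> F} \<subseteq> {x. f x \<in> G} \<or> {x. f x \<in> G} \<subseteq> {x. f x \<in> F}" if "F \<in> \<F>" "G \<in> \<F>" for F G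
 proof -
  have "F \<subseteq> G \<or> G \<subseteq> F" using assms(1) that unfolding chain_of_subspaces_def by metis
  then show ?thesis by blast
 qed
 ultimately show ?thesis using assms(1) by (simp add: chain_of_subspaces_def)
qed

lemma chain_of_subspaces_Un:
 assumes "chain_of_subspaces \<F>" "chain_of_subspaces \<G>" and "\<And>F G. F \<in> \<F> \<Longrightarrow> G \<in> \<G> \<Longrightarrow> F \<subseteq> G"
 shows "chain_of_subspaces (\<F> \<union> \<G>)" using assms unfolding chain_of_subspaces_def by (metis UnE finite_Un)

text \<open>The chains on Q and R become demands on P: preimages under a and images under c. As
  \<open>a (c x) = 0\<close>, every image lies in the kernel of a and so in every preimage, and the
  union is again a chain. A basis of P adapted to it yields bases of the image of a and of the image
  of c. The other two relations put the image of a into the kernel of b and the image of b into the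
  kernel of c, where the bases are extended.\<close>

lemma triangle_adapted:
 assumes a: "Vector_Spaces.linear scl scl a" and b: "Vector_Spaces.linear scl scl b"
  and c: "Vector_Spaces.linear scl scl c" and P: "subspace P" and Q: "subspace Q" and R: "subspace R"
  and im: "a ` P \<subseteq> Q" "b ` Q \<subseteq> R" "c ` R \<subseteq> P" and ba: "\<And>x. x \<in> P \<Longrightarrow> b (a x) = 0"
  and cb: "\<And>x. x \<in> Q \<Longrightarrow> c (b x) = 0" and ac: "\<And>x. x \<in> R \<Longrightarrow> a (c x) = 0"
  and \<Q>: "chain_of_subspaces \<Q>" and \<R>: "chain_of_subspaces \<R>"
 obtains \<P> where "chain_of_subspaces \<P>"
  "\<And>X. adapted \<P> P X \<Longrightarrow>
    \<exists>Y Z. adapted \<Q> Q Y \<and> adapted \<R> R Z \<and> matches a X Y \<and> matches b Y Z \<and> matches c Z X"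
proof -
 interpret a: Vector_Spaces.linear scl scl a by fact
 interpret b: Vector_Spaces.linear scl scl b by fact
 interpret c: Vector_Spaces.linear scl scl c by fact
 \<comment> \<open>\<open>UNIV\<close> contributes the whole image of c and \<open>{0}\<close> the
   kernel of a, so that X splits along both.\<close>
 let ?\<C> = "(\<lambda>F. c ` (F \<inter> R)) ` insert UNIV \<R>" and ?\<A> = "(\<lambda>F. {x. a x \<in> F}) ` insert {0} \<Q>"
 have \<R>': "chain_of_subspaces (insert UNIV \<R>)" using \<R> by (auto simp: chain_of_subspaces_def)
 have \<Q>': "chain_of_subspaces (insert {0} \<Q>)" using \<Q> subspace_0 by (auto simp: chain_of_subspaces_def)
 have chC: "chain_of_subspaces ?\<C>" using chain_of_subspaces_image[OF \<R>' c R] .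
 have chA: "chain_of_subspaces ?\<A>" using chain_of_subspaces_vimage[OF \<Q>' a] .
 have "F \<subseteq> G" if "F \<in> ?\<C>" "G \<in> ?\<A>" for F G
 proof
  fix x assume "x \<in> F"
  moreover obtain F' where "F = c ` (F' \<inter> R)" using \<open>F \<in> ?\<C>\<close> by (rule imageE)
  ultimately have "a x = 0" using ac by auto
  moreover have "0 \<in> H" if "H \<in> insert {0} \<Q>" for H
   using \<Q>' that subspace_0 by (auto simp: chain_of_subspaces_def)
  moreover obtain H where "H \<in> insert {0} \<Q>" "G = {x. a x \<in> H}" using \<open>G \<in> ?\<A>\<close> by (rule imageE)
  ultimately show "x \<in> G" by simp
 qed
 then have ch: "chain_of_subspaces (?\<C> \<union> ?\<A>)" by (rule chain_of_subspaces_Un[OF chC chA])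
 moreover have "\<exists>Y Z. adapted \<Q> Q Y \<and> adapted \<R> R Z \<and> matches a X Y \<and> matches b Y Z \<and> matches c Z X"
  if X: "adapted (?\<C> \<union> ?\<A>) P X" for X
 proof -
  have XA: "adapted ?\<A> P X" and XC: "adapted ?\<C> P X" using adapted_mono[OF X] by blast+
  let ?Y1 = "a ` X - {0}" and ?X1 = "X \<inter> c ` R"
  have Y1: "adapted \<Q> (a ` P) ?Y1" and injX: "inj_on a {x \<in> X. a x \<noteq> 0}"
   using adapted_image[OF a P XA] by auto
  have X1: "adapted ((\<lambda>F. c ` (F \<inter> R)) ` \<R>) (c ` R) ?X1" unfolding adapted_def
  proof (intro conjI ballI)
   show "independent ?X1" using adaptedD(1)[OF X] by (rule independent_mono) auto
   have "c ` R \<inter> P \<subseteq> span ?X1" using adaptedD(5)[OF XC, of "c ` (UNIV \<inter> R)"] by simp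
   then show "span ?X1 = c ` R" using im(3) R c.subspace_image[of R] span_minimal[of ?X1 "c ` R"] by auto
  next
   fix F assume F: "F \<in> (\<lambda>F. c ` (F \<inter> R)) ` \<R>"
   then have FR: "F \<subseteq> c ` R" by auto
   have "F \<inter> P \<subseteq> span (X \<inter> F)" using adaptedD(5)[OF XC, of F] F by blast
   moreover have "F \<inter> c ` R \<subseteq> F \<inter> P" using FR im(3) by auto
   moreover have "X \<inter> F = ?X1 \<inter> F" using FR by auto
   ultimately show "F \<inter> c ` R \<subseteq> span (?X1 \<inter> F)" by (metis order_trans)
  qed
  have "subspace (b ` Q)" using Q b.subspace_image by blast
  then obtain W where W: "adapted (\<R> \<union> (\<lambda>F. b ` (F \<inter> Q)) ` \<Q>) (b ` Q) W"
   using adapted_two_chains[OF \<R> chain_of_subspaces_image[OF \<Q> b Q]] by blast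
  have W1: "adapted \<R> (b ` Q) W" and W2: "adapted ((\<lambda>F. b ` (F \<inter> Q)) ` \<Q>) (b ` Q) W"
   using adapted_mono[OF W] by blast+
  have "b x = 0" if "x \<in> a ` P" for x using ba that by auto
  then obtain Y where Y: "?Y1 \<subseteq> Y" "adapted \<Q> Q Y" "matches b Y W"
   using adapted_fill[OF b Q \<Q> im(1) _ Y1 W2] by blast
  have "c x = 0" if "x \<in> b ` Q" for x using cb that by auto
  then obtain Z where Z: "W \<subseteq> Z" "adapted \<R> R Z" "matches c Z ?X1"
   using adapted_fill[OF c R \<R> im(2) _ W1 X1] by blast
  have "matches a X Y" using Y(1) injX by (auto simp: matches_def)
  moreover have "matches b Y Z" using Y(3) Z(1) by (auto simp: matches_def)
  moreover have "matches c Z X" using Z(3) by (auto simp: matches_def)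
  ultimately show ?thesis using Y(2) Z(2) by blast
 qed
 ultimately show thesis using that by blast
qed

end

subsection \<open>Representations with a string basis\<close>

context complex_vector_space
begin

lemma family_coeff_eq:
 assumes "finite K" "inj_on b K" "independent (b ` K)"
  and "(\<Sum>k\<in>K. scl (c k) (b k)) = (\<Sum>k\<in>K. scl (d k) (b k))" "k \<in> K" shows "c k = d k"
proof -
 have "(\<Sum>k\<in>K. scl (c k - d k) (b k)) = 0" using assms(4) by (simp add: scale_left_diff_distrib sum_subtractf)
 moreover have "(\<Sum>k\<in>K. scl (c k - d k) (b k))
   = (\<Sum>v\<in>b ` K. scl (c (inv_into K b v) - d (inv_into K b v)) v)" using assms(2) by (simp add: sum.reindex)
 ultimately have "c (inv_into K b (b k)) - d (inv_into K b (b k)) = 0"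
  using independentD[OF assms(3), of "b ` K" "\<lambda>v. c (inv_into K b v) - d (inv_into K b v)" "b k"]
   assms(1,5) by simp
 then show ?thesis using assms(2,5) by simp
qed

lemma family_coeff_0:
 assumes "finite K" "inj_on b K" "independent (b ` K)" "(\<Sum>k\<in>K. scl (c k) (b k)) = 0" "k \<in> K" shows "c k = 0"
 using family_coeff_eq[OF assms(1-3), of c "\<lambda>_. 0"] assms(4,5) by simp

lemma span_family:
 assumes "finite K" "inj_on b K" shows "span (b ` K) = {\<Sum>k\<in>K. scl (c k) (b k) |c. True}"
proof -
 have "(\<Sum>v\<in>b ` K. scl (u v) v) = (\<Sum>k\<in>K. scl ((u \<circ> b) k) (b k))" for u
  using assms(2) by (simp add: sum.reindex)
 then have "span (b ` K) \<subseteq> {\<Sum>k\<in>K. scl (c k) (b k) |c. True}"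
  using assms(1) unfolding span_finite[OF finite_imageI[OF assms(1)]] by blast
 moreover have "(\<Sum>k\<in>K. scl (c k) (b k)) \<in> span (b ` K)" for c by (intro span_sum span_scale span_base) auto
 ultimately show ?thesis by blast
qed

lemma family_independent:
 assumes "finite K" "\<And>c. (\<Sum>k\<in>K. scl (c k) (b k)) = 0 \<Longrightarrow> \<forall>k\<in>K. c k = 0"
 shows "inj_on b K" "independent (b ` K)"
proof -
 show inj: "inj_on b K"
 proof (rule inj_onI, rule ccontr)
  fix k l assume kl: "k \<in> K" "l \<in> K" "b k = b l" "k \<noteq> l"
  let ?c = "\<lambda>m. if m = k then 1 else if m = l then - 1 else (0 :: complex)"
  have "(\<Sum>m\<in>K. scl (?c m) (b m)) = (\<Sum>m\<in>{k, l}. scl (?c m) (b m))"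
   using kl assms(1) by (intro sum.mono_neutral_right) auto
  also have "\<dots> = 0" using kl by simp
  finally have "?c k = 0" using assms(2)[of ?c] kl(1) by blast
  then show False by simp
 qed
 show "independent (b ` K)"
 proof (rule independent_if_scalars_zero)
  fix u x assume u: "(\<Sum>v\<in>b ` K. scl (u v) v) = 0" "x \<in> b ` K"
  then have "(\<Sum>k\<in>K. scl (u (b k)) (b k)) = 0" using inj by (simp add: sum.reindex)
  then show "u x = 0" using assms(2)[of "u \<circ> b"] u(2) by auto
 qed (use assms(1) in simp)
qed

text \<open>The last two assumptions pin F down as the span of the family. The dimensions of Hom and
  Ext below are all computed in this way, from an explicit parametrisation by coefficients.\<close>

lemma dim_parametrized:
 assumes "finite K" "\<And>c. (\<Sum>k\<in>K. scl (c k) (b k)) = 0 \<Longrightarrow> \<forall>k\<in>K. c k = 0"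
  and "\<And>c. (\<Sum>k\<in>K. scl (c k) (b k)) \<in> F" "\<And>x. x \<in> F \<Longrightarrow> \<exists>c. x = (\<Sum>k\<in>K. scl (c k) (b k))" shows "dim F = card K"
proof -
 note b = family_independent[OF assms(1,2)]
 have F: "F = span (b ` K)"
 proof
  show "F \<subseteq> span (b ` K)"
  proof
   fix x assume "x \<in> F"
   then obtain c where "x = (\<Sum>k\<in>K. scl (c k) (b k))" using assms(4) by blast
   then show "x \<in> span (b ` K)" by (simp add: span_sum span_scale span_base)
  qed
  show "span (b ` K) \<subseteq> F" using equalityD1[OF span_family[OF assms(1) b(1)]] assms(3) by blast
 qed
 then have "dim F = card (b ` K)" using b(2) by (simp add: dim_eq_card_independent)
 then show ?thesis using b(1) by (simp add: card_image)
qed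

end

text \<open>The structure on families of maps with respect to which \<open>fam_dim\<close>
  measures.\<close>

lemma complex_vector_space_function:
 assumes "complex_vector_space s" shows "complex_vector_space (\<lambda>c \<phi> i x. s c (\<phi> i x))"
proof -
 interpret complex_vector_space s by fact
 show ?thesis by unfold_locales (simp_all add: fun_eq_iff scale_right_distrib scale_left_distrib)
qed

text \<open>Extending from a basis of V gives a globally linear map that agrees with f on V; this
  makes the theory of linear maps applicable to \<open>mp\<close>, which is controlled only on the
  space at the tail.\<close>

lemma linear_between_extend:
 assumes "complex_vector_space s" "complex_vector_space t" "module.subspace s V"
  and f: "linear_between s t V W f" shows "\<exists>g. Vector_Spaces.linear s t g \<and> (\<forall>x\<in>V. g x = f x)"
proof -
 interpret s: complex_vector_space s by fact
 interpret t: complex_vector_space t by fact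
 interpret p: vector_space_pair s t by unfold_locales
 obtain B where B: "B \<subseteq> V" "s.independent B" "V \<subseteq> s.span B" using s.maximal_independent_subset by blast
 obtain g where g: "Vector_Spaces.linear s t g" "\<forall>x\<in>B. g x = f x"
  using p.linear_independent_extend[OF B(2)] by blast
 interpret g: Vector_Spaces.linear s t g by fact
 have f0: "f 0 = 0" using f s.subspace_0[OF assms(3)] s.scale_zero_left[of 0] t.scale_zero_left
  unfolding linear_between_def by metis
 have "s.subspace {x \<in> V. g x = f x}" unfolding s.subspace_def using f f0 assms(3) g.add g.scale g.zero
  by (auto simp: linear_between_def s.subspace_def)
 then have "s.span B \<subseteq> {x \<in> V. g x = f x}" using B(1) g(2) by (intro s.span_minimal) auto
 then show ?thesis using g(1) B(3) by blast
qed

lemma linear_betweenI: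
 assumes "Vector_Spaces.linear s t g" "\<And>x. x \<in> V \<Longrightarrow> g x \<in> W" and "\<And>x. x \<in> V \<Longrightarrow> f x = g x" "module.subspace s V"
 shows "linear_between s t V W f"
proof -
 interpret g: Vector_Spaces.linear s t g by fact
 have "x + y \<in> V" "s c x \<in> V" if "x \<in> V" "y \<in> V" for x y c
  using assms(4) that by (auto simp: g.vs1.subspace_add g.vs1.subspace_scale)
 then show ?thesis using assms by (auto simp: linear_between_def g.add g.scale)
qed

lemma linear_between_sum:
 assumes "complex_vector_space s" "complex_vector_space t" "module.subspace s V"
  and "linear_between s t V W f" "finite K" "\<And>k. k \<in> K \<Longrightarrow> b k \<in> V"
 shows "f (\<Sum>k\<in>K. s (c k) (b k)) = (\<Sum>k\<in>K. t (c k) (f (b k)))"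
proof -
 interpret s: complex_vector_space s by fact
 obtain g where g: "Vector_Spaces.linear s t g" "\<And>x. x \<in> V \<Longrightarrow> g x = f x"
  using linear_between_extend[OF assms(1-4)] by blast
 interpret g: Vector_Spaces.linear s t g by fact
 have "(\<Sum>k\<in>K. s (c k) (b k)) \<in> V" using assms by (intro s.subspace_sum s.subspace_scale) auto
 then show ?thesis using g(2) assms(6) by (simp flip: g(2) add: g.sum g.scale)
qed

text \<open>The combinatorics \<open>(J, w, \<rho>)\<close> is kept apart from the vectors b: J
  indexes the basis, w gives the vertex and \<open>\<rho> a\<close> is a partial injection on
  indices. Representations with the same combinatorics can then be compared, and invariants read off
  from it alone.\<close>

locale string_model = complex_vector_space "scl N"
 for Q :: "('i, 'e) quiver" and N :: "('i, 'e, 'v::ab_group_add) rep"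
  and J :: "'j set" and w :: "'j \<Rightarrow> 'i" and \<rho> :: "'e \<Rightarrow> 'j \<Rightarrow> 'j option" and b :: "'j \<Rightarrow> 'v" +
 assumes fin: "finite J" and w_verts: "k \<in> J \<Longrightarrow> w k \<in> verts Q"
  and inj: "i \<in> verts Q \<Longrightarrow> inj_on b {k \<in> J. w k = i}"
  and indep: "i \<in> verts Q \<Longrightarrow> independent (b ` {k \<in> J. w k = i})"
  and span: "i \<in> verts Q \<Longrightarrow> span (b ` {k \<in> J. w k = i}) = spc N i"
  and act: "a \<in> arcs Q \<Longrightarrow> k \<in> J \<Longrightarrow> w k = tail Q a \<Longrightarrow>
   mp N a (b k) = (case \<rho> a k of None \<Rightarrow> 0 | Some l \<Rightarrow> b l)"
  and \<rho>_mem: "a \<in> arcs Q \<Longrightarrow> k \<in> J \<Longrightarrow> w k = tail Q a \<Longrightarrow> \<rho> a k = Some l \<Longrightarrow> l \<in> J \<and> w l = head Q a"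
  and \<rho>_inj: "a \<in> arcs Q \<Longrightarrow> k \<in> J \<Longrightarrow> w k = tail Q a \<Longrightarrow> k' \<in> J \<Longrightarrow> w k' = tail Q a \<Longrightarrow>
   \<rho> a k = Some l \<Longrightarrow> \<rho> a k' = Some l \<Longrightarrow> k = k'"
begin

abbreviation fibre :: "'i \<Rightarrow> 'j set" where "fibre i \<equiv> {k \<in> J. w k = i}"

lemma finite_fibre [simp]: "finite (fibre i)" using fin by simp

lemma b_mem: "k \<in> J \<Longrightarrow> b k \<in> spc N (w k)" using span[OF w_verts] span_base[of "b k" "b ` fibre (w k)"] by auto

lemma subspace_spc: "i \<in> verts Q \<Longrightarrow> subspace (spc N i)" using span subspace_span by metis

lemma spc_eq: "i \<in> verts Q \<Longrightarrow> spc N i = {\<Sum>k\<in>fibre i. scl N (c k) (b k) |c. True}"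
 unfolding span[symmetric] by (rule span_family[OF finite_fibre inj])

lemma coeff_0:
 assumes "i \<in> verts Q" "(\<Sum>k\<in>fibre i. scl N (c k) (b k)) = 0" "k \<in> fibre i" shows "c k = 0"
 using family_coeff_0[OF finite_fibre inj[OF assms(1)] indep[OF assms(1)] assms(2,3)] .

lemma dim_spc: "i \<in> verts Q \<Longrightarrow> dim (spc N i) = card (fibre i)"
 by (simp flip: span add: dim_eq_card_independent indep card_image inj)

end

text \<open>Basis vectors with equal index are matched; the two composites with an arrow are linear
  and agree on the basis.\<close>

lemma string_model_iso:
 assumes N: "string_model Q N J w \<rho> b" and M: "string_model Q M J w \<rho> b'"
  and N': "\<And>a. a \<in> arcs Q \<Longrightarrow> linear_between (scl N) (scl N) (spc N (tail Q a)) (spc N (head Q a)) (mp N a)"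
  and M': "\<And>a. a \<in> arcs Q \<Longrightarrow> linear_between (scl M) (scl M) (spc M (tail Q a)) (spc M (head Q a)) (mp M a)"
  and tails: "\<And>a. a \<in> arcs Q \<Longrightarrow> tail Q a \<in> verts Q" and heads: "\<And>a. a \<in> arcs Q \<Longrightarrow> head Q a \<in> verts Q"
 shows "rep_iso Q N M"
proof -
 interpret N: string_model Q N J w \<rho> b by fact
 interpret M: string_model Q M J w \<rho> b' by fact
 interpret p: vector_space_pair "scl N" "scl M" by unfold_locales
 have "\<exists>g. Vector_Spaces.linear (scl N) (scl M) g \<and> (\<forall>k\<in>N.fibre i. g (b k) = b' k)" if i: "i \<in> verts Q" for i
 proof -
  obtain g where g: "Vector_Spaces.linear (scl N) (scl M) g"
   "\<forall>x\<in>b ` N.fibre i. g x = (b' \<circ> inv_into (N.fibre i) b) x"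
   using p.linear_independent_extend[OF N.indep[OF i]] by metis
  then show ?thesis using N.inj[OF i] by auto
 qed
 then obtain \<phi> where \<phi>: "\<And>i. i \<in> verts Q \<Longrightarrow> Vector_Spaces.linear (scl N) (scl M) (\<phi> i)"
  "\<And>i k. i \<in> verts Q \<Longrightarrow> k \<in> J \<Longrightarrow> w k = i \<Longrightarrow> \<phi> i (b k) = b' k" by (metis (mono_tags, lifting) mem_Collect_eq)
 have img: "\<phi> i ` b ` N.fibre i = b' ` M.fibre i" if "i \<in> verts Q" for i
  unfolding image_image using \<phi>(2)[OF that] by (intro image_cong) auto
 have bij: "bij_betw (\<phi> i) (spc N i) (spc M i)" if i: "i \<in> verts Q" for i
 proof -
  interpret g: Vector_Spaces.linear "scl N" "scl M" "\<phi> i" using \<phi>(1)[OF i] .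
  have "inj_on (\<phi> i) (b ` N.fibre i)" using \<phi>(2)[OF i] M.inj[OF i] by (auto simp: inj_on_def)
  then have "inj_on (\<phi> i) (spc N i)"
   using g.inj_on_span_independent_image[of "b ` N.fibre i"] img[OF i] M.indep[OF i] N.span[OF i] by simp
  moreover have "\<phi> i ` spc N i = spc M i"
   using img[OF i] N.span[OF i] M.span[OF i] g.span_image[of "b ` N.fibre i"] by simp
  ultimately show ?thesis by (simp add: bij_betw_def)
 qed
 have lb: "linear_between (scl N) (scl M) (spc N i) (spc M i) (\<phi> i)" if i: "i \<in> verts Q" for i
  by (rule linear_betweenI[OF \<phi>(1)[OF i]]) (use bij[OF i] N.subspace_spc[OF i] in \<open>auto simp: bij_betw_def\<close>)
 have "\<phi> (head Q a) (mp N a x) = mp M a (\<phi> (tail Q a) x)"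
  if a: "a \<in> arcs Q" and x: "x \<in> spc N (tail Q a)" for a x
 proof -
  obtain g where g: "Vector_Spaces.linear (scl N) (scl N) g"
    "\<And>x. x \<in> spc N (tail Q a) \<Longrightarrow> g x = mp N a x"
   using linear_between_extend[OF _ _ N.subspace_spc[OF tails[OF a]] N'[OF a]]
    N.complex_vector_space_axioms by blast
  obtain h where h: "Vector_Spaces.linear (scl M) (scl M) h"
    "\<And>x. x \<in> spc M (tail Q a) \<Longrightarrow> h x = mp M a x"
   using linear_between_extend[OF _ _ M.subspace_spc[OF tails[OF a]] M'[OF a]]
    M.complex_vector_space_axioms by blast
  have l1: "Vector_Spaces.linear (scl N) (scl M) (\<phi> (head Q a) \<circ> g)"
   using Vector_Spaces.linear_compose g(1) \<phi>(1)[OF heads[OF a]] by blast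
  have l2: "Vector_Spaces.linear (scl N) (scl M) (h \<circ> \<phi> (tail Q a))"
   using Vector_Spaces.linear_compose h(1) \<phi>(1)[OF tails[OF a]] by blast
  interpret gh: Vector_Spaces.linear "scl N" "scl M" "\<phi> (head Q a)" using \<phi>(1)[OF heads[OF a]] .
  have "(\<phi> (head Q a) \<circ> g) x = (h \<circ> \<phi> (tail Q a)) x"
  proof (rule p.linear_eq_on[OF l1 l2])
   show "x \<in> N.span (b ` N.fibre (tail Q a))" using x N.span tails a by simp
   fix v assume "v \<in> b ` N.fibre (tail Q a)"
   then obtain k where k: "v = b k" "k \<in> J" "w k = tail Q a" by blast
   have "g v = mp N a v" using g(2) k N.b_mem[of k] by simp
   moreover have "h (b' k) = mp M a (b' k)" using h(2) k M.b_mem[of k] by simp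
   ultimately show "(\<phi> (head Q a) \<circ> g) v = (h \<circ> \<phi> (tail Q a)) v"
    using k N.act[OF a k(2,3)] M.act[OF a k(2,3)] \<phi>(2)[OF tails[OF a] k(2,3)]
     N.\<rho>_mem[OF a k(2,3)] \<phi>(2)[OF heads[OF a]] gh.zero by (auto split: option.splits)
  qed
  moreover have "\<phi> (tail Q a) x \<in> spc M (tail Q a)" using bij[OF tails[OF a]] x by (auto simp: bij_betw_def)
  ultimately show ?thesis using g(2)[OF x] h(2) by simp
 qed
 then show ?thesis unfolding rep_iso_def using lb bij by blast
qed

text \<open>The converse comparison: the basis of M is pulled back along the isomorphism.\<close>

lemma string_model_transfer:
 assumes iso: "rep_iso Q N M" and M: "string_model Q M J w \<rho> b'"
  and vs: "vector_space (scl N)" and sub: "\<And>i. i \<in> verts Q \<Longrightarrow> module.subspace (scl N) (spc N i)"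
  and N': "\<And>a x. a \<in> arcs Q \<Longrightarrow> x \<in> spc N (tail Q a) \<Longrightarrow> mp N a x \<in> spc N (head Q a)"
  and tails: "\<And>a. a \<in> arcs Q \<Longrightarrow> tail Q a \<in> verts Q" and heads: "\<And>a. a \<in> arcs Q \<Longrightarrow> head Q a \<in> verts Q"
 obtains b where "string_model Q N J w \<rho> b"
proof -
 interpret N: complex_vector_space "scl N" using vs by (simp add: complex_vector_space_def)
 interpret M: string_model Q M J w \<rho> b' by fact
 obtain \<phi> where \<phi>: "\<And>i. i \<in> verts Q \<Longrightarrow> linear_between (scl N) (scl M) (spc N i) (spc M i) (\<phi> i)"
  "\<And>i. i \<in> verts Q \<Longrightarrow> bij_betw (\<phi> i) (spc N i) (spc M i)"
  "\<And>a x. a \<in> arcs Q \<Longrightarrow> x \<in> spc N (tail Q a) \<Longrightarrow> \<phi> (head Q a) (mp N a x) = mp M a (\<phi> (tail Q a) x)"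
  using iso unfolding rep_iso_def by blast
 define b where "b = (\<lambda>k. inv_into (spc N (w k)) (\<phi> (w k)) (b' k))"
 have b: "b k \<in> spc N i" "\<phi> i (b k) = b' k" if "k \<in> J" "w k = i" for k i
  using that bij_betw_inv_into_right[OF \<phi>(2)[OF M.w_verts[OF that(1)]] M.b_mem[OF that(1)]]
   bij_betw_imp_surj_on[OF \<phi>(2)[OF M.w_verts[OF that(1)]]] M.b_mem[OF that(1)]
  by (auto simp: b_def intro: inv_into_into)
 have injw: "inj_on (\<phi> i) (spc N i)" if "i \<in> verts Q" for i using \<phi>(2)[OF that] by (simp add: bij_betw_def)
 have img: "\<phi> i ` b ` M.fibre i = b' ` M.fibre i" for i
  unfolding image_image using b(2) by (intro image_cong) auto
 have injb: "inj_on b (M.fibre i)" if "i \<in> verts Q" for i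
 proof (rule inj_onI)
  fix k l assume "k \<in> M.fibre i" "l \<in> M.fibre i" "b k = b l"
  then show "k = l" using b(2)[of k i] b(2)[of l i] M.inj[OF that] by (auto simp: inj_on_def)
 qed
 have bsub: "b ` M.fibre i \<subseteq> spc N i" for i using b(1) by auto
 have ext: "\<exists>g. Vector_Spaces.linear (scl N) (scl M) g \<and> (\<forall>x\<in>spc N i. g x = \<phi> i x)" if "i \<in> verts Q" for i
  using linear_between_extend[OF N.complex_vector_space_axioms M.complex_vector_space_axioms sub[OF that] \<phi>(1)[OF that]] .
 have ind: "N.independent (b ` M.fibre i) \<and> N.span (b ` M.fibre i) = spc N i" if i: "i \<in> verts Q" for i
 proof -
  obtain g where g: "Vector_Spaces.linear (scl N) (scl M) g" "\<forall>x\<in>spc N i. g x = \<phi> i x"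
   using ext[OF i] by blast
  interpret g: Vector_Spaces.linear "scl N" "scl M" g by fact
  have gimg: "g ` b ` M.fibre i = b' ` M.fibre i"
   using image_cong[of "b ` M.fibre i" _ g "\<phi> i"] g(2) bsub[of i] img[of i] by (simp add: subset_iff)
  have "inj_on g (spc N i)" using injw[OF i] g(2) by (auto simp: inj_on_def)
  have "N.independent (b ` M.fibre i)"
  proof (rule g.independent_if_image)
   show "M.independent (g ` b ` M.fibre i)" using gimg M.indep[OF i] by simp
   show "inj_on g (b ` M.fibre i)" using \<open>inj_on g (spc N i)\<close> bsub inj_on_subset by blast
  qed
  moreover have sp: "N.span (b ` M.fibre i) \<subseteq> spc N i" using bsub sub[OF i] by (rule N.span_minimal)
  moreover have "x \<in> N.span (b ` M.fibre i)" if x: "x \<in> spc N i" for x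
  proof -
   have "g x \<in> spc M i" using g(2) x \<phi>(2)[OF i] by (auto simp: bij_betw_def)
   then have "g x \<in> g ` N.span (b ` M.fibre i)" using M.span[OF i] gimg g.span_image by metis
   then obtain y where "y \<in> N.span (b ` M.fibre i)" "g x = g y" by blast
   then show ?thesis using \<open>inj_on g (spc N i)\<close> sp x by (auto simp: inj_on_def)
  qed
  ultimately show ?thesis by blast
 qed
 have "string_model Q N J w \<rho> b"
 proof (unfold_locales, goal_cases)
  case 1 then show ?case by (rule M.fin)
 next
  case (2 k) then show ?case by (rule M.w_verts)
 next
  case (3 i) then show ?case by (rule injb)
 next
  case (4 i) then show ?case using ind by blast
 next
  case (5 i) then show ?case using ind by blast
 next
  case (6 a k)
  have h: "head Q a \<in> verts Q" using heads 6 by blast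
  have bk: "b k \<in> spc N (tail Q a)" using b(1) 6 by simp
  have "\<phi> (head Q a) (mp N a (b k)) = mp M a (b' k)" using \<phi>(3)[OF 6(1) bk] b(2)[OF 6(2,3)] by simp
  also have "\<dots> = (case \<rho> a k of None \<Rightarrow> 0 | Some l \<Rightarrow> b' l)" using M.act[OF 6] .
  also have "\<dots> = \<phi> (head Q a) (case \<rho> a k of None \<Rightarrow> 0 | Some l \<Rightarrow> b l)"
  proof (cases "\<rho> a k")
   case None
   obtain g where "Vector_Spaces.linear (scl N) (scl M) g" "\<forall>x\<in>spc N (head Q a). g x = \<phi> (head Q a) x"
    using ext[OF h] by blast
   then have "\<phi> (head Q a) 0 = 0"
    using N.subspace_0[OF sub[OF h]] by (metis Vector_Spaces.linear.axioms(3) module_hom.zero)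
   then show ?thesis using None by simp
  next
   case (Some l)
   then show ?thesis using b(2) M.\<rho>_mem[OF 6] by simp
  qed
  finally have eq: "\<phi> (head Q a) (mp N a (b k)) = \<phi> (head Q a) (case \<rho> a k of None \<Rightarrow> 0 | Some l \<Rightarrow> b l)" .
  have "(case \<rho> a k of None \<Rightarrow> 0 | Some l \<Rightarrow> b l) \<in> spc N (head Q a)"
   using N.subspace_0[OF sub[OF h]] b(1) M.\<rho>_mem[OF 6] by (auto split: option.splits)
  then show ?case using inj_onD[OF injw[OF h] eq] N'[OF 6(1) bk] by blast
 next
  case (7 a k l) then show ?case using M.\<rho>_mem by blast
 next
  case (8 a k k' l) then show ?case using M.\<rho>_inj by blast
 qed
 then show thesis by (rule that)
qed

subsection \<open>Triangulated polygons\<close>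

text \<open>
  A pair \<open>(i, j)\<close> stands for the diagonal joining the vertices \<open>i\<close> and \<open>j\<close> of a polygon with vertices
  \<open>lo, \<dots>, hi\<close>; the side \<open>(lo, hi)\<close> counts as a diagonal, the sides \<open>(i, i + 1)\<close> do not. The triangle
  below a diagonal has its third vertex at the \<open>apex\<close>.
\<close>

type_synonym chord = "int \<times> int"

definition encloses :: "chord \<Rightarrow> chord \<Rightarrow> bool" where
 "encloses x y \<longleftrightarrow> fst x \<le> fst y \<and> snd y \<le> snd x"

text \<open>Maximality of a triangulation is present as the existence of the root and of a triangle
  below every chord. A child \<open>lft x\<close> or \<open>rgt x\<close> that is a side of the
  polygon is not in D and ends its branch of the tree.\<close>

locale polygon_triangulation =
 fixes D :: "chord set" and lo hi :: int
 assumes root_mem: "(lo, hi) \<in> D" and bounds: "(i, j) \<in> D \<Longrightarrow> lo \<le> i \<and> i + 2 \<le> j \<and> j \<le> hi"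
  and noncross: "(i, j) \<in> D \<Longrightarrow> (k, l) \<in> D \<Longrightarrow> i < k \<Longrightarrow> k < j \<Longrightarrow> j < l \<Longrightarrow> False" and apex_ex: "(i, j) \<in> D \<Longrightarrow>
   \<exists>m. i < m \<and> m < j \<and> ((i, m) \<in> D \<or> m = i + 1) \<and> ((m, j) \<in> D \<or> j = m + 1)"
begin

abbreviation root :: chord where "root \<equiv> (lo, hi)"

definition apex :: "chord \<Rightarrow> int" where
 "apex x = (SOME m. fst x < m \<and> m < snd x \<and> ((fst x, m) \<in> D \<or> m = fst x + 1) \<and>
           ((m, snd x) \<in> D \<or> snd x = m + 1))"

definition lft :: "chord \<Rightarrow> chord" where "lft x = (fst x, apex x)"

definition rgt :: "chord \<Rightarrow> chord" where "rgt x = (apex x, snd x)"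

lemma fst_lft [simp]: "fst (lft x) = fst x" and snd_lft [simp]: "snd (lft x) = apex x"
 and fst_rgt [simp]: "fst (rgt x) = apex x" and snd_rgt [simp]: "snd (rgt x) = snd x"
 by (simp_all add: lft_def rgt_def)

lemma apex:
 assumes "x \<in> D" shows "fst x < apex x" "apex x < snd x" "lft x \<in> D \<or> apex x = fst x + 1"
  "rgt x \<in> D \<or> snd x = apex x + 1"
proof -
 have "\<exists>m. fst x < m \<and> m < snd x \<and> ((fst x, m) \<in> D \<or> m = fst x + 1) \<and>
     ((m, snd x) \<in> D \<or> snd x = m + 1)" using apex_ex[of "fst x" "snd x"] assms by simp
 from someI_ex[OF this] show "fst x < apex x" "apex x < snd x" "lft x \<in> D \<or> apex x = fst x + 1"
  "rgt x \<in> D \<or> snd x = apex x + 1" unfolding apex_def[symmetric] lft_def rgt_def by auto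
qed

lemma noncross':
 assumes "x \<in> D" "y \<in> D" "fst x < fst y" "fst y < snd x" "snd x < snd y" shows False
 using noncross[of "fst x" "snd x" "fst y" "snd y"] assms by simp

lemma chord_bounds:
 assumes "x \<in> D" shows "lo \<le> fst x" "fst x + 2 \<le> snd x" "snd x \<le> hi"
 using bounds[of "fst x" "snd x"] assms by auto

lemma finite_D: "finite D" by (rule finite_subset[of _ "{lo..hi} \<times> {lo..hi}"])
  (use chord_bounds in force, simp)

lemma encloses_refl [simp]: "encloses x x" and encloses_trans: "encloses x y \<Longrightarrow> encloses y z \<Longrightarrow> encloses x z"
 and encloses_root: "x \<in> D \<Longrightarrow> encloses root x" using chord_bounds[of x] by (auto simp: encloses_def)

lemma encloses_lft [simp]: "x \<in> D \<Longrightarrow> encloses x (lft x)" and encloses_rgt [simp]: "x \<in> D \<Longrightarrow> encloses x (rgt x)"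
 using apex[of x] by (auto simp: encloses_def)

lemma not_encloses_lft [simp]: "x \<in> D \<Longrightarrow> \<not> encloses (lft x) x"
 and not_encloses_rgt [simp]: "x \<in> D \<Longrightarrow> \<not> encloses (rgt x) x" using apex[of x] by (auto simp: encloses_def)

lemma encloses_lft_rgt_False:
 "y \<in> D \<Longrightarrow> encloses (lft x) y \<Longrightarrow> encloses (rgt x) y \<Longrightarrow> False"
 using chord_bounds[of y] by (auto simp: encloses_def)

text \<open>A chord below x that straddles the apex would cross a side of the triangle below x,
  unless it shares both ends with x. Hence enclosure within D is the descendant relation of the
  tree.\<close>

lemma encloses_cases:
 assumes "x \<in> D" "y \<in> D" "encloses x y"
 obtains "y = x" | "lft x \<in> D" "encloses (lft x) y" | "rgt x \<in> D" "encloses (rgt x) y"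
proof -
 note a = apex[OF assms(1)] and b = chord_bounds[OF assms(2)]
 consider "snd y \<le> apex x" | "apex x \<le> fst y" | "fst y < apex x" "apex x < snd y" by linarith
 then show thesis
 proof cases
  case 1
  then have "lft x \<in> D" using a b assms(3) by (auto simp: encloses_def)
  then show ?thesis using that(2) 1 assms(3) by (auto simp: encloses_def)
 next
  case 2
  then have "rgt x \<in> D" using a b assms(3) by (auto simp: encloses_def)
  then show ?thesis using that(3) 2 assms(3) by (auto simp: encloses_def)
 next
  case 3
  have "fst y = fst x"
  proof (rule ccontr)
   assume "fst y \<noteq> fst x"
   then have "fst x < fst y" using assms(3) by (auto simp: encloses_def)
   then have "lft x \<in> D" using a(3) 3 by auto
   then show False using noncross'[of "lft x" y] assms(2) \<open>fst x < fst y\<close> 3 by auto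
  qed
  moreover have "snd y = snd x"
  proof (rule ccontr)
   assume "snd y \<noteq> snd x"
   then have "snd y < snd x" using assms(3) by (auto simp: encloses_def)
   then have "rgt x \<in> D" using a(4) 3 by auto
   then show False using noncross'[of y "rgt x"] assms(2) \<open>snd y < snd x\<close> 3 by auto
  qed
  ultimately show ?thesis using that(1) by (simp add: prod_eq_iff)
 qed
qed

lemma chord_induct [consumes 1, case_names chord]:
 assumes "x \<in> D" and "\<And>x. x \<in> D \<Longrightarrow> (lft x \<in> D \<Longrightarrow> P (lft x)) \<Longrightarrow> (rgt x \<in> D \<Longrightarrow> P (rgt x)) \<Longrightarrow> P x" shows "P x"
 using assms(1)
proof (induction "nat (snd x - fst x)" arbitrary: x rule: less_induct)
 case less
 show ?case
 proof (rule assms(2)[OF less.prems])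
  show "P (lft x)" if "lft x \<in> D" by (rule less.hyps[OF _ that]) (use apex(1,2)[OF less.prems] in auto)
  show "P (rgt x)" if "rgt x \<in> D" by (rule less.hyps[OF _ that]) (use apex(1,2)[OF less.prems] in auto)
 qed
qed

text \<open>Induction along the path of the tree from x down to y; P is carried only through chords
  that still enclose y.\<close>

lemma descend_encloses:
 assumes "x \<in> D" "y \<in> D" "encloses x y" "P x"
  and "\<And>z. z \<in> D \<Longrightarrow> encloses x z \<Longrightarrow> encloses z y \<Longrightarrow> P z \<Longrightarrow> lft z \<in> D \<Longrightarrow> encloses (lft z) y \<Longrightarrow> P (lft z)"
  and "\<And>z. z \<in> D \<Longrightarrow> encloses x z \<Longrightarrow> encloses z y \<Longrightarrow> P z \<Longrightarrow> rgt z \<in> D \<Longrightarrow> encloses (rgt z) y \<Longrightarrow> P (rgt z)"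
 shows "P y" using assms
proof (induction x rule: chord_induct)
 case (chord x)
 from chord(1,4,5) show ?case
 proof (cases rule: encloses_cases)
  case 1
  then show ?thesis using chord by simp
 next
  case 2
  show ?thesis
  proof (rule chord(2))
   show "P (lft x)" using chord(7)[of x] chord 2 by auto
  qed (use 2 chord encloses_trans[OF encloses_lft[OF chord(1)]] in auto)
 next
  case 3
  show ?thesis
  proof (rule chord(3))
   show "P (rgt x)" using chord(8)[of x] chord 3 by auto
  qed (use 3 chord encloses_trans[OF encloses_rgt[OF chord(1)]] in auto)
 qed
qed

text \<open>The arrows of the quiver of the triangulation, clockwise in each triangle.\<close>

definition edges :: "(chord \<times> chord) set" where
 "edges = {(x, rgt x) |x. x \<in> D \<and> rgt x \<in> D} \<union> {(lft x, x) |x. x \<in> D \<and> lft x \<in> D} \<union>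
   {(rgt x, lft x) |x. x \<in> D \<and> lft x \<in> D \<and> rgt x \<in> D}"

lemma edges_cases:
 assumes "(u, v) \<in> edges"
 obtains (down) "u \<in> D" "v \<in> D" "v = rgt u"
 | (up) "u \<in> D" "v \<in> D" "u = lft v"
 | (across) x where "x \<in> D" "u \<in> D" "v \<in> D" "u = rgt x" "v = lft x" using assms unfolding edges_def by blast

lemma edges_mem: "(u, v) \<in> edges \<Longrightarrow> u \<in> D \<and> v \<in> D" by (auto elim: edges_cases)

lemma edgesI:
 "x \<in> D \<Longrightarrow> rgt x \<in> D \<Longrightarrow> (x, rgt x) \<in> edges"
 "x \<in> D \<Longrightarrow> lft x \<in> D \<Longrightarrow> (lft x, x) \<in> edges"
 "x \<in> D \<Longrightarrow> lft x \<in> D \<Longrightarrow> rgt x \<in> D \<Longrightarrow> (rgt x, lft x) \<in> edges" unfolding edges_def by blast+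

text \<open>The arrows inside the subtree at x are the three of the triangle below x and those
  inside one of the two smaller subtrees; every recursion over the tree that involves arrows rests
  on this.\<close>

lemma edges_encloses_cases:
 assumes "x \<in> D" "(u, v) \<in> edges" "encloses x u" "encloses x v"
 obtains "rgt x \<in> D" "u = x" "v = rgt x"
 | "lft x \<in> D" "u = lft x" "v = x"
 | "lft x \<in> D" "rgt x \<in> D" "u = rgt x" "v = lft x"
 | "lft x \<in> D" "encloses (lft x) u" "encloses (lft x) v"
 | "rgt x \<in> D" "encloses (rgt x) u" "encloses (rgt x) v"
proof -
 obtain z where z: "z \<in> D" "encloses x z" "encloses z u" "encloses z v"
  "rgt x \<in> D \<and> u = x \<and> v = rgt x \<or> lft x \<in> D \<and> u = lft x \<and> v = x \<or>
   lft x \<in> D \<and> rgt x \<in> D \<and> u = rgt x \<and> v = lft x \<or> z \<noteq> x" using assms(2)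
 proof (cases rule: edges_cases)
  case down
  then show ?thesis using that[of u] assms by auto
 next
  case up
  then show ?thesis using that[of v] assms by auto
 next
  case (across y)
  then show ?thesis by (cases "y = x") (use that[of y] assms apex(1,2)[of y] in \<open>auto simp: encloses_def\<close>)
 qed
 from assms(1) z(1,2) show ?thesis
 proof (cases rule: encloses_cases)
  case 1
  then show ?thesis using z that by blast
 next
  case 2
  then show ?thesis using z that(4) encloses_trans by blast
 next
  case 3
  then show ?thesis using z that(5) encloses_trans by blast
 qed
qed

lemma lft_inj_aux:
 assumes "x \<in> D" "y \<in> D" "encloses x y" "lft x = lft y" shows "x = y" using assms(1-3)
proof (cases rule: encloses_cases)
 case 3
 then have "apex x \<le> fst y" by (simp add: encloses_def)
 moreover have "apex x = apex y" using arg_cong[OF assms(4), of snd] by simp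
 ultimately show ?thesis using apex(1)[OF assms(2)] by linarith
qed (use assms in simp_all)

lemma rgt_inj_aux:
 assumes "x \<in> D" "y \<in> D" "encloses x y" "rgt x = rgt y" shows "x = y" using assms(1-3)
proof (cases rule: encloses_cases)
 case 2
 then have "snd y \<le> apex x" by (simp add: encloses_def)
 moreover have "apex x = apex y" using arg_cong[OF assms(4), of fst] by simp
 ultimately show ?thesis using apex(2)[OF assms(2)] by linarith
qed (use assms in simp_all)

text \<open>Two parents on the same side share an end and so are nested, which puts the apex of the
  inner one in the wrong place; parents on opposite sides would cross. So every chord has one parent
  and lies on one side of it.\<close>

lemma parents_eq:
 assumes "x \<in> D" "y \<in> D" shows "lft x = lft y \<Longrightarrow> x = y" "rgt x = rgt y \<Longrightarrow> x = y" "lft x \<noteq> rgt y"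
proof -
 show "x = y" if l: "lft x = lft y"
 proof -
  have "encloses x y \<or> encloses y x" using arg_cong[OF l, of fst] by (auto simp: encloses_def)
  then show ?thesis using lft_inj_aux assms l by metis
 qed
 show "x = y" if l: "rgt x = rgt y"
 proof -
  have "encloses x y \<or> encloses y x" using arg_cong[OF l, of snd] by (auto simp: encloses_def)
  then show ?thesis using rgt_inj_aux assms l by metis
 qed
 show "lft x \<noteq> rgt y"
 proof
  assume l: "lft x = rgt y"
  have "fst x = apex y" "apex x = snd y" using arg_cong[OF l, of fst] arg_cong[OF l, of snd] by auto
  then show False using noncross'[of y x] assms apex(1)[OF assms(1)] apex(2)[OF assms(1)]
    apex(1)[OF assms(2)] apex(2)[OF assms(2)] by linarith
 qed
qed

lemma lft_neq [simp]: "x \<in> D \<Longrightarrow> lft x \<noteq> x" and rgt_neq [simp]: "x \<in> D \<Longrightarrow> rgt x \<noteq> x"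
 and lft_neq_rgt [simp]: "x \<in> D \<Longrightarrow> lft x \<noteq> rgt x" using apex(1,2)[of x] by (auto simp: prod_eq_iff)

lemma edges_irrefl: "(u, u) \<notin> edges" by (metis edges_cases lft_neq rgt_neq lft_neq_rgt)

end

locale polygon_representation = polygon_triangulation D lo hi + complex_vector_space scl
 for D lo hi and scl :: "complex \<Rightarrow> 'v::ab_group_add \<Rightarrow> 'v" +
 fixes V :: "chord \<Rightarrow> 'v set" and f :: "chord \<Rightarrow> chord \<Rightarrow> 'v \<Rightarrow> 'v"
 assumes subsp: "x \<in> D \<Longrightarrow> subspace (V x)" and lin: "(u, v) \<in> edges \<Longrightarrow> Vector_Spaces.linear scl scl (f u v)"
  and maps: "(u, v) \<in> edges \<Longrightarrow> f u v ` V u \<subseteq> V v"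
  and zero: "x \<in> D \<Longrightarrow> lft x \<in> D \<Longrightarrow> rgt x \<in> D \<Longrightarrow> \<xi> \<in> V x \<Longrightarrow> f (rgt x) (lft x) (f x (rgt x) \<xi>) = 0"
   "x \<in> D \<Longrightarrow> lft x \<in> D \<Longrightarrow> rgt x \<in> D \<Longrightarrow> \<xi> \<in> V (rgt x) \<Longrightarrow> f (lft x) x (f (rgt x) (lft x) \<xi>) = 0"
   "x \<in> D \<Longrightarrow> lft x \<in> D \<Longrightarrow> rgt x \<in> D \<Longrightarrow> \<xi> \<in> V (lft x) \<Longrightarrow> f x (rgt x) (f (lft x) x \<xi>) = 0"
begin

definition string_basis_on :: "chord \<Rightarrow> (chord \<Rightarrow> 'v set) \<Rightarrow> bool" where
 "string_basis_on x B \<longleftrightarrow>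
   (\<forall>y\<in>D. encloses x y \<longrightarrow> independent (B y) \<and> span (B y) = V y) \<and>
   (\<forall>u v. (u, v) \<in> edges \<longrightarrow> encloses x u \<longrightarrow> encloses x v \<longrightarrow> matches (f u v) (B u) (B v))"

lemma string_basis_onD:
 assumes "string_basis_on x B" shows "y \<in> D \<Longrightarrow> encloses x y \<Longrightarrow> independent (B y)"
  "y \<in> D \<Longrightarrow> encloses x y \<Longrightarrow> span (B y) = V y"
  "(u, v) \<in> edges \<Longrightarrow> encloses x u \<Longrightarrow> encloses x v \<Longrightarrow> matches (f u v) (B u) (B v)"
 using assms unfolding string_basis_on_def by blast+

text \<open>The subtree below x is felt at x only through one chain. Handing up a chain, and not a
  fixed basis, leaves the freedom needed when the triangle above x, or the loop, imposes conditions
  of its own.\<close>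

lemma adapted_basis_extends:
 assumes "x \<in> D" shows "\<exists>\<P>. chain_of_subspaces \<P> \<and>
   (\<forall>X. adapted \<P> (V x) X \<longrightarrow> (\<exists>B. string_basis_on x B \<and> B x = X))" using assms
proof (induction x rule: chord_induct)
 case (chord x)
 note L = \<open>lft x \<in> D \<Longrightarrow> _\<close> and R = \<open>rgt x \<in> D \<Longrightarrow> _\<close>
 have emp: "chain_of_subspaces {}" by (auto simp: chain_of_subspaces_def)
 \<comment> \<open>A missing child is replaced by the zero space with zero maps, so that
   \<open>triangle_adapted\<close> covers triangles of all shapes.\<close>
 define VL where "VL = (if lft x \<in> D then V (lft x) else {0})"
 define VR where "VR = (if rgt x \<in> D then V (rgt x) else {0})"
 define a where "a = (if rgt x \<in> D then f x (rgt x) else (\<lambda>_. 0))"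
 define b where "b = (if lft x \<in> D \<and> rgt x \<in> D then f (rgt x) (lft x) else (\<lambda>_. 0))"
 define c where "c = (if lft x \<in> D then f (lft x) x else (\<lambda>_. 0))"
 interpret vector_space_pair scl scl by unfold_locales
 have lin0: "Vector_Spaces.linear scl scl (\<lambda>_. 0)" by (rule linear_zero)
 have lin_abc: "Vector_Spaces.linear scl scl a" "Vector_Spaces.linear scl scl b"
   "Vector_Spaces.linear scl scl c"
  using lin0 edgesI[OF chord(1)] by (auto simp: a_def b_def c_def intro: lin)
 have sub: "subspace (V x)" "subspace VL" "subspace VR"
  using chord(1) by (auto simp: VL_def VR_def intro: subsp)
 have im: "a ` V x \<subseteq> VR" "b ` VR \<subseteq> VL" "c ` VL \<subseteq> V x"
  using maps[OF edgesI(1)[OF chord(1)]] maps[OF edgesI(2)[OF chord(1)]]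
   maps[OF edgesI(3)[OF chord(1)]] subspace_0[OF sub(1)]
   subspace_0[OF sub(2)] subspace_0[OF sub(3)]
  by (auto simp: a_def b_def c_def VL_def VR_def split: if_splits)
 have c0: "c 0 = 0" and a0: "a 0 = 0" using lin_abc linear_0 by blast+
 have zero': "\<And>\<xi>. \<xi> \<in> V x \<Longrightarrow> b (a \<xi>) = 0" "\<And>\<xi>. \<xi> \<in> VR \<Longrightarrow> c (b \<xi>) = 0" "\<And>\<xi>. \<xi> \<in> VL \<Longrightarrow> a (c \<xi>) = 0"
  using zero[OF chord(1)] c0 a0 by (auto simp: a_def b_def c_def VL_def VR_def split: if_splits)
 obtain \<L> where \<L>: "chain_of_subspaces \<L>" "lft x \<in> D \<Longrightarrow> \<forall>X. adapted \<L> (V (lft x)) X \<longrightarrow>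
   (\<exists>B. string_basis_on (lft x) B \<and> B (lft x) = X)" using L emp by (cases "lft x \<in> D") blast+
 obtain \<R> where \<R>: "chain_of_subspaces \<R>" "rgt x \<in> D \<Longrightarrow> \<forall>X. adapted \<R> (V (rgt x)) X \<longrightarrow>
   (\<exists>B. string_basis_on (rgt x) B \<and> B (rgt x) = X)" using R emp by (cases "rgt x \<in> D") blast+
 obtain \<P> where \<P>: "chain_of_subspaces \<P>"
  "\<And>X. adapted \<P> (V x) X \<Longrightarrow> \<exists>Y Z. adapted \<R> VR Y \<and> adapted \<L> VL Z \<and>
    matches a X Y \<and> matches b Y Z \<and> matches c Z X"
  using triangle_adapted[OF lin_abc sub(1,3,2) im zero' \<R>(1) \<L>(1)] by blast
 show ?case
 proof (intro exI[of _ \<P>] conjI allI impI \<P>(1))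
  fix X assume X: "adapted \<P> (V x) X"
  obtain Y Z where YZ: "adapted \<R> VR Y" "adapted \<L> VL Z"
   and m: "matches a X Y" "matches b Y Z" "matches c Z X" using \<P>(2)[OF X] by blast
  obtain BL where BL: "lft x \<in> D \<Longrightarrow> string_basis_on (lft x) BL \<and> BL (lft x) = Z"
   using \<L>(2) YZ(2) by (cases "lft x \<in> D") (auto simp: VL_def)
  obtain BR where BR: "rgt x \<in> D \<Longrightarrow> string_basis_on (rgt x) BR \<and> BR (rgt x) = Y"
   using \<R>(2) YZ(1) by (cases "rgt x \<in> D") (auto simp: VR_def)
  define B where "B = (\<lambda>y. if y = x then X else if encloses (lft x) y then BL y else BR y)"
  have Bl: "B y = BL y" if "encloses (lft x) y" "y \<in> D" for y
   using that not_encloses_lft[OF chord(1)] by (auto simp: B_def)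
  have Br: "B y = BR y" if "encloses (rgt x) y" "y \<in> D" for y
   using that not_encloses_rgt[OF chord(1)] encloses_lft_rgt_False[of y x] by (auto simp: B_def)
  have Bx: "B x = X" by (simp add: B_def)
  have "\<forall>y\<in>D. encloses x y \<longrightarrow> independent (B y) \<and> span (B y) = V y"
  proof (intro ballI impI)
   fix y assume y: "y \<in> D" "encloses x y"
   from chord(1) y show "independent (B y) \<and> span (B y) = V y"
   proof (cases rule: encloses_cases)
    case 1
    then show ?thesis using Bx adaptedD(1,2)[OF X] by simp
   next
    case 2
    then show ?thesis using BL Bl y by (simp add: string_basis_on_def)
   next
    case 3
    then show ?thesis using BR Br y by (simp add: string_basis_on_def)
   qed
  qed
  moreover have "matches (f u v) (B u) (B v)" if e: "(u, v) \<in> edges" "encloses x u" "encloses x v" for u v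
   using chord(1) e
  proof (cases rule: edges_encloses_cases)
   case 1
   then show ?thesis using m(1) Bx Br[of "rgt x"] BR by (auto simp: a_def)
  next
   case 2
   then show ?thesis using m(3) Bx Bl[of "lft x"] BL by (auto simp: c_def)
  next
   case 3
   then show ?thesis using m(2) Br[of "rgt x"] Bl[of "lft x"] BL BR by (auto simp: b_def)
  next
   case 4
   then show ?thesis using e edges_mem[OF e(1)] Bl BL string_basis_onD(3)[of "lft x" BL u v] by simp
  next
   case 5
   then show ?thesis using e edges_mem[OF e(1)] Br BR string_basis_onD(3)[of "rgt x" BR u v] by simp
  qed
  ultimately show "\<exists>B. string_basis_on x B \<and> B x = X" using Bx unfolding string_basis_on_def by blast
 qed
qed

lemma string_basis_exists:
 assumes "Vector_Spaces.linear scl scl e" "e ` V root \<subseteq> V root" "\<And>\<xi>. \<xi> \<in> V root \<Longrightarrow> e (e \<xi>) = 0"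
 obtains B where "\<And>y. y \<in> D \<Longrightarrow> independent (B y)" "\<And>y. y \<in> D \<Longrightarrow> span (B y) = V y"
  "\<And>u v. (u, v) \<in> edges \<Longrightarrow> matches (f u v) (B u) (B v)" "matches e (B root) (B root)"
proof -
 obtain \<P> where \<P>: "chain_of_subspaces \<P>"
   "\<And>X. adapted \<P> (V root) X \<Longrightarrow> \<exists>B. string_basis_on root B \<and> B root = X"
  using adapted_basis_extends[OF root_mem] by blast
 obtain X where X: "adapted \<P> (V root) X" "matches e X X"
  using loop_adapted[OF assms(1) subsp[OF root_mem] assms(2,3) \<P>(1)] by blast
 obtain B where B: "string_basis_on root B" "B root = X" using \<P>(2)[OF X(1)] by blast
 show thesis
 proof (rule that[of B])
  show "matches (f u v) (B u) (B v)" if "(u, v) \<in> edges" for u v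
   using string_basis_onD(3)[OF B(1) that] edges_mem[OF that] encloses_root by blast
 qed (use string_basis_onD(1,2)[OF B(1)] B(2) X(2) encloses_root in simp_all)
qed

end

section \<open>Hom, Ext and the E-invariant read off from a string basis\<close>

lemma sum_fun_apply2: "(\<Sum>k\<in>K. f k) i x = (\<Sum>k\<in>K. f k i x)" by (induction K rule: infinite_finite_induct) auto

lemma linear_between_0: "linear_between s t V W f \<Longrightarrow> 0 \<in> V \<Longrightarrow> f 0 = 0"
 unfolding linear_between_def by (metis add_cancel_right_right)

lemma (in vector_space) finite_dimensional_subspace:
 assumes "subspace S" "S \<subseteq> span B" "finite B" shows "\<exists>B'. finite B' \<and> S = span B'"
proof -
 obtain C where C: "C \<subseteq> S" "independent C" "S \<subseteq> span C" using maximal_independent_subset by blast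
 moreover have "finite C" using independent_span_bound[OF assms(3) C(2)] C(1) assms(2) by blast
 ultimately show ?thesis using assms(1) span_minimal by (metis subset_antisym)
qed

locale string_model_rep = string_model Q N J w \<rho> b
 for Q :: "('i, 'e) quiver" and N :: "('i, 'e, 'v::ab_group_add) rep"
  and J :: "'j set" and w :: "'j \<Rightarrow> 'i" and \<rho> :: "'e \<Rightarrow> 'j \<Rightarrow> 'j option" and b :: "'j \<Rightarrow> 'v" +
 fixes R :: "('e \<times> 'e) set"
 assumes rep: "is_rep Q R N" and finite_verts: "finite (verts Q)" and finite_arcs: "finite (arcs Q)"
  and tails: "a \<in> arcs Q \<Longrightarrow> tail Q a \<in> verts Q" and heads: "a \<in> arcs Q \<Longrightarrow> head Q a \<in> verts Q"
  and rels: "(c, a) \<in> R \<Longrightarrow> a \<in> arcs Q \<and> c \<in> arcs Q \<and> tail Q c = head Q a"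
begin

lemma mp_linear: "a \<in> arcs Q \<Longrightarrow> linear_between (scl N) (scl N) (spc N (tail Q a)) (spc N (head Q a)) (mp N a)"
 using rep by (simp add: is_rep_def)

lemma mp_relation: "(c, a) \<in> R \<Longrightarrow> x \<in> spc N (tail Q a) \<Longrightarrow> mp N c (mp N a x) = 0"
 using rep by (fastforce simp: is_rep_def)

lemma mp_sum:
 assumes "a \<in> arcs Q" "K \<subseteq> fibre (tail Q a)"
 shows "mp N a (\<Sum>k\<in>K. scl N (c k) (b k)) = (\<Sum>k\<in>K. scl N (c k) (mp N a (b k)))"
proof (rule linear_between_sum[OF complex_vector_space_axioms complex_vector_space_axioms
   subspace_spc[OF tails[OF assms(1)]] mp_linear[OF assms(1)]])
 show "finite K" using assms(2) finite_fibre finite_subset by blast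
 show "b k \<in> spc N (tail Q a)" if "k \<in> K" for k using assms(2) that b_mem[of k] by auto
qed

text \<open>As \<open>\<rho> a\<close> is injective where defined, the images of the surviving basis
  vectors are distinct basis vectors; so the kernel of an arrow is spanned by the basis vectors that
  it kills.\<close>

lemma mp_sum_eq_0:
 assumes a: "a \<in> arcs Q" and z: "mp N a (\<Sum>k\<in>fibre (tail Q a). scl N (c k) (b k)) = 0"
  and k: "k \<in> fibre (tail Q a)" "\<rho> a k \<noteq> None" shows "c k = 0"
proof -
 let ?F = "{k \<in> fibre (tail Q a). \<rho> a k \<noteq> None}"
 let ?g = "\<lambda>k. the (\<rho> a k)"
 have inj_g: "inj_on ?g ?F" using \<rho>_inj[OF a] by (auto simp: inj_on_def)
 have "(\<Sum>k\<in>?F. scl N (c k) (b (?g k))) = (\<Sum>k\<in>fibre (tail Q a). scl N (c k) (mp N a (b k)))"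
  using act[OF a] by (intro sum.mono_neutral_cong_left) (auto split: option.splits)
 also have "\<dots> = 0" using z mp_sum[OF a order_refl, of c] by simp
 finally have eq: "(\<Sum>k\<in>?F. scl N (c k) (b (?g k))) = 0" .
 have sub: "?g ` ?F \<subseteq> fibre (head Q a)"
 proof (rule image_subsetI)
  fix k assume k: "k \<in> ?F"
  then obtain l where "\<rho> a k = Some l" by auto
  then show "?g k \<in> fibre (head Q a)" using \<rho>_mem[OF a, of k l] k by simp
 qed
 \<comment> \<open>The sum is reindexed by heads and padded with zeros to the full fibre, the form
   that \<open>coeff_0\<close> requires.\<close>
 have "(\<Sum>l\<in>fibre (head Q a). scl N (if l \<in> ?g ` ?F then c (inv_into ?F ?g l) else 0) (b l))
   = (\<Sum>l\<in>?g ` ?F. scl N (c (inv_into ?F ?g l)) (b l))"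
  using sub by (intro sum.mono_neutral_cong_right) auto
 also have "\<dots> = (\<Sum>k\<in>?F. scl N (c k) (b (?g k)))" unfolding sum.reindex[OF inj_g] o_def
  by (rule sum.cong[OF refl]) (simp only: inv_into_f_f[OF inj_g])
 finally have "(\<Sum>l\<in>fibre (head Q a). scl N (if l \<in> ?g ` ?F then c (inv_into ?F ?g l) else 0) (b l)) = 0"
  using eq by simp
 moreover have kF: "k \<in> ?F" using k by simp
 then have "?g k \<in> fibre (head Q a)" using sub by blast
 ultimately have "(if ?g k \<in> ?g ` ?F then c (inv_into ?F ?g (?g k)) else 0) = 0"
  by (rule coeff_0[OF heads[OF a]])
 moreover have "?g k \<in> ?g ` ?F" by (rule image_eqI[OF refl kF])
 ultimately show ?thesis by (simp only: if_True inv_into_f_f[OF inj_g kF])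
qed

lemma mp_sum_killed:
 assumes a: "a \<in> arcs Q" and "\<And>k. k \<in> fibre (tail Q a) \<Longrightarrow> \<rho> a k \<noteq> None \<Longrightarrow> c k = 0"
 shows "mp N a (\<Sum>k\<in>fibre (tail Q a). scl N (c k) (b k)) = 0" unfolding mp_sum[OF a order_refl]
proof (rule sum.neutral, rule ballI)
 fix k assume k: "k \<in> fibre (tail Q a)"
 show "scl N (c k) (mp N a (b k)) = 0" using act[OF a, of k] assms(2)[OF k] k by (cases "\<rho> a k") auto
qed

lemma simple_family:
 assumes i: "i \<in> verts Q" shows "\<phi> \<in> linear_family Q (simple_rep i) N \<longleftrightarrow>
  (\<exists>v\<in>spc N i. \<phi> = (\<lambda>k x. if k = i then scl N x v else 0))"
proof
 assume \<phi>: "\<phi> \<in> linear_family Q (simple_rep i) N"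
 then have lb: "linear_between (*) (scl N) (if k = i then UNIV else {0}) (spc N k) (\<phi> k)" if "k \<in> verts Q" for k
  using that by (auto simp: linear_family_def simple_rep_def)
 have out: "\<phi> k x = 0" if "k \<notin> verts Q \<or> k \<noteq> i \<and> x \<noteq> 0" for k x
  using \<phi> that by (auto simp: linear_family_def simple_rep_def split: if_splits)
 have zero: "\<phi> k 0 = 0" for k
 proof (cases "k \<in> verts Q")
  case True
  show ?thesis by (rule linear_between_0[OF lb[OF True]]) simp
 qed (use out in auto)
 have v: "\<phi> i 1 \<in> spc N i" using lb[OF i] by (simp add: linear_between_def)
 define u where "u = \<phi> i 1"
 have "\<phi> i (x * 1) = scl N x u" for x using lb[OF i] unfolding linear_between_def u_def by (metis UNIV_I)
 then have "\<phi> i x = scl N x u" for x by simp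
 then have "\<phi> k x = (if k = i then scl N x (\<phi> i 1) else 0)" for k x
  using out[of k x] zero[of k] unfolding u_def[symmetric] by (cases "k = i"; cases "x = 0") simp_all
 then have "\<phi> = (\<lambda>k x. if k = i then scl N x (\<phi> i 1) else 0)" by (intro ext)
 then show "\<exists>v\<in>spc N i. \<phi> = (\<lambda>k x. if k = i then scl N x v else 0)" using v by blast
next
 assume "\<exists>v\<in>spc N i. \<phi> = (\<lambda>k x. if k = i then scl N x v else 0)"
 then obtain v where v: "v \<in> spc N i" "\<phi> = (\<lambda>k x. if k = i then scl N x v else 0)" by blast
 show "\<phi> \<in> linear_family Q (simple_rep i) N"
  using v i subspace_scale[OF subspace_spc[OF i] v(1)] subspace_0[OF subspace_spc]
  by (auto simp: linear_family_def simple_rep_def linear_between_def scale_left_distrib)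
qed

text \<open>A morphism from the simple at i is a vector at i killed by all arrows leaving i. Kernels
  of arrows are spanned by basis vectors, hence so is their intersection.\<close>

lemma dim_Hom_simple:
 assumes i: "i \<in> verts Q"
 shows "dim_Hom Q (simple_rep i) N = card {k \<in> fibre i. \<forall>a\<in>arcs Q. tail Q a = i \<longrightarrow> \<rho> a k = None}"
proof -
 let ?K = "{k \<in> fibre i. \<forall>a\<in>arcs Q. tail Q a = i \<longrightarrow> \<rho> a k = None}"
 interpret fn: complex_vector_space "\<lambda>c (\<phi> :: 'i \<Rightarrow> complex \<Rightarrow> 'v) i x. scl N c (\<phi> i x)"
  using complex_vector_space_function complex_vector_space_axioms by blast
 define e where "e = (\<lambda>k j x. if j = i then scl N x (b k) else 0)"
 let ?sum = "\<lambda>c. \<Sum>k\<in>?K. (\<lambda>j x. scl N (c k) (e k j x))"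
 let ?v = "\<lambda>c. \<Sum>k\<in>?K. scl N (c k) (b k)"
 have sum_e: "?sum c
   = (\<lambda>j x. if j = i then scl N x (?v c) else 0)" for c
  by (intro ext) (simp add: sum_fun_apply2 e_def scale_sum_right scale_left_commute mult.commute)
 have sub: "?K \<subseteq> fibre i" by auto
 have ext0: "?v c = (\<Sum>k\<in>fibre i. scl N (if k \<in> ?K then c k else 0) (b k))" for c
  by (rule sum.mono_neutral_cong_left) auto
 have HomI: "\<phi> \<in> Hom Q (simple_rep i) N \<longleftrightarrow>
  (\<exists>v\<in>spc N i. \<phi> = (\<lambda>k x. if k = i then scl N x v else 0) \<and> (\<forall>a\<in>arcs Q. tail Q a = i \<longrightarrow> mp N a v = 0))" for \<phi>
 proof -
  have "(\<forall>a\<in>arcs Q. \<forall>x\<in>spc (simple_rep i) (tail Q a).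
     \<phi> (head Q a) (mp (simple_rep i) a x) = mp N a (\<phi> (tail Q a) x)) \<longleftrightarrow>
     (\<forall>a\<in>arcs Q. tail Q a = i \<longrightarrow> mp N a v = 0)"
   if v: "v \<in> spc N i" "\<phi> = (\<lambda>k x. if k = i then scl N x v else 0)" for v
  proof -
   have "mp N a (scl N x v) = scl N x (mp N a v)" if "a \<in> arcs Q" "tail Q a = i" for a x
    using mp_linear[OF that(1)] that(2) v(1) by (simp add: linear_between_def)
   moreover have "mp N a 0 = 0" if "a \<in> arcs Q" for a using mp_sum[OF that, of "{}"] by simp
   ultimately show ?thesis unfolding v(2) simple_rep_def by (auto split: if_splits)
  qed
  then show ?thesis unfolding Hom_def mem_Collect_eq simple_family[OF i, of \<phi>] by blast
 qed
 have "fn.dim (Hom Q (simple_rep i) N) = card ?K"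
 proof (rule fn.dim_parametrized[of ?K e])
  show "finite ?K" by (rule finite_subset[OF sub finite_fibre])
  fix c
  show "\<forall>k\<in>?K. c k = 0" if z: "?sum c = 0"
  proof
   fix k assume k: "k \<in> ?K"
   from fun_cong[OF fun_cong[OF z[unfolded sum_e], of i], of 1]
   have "?v c = 0" by (simp only: simp_thms if_True zero_fun_apply scale_one)
   then have "(\<Sum>k\<in>fibre i. scl N (if k \<in> ?K then c k else 0) (b k)) = 0" by (simp only: ext0)
   then have "(if k \<in> ?K then c k else 0) = 0" by (rule coeff_0[OF i]) (use k in auto)
   then show "c k = 0" using k by simp
  qed
  show "?sum c \<in> Hom Q (simple_rep i) N" unfolding sum_e HomI
  proof (intro bexI[of _ "\<Sum>k\<in>?K. scl N (c k) (b k)"] conjI refl ballI impI)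
   show "?v c \<in> spc N i"
    using b_mem by (intro subspace_sum[OF subspace_spc[OF i]] subspace_scale[OF subspace_spc[OF i]]) auto
   fix a assume a: "a \<in> arcs Q" "tail Q a = i"
   show "mp N a (?v c) = 0" unfolding ext0 by (rule mp_sum_killed[OF a(1), unfolded a(2)]) (use a in auto)
  qed
 next
  fix \<phi> assume "\<phi> \<in> Hom Q (simple_rep i) N"
  then obtain v where v: "v \<in> spc N i" "\<phi> = (\<lambda>k x. if k = i then scl N x v else 0)"
   "\<And>a. a \<in> arcs Q \<Longrightarrow> tail Q a = i \<Longrightarrow> mp N a v = 0" unfolding HomI by blast
  obtain c where c: "v = (\<Sum>k\<in>fibre i. scl N (c k) (b k))" using v(1) unfolding spc_eq[OF i] by blast
  have "c k = 0" if k: "k \<in> fibre i - ?K" for k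
  proof -
   obtain a where "a \<in> arcs Q" "tail Q a = i" "\<rho> a k \<noteq> None" using k by auto
   then show ?thesis using mp_sum_eq_0[of a c k] v(3)[of a] c k by auto
  qed
  then have "v = (?v c)" unfolding c by (intro sum.mono_neutral_right) auto
  then show "\<exists>c. \<phi> = ?sum c" unfolding sum_e v(2) by blast
 qed
 then show ?thesis by (simp add: dim_Hom_def fam_dim_def)
qed

end

context string_model_rep
begin

lemma b_mem_fibre: "k \<in> J \<Longrightarrow> w k = i \<Longrightarrow> b k \<in> spc N i" using b_mem[of k] by simp

lemma mp_0: "a \<in> arcs Q \<Longrightarrow> mp N a 0 = 0" using mp_sum[of a "{}"] by simp

lemma mp_scale: "a \<in> arcs Q \<Longrightarrow> v \<in> spc N (tail Q a) \<Longrightarrow> mp N a (scl N x v) = scl N x (mp N a v)"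
 and mp_add: "a \<in> arcs Q \<Longrightarrow> v \<in> spc N (tail Q a) \<Longrightarrow> v' \<in> spc N (tail Q a) \<Longrightarrow> mp N a (v + v') = mp N a v + mp N a v'"
 and mp_mem: "a \<in> arcs Q \<Longrightarrow> v \<in> spc N (tail Q a) \<Longrightarrow> mp N a v \<in> spc N (head Q a)"
 using mp_linear[of a] by (auto simp: linear_between_def)

abbreviation simple_extension :: "'i \<Rightarrow> ('e \<Rightarrow> 'v) \<Rightarrow> 'e \<Rightarrow> complex \<Rightarrow> 'v" where
 "simple_extension i u \<equiv> \<lambda>a x. if a \<in> arcs Q \<and> tail Q a = i then scl N x (u a) else 0"

text \<open>After one arrow the component in the simple is 0, so a path of two arrows sees the
  extension only through its value on the first one; each relation reduces to
  \<open>mp N c (u a) = 0\<close>.\<close>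

lemma is_rep_ext_simple:
 assumes i: "i \<in> verts Q" and u: "\<And>a. a \<in> arcs Q \<Longrightarrow> tail Q a = i \<Longrightarrow> u a \<in> spc N (head Q a)"
  and uR: "\<And>a c. (c, a) \<in> R \<Longrightarrow> tail Q a = i \<Longrightarrow> mp N c (u a) = 0"
 shows "is_rep Q R (ext_rep (simple_rep i) N (simple_extension i u))"
proof -
 let ?f = "simple_extension i u"
 let ?s = "\<lambda>c (y, x). (scl N c y, c * x :: complex)"
 let ?S = "\<lambda>k. spc N k \<times> (if k = i then UNIV else {0 :: complex})"
 let ?m = "\<lambda>a (y, x). (mp N a y + ?f a x, 0 :: complex)"
 have ext_eq: "ext_rep (simple_rep i) N ?f = \<lparr>scl = ?s, spc = ?S, mp = ?m\<rparr>"
  by (simp add: ext_rep_def simple_rep_def fun_eq_iff)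
 interpret p: complex_vector_space ?s by unfold_locales (auto simp: algebra_simps)
 have sub: "p.subspace (?S k)" if "k \<in> verts Q" for k
 proof (rule p.subspaceI)
  show "0 \<in> ?S k" using subspace_0[OF subspace_spc[OF that]] by (simp add: zero_prod_def)
  show "v + v' \<in> ?S k" if "v \<in> ?S k" "v' \<in> ?S k" for v v'
   using that subspace_add[OF subspace_spc[OF \<open>k \<in> verts Q\<close>], of "fst v" "fst v'"] by (auto split: if_splits)
  show "?s c v \<in> ?S k" if "v \<in> ?S k" for c v
   using that subspace_scale[OF subspace_spc[OF \<open>k \<in> verts Q\<close>], of "fst v" c] by (auto split: if_splits)
 qed
 have fd: "\<exists>B. finite B \<and> ?S k = p.span B" if k: "k \<in> verts Q" for k
 proof (rule p.finite_dimensional_subspace[OF sub[OF k]])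
  interpret l: Vector_Spaces.linear "scl N" ?s "\<lambda>v. (v, 0)" by unfold_locales (auto simp: algebra_simps)
  let ?B = "insert (0, 1) ((\<lambda>v. (v, 0)) ` b ` fibre k)"
  show "finite ?B" by simp
  show "?S k \<subseteq> p.span ?B"
  proof clarify
   fix y x assume y: "y \<in> spc N k" "x \<in> (if k = i then UNIV else {0 :: complex})"
   have "(y, 0) \<in> p.span ((\<lambda>v. (v, 0)) ` b ` fibre k)"
    unfolding l.span_image span[OF k] using y(1) by (rule imageI)
   then have "(y, 0) \<in> p.span ?B" using p.span_mono[OF subset_insertI] by blast
   moreover have "?s x (0, 1) \<in> p.span ?B" by (intro p.span_scale p.span_base) simp
   ultimately have "(y, 0) + ?s x (0, 1) \<in> p.span ?B" by (rule p.span_add)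
   then show "(y, x) \<in> p.span ?B" by simp
  qed
 qed
 have f_mem: "?f a x \<in> spc N (head Q a)" if "a \<in> arcs Q" for a x
  using u[OF that] subspace_scale[OF subspace_spc[OF heads[OF that]]]
   subspace_0[OF subspace_spc[OF heads[OF that]]] by auto
 have lin: "linear_between ?s ?s (?S (tail Q a)) (?S (head Q a)) (?m a)" if a: "a \<in> arcs Q" for a
  unfolding linear_between_def
 proof (intro conjI ballI allI)
  show "?m a v \<in> ?S (head Q a)" if "v \<in> ?S (tail Q a)" for v
   using that mp_mem[OF a] f_mem[OF a] subspace_add[OF subspace_spc[OF heads[OF a]]] by auto
  show "?m a (v + v') = ?m a v + ?m a v'" if "v \<in> ?S (tail Q a)" "v' \<in> ?S (tail Q a)" for v v'
   using that mp_add[OF a] by (auto simp: scale_left_distrib algebra_simps)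
  show "?m a (?s c v) = ?s c (?m a v)" if "v \<in> ?S (tail Q a)" for c v
   using that mp_scale[OF a] by (auto simp: scale_right_distrib)
 qed
 have rel: "?m c (?m a v) = 0" if ca: "(c, a) \<in> R" and v: "v \<in> ?S (tail Q a)" for c a v
 proof -
  obtain y x where yx: "v = (y, x)" "y \<in> spc N (tail Q a)" using v by auto
  note ac = rels[OF ca]
  have "mp N c (mp N a y + ?f a x) = mp N c (mp N a y) + mp N c (?f a x)"
   using ac mp_add mp_mem yx(2) f_mem by auto
  also have "mp N c (mp N a y) = 0" using mp_relation[OF ca yx(2)] .
  also have "mp N c (?f a x) = 0" using ac uR[OF ca] u mp_scale[of c "u a" x] mp_0 by auto
  finally show ?thesis by (simp add: yx zero_prod_def)
 qed
 have "\<forall>(c, a)\<in>R. \<forall>v\<in>?S (tail Q a). ?m c (?m a v) = 0" using rel by blast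
 moreover have "\<forall>a\<in>arcs Q. linear_between ?s ?s (?S (tail Q a)) (?S (head Q a)) (?m a)" using lin by blast
 moreover have "\<forall>k\<in>verts Q. p.subspace (?S k) \<and> (\<exists>B. finite B \<and> ?S k = p.span B)" using sub fd by blast
 ultimately show ?thesis unfolding ext_eq is_rep_def rep.select_convs using p.vector_space_axioms by blast
qed

lemma ext_cocycles_simple:
 assumes i: "i \<in> verts Q" shows "f \<in> ext_cocycles Q R (simple_rep i) N \<longleftrightarrow>
  (\<exists>u. (\<forall>a\<in>arcs Q. tail Q a = i \<longrightarrow> u a \<in> spc N (head Q a) \<and> (\<forall>c. (c, a) \<in> R \<longrightarrow> mp N c (u a) = 0)) \<and>
     f = simple_extension i u)"
 (is "_ \<longleftrightarrow> ?u")
proof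
 let ?E = "ext_rep (simple_rep i) N f"
 assume f: "f \<in> ext_cocycles Q R (simple_rep i) N"
 have lb: "linear_between (*) (scl N) (if tail Q a = i then UNIV else {0}) (spc N (head Q a)) (f a)"
  if "a \<in> arcs Q" for a using f that by (auto simp: ext_cocycles_def simple_rep_def)
 have out: "f a x = 0" if "a \<notin> arcs Q \<or> tail Q a \<noteq> i \<and> x \<noteq> 0" for a x
  using f that by (auto simp: ext_cocycles_def simple_rep_def split: if_splits)
 have zero: "f a 0 = 0" if "a \<in> arcs Q" for a by (rule linear_between_0[OF lb[OF that]]) simp
 define u where "u = (\<lambda>a. f a 1)"
 have "f a (x * 1) = scl N x (u a)" if "a \<in> arcs Q" "tail Q a = i" for a x
  using lb[OF that(1)] that(2) unfolding linear_between_def u_def by (metis UNIV_I)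
 then have fu: "f a x = scl N x (u a)" if "a \<in> arcs Q" "tail Q a = i" for a x using that by simp
 have "f a x = (if a \<in> arcs Q \<and> tail Q a = i then scl N x (u a) else 0)" for a x
  using out[of a x] zero[of a] fu[of a x] by (cases "a \<in> arcs Q"; cases "tail Q a = i"; cases "x = 0") simp_all
 then have "f = simple_extension i u" by (intro ext)
 moreover have "u a \<in> spc N (head Q a)" if "a \<in> arcs Q" "tail Q a = i" for a
  using lb[OF that(1)] that(2) by (simp add: linear_between_def u_def)
 moreover have "mp N c (u a) = 0" if a: "a \<in> arcs Q" "tail Q a = i" and ca: "(c, a) \<in> R" for a c
 proof -
  have "is_rep Q R ?E" using f by (simp add: ext_cocycles_def)
  then have "\<forall>x\<in>spc ?E (tail Q a).
    mp ?E c (mp ?E a x) = 0" using ca unfolding is_rep_def by blast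
  moreover have "(0, 1) \<in> spc ?E (tail Q a)"
   using a subspace_0[OF subspace_spc[OF i]] by (simp add: ext_rep_def simple_rep_def)
  ultimately have "mp ?E c (mp ?E a (0, 1)) = 0" by blast
  then have "mp N c (mp N a 0 + f a 1) + f c 0 = 0" by (simp add: ext_rep_def simple_rep_def zero_prod_def)
  then show ?thesis using rels[OF ca] zero mp_0 by (simp add: u_def)
 qed
 ultimately show "?u" by blast
next
 let ?E = "ext_rep (simple_rep i) N f"
 assume "?u"
 then obtain u where u: "\<And>a. a \<in> arcs Q \<Longrightarrow> tail Q a = i \<Longrightarrow> u a \<in> spc N (head Q a)"
  "\<And>a c. a \<in> arcs Q \<Longrightarrow> tail Q a = i \<Longrightarrow> (c, a) \<in> R \<Longrightarrow> mp N c (u a) = 0" and f: "f = simple_extension i u"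
  by blast
 have "is_rep Q R ?E" unfolding f using is_rep_ext_simple[OF i u(1)] u(2) rels by blast
 moreover have "linear_between (*) (scl N) (if tail Q a = i then UNIV else {0}) (spc N (head Q a)) (f a)"
  if "a \<in> arcs Q" for a
  using that u(1) subspace_scale[OF subspace_spc[OF heads[OF that]]] subspace_0[OF subspace_spc[OF heads[OF that]]]
  by (auto simp: linear_between_def f scale_left_distrib)
 moreover have "f a x = 0" if "a \<notin> arcs Q \<or> x \<notin> (if tail Q a = i then UNIV else {0})" for a x
  using that by (auto simp: f split: if_splits)
 ultimately show "f \<in> ext_cocycles Q R (simple_rep i) N" by (simp add: ext_cocycles_def simple_rep_def)
qed

text \<open>
  Number of basis vectors of the subspace of \<open>spc N (head Q a)\<close> in which an extension of the simple
  at the tail of \<open>a\<close> may take its values.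
\<close>

definition free_card :: "'e \<Rightarrow> nat" where
 "free_card a = card {k \<in> fibre (head Q a). \<forall>c. (c, a) \<in> R \<longrightarrow> \<rho> c k = None}"

text \<open>A cocycle chooses, independently for each arrow leaving i, a vector killed by all arrows
  that follow it in a relation; hence a basis indexed by pairs of an arrow and a basis vector at its
  head.\<close>

lemma dim_cocycles:
 assumes i: "i \<in> verts Q"
 shows "fam_dim (scl N) (ext_cocycles Q R (simple_rep i) N) = (\<Sum>a | a \<in> arcs Q \<and> tail Q a = i. free_card a)"
proof -
 interpret fn: complex_vector_space "\<lambda>c (\<phi> :: 'e \<Rightarrow> complex \<Rightarrow> 'v) i x. scl N c (\<phi> i x)"
  using complex_vector_space_function complex_vector_space_axioms by blast
 let ?F = "\<lambda>a. {k \<in> fibre (head Q a). \<forall>c. (c, a) \<in> R \<longrightarrow> \<rho> c k = None}"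
 let ?A = "{a \<in> arcs Q. tail Q a = i}"
 let ?K = "SIGMA a : ?A. ?F a"
 have finA: "finite ?A" using finite_arcs by simp
 have finF: "finite (?F a)" for a by (rule finite_subset[OF _ finite_fibre]) auto
 have finK: "finite ?K" using finA finF by blast
 define e where "e = (\<lambda>(a :: 'e, k) (a' :: 'e) x. if a' = a then scl N x (b k) else 0)"
 let ?sum = "\<lambda>c. \<Sum>p\<in>?K. (\<lambda>a x. scl N (c p) (e p a x))"
 have sum_e: "?sum c
   = (\<lambda>a x. if a \<in> arcs Q \<and> tail Q a = i then scl N x (\<Sum>k\<in>?F a. scl N (c (a, k)) (b k)) else 0)" for c
 proof (intro ext)
  fix a x
  have "?sum c a x = (\<Sum>p\<in>?K. scl N (c p) (e p a x))" by (rule sum_fun_apply2)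
  also have "\<dots> = (\<Sum>a'\<in>?A. \<Sum>k\<in>?F a'. scl N (c (a', k)) (e (a', k) a x))"
   by (subst sum.Sigma[OF finA]) (use finF in \<open>auto simp: case_prod_beta\<close>)
  also have "\<dots> = (\<Sum>a'\<in>?A. if a' = a then \<Sum>k\<in>?F a. scl N (c (a, k)) (scl N x (b k)) else 0)"
   by (intro sum.cong refl) (auto simp: e_def)
  also have "\<dots> = (if a \<in> ?A then \<Sum>k\<in>?F a. scl N (c (a, k)) (scl N x (b k)) else 0)"
   by (rule sum.delta[OF finA])
  also have "(\<Sum>k\<in>?F a. scl N (c (a, k)) (scl N x (b k))) = scl N x (\<Sum>k\<in>?F a. scl N (c (a, k)) (b k))"
   unfolding scale_sum_right by (intro sum.cong refl) (simp add: mult.commute)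
  finally show "?sum c a x =
   (if a \<in> arcs Q \<and> tail Q a = i then scl N x (\<Sum>k\<in>?F a. scl N (c (a, k)) (b k)) else 0)" by simp
 qed
 have ext0: "(\<Sum>k\<in>?F a. scl N (c k) (b k)) = (\<Sum>k\<in>fibre (head Q a). scl N (if k \<in> ?F a then c k else 0) (b k))" for a c
  by (rule sum.mono_neutral_cong_left) auto
 have "fn.dim (ext_cocycles Q R (simple_rep i) N) = card ?K"
 proof (rule fn.dim_parametrized[of ?K e, OF finK])
  fix c
  show "\<forall>p\<in>?K. c p = 0" if z: "?sum c = 0"
  proof clarify
   fix a k assume a: "a \<in> arcs Q" "i = tail Q a" and k: "k \<in> J" "w k = head Q a" "\<forall>c. (c, a) \<in> R \<longrightarrow> \<rho> c k = None"
   from fun_cong[OF fun_cong[OF z[unfolded sum_e], of a], of 1]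
   have "(\<Sum>k\<in>?F a. scl N (c (a, k)) (b k)) = 0" using a by (simp only: simp_thms if_True zero_fun_apply scale_one)
   then have "(\<Sum>k\<in>fibre (head Q a). scl N (if k \<in> ?F a then c (a, k) else 0) (b k)) = 0" by (simp only: ext0)
   then have "(if k \<in> ?F a then c (a, k) else 0) = 0" by (rule coeff_0[OF heads[OF a(1)]]) (use k in auto)
   then show "c (a, k) = 0" using k by simp
  qed
  show "?sum c \<in> ext_cocycles Q R (simple_rep i) N" unfolding sum_e ext_cocycles_simple[OF i]
  proof (intro exI[of _ "\<lambda>a. \<Sum>k\<in>?F a. scl N (c (a, k)) (b k)"] conjI ballI impI allI refl)
   fix a assume a: "a \<in> arcs Q" "tail Q a = i"
   show "(\<Sum>k\<in>?F a. scl N (c (a, k)) (b k)) \<in> spc N (head Q a)"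
    using b_mem_fibre by (intro subspace_sum[OF subspace_spc[OF heads[OF a(1)]]]
      subspace_scale[OF subspace_spc[OF heads[OF a(1)]]]) auto
   fix d assume d: "(d, a) \<in> R"
   then have d': "d \<in> arcs Q" "tail Q d = head Q a" using rels by auto
   show "mp N d (\<Sum>k\<in>?F a. scl N (c (a, k)) (b k)) = 0"
    unfolding ext0 by (rule mp_sum_killed[OF d'(1), unfolded d'(2)]) (use d in auto)
  qed
 next
  fix f assume "f \<in> ext_cocycles Q R (simple_rep i) N"
  then obtain u where u: "\<And>a. a \<in> arcs Q \<Longrightarrow> tail Q a = i \<Longrightarrow> u a \<in> spc N (head Q a)"
   "\<And>a c. a \<in> arcs Q \<Longrightarrow> tail Q a = i \<Longrightarrow> (c, a) \<in> R \<Longrightarrow> mp N c (u a) = 0" and f: "f = simple_extension i u"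
   unfolding ext_cocycles_simple[OF i] by blast
  have ex: "\<exists>c. u a = (\<Sum>k\<in>?F a. scl N (c k) (b k))" if a: "a \<in> arcs Q" "tail Q a = i" for a
  proof -
   obtain c where c: "u a = (\<Sum>k\<in>fibre (head Q a). scl N (c k) (b k))"
    using u(1)[OF a] unfolding spc_eq[OF heads[OF a(1)]] by blast
   have "c k = 0" if k: "k \<in> fibre (head Q a) - ?F a" for k
   proof -
    obtain d where d: "(d, a) \<in> R" "\<rho> d k \<noteq> None" using k by auto
    then show ?thesis using mp_sum_eq_0[of d c k] u(2)[OF a d(1)] c k rels[OF d(1)] by auto
   qed
   then have "u a = (\<Sum>k\<in>?F a. scl N (c k) (b k))" unfolding c by (intro sum.mono_neutral_right) auto
   then show ?thesis by blast
  qed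
  define c where "c = (\<lambda>a. SOME c. u a = (\<Sum>k\<in>?F a. scl N (c k) (b k)))"
  have c: "u a = (\<Sum>k\<in>?F a. scl N (c a k) (b k))" if "a \<in> arcs Q" "tail Q a = i" for a
   unfolding c_def by (rule someI_ex[OF ex[OF that]])
  have "f = (\<Sum>p\<in>?K. (\<lambda>a x. scl N ((\<lambda>(a, k). c a k) p) (e p a x)))"
   unfolding sum_e f prod.case using c by (intro ext if_cong refl) simp_all
  then show "\<exists>c. f = ?sum c" by blast
 qed
 also have "\<dots> = (\<Sum>a\<in>?A. free_card a)" using finA finF by (simp add: card_SigmaI free_card_def)
 finally show ?thesis by (simp add: fam_dim_def)
qed

text \<open>The coboundary of v collects, up to sign, the images of v under the arrows leaving i. It
  vanishes on the space counted by \<open>dim_Hom_simple\<close>, and the remaining basis vectors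
  stay independent.\<close>

lemma dim_coboundaries:
 assumes i: "i \<in> verts Q" shows "fam_dim (scl N) (ext_coboundaries Q (simple_rep i) N)
  = card {k \<in> fibre i. \<exists>a\<in>arcs Q. tail Q a = i \<and> \<rho> a k \<noteq> None}"
proof -
 interpret fn: complex_vector_space "\<lambda>c (\<phi> :: 'e \<Rightarrow> complex \<Rightarrow> 'v) i x. scl N c (\<phi> i x)"
  using complex_vector_space_function complex_vector_space_axioms by blast
 let ?K = "{k \<in> fibre i. \<exists>a\<in>arcs Q. tail Q a = i \<and> \<rho> a k \<noteq> None}"
 have finK: "finite ?K" by (rule finite_subset[OF _ finite_fibre[of i]]) auto
 define cb where "cb = (\<lambda>v (a :: 'e) x. if a \<in> arcs Q \<and> tail Q a = i then - scl N x (mp N a v) else 0)"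
 let ?cb = "\<lambda>c k a x. scl N (c k) (cb (b k) a x)"
 define d where "d = (\<lambda>(h :: 'i \<Rightarrow> complex \<Rightarrow> 'v) (a :: 'e) x. if a \<in> arcs Q \<and> x \<in> spc (simple_rep i :: ('i, 'e, complex) rep) (tail Q a)
      then h (head Q a) (mp (simple_rep i) a x) - mp N a (h (tail Q a) x) else 0)"
 define s where "s = (\<lambda>v (k :: 'i) x. if k = i then scl N x v else 0)"
 have d_s: "d (s v) = cb v" if "v \<in> spc N i" for v
  using that mp_0 mp_scale by (intro ext) (auto simp: d_def s_def cb_def simple_rep_def)
 have fam: "h \<in> linear_family Q (simple_rep i) N \<longleftrightarrow> (\<exists>v\<in>spc N i. h = s v)" for h
  unfolding s_def by (rule simple_family[OF i])
 have cobd: "ext_coboundaries Q (simple_rep i) N = {f. \<exists>h\<in>linear_family Q (simple_rep i) N. f = d h}"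
  by (simp add: ext_coboundaries_def d_def)
 have cob: "f \<in> ext_coboundaries Q (simple_rep i) N \<longleftrightarrow> (\<exists>v\<in>spc N i. f = cb v)" for f
 proof
  assume "f \<in> ext_coboundaries Q (simple_rep i) N"
  then obtain h where h: "h \<in> linear_family Q (simple_rep i) N" "f = d h" unfolding cobd by blast
  then obtain v where "v \<in> spc N i" "h = s v" unfolding fam by blast
  then show "\<exists>v\<in>spc N i. f = cb v" using h(2) d_s by blast
 next
  assume "\<exists>v\<in>spc N i. f = cb v"
  then obtain v where v: "v \<in> spc N i" "f = d (s v)" using d_s by auto
  then have "s v \<in> linear_family Q (simple_rep i) N" unfolding fam by blast
  then show "f \<in> ext_coboundaries Q (simple_rep i) N" unfolding cobd using v(2) by blast
 qed
 have cb_sum: "(\<Sum>k\<in>L. ?cb c k) = cb (\<Sum>k\<in>L. scl N (c k) (b k))" if L: "L \<subseteq> fibre i" for L c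
 proof (intro ext)
  fix a x
  show "(\<Sum>k\<in>L. ?cb c k) a x = cb (\<Sum>k\<in>L. scl N (c k) (b k)) a x" unfolding sum_fun_apply2
   using L mp_sum[of a L c] by (auto simp: cb_def scale_sum_right sum_negf mult.commute)
 qed
 have "fn.dim (ext_coboundaries Q (simple_rep i) N) = card ?K"
 proof (rule fn.dim_parametrized[of ?K "\<lambda>k. cb (b k)", OF finK])
  fix c
  have ext0: "(\<Sum>k\<in>?K. scl N (c k) (b k)) = (\<Sum>k\<in>fibre i. scl N (if k \<in> ?K then c k else 0) (b k))"
   by (rule sum.mono_neutral_cong_left) auto
  show "\<forall>k\<in>?K. c k = 0" if z: "(\<Sum>k\<in>?K. ?cb c k) = 0"
  proof
   fix k assume k: "k \<in> ?K"
   then obtain a where a: "a \<in> arcs Q" "tail Q a = i" "\<rho> a k \<noteq> None" by blast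
   have "cb (\<Sum>k\<in>?K. scl N (c k) (b k)) = 0" using z by (subst (asm) cb_sum) auto
   from fun_cong[OF fun_cong[OF this, of a], of 1]
   have "mp N a (\<Sum>k\<in>?K. scl N (c k) (b k)) = 0" using a(1,2) by (simp add: cb_def)
   then have "mp N a (\<Sum>k\<in>fibre i. scl N (if k \<in> ?K then c k else 0) (b k)) = 0" by (simp only: ext0)
   then have "(if k \<in> ?K then c k else 0) = 0"
    using mp_sum_eq_0[OF a(1), of "\<lambda>k. if k \<in> ?K then c k else 0" k] a k by blast
   then show "c k = 0" using k by simp
  qed
  show "(\<Sum>k\<in>?K. ?cb c k) \<in> ext_coboundaries Q (simple_rep i) N"
  proof (subst cb_sum)
   have "(\<Sum>k\<in>?K. scl N (c k) (b k)) \<in> spc N i"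
    using b_mem_fibre by (intro subspace_sum[OF subspace_spc[OF i]] subspace_scale[OF subspace_spc[OF i]]) auto
   then show "cb (\<Sum>k\<in>?K. scl N (c k) (b k)) \<in> ext_coboundaries Q (simple_rep i) N" unfolding cob by blast
  qed auto
 next
  fix f assume "f \<in> ext_coboundaries Q (simple_rep i) N"
  then obtain v where v: "v \<in> spc N i" "f = cb v" unfolding cob by blast
  obtain c where c: "v = (\<Sum>k\<in>fibre i. scl N (c k) (b k))" using v(1) unfolding spc_eq[OF i] by blast
  have "f = (\<Sum>k\<in>fibre i. ?cb c k)" unfolding v(2) c by (rule cb_sum[symmetric]) simp
  also have "\<dots> = (\<Sum>k\<in>?K. ?cb c k)"
  proof (rule sum.mono_neutral_right)
   show "\<forall>k\<in>fibre i - ?K. ?cb c k = 0"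
   proof
    fix k assume k: "k \<in> fibre i - ?K"
    have "cb (b k) a x = 0" for a x using k act[of a k] by (auto simp: cb_def)
    then show "?cb c k = 0" by (simp add: fun_eq_iff)
   qed
  qed auto
  finally show "\<exists>c. f = (\<Sum>k\<in>?K. ?cb c k)" by blast
 qed
 then show ?thesis by (simp add: fam_dim_def)
qed

text \<open>The basis vectors counted by Hom and by the coboundaries are complementary in the fibre,
  so together they amount to its cardinality.\<close>

lemma g_inv_eq:
 assumes i: "i \<in> verts Q"
 shows "g_inv Q R N i = (\<Sum>a | a \<in> arcs Q \<and> tail Q a = i. int (free_card a)) - int (card (fibre i))"
proof -
 let ?K0 = "{k \<in> fibre i. \<forall>a\<in>arcs Q. tail Q a = i \<longrightarrow> \<rho> a k = None}"
 let ?K1 = "{k \<in> fibre i. \<exists>a\<in>arcs Q. tail Q a = i \<and> \<rho> a k \<noteq> None}"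
 have "card (?K0 \<union> ?K1) = card ?K0 + card ?K1"
  by (rule card_Un_disjoint) (auto intro: finite_subset[OF _ finite_fibre[of i]])
 moreover have "?K0 \<union> ?K1 = fibre i" by blast
 ultimately have "card (fibre i) = card ?K0 + card ?K1" by simp
 then show ?thesis
  unfolding g_inv_def dim_Ext1_def dim_Hom_simple[OF i] dim_cocycles[OF i] dim_coboundaries[OF i] by simp
qed

lemma E_inv_eq:
 "E_inv Q R N = int (dim_Hom Q N N) - (\<Sum>i\<in>verts Q. int (card (fibre i)) ^ 2)
   + (\<Sum>a\<in>arcs Q. int (card (fibre (tail Q a))) * int (free_card a))"
proof -
 have "(\<Sum>i\<in>verts Q. int (dim (spc N i)) * g_inv Q R N i)
  = (\<Sum>i\<in>verts Q. \<Sum>a | a \<in> arcs Q \<and> tail Q a = i. int (card (fibre i)) * int (free_card a))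
   - (\<Sum>i\<in>verts Q. int (card (fibre i)) ^ 2)" unfolding sum_subtractf[symmetric]
  by (intro sum.cong refl) (simp add: dim_spc g_inv_eq right_diff_distrib sum_distrib_left power2_eq_square)
 also have "(\<Sum>i\<in>verts Q. \<Sum>a | a \<in> arcs Q \<and> tail Q a = i. int (card (fibre i)) * int (free_card a))
  = (\<Sum>i\<in>verts Q. \<Sum>a | a \<in> arcs Q \<and> tail Q a = i. int (card (fibre (tail Q a))) * int (free_card a))"
  by (intro sum.cong refl) auto
 also have "\<dots> = (\<Sum>a\<in>arcs Q. int (card (fibre (tail Q a))) * int (free_card a))"
  by (rule sum.group) (use finite_arcs finite_verts tails in auto)
 finally show ?thesis unfolding E_inv_def by simp
qed

end

section \<open>Endomorphisms as matrices in a string basis\<close>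

context string_model_rep
begin

text \<open>
  \<open>commuting m\<close> expresses that \<open>b k \<mapsto> \<Sum>l. m k l \<cdot> b l\<close> commutes with all arrows.
\<close>

definition commuting :: "('j \<Rightarrow> 'j \<Rightarrow> complex) \<Rightarrow> bool" where
 "commuting m \<longleftrightarrow> (\<forall>a\<in>arcs Q. \<forall>k\<in>fibre (tail Q a).
   (\<forall>k'. \<rho> a k = Some k' \<longrightarrow>
    (\<forall>k2\<in>fibre (tail Q a). \<forall>l. \<rho> a k2 = Some l \<longrightarrow> m k' l = m k k2) \<and>
    (\<forall>l\<in>fibre (head Q a). (\<forall>k2\<in>fibre (tail Q a). \<rho> a k2 \<noteq> Some l) \<longrightarrow> m k' l = 0)) \<and>
   (\<rho> a k = None \<longrightarrow> (\<forall>k2\<in>fibre (tail Q a). \<rho> a k2 \<noteq> None \<longrightarrow> m k k2 = 0)))"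

lemma mp_combination:
 assumes a: "a \<in> arcs Q" shows "mp N a (\<Sum>k\<in>fibre (tail Q a). scl N (c k) (b k)) =
  (\<Sum>l\<in>fibre (head Q a). scl N (\<Sum>k\<in>{k \<in> fibre (tail Q a). \<rho> a k = Some l}. c k) (b l))"
proof -
 let ?T = "fibre (tail Q a)" and ?H = "fibre (head Q a)"
 have "mp N a (\<Sum>k\<in>?T. scl N (c k) (b k)) = (\<Sum>k\<in>?T. scl N (c k) (mp N a (b k)))"
  by (rule mp_sum[OF a order_refl])
 also have "\<dots> = (\<Sum>k\<in>?T. \<Sum>l\<in>?H. if \<rho> a k = Some l then scl N (c k) (b l) else 0)"
 proof (rule sum.cong[OF refl])
  fix k assume k: "k \<in> ?T"
  show "scl N (c k) (mp N a (b k)) = (\<Sum>l\<in>?H. if \<rho> a k = Some l then scl N (c k) (b l) else 0)"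
  proof (cases "\<rho> a k")
   case None
   then show ?thesis using act[OF a, of k] k by simp
  next
   case (Some l)
   then have "l \<in> ?H" using \<rho>_mem[OF a, of k l] k by simp
   then have "(\<Sum>l'\<in>?H. if \<rho> a k = Some l' then scl N (c k) (b l') else 0) = scl N (c k) (b l)"
    using Some sum.delta'[OF finite_fibre[of "head Q a"], of l "\<lambda>l'. scl N (c k) (b l')"] by simp
   then show ?thesis using act[OF a, of k] k Some by simp
  qed
 qed
 also have "\<dots> = (\<Sum>l\<in>?H. \<Sum>k\<in>?T. if \<rho> a k = Some l then scl N (c k) (b l) else 0)" by (rule sum.swap)
 also have "\<dots> = (\<Sum>l\<in>?H. scl N (\<Sum>k\<in>{k \<in> ?T. \<rho> a k = Some l}. c k) (b l))"
 proof (rule sum.cong[OF refl])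
  fix l
  have "(\<Sum>k\<in>?T. if \<rho> a k = Some l then scl N (c k) (b l) else 0)
    = (\<Sum>k\<in>{k \<in> ?T. \<rho> a k = Some l}. scl N (c k) (b l))"
   by (rule sum.inter_filter[symmetric, OF finite_fibre])
  then show "(\<Sum>k\<in>?T. if \<rho> a k = Some l then scl N (c k) (b l) else 0)
    = scl N (\<Sum>k\<in>{k \<in> ?T. \<rho> a k = Some l}. c k) (b l)" by (simp add: scale_sum_left)
 qed
 finally show ?thesis .
qed

text \<open>Comparison of coefficients: by injectivity of \<open>\<rho> a\<close>, each coefficient
  of the image of \<open>\<phi> (tail Q a) (b k)\<close> under a is a single matrix entry or
  0.\<close>

lemma commuting_iff:
 assumes \<phi>: "\<And>k. k \<in> J \<Longrightarrow> \<phi> (w k) (b k) = (\<Sum>l\<in>fibre (w k). scl N (m k l) (b l))"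
  and \<phi>0: "\<And>i. i \<in> verts Q \<Longrightarrow> \<phi> i 0 = 0" shows "commuting m \<longleftrightarrow>
  (\<forall>a\<in>arcs Q. \<forall>k\<in>fibre (tail Q a). \<phi> (head Q a) (mp N a (b k)) = mp N a (\<phi> (tail Q a) (b k)))"
proof -
 let ?P = "\<lambda>a k. (\<forall>k'. \<rho> a k = Some k' \<longrightarrow>
    (\<forall>k2\<in>fibre (tail Q a). \<forall>l. \<rho> a k2 = Some l \<longrightarrow> m k' l = m k k2) \<and>
    (\<forall>l\<in>fibre (head Q a). (\<forall>k2\<in>fibre (tail Q a). \<rho> a k2 \<noteq> Some l) \<longrightarrow> m k' l = 0)) \<and>
   (\<rho> a k = None \<longrightarrow> (\<forall>k2\<in>fibre (tail Q a). \<rho> a k2 \<noteq> None \<longrightarrow> m k k2 = 0))"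
 have "?P a k \<longleftrightarrow> \<phi> (head Q a) (mp N a (b k)) = mp N a (\<phi> (tail Q a) (b k))"
  if a: "a \<in> arcs Q" and k: "k \<in> fibre (tail Q a)" for a k
 proof -
  let ?T = "fibre (tail Q a)" and ?H = "fibre (head Q a)"
  define lhs where "lhs = (\<lambda>l. case \<rho> a k of None \<Rightarrow> 0 | Some k' \<Rightarrow> m k' l)"
  define rhs where "rhs = (\<lambda>l. \<Sum>k2\<in>{k \<in> ?T. \<rho> a k = Some l}. m k k2)"
  have L: "\<phi> (head Q a) (mp N a (b k)) = (\<Sum>l\<in>?H. scl N (lhs l) (b l))"
  proof (cases "\<rho> a k")
   case None
   then show ?thesis using act[OF a, of k] k \<phi>0[OF heads[OF a]] by (simp add: lhs_def)
  next
   case (Some k')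
   then show ?thesis using act[OF a, of k] k \<rho>_mem[OF a, of k k'] \<phi>[of k'] by (simp add: lhs_def)
  qed
  have R: "mp N a (\<phi> (tail Q a) (b k)) = (\<Sum>l\<in>?H. scl N (rhs l) (b l))"
   using k \<phi>[of k] mp_combination[OF a, of "m k"] by (simp add: rhs_def)
  have "\<phi> (head Q a) (mp N a (b k)) = mp N a (\<phi> (tail Q a) (b k)) \<longleftrightarrow> (\<forall>l\<in>?H. lhs l = rhs l)"
  proof
   assume "\<phi> (head Q a) (mp N a (b k)) = mp N a (\<phi> (tail Q a) (b k))"
   then have eq: "(\<Sum>l\<in>?H. scl N (lhs l) (b l)) = (\<Sum>l\<in>?H. scl N (rhs l) (b l))" using L R by simp
   show "\<forall>l\<in>?H. lhs l = rhs l"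
    using family_coeff_eq[OF finite_fibre inj[OF heads[OF a]] indep[OF heads[OF a]] eq] by blast
  next
   assume "\<forall>l\<in>?H. lhs l = rhs l"
   then show "\<phi> (head Q a) (mp N a (b k)) = mp N a (\<phi> (tail Q a) (b k))"
    unfolding L R by (intro sum.cong) auto
  qed
  also have "\<dots> \<longleftrightarrow> ?P a k"
  proof -
   have r1: "rhs l = m k k2" if "k2 \<in> ?T" "\<rho> a k2 = Some l" for k2 l
   proof -
    have "k = k2" if "k \<in> {k \<in> ?T. \<rho> a k = Some l}" for k
     using \<rho>_inj[OF a, of k k2 l] that \<open>k2 \<in> ?T\<close> \<open>\<rho> a k2 = Some l\<close> by simp
    then have "{k \<in> ?T. \<rho> a k = Some l} = {k2}" using that by blast
    then show ?thesis by (simp add: rhs_def)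
   qed
   have r2: "rhs l = 0" if "\<forall>k2\<in>?T. \<rho> a k2 \<noteq> Some l" for l
   proof -
    have "{k \<in> ?T. \<rho> a k = Some l} = {}" using that by blast
    then show ?thesis by (simp only: rhs_def sum.empty)
   qed
   have mem: "l \<in> ?H" if "k2 \<in> ?T" "\<rho> a k2 = Some l" for k2 l using \<rho>_mem[OF a, of k2 l] that by simp
   have gen: "(\<forall>l\<in>?H. X l = rhs l) \<longleftrightarrow>
     (\<forall>k2\<in>?T. \<forall>l. \<rho> a k2 = Some l \<longrightarrow> X l = m k k2) \<and>
     (\<forall>l\<in>?H. (\<forall>k2\<in>?T. \<rho> a k2 \<noteq> Some l) \<longrightarrow> X l = 0)" for X
   proof (intro iffI conjI ballI allI impI)
    fix k2 l assume "\<forall>l\<in>?H. X l = rhs l" "k2 \<in> ?T" "\<rho> a k2 = Some l"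
    then show "X l = m k k2" using r1[of k2 l] mem[of k2 l] by simp
   next
    fix l assume "\<forall>l\<in>?H. X l = rhs l" "l \<in> ?H" "\<forall>k2\<in>?T. \<rho> a k2 \<noteq> Some l"
    then show "X l = 0" using r2[of l] by simp
   next
    fix l
    assume X: "(\<forall>k2\<in>?T. \<forall>l. \<rho> a k2 = Some l \<longrightarrow> X l = m k k2) \<and>
     (\<forall>l\<in>?H. (\<forall>k2\<in>?T. \<rho> a k2 \<noteq> Some l) \<longrightarrow> X l = 0)" and l: "l \<in> ?H"
    show "X l = rhs l"
    proof (cases "\<exists>k2\<in>?T. \<rho> a k2 = Some l")
     case True
     then obtain k2 where k2: "k2 \<in> ?T" "\<rho> a k2 = Some l" by blast
     have "X l = m k k2" using X k2 by blast
     then show ?thesis using r1[OF k2] by simp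
    next
     case False
     then have "X l = 0" using X l by blast
     then show ?thesis using r2[of l] False by simp
    qed
   qed
   show ?thesis
   proof (cases "\<rho> a k")
    case None
    then have "(\<forall>l\<in>?H. lhs l = rhs l) \<longleftrightarrow> (\<forall>k2\<in>?T. \<rho> a k2 \<noteq> None \<longrightarrow> m k k2 = 0)"
     unfolding gen by (auto simp: lhs_def)
    then show ?thesis using None by simp
   next
    case (Some k')
    then have "lhs = m k'" by (simp add: lhs_def)
    then show ?thesis unfolding gen using Some by simp
   qed
  qed
  finally show ?thesis by (rule sym)
 qed
 then show ?thesis unfolding commuting_def by (intro ball_cong refl)
qed

lemma Hom_linear: "\<phi> \<in> Hom Q N N \<Longrightarrow> i \<in> verts Q \<Longrightarrow> linear_between (scl N) (scl N) (spc N i) (spc N i) (\<phi> i)"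
 and Hom_outside: "\<phi> \<in> Hom Q N N \<Longrightarrow> i \<notin> verts Q \<or> x \<notin> spc N i \<Longrightarrow> \<phi> i x = 0"
 by (auto simp: Hom_def linear_family_def)

lemma Hom_0: "\<phi> \<in> Hom Q N N \<Longrightarrow> i \<in> verts Q \<Longrightarrow> \<phi> i 0 = 0"
 using linear_between_0[OF Hom_linear] subspace_0[OF subspace_spc] by blast

lemma Hom_matrix:
 assumes "\<phi> \<in> Hom Q N N"
 obtains m where "commuting m"
  "\<And>k. k \<in> J \<Longrightarrow> \<phi> (w k) (b k) = (\<Sum>l\<in>fibre (w k). scl N (m k l) (b l))"
proof -
 have ex: "\<exists>c. \<phi> (w k) (b k) = (\<Sum>l\<in>fibre (w k). scl N (c l) (b l))" if k: "k \<in> J" for k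
 proof -
  have "\<phi> (w k) (b k) \<in> spc N (w k)"
   using Hom_linear[OF assms w_verts[OF k]] b_mem[OF k] by (simp add: linear_between_def)
  then show ?thesis unfolding spc_eq[OF w_verts[OF k]] by blast
 qed
 define m where "m = (\<lambda>k. SOME c. \<phi> (w k) (b k) = (\<Sum>l\<in>fibre (w k). scl N (c l) (b l)))"
 have m: "\<phi> (w k) (b k) = (\<Sum>l\<in>fibre (w k). scl N (m k l) (b l))" if "k \<in> J" for k
  unfolding m_def by (rule someI_ex[OF ex[OF that]])
 moreover have "commuting m"
 proof (subst commuting_iff[of \<phi> m])
  show "\<phi> (w k) (b k) = (\<Sum>l\<in>fibre (w k). scl N (m k l) (b l))" if "k \<in> J" for k using m[OF that] .
  show "\<phi> i 0 = 0" if "i \<in> verts Q" for i using Hom_0[OF assms that] .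
  show "\<forall>a\<in>arcs Q. \<forall>k\<in>fibre (tail Q a). \<phi> (head Q a) (mp N a (b k)) = mp N a (\<phi> (tail Q a) (b k))"
  proof (intro ballI)
  fix a k assume a: "a \<in> arcs Q" and k: "k \<in> fibre (tail Q a)"
  have "b k \<in> spc N (tail Q a)" using b_mem_fibre k by blast
  then show "\<phi> (head Q a) (mp N a (b k)) = mp N a (\<phi> (tail Q a) (b k))" using assms a by (simp add: Hom_def)
  qed
 qed
 ultimately show thesis using that by blast
qed

lemma Hom_exists:
 assumes "commuting m"
 obtains \<phi> where "\<phi> \<in> Hom Q N N"
  "\<And>k. k \<in> J \<Longrightarrow> \<phi> (w k) (b k) = (\<Sum>l\<in>fibre (w k). scl N (m k l) (b l))"
proof -
 interpret p: vector_space_pair "scl N" "scl N" by unfold_locales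
 let ?v = "\<lambda>k. \<Sum>l\<in>fibre (w k). scl N (m k l) (b l)"
 have ex: "\<exists>g. Vector_Spaces.linear (scl N) (scl N) g \<and> (\<forall>k\<in>fibre i. g (b k) = ?v k)" if i: "i \<in> verts Q" for i
 proof -
  define v where "v = ?v"
  obtain g where g: "Vector_Spaces.linear (scl N) (scl N) g"
   "\<forall>x\<in>b ` fibre i. g x = v (inv_into (fibre i) b x)"
   using p.linear_independent_extend[OF indep[OF i], of "\<lambda>x. v (inv_into (fibre i) b x)"] by blast
  have "g (b k) = v k" if "k \<in> fibre i" for k using g(2) that inv_into_f_f[OF inj[OF i] that] by simp
  then show ?thesis using g(1) unfolding v_def by blast
 qed
 define g where "g = (\<lambda>i. SOME g. Vector_Spaces.linear (scl N) (scl N) g \<and> (\<forall>k\<in>fibre i. g (b k) = ?v k))"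
 have g: "Vector_Spaces.linear (scl N) (scl N) (g i) \<and> (\<forall>k\<in>fibre i. g i (b k) = ?v k)" if "i \<in> verts Q" for i
  unfolding g_def by (rule someI_ex[OF ex[OF that]])
 define \<phi> where "\<phi> = (\<lambda>i x. if i \<in> verts Q \<and> x \<in> spc N i then g i x else 0)"
 have \<phi>: "\<phi> (w k) (b k) = ?v k" if "k \<in> J" for k
  using that g[OF w_verts[OF that]] w_verts[OF that] b_mem[OF that] by (simp add: \<phi>_def)
 have g_mem: "g i x \<in> spc N i" if i: "i \<in> verts Q" and x: "x \<in> spc N i" for i x
 proof -
  interpret gi: Vector_Spaces.linear "scl N" "scl N" "g i" using g[OF i] by blast
  have "g i ` b ` fibre i \<subseteq> spc N i"
  proof clarify
   fix k assume k: "k \<in> J" "i = w k"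
   have "?v k \<in> spc N (w k)" using b_mem_fibre by (intro subspace_sum[OF subspace_spc[OF w_verts[OF k(1)]]]
      subspace_scale[OF subspace_spc[OF w_verts[OF k(1)]]]) auto
   then show "g (w k) (b k) \<in> spc N (w k)" using g[OF w_verts[OF k(1)]] k by simp
  qed
  then have "span (g i ` b ` fibre i) \<subseteq> spc N i" by (rule span_minimal[OF _ subspace_spc[OF i]])
  then show ?thesis using x span[OF i] gi.span_image by blast
 qed
 have lb: "linear_between (scl N) (scl N) (spc N i) (spc N i) (\<phi> i)" if i: "i \<in> verts Q" for i
 proof (rule linear_betweenI)
  show "Vector_Spaces.linear (scl N) (scl N) (g i)" using g[OF i] by blast
  show "g i x \<in> spc N i" if "x \<in> spc N i" for x using g_mem[OF i that] .
  show "\<phi> i x = g i x" if "x \<in> spc N i" for x using i that by (simp add: \<phi>_def)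
 qed (rule subspace_spc[OF i])
 have \<phi>0: "\<phi> i 0 = 0" if "i \<in> verts Q" for i
  using linear_between_0[OF lb[OF that]] subspace_0[OF subspace_spc[OF that]] by blast
 have com: "\<forall>a\<in>arcs Q. \<forall>k\<in>fibre (tail Q a). \<phi> (head Q a) (mp N a (b k)) = mp N a (\<phi> (tail Q a) (b k))"
  using assms by (subst (asm) commuting_iff[of \<phi> m]) (simp_all only: \<phi> \<phi>0)
 have "\<phi> (head Q a) (mp N a x) = mp N a (\<phi> (tail Q a) x)"
  if a: "a \<in> arcs Q" and x: "x \<in> spc N (tail Q a)" for a x
 proof -
  let ?T = "fibre (tail Q a)"
  note vs = complex_vector_space_axioms complex_vector_space_axioms
  note t = tails[OF a] and h = heads[OF a]
  obtain c where c: "x = (\<Sum>k\<in>?T. scl N (c k) (b k))" using x unfolding spc_eq[OF t] by blast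
  have bT: "b k \<in> spc N (tail Q a)" if "k \<in> ?T" for k using that b_mem_fibre by blast
  have "\<phi> (head Q a) (mp N a x) = \<phi> (head Q a) (\<Sum>k\<in>?T. scl N (c k) (mp N a (b k)))"
   unfolding c mp_sum[OF a order_refl] ..
  also have "\<dots> = (\<Sum>k\<in>?T. scl N (c k) (\<phi> (head Q a) (mp N a (b k))))"
   by (rule linear_between_sum[OF vs subspace_spc[OF h] lb[OF h] finite_fibre mp_mem[OF a bT]])
  also have "\<dots> = (\<Sum>k\<in>?T. scl N (c k) (mp N a (\<phi> (tail Q a) (b k))))"
   using com a by (intro sum.cong refl) simp
  also have "\<dots> = mp N a (\<Sum>k\<in>?T. scl N (c k) (\<phi> (tail Q a) (b k)))"
  proof (rule linear_between_sum[OF vs subspace_spc[OF t] mp_linear[OF a] finite_fibre, symmetric])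
   fix k assume "k \<in> ?T"
   then show "\<phi> (tail Q a) (b k) \<in> spc N (tail Q a)" using lb[OF t] bT by (simp add: linear_between_def)
  qed
  also have "(\<Sum>k\<in>?T. scl N (c k) (\<phi> (tail Q a) (b k))) = \<phi> (tail Q a) x"
   unfolding c by (rule linear_between_sum[OF vs subspace_spc[OF t] lb[OF t] finite_fibre bT, symmetric])
  finally show ?thesis .
 qed
 then have "\<phi> \<in> Hom Q N N" using lb by (simp add: Hom_def linear_family_def) (simp add: \<phi>_def)
 then show thesis using that \<phi> by blast
qed

lemma Hom_eqI:
 assumes "\<phi> \<in> Hom Q N N" "\<psi> \<in> Hom Q N N" "\<And>k. k \<in> J \<Longrightarrow> \<phi> (w k) (b k) = \<psi> (w k) (b k)" shows "\<phi> = \<psi>"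
proof (intro ext)
 fix i x
 show "\<phi> i x = \<psi> i x"
 proof (cases "i \<in> verts Q \<and> x \<in> spc N i")
  case True
  then have i: "i \<in> verts Q" by blast
  obtain c where c: "x = (\<Sum>k\<in>fibre i. scl N (c k) (b k))" using True unfolding spc_eq[OF i] by blast
  have bi: "b k \<in> spc N i" if "k \<in> fibre i" for k using that b_mem_fibre by blast
  note vs = complex_vector_space_axioms complex_vector_space_axioms
  have e: "\<theta> i x = (\<Sum>k\<in>fibre i. scl N (c k) (\<theta> i (b k)))" if "\<theta> \<in> Hom Q N N" for \<theta>
   unfolding c by (rule linear_between_sum[OF vs subspace_spc[OF i] Hom_linear[OF that i] finite_fibre bi])
  show ?thesis unfolding e[OF assms(1)] e[OF assms(2)] using assms(3) by (intro sum.cong refl) auto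
 next
  case False
  then show ?thesis using Hom_outside assms(1,2) by metis
 qed
qed

text \<open>A matrix entry between different vertices does not occur in an endomorphism; this is why
  independence and completeness are tested only on pairs of indices over the same vertex.\<close>

lemma dim_Hom_eq:
 assumes S: "finite S" and \<mu>: "\<And>s. s \<in> S \<Longrightarrow> commuting (\<mu> s)"
  and independent: "\<And>c. (\<And>k l. k \<in> J \<Longrightarrow> l \<in> J \<Longrightarrow> w k = w l \<Longrightarrow> (\<Sum>s\<in>S. c s * \<mu> s k l) = 0) \<Longrightarrow> \<forall>s\<in>S. c s = 0"
  and complete: "\<And>m. commuting m \<Longrightarrow>
   \<exists>c. \<forall>k\<in>J. \<forall>l\<in>J. w k = w l \<longrightarrow> m k l = (\<Sum>s\<in>S. c s * \<mu> s k l)" shows "dim_Hom Q N N = card S"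
proof -
 interpret fn: complex_vector_space "\<lambda>c (\<phi> :: 'i \<Rightarrow> 'v \<Rightarrow> 'v) i x. scl N c (\<phi> i x)"
  using complex_vector_space_function complex_vector_space_axioms by blast
 have sub: "fn.subspace (Hom Q N N)"
 proof (rule fn.subspaceI)
  show "0 \<in> Hom Q N N" using subspace_0[OF subspace_spc] mp_0
   by (auto simp: Hom_def linear_family_def linear_between_def)
  fix \<phi> \<psi> assume \<phi>: "\<phi> \<in> Hom Q N N" and \<psi>: "\<psi> \<in> Hom Q N N"
  note lb = Hom_linear[OF \<phi>] Hom_linear[OF \<psi>]
  have "linear_between (scl N) (scl N) (spc N i) (spc N i) ((\<phi> + \<psi>) i)" if "i \<in> verts Q" for i
   using lb[OF that] subspace_add[OF subspace_spc[OF that]]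
   unfolding linear_between_def by (simp add: scale_right_distrib)
  moreover have "(\<phi> + \<psi>) (head Q a) (mp N a x) = mp N a ((\<phi> + \<psi>) (tail Q a) x)"
   if a: "a \<in> arcs Q" and x: "x \<in> spc N (tail Q a)" for a x
  proof -
   have "\<phi> (tail Q a) x \<in> spc N (tail Q a)" "\<psi> (tail Q a) x \<in> spc N (tail Q a)"
    using lb[OF tails[OF a]] x by (simp_all add: linear_between_def)
   then show ?thesis using \<phi> \<psi> a x mp_add[OF a] by (simp add: Hom_def)
  qed
  ultimately show "\<phi> + \<psi> \<in> Hom Q N N"
   using Hom_outside[OF \<phi>] Hom_outside[OF \<psi>] by (simp add: Hom_def linear_family_def)
 next
  fix c \<phi> assume \<phi>: "\<phi> \<in> Hom Q N N"
  have "linear_between (scl N) (scl N) (spc N i) (spc N i) (\<lambda>x. scl N c (\<phi> i x))" if "i \<in> verts Q" for i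
   using Hom_linear[OF \<phi> that] subspace_scale[OF subspace_spc[OF that]]
   unfolding linear_between_def by (simp add: scale_right_distrib mult.commute)
  moreover have "scl N c (\<phi> (head Q a) (mp N a x)) = mp N a (scl N c (\<phi> (tail Q a) x))"
   if a: "a \<in> arcs Q" and x: "x \<in> spc N (tail Q a)" for a x
  proof -
   have "\<phi> (tail Q a) x \<in> spc N (tail Q a)"
    using Hom_linear[OF \<phi> tails[OF a]] x by (simp add: linear_between_def)
   then show ?thesis using \<phi> a x mp_scale[OF a] by (simp add: Hom_def)
  qed
  ultimately show "(\<lambda>i x. scl N c (\<phi> i x)) \<in> Hom Q N N"
   using Hom_outside[OF \<phi>] by (simp add: Hom_def linear_family_def)
 qed
 let ?P = "\<lambda>s \<phi>. \<phi> \<in> Hom Q N N \<and> (\<forall>k\<in>J. \<phi> (w k) (b k) = (\<Sum>l\<in>fibre (w k). scl N (\<mu> s k l) (b l)))"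
 have ex: "\<exists>\<phi>. ?P s \<phi>" if "s \<in> S" for s by (rule Hom_exists[OF \<mu>[OF that]]) blast
 define \<Phi> where "\<Phi> = (\<lambda>s. SOME \<phi>. ?P s \<phi>)"
 have \<Phi>: "?P s (\<Phi> s)" if "s \<in> S" for s unfolding \<Phi>_def by (rule someI_ex[OF ex[OF that]])
 let ?sum = "\<lambda>c. \<Sum>s\<in>S. (\<lambda>i x. scl N (c s) (\<Phi> s i x))"
 have comb: "?sum c \<in> Hom Q N N" for c
  using \<Phi> by (intro fn.subspace_sum[OF sub] fn.subspace_scale[OF sub]) blast
 have val: "?sum c (w k) (b k)
   = (\<Sum>l\<in>fibre (w k). scl N (\<Sum>s\<in>S. c s * \<mu> s k l) (b l))" if k: "k \<in> J" for c k
 proof -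
  have "?sum c (w k) (b k)
   = (\<Sum>s\<in>S. scl N (c s) (\<Sum>l\<in>fibre (w k). scl N (\<mu> s k l) (b l)))"
   unfolding sum_fun_apply2 using \<Phi> k by (intro sum.cong refl) simp
  also have "\<dots> = (\<Sum>s\<in>S. \<Sum>l\<in>fibre (w k). scl N (c s * \<mu> s k l) (b l))" by (simp add: scale_sum_right)
  also have "\<dots> = (\<Sum>l\<in>fibre (w k). \<Sum>s\<in>S. scl N (c s * \<mu> s k l) (b l))" by (rule sum.swap)
  finally show ?thesis by (simp add: scale_sum_left)
 qed
 have "fn.dim (Hom Q N N) = card S"
 proof (rule fn.dim_parametrized[of S \<Phi>, OF S _ comb])
  fix c assume z: "?sum c = 0"
  show "\<forall>s\<in>S. c s = 0"
  proof (rule independent)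
   fix k l assume kl: "k \<in> J" "l \<in> J" "w k = w l"
   have "(\<Sum>l\<in>fibre (w k). scl N (\<Sum>s\<in>S. c s * \<mu> s k l) (b l)) = 0"
    unfolding val[OF kl(1), symmetric] z by simp
   then show "(\<Sum>s\<in>S. c s * \<mu> s k l) = 0" by (rule coeff_0[OF w_verts[OF kl(1)]]) (use kl in simp)
  qed
 next
  fix \<phi> assume \<phi>: "\<phi> \<in> Hom Q N N"
  obtain m where m: "commuting m" "\<And>k. k \<in> J \<Longrightarrow> \<phi> (w k) (b k) = (\<Sum>l\<in>fibre (w k). scl N (m k l) (b l))"
   using Hom_matrix[OF \<phi>] by metis
  obtain c where c: "\<forall>k\<in>J. \<forall>l\<in>J. w k = w l \<longrightarrow> m k l = (\<Sum>s\<in>S. c s * \<mu> s k l)" using complete[OF m(1)] by blast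
  have "\<phi> = ?sum c"
  proof (rule Hom_eqI[OF \<phi> comb])
   fix k assume k: "k \<in> J"
   show "\<phi> (w k) (b k) = ?sum c (w k) (b k)"
    unfolding val[OF k] m(2)[OF k] using c k by (intro sum.cong refl) auto
  qed
  then show "\<exists>c. \<phi> = ?sum c" by blast
 qed
 then show ?thesis by (simp add: dim_Hom_def fam_dim_def)
qed

end

subsection \<open>The quiver of a triangulated polygon with a loop at the root\<close>

declare split_paired_All [simp del] split_paired_Ex [simp del]

text \<open>The interface between topology and algebra: the classification and the computation of E
  rest on these axioms, and the quiver of the orbifold is later shown to satisfy them.\<close>

locale tree_quiver = polygon_triangulation D lo hi for D :: "chord set" and lo hi :: int +
 fixes Q :: "('i, 'e) quiver" and R :: "('e \<times> 'e) set"
  and cl :: "chord \<Rightarrow> 'i" and ar :: "chord \<Rightarrow> chord \<Rightarrow> 'e" and ep :: 'e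
 assumes verts: "verts Q = cl ` D" and cl_inj: "inj_on cl D"
  and arcs: "arcs Q = insert ep {ar u v |u v. (u, v) \<in> edges}"
  and tail_ar: "(u, v) \<in> edges \<Longrightarrow> tail Q (ar u v) = cl u"
  and head_ar: "(u, v) \<in> edges \<Longrightarrow> head Q (ar u v) = cl v"
  and tail_ep: "tail Q ep = cl root" and head_ep: "head Q ep = cl root" and rels: "R = insert (ep, ep) (
    {(ar (rgt x) (lft x), ar x (rgt x)) |x. x \<in> D \<and> lft x \<in> D \<and> rgt x \<in> D} \<union>
    {(ar (lft x) x, ar (rgt x) (lft x)) |x. x \<in> D \<and> lft x \<in> D \<and> rgt x \<in> D} \<union>
    {(ar x (rgt x), ar (lft x) x) |x. x \<in> D \<and> lft x \<in> D \<and> rgt x \<in> D})"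
begin

lemma cl_eq: "x \<in> D \<Longrightarrow> y \<in> D \<Longrightarrow> cl x = cl y \<longleftrightarrow> x = y" using cl_inj by (auto simp: inj_on_def)

lemma ar_arcs: "(u, v) \<in> edges \<Longrightarrow> ar u v \<in> arcs Q" and ep_arcs: "ep \<in> arcs Q" unfolding arcs by blast+

lemma arcs_cases:
 assumes "a \<in> arcs Q"
 obtains "a = ep" | u v where "a = ar u v" "(u, v) \<in> edges" "u \<in> D" "v \<in> D"
 using assms edges_mem unfolding arcs by blast

lemma ar_eq: "(u, v) \<in> edges \<Longrightarrow> (u', v') \<in> edges \<Longrightarrow> ar u v = ar u' v' \<longleftrightarrow> u = u' \<and> v = v'"
 by (metis tail_ar head_ar cl_eq edges_mem)

lemma ar_neq_ep: "(u, v) \<in> edges \<Longrightarrow> ar u v \<noteq> ep"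
 by (metis tail_ar head_ar tail_ep head_ep cl_eq edges_mem edges_irrefl)

lemma finite_verts: "finite (verts Q)" using verts finite_D by simp

lemma finite_edges: "finite edges" by (rule finite_subset[of _ "D \<times> D"]) (use edges_mem finite_D in auto)

lemma finite_arcs: "finite (arcs Q)"
proof -
 have "{ar u v |u v. (u, v) \<in> edges} = (\<lambda>(u, v). ar u v) ` edges" by auto
 then show ?thesis using arcs finite_edges by simp
qed

lemma tails: "a \<in> arcs Q \<Longrightarrow> tail Q a \<in> verts Q" and heads: "a \<in> arcs Q \<Longrightarrow> head Q a \<in> verts Q"
 using verts tail_ar head_ar tail_ep head_ep root_mem by (auto elim!: arcs_cases)

lemma rels_composable:
 assumes "(c, a) \<in> R" shows "a \<in> arcs Q \<and> c \<in> arcs Q \<and> tail Q c = head Q a"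
 using assms rels ar_arcs ep_arcs edgesI tail_ar head_ar tail_ep head_ep by fastforce

lemma edge_not_down_up: "x \<in> D \<Longrightarrow> y \<in> D \<Longrightarrow> x = lft y \<Longrightarrow> rgt x \<noteq> y"
 using apex[of y] apex[of x] by (auto simp: prod_eq_iff)

text \<open>Every arrow between chords lies in exactly one triangle, so at most one relation begins
  with it. The next two lemmas treat the other two arrows of a triangle.\<close>

lemma next_down:
 assumes "x \<in> D" "rgt x \<in> D" shows "(c, ar x (rgt x)) \<in> R \<longleftrightarrow> lft x \<in> D \<and> c = ar (rgt x) (lft x)"
proof
 assume "(c, ar x (rgt x)) \<in> R"
 then consider "ar x (rgt x) = ep"
  | y where "y \<in> D" "lft y \<in> D" "rgt y \<in> D" "c = ar (rgt y) (lft y)" "ar x (rgt x) = ar y (rgt y)"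
  | y where "y \<in> D" "lft y \<in> D" "rgt y \<in> D" "ar x (rgt x) = ar (rgt y) (lft y)"
  | y where "y \<in> D" "lft y \<in> D" "rgt y \<in> D" "ar x (rgt x) = ar (lft y) y" unfolding rels by blast
 then show "lft x \<in> D \<and> c = ar (rgt x) (lft x)"
 proof cases
  case 1
  then show ?thesis using ar_neq_ep edgesI assms by blast
 next
  case (2 y)
  then have "x = y" using ar_eq[OF edgesI(1)[OF assms] edgesI(1)[OF 2(1,3)]] 2(5) by blast+
  then show ?thesis using 2 by simp
 next
  case (3 y)
  then have "rgt x = lft y" using ar_eq[OF edgesI(1)[OF assms] edgesI(3)[OF 3(1-3)]] 3(4) by blast+
  then show ?thesis using parents_eq(3)[of y x] 3 assms by metis
 next
  case (4 y)
  then have "x = lft y" "rgt x = y" using ar_eq[OF edgesI(1)[OF assms] edgesI(2)[OF 4(1,2)]] 4(4) by blast+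
  then show ?thesis using edge_not_down_up[of x y] 4 assms by metis
 qed
next
 assume "lft x \<in> D \<and> c = ar (rgt x) (lft x)"
 then show "(c, ar x (rgt x)) \<in> R" unfolding rels using assms by blast
qed

lemma next_up:
 assumes "x \<in> D" "lft x \<in> D" shows "(c, ar (lft x) x) \<in> R \<longleftrightarrow> rgt x \<in> D \<and> c = ar x (rgt x)"
proof
 assume "(c, ar (lft x) x) \<in> R"
 then consider "ar (lft x) x = ep"
  | y where "y \<in> D" "lft y \<in> D" "rgt y \<in> D" "ar (lft x) x = ar y (rgt y)"
  | y where "y \<in> D" "lft y \<in> D" "rgt y \<in> D" "ar (lft x) x = ar (rgt y) (lft y)"
  | y where "y \<in> D" "lft y \<in> D" "rgt y \<in> D" "c = ar y (rgt y)" "ar (lft x) x = ar (lft y) y"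
  unfolding rels by blast
 then show "rgt x \<in> D \<and> c = ar x (rgt x)"
 proof cases
  case 1
  then show ?thesis using ar_neq_ep edgesI assms by blast
 next
  case (2 y)
  then have "lft x = y" "x = rgt y" using ar_eq[OF edgesI(2)[OF assms] edgesI(1)[OF 2(1,3)]] 2(4) by blast+
  then show ?thesis using edge_not_down_up[of y x] 2 assms by metis
 next
  case (3 y)
  then have "lft x = rgt y" using ar_eq[OF edgesI(2)[OF assms] edgesI(3)[OF 3(1-3)]] 3(4) by blast+
  then show ?thesis using parents_eq(3)[of x y] 3 assms by metis
 next
  case (4 y)
  then have "x = y" using ar_eq[OF edgesI(2)[OF assms] edgesI(2)[OF 4(1,2)]] 4(5) by blast+
  then show ?thesis using 4 by simp
 qed
next
 assume "rgt x \<in> D \<and> c = ar x (rgt x)"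
 then show "(c, ar (lft x) x) \<in> R" unfolding rels using assms by blast
qed

lemma next_across:
 assumes "x \<in> D" "lft x \<in> D" "rgt x \<in> D" shows "(c, ar (rgt x) (lft x)) \<in> R \<longleftrightarrow> c = ar (lft x) x"
proof
 assume "(c, ar (rgt x) (lft x)) \<in> R"
 then consider "ar (rgt x) (lft x) = ep"
  | y where "y \<in> D" "lft y \<in> D" "rgt y \<in> D" "ar (rgt x) (lft x) = ar y (rgt y)"
  | y where "y \<in> D" "lft y \<in> D" "rgt y \<in> D" "c = ar (lft y) y" "ar (rgt x) (lft x) = ar (rgt y) (lft y)"
  | y where "y \<in> D" "lft y \<in> D" "rgt y \<in> D" "ar (rgt x) (lft x) = ar (lft y) y" unfolding rels by blast
 then show "c = ar (lft x) x"
 proof cases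
  case 1
  then show ?thesis using ar_neq_ep edgesI assms by blast
 next
  case (2 y)
  then have "lft x = rgt y" using ar_eq[OF edgesI(3)[OF assms] edgesI(1)[OF 2(1,3)]] 2(4) by blast+
  then show ?thesis using parents_eq(3)[of x y] 2 assms by metis
 next
  case (3 y)
  then have "lft x = lft y" using ar_eq[OF edgesI(3)[OF assms] edgesI(3)[OF 3(1-3)]] 3(5) by blast+
  then have "x = y" using parents_eq(1) assms 3 by blast
  then show ?thesis using 3 by simp
 next
  case (4 y)
  then have "rgt x = lft y" using ar_eq[OF edgesI(3)[OF assms] edgesI(2)[OF 4(1,2)]] 4(4) by blast+
  then show ?thesis using parents_eq(3)[of y x] 4 assms by metis
 qed
next
 assume "c = ar (lft x) x"
 then show "(c, ar (rgt x) (lft x)) \<in> R" unfolding rels using assms by blast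
qed

lemma next_ep: "(c, ep) \<in> R \<longleftrightarrow> c = ep" unfolding rels using ar_neq_ep edgesI by blast

lemma sum_arcs:
 fixes g :: "'e \<Rightarrow> int" shows "(\<Sum>a\<in>arcs Q. g a) = g ep + (\<Sum>x\<in>D.
   (if rgt x \<in> D then g (ar x (rgt x)) else 0) + (if lft x \<in> D then g (ar (lft x) x) else 0)
    + (if lft x \<in> D \<and> rgt x \<in> D then g (ar (rgt x) (lft x)) else 0))"
proof -
 let ?A1 = "{x \<in> D. rgt x \<in> D}" and ?A2 = "{x \<in> D. lft x \<in> D}" and ?A3 = "{x \<in> D. lft x \<in> D \<and> rgt x \<in> D}"
 let ?f1 = "\<lambda>x. ar x (rgt x)" and ?f2 = "\<lambda>x. ar (lft x) x" and ?f3 = "\<lambda>x. ar (rgt x) (lft x)"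
 have fin: "finite ?A1" "finite ?A2" "finite ?A3" using finite_D by auto
 have "{ar u v |u v. (u, v) \<in> edges} = ?f1 ` ?A1 \<union> ?f2 ` ?A2 \<union> ?f3 ` ?A3" unfolding edges_def by blast
 then have arcs': "arcs Q = insert ep (?f1 ` ?A1 \<union> ?f2 ` ?A2 \<union> ?f3 ` ?A3)" by (simp add: arcs)
 have ep: "ep \<notin> ?f1 ` ?A1 \<union> ?f2 ` ?A2 \<union> ?f3 ` ?A3"
  using ar_neq_ep[OF edgesI(1)] ar_neq_ep[OF edgesI(2)] ar_neq_ep[OF edgesI(3)] by fastforce
 have d12: "?f1 ` ?A1 \<inter> ?f2 ` ?A2 = {}"
 proof -
  have "?f1 x \<noteq> ?f2 y" if "x \<in> ?A1" "y \<in> ?A2" for x y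
   using ar_eq[OF edgesI(1)[of x] edgesI(2)[of y]] edge_not_down_up[of x y] that by auto
  then show ?thesis by blast
 qed
 have d3: "(?f1 ` ?A1 \<union> ?f2 ` ?A2) \<inter> ?f3 ` ?A3 = {}"
 proof -
  have "?f1 x \<noteq> ?f3 y" if "x \<in> ?A1" "y \<in> ?A3" for x y
   using ar_eq[OF edgesI(1)[of x] edgesI(3)[of y]] parents_eq(3)[of y x] that by auto
  moreover have "?f2 x \<noteq> ?f3 y" if "x \<in> ?A2" "y \<in> ?A3" for x y
   using ar_eq[OF edgesI(2)[of x] edgesI(3)[of y]] parents_eq(3)[of x y] that by auto
  ultimately show ?thesis by blast
 qed
 have i1: "inj_on ?f1 ?A1" by (intro inj_onI) (use ar_eq edgesI in blast)
 have i2: "inj_on ?f2 ?A2" by (intro inj_onI) (use ar_eq edgesI in blast)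
 have i3: "inj_on ?f3 ?A3"
 proof (intro inj_onI)
  fix x y assume xy: "x \<in> ?A3" "y \<in> ?A3" "?f3 x = ?f3 y"
  then have "lft x = lft y" using ar_eq[OF edgesI(3)[of x] edgesI(3)[of y]] by blast
  then show "x = y" using parents_eq(1)[of x y] xy by blast
 qed
 have "(\<Sum>a\<in>arcs Q. g a) = g ep + ((\<Sum>x\<in>?A1. g (?f1 x)) + (\<Sum>x\<in>?A2. g (?f2 x)) + (\<Sum>x\<in>?A3. g (?f3 x)))"
  unfolding arcs' using fin ep d12 d3
  by (simp add: sum.union_disjoint sum.reindex[OF i1] sum.reindex[OF i2] sum.reindex[OF i3] del: Un_iff)
 then show ?thesis using finite_D by (simp add: sum.distrib sum.inter_filter)
qed

text \<open>The recursion along which the sums of local terms telescope.\<close>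

lemma sum_enclosed:
 fixes g :: "chord \<Rightarrow> int"
 assumes "x \<in> D" shows "(\<Sum>y | y \<in> D \<and> encloses x y. g y) = g x
  + (if lft x \<in> D then \<Sum>y | y \<in> D \<and> encloses (lft x) y. g y else 0)
  + (if rgt x \<in> D then \<Sum>y | y \<in> D \<and> encloses (rgt x) y. g y else 0)"
proof -
 let ?L = "if lft x \<in> D then {y \<in> D. encloses (lft x) y} else {}"
 let ?R = "if rgt x \<in> D then {y \<in> D. encloses (rgt x) y} else {}"
 have eq: "{y \<in> D. encloses x y} = insert x (?L \<union> ?R)"
 proof (intro subset_antisym subsetI)
  fix y assume "y \<in> {y \<in> D. encloses x y}"
  then have y: "y \<in> D" "encloses x y" by auto
  from assms y show "y \<in> insert x (?L \<union> ?R)" by (cases rule: encloses_cases) (use y in auto)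
 next
  fix y assume "y \<in> insert x (?L \<union> ?R)"
  then show "y \<in> {y \<in> D. encloses x y}"
   using assms encloses_trans[OF encloses_lft[OF assms], of y] encloses_trans[OF encloses_rgt[OF assms], of y]
   by (auto split: if_splits)
 qed
 have "finite ?L" "finite ?R" using finite_D by auto
 moreover have "x \<notin> ?L \<union> ?R" using assms by (auto split: if_splits)
 moreover have "y \<notin> ?R" if "y \<in> ?L" for y
  using that encloses_lft_rgt_False[of y x] by (simp split: if_splits) blast
 then have "?L \<inter> ?R = {}" by blast
 ultimately show ?thesis unfolding eq by (simp add: sum.union_disjoint)
qed

text \<open>
  Models: a set \<open>J\<close> of diagonals with a colour, on which arrows act as the identity on colours except
  that \<open>ep\<close> moves the root from colour \<open>True\<close> to colour \<open>False\<close>.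
\<close>

definition step :: "'e \<Rightarrow> chord \<times> bool \<Rightarrow> chord \<times> bool \<Rightarrow> bool" where
 "step a k l \<longleftrightarrow> (fst k, fst l) \<in> edges \<and> a = ar (fst k) (fst l) \<and> snd k = snd l \<or>
   a = ep \<and> k = (root, True) \<and> l = (root, False)"

definition act_on :: "(chord \<times> bool) set \<Rightarrow> 'e \<Rightarrow> chord \<times> bool \<Rightarrow> (chord \<times> bool) option" where
 "act_on J a k = (if \<exists>l\<in>J. step a k l then Some (THE l. l \<in> J \<and> step a k l) else None)"

lemma step_functional: "step a k l \<Longrightarrow> step a k l' \<Longrightarrow> l = l'"
 unfolding step_def using ar_eq ar_neq_ep by (metis prod_eq_iff)

lemma step_injective: "step a k l \<Longrightarrow> step a k' l \<Longrightarrow> k = k'"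
 unfolding step_def using ar_eq ar_neq_ep by (metis prod_eq_iff)

lemma act_on_Some: "act_on J a k = Some l \<longleftrightarrow> l \<in> J \<and> step a k l"
proof
 assume a: "act_on J a k = Some l"
 then have "\<exists>!l. l \<in> J \<and> step a k l" unfolding act_on_def by (metis option.distinct(1) step_functional)
 from theI'[OF this] show "l \<in> J \<and> step a k l" using a unfolding act_on_def by (auto split: if_splits)
next
 assume l: "l \<in> J \<and> step a k l"
 then have "(THE l. l \<in> J \<and> step a k l) = l" using step_functional by blast
 then show "act_on J a k = Some l" using l unfolding act_on_def by auto
qed

lemma act_on_None: "act_on J a k = None \<longleftrightarrow> (\<forall>l\<in>J. \<not> step a k l)" by (simp add: act_on_def)

lemma step_ar: "(u, v) \<in> edges \<Longrightarrow> step (ar u v) k l \<longleftrightarrow> fst k = u \<and> fst l = v \<and> snd k = snd l"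
 unfolding step_def using ar_eq ar_neq_ep by metis

lemma step_ep: "step ep k l \<longleftrightarrow> k = (root, True) \<and> l = (root, False)"
 unfolding step_def using ar_neq_ep by metis

lemma act_on_ar_None:
 assumes "(u, v) \<in> edges" "fst k = u" shows "act_on J (ar u v) k = None \<longleftrightarrow> (v, snd k) \<notin> J"
 unfolding act_on_None step_ar[OF assms(1)]
proof
 assume v: "(v, snd k) \<notin> J"
 have "l = (v, snd k)" if "fst k = u \<and> fst l = v \<and> snd k = snd l" for l using that by (simp add: prod_eq_iff)
 then show "\<forall>l\<in>J. \<not> (fst k = u \<and> fst l = v \<and> snd k = snd l)" using v by metis
next
 assume "\<forall>l\<in>J. \<not> (fst k = u \<and> fst l = v \<and> snd k = snd l)"
 from bspec[OF this, of "(v, snd k)"] show "(v, snd k) \<notin> J" using assms(2) by auto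
qed

definition modelled :: "('i, 'e, 'v::ab_group_add) rep \<Rightarrow> (chord \<times> bool) set \<Rightarrow> bool" where
 "modelled N J \<longleftrightarrow> J \<subseteq> D \<times> UNIV \<and> (\<exists>b. string_model Q N J (cl \<circ> fst) (act_on J) b)"

end

section \<open>The E-invariant of a representation modelled on coloured chords\<close>

locale tree_model = tree_quiver D lo hi Q R cl ar ep +
  string_model_rep Q N J "cl \<circ> fst" "act_on J" b R
 for D :: "chord set" and lo hi :: int and Q :: "('i, 'e) quiver" and R cl ar ep
  and N :: "('i, 'e, 'v::ab_group_add) rep" and J b +
 assumes J_D: "J \<subseteq> D \<times> UNIV"
begin

text \<open>Integer indicators turn the counts of basis vectors into polynomials; they vanish
  outside D, which takes care of missing children.\<close>

definition p :: "chord \<Rightarrow> bool \<Rightarrow> int" where "p x c = of_bool ((x, c) \<in> J)"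

definition d :: "chord \<Rightarrow> int" where "d x = p x False + p x True"

lemma p_outside: "x \<notin> D \<Longrightarrow> p x c = 0" "x \<notin> D \<Longrightarrow> d x = 0" using J_D by (auto simp: p_def d_def)

lemma fibre_cl:
 assumes "x \<in> D" shows "fibre (cl x) = {k \<in> J. fst k = x}"
proof -
 have "(cl \<circ> fst) k = cl x \<longleftrightarrow> fst k = x" if "k \<in> J" for k
  using cl_eq[of "fst k" x] subsetD[OF J_D that] assms by (auto simp: mem_Times_iff)
 then show ?thesis by blast
qed

lemma card_colours:
 "int (card {k \<in> J. fst k = x \<and> P (snd k)}) = p x False * of_bool (P False) + p x True * of_bool (P True)"
proof -
 have "{k \<in> J. fst k = x \<and> P (snd k)} =
   (if (x, False) \<in> J \<and> P False then {(x, False)} else {}) \<union> (if (x, True) \<in> J \<and> P True then {(x, True)} else {})"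
  by (auto split: if_splits) (metis (full_types))+
 then show ?thesis by (auto simp: p_def)
qed

lemma card_fibre: "x \<in> D \<Longrightarrow> int (card (fibre (cl x))) = d x"
 unfolding fibre_cl d_def using card_colours[of x "\<lambda>_. True"] by simp

text \<open>Of the basis vectors at \<open>rgt x\<close>, those count whose colour does not continue
  to \<open>lft x\<close>. If \<open>lft x\<close> is a side of the polygon its indicators are 0, in
  agreement with the absence of a relation.\<close>

lemma free_down:
 assumes "x \<in> D" "rgt x \<in> D" shows "int (free_card (ar x (rgt x)))
  = p (rgt x) False * (1 - p (lft x) False) + p (rgt x) True * (1 - p (lft x) True)"
proof -
 have "{k \<in> fibre (head Q (ar x (rgt x))). \<forall>c. (c, ar x (rgt x)) \<in> R \<longrightarrow> act_on J c k = None}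
   = {k \<in> J. fst k = rgt x \<and> (lft x, snd k) \<notin> J}"
  unfolding next_down[OF assms] head_ar[OF edgesI(1)[OF assms]] fibre_cl[OF assms(2)]
  using act_on_ar_None[OF edgesI(3)[OF assms(1) _ assms(2)]] J_D by auto
 then show ?thesis
  unfolding free_card_def by (simp only: card_colours[of _ "\<lambda>c. (lft x, c) \<notin> J"]) (simp add: p_def)
qed

lemma free_up:
 assumes "x \<in> D" "lft x \<in> D"
 shows "int (free_card (ar (lft x) x)) = p x False * (1 - p (rgt x) False) + p x True * (1 - p (rgt x) True)"
proof -
 have "{k \<in> fibre (head Q (ar (lft x) x)). \<forall>c. (c, ar (lft x) x) \<in> R \<longrightarrow> act_on J c k = None}
   = {k \<in> J. fst k = x \<and> (rgt x, snd k) \<notin> J}"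
  unfolding next_up[OF assms] head_ar[OF edgesI(2)[OF assms]] fibre_cl[OF assms(1)]
  using act_on_ar_None[OF edgesI(1)[OF assms(1)]] J_D by auto
 then show ?thesis
  unfolding free_card_def by (simp only: card_colours[of _ "\<lambda>c. (rgt x, c) \<notin> J"]) (simp add: p_def)
qed

lemma free_across:
 assumes "x \<in> D" "lft x \<in> D" "rgt x \<in> D" shows "int (free_card (ar (rgt x) (lft x)))
  = p (lft x) False * (1 - p x False) + p (lft x) True * (1 - p x True)"
proof -
 have "{k \<in> fibre (head Q (ar (rgt x) (lft x))). \<forall>c. (c, ar (rgt x) (lft x)) \<in> R \<longrightarrow> act_on J c k = None}
   = {k \<in> J. fst k = lft x \<and> (x, snd k) \<notin> J}"
  unfolding next_across[OF assms] head_ar[OF edgesI(3)[OF assms]] fibre_cl[OF assms(2)]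
  using act_on_ar_None[OF edgesI(2)[OF assms(1,2)]] J_D by auto
 then show ?thesis
  unfolding free_card_def by (simp only: card_colours[of _ "\<lambda>c. (x, c) \<notin> J"]) (simp add: p_def)
qed

text \<open>The loop follows itself in its relation. It always kills colour False, and colour True
  only when there is no False copy of the root to map to.\<close>

lemma free_ep: "int (free_card ep) = p root False + p root True * (1 - p root False)"
proof -
 have "{k \<in> fibre (head Q ep). \<forall>c. (c, ep) \<in> R \<longrightarrow> act_on J c k = None}
   = {k \<in> J. fst k = root \<and> (snd k \<longrightarrow> (root, False) \<notin> J)}"
  unfolding next_ep head_ep fibre_cl[OF root_mem] by (auto simp: act_on_None step_ep)
 then show ?thesis unfolding free_card_def
  by (simp only: card_colours[of _ "\<lambda>c. c \<longrightarrow> (root, False) \<notin> J"]) (simp add: p_def)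
qed

text \<open>The contribution of the triangle below x to E, one product for each of its three arrows;
  the square belongs to the vertex x at the top of the triangle.\<close>

definition defect :: "chord \<Rightarrow> int" where
 "defect x = d x * (p (rgt x) False * (1 - p (lft x) False) + p (rgt x) True * (1 - p (lft x) True))
   + d (lft x) * (p x False * (1 - p (rgt x) False) + p x True * (1 - p (rgt x) True))
   + d (rgt x) * (p (lft x) False * (1 - p x False) + p (lft x) True * (1 - p x True)) - d x ^ 2"

text \<open>Each arrow other than the loop belongs to one triangle and each vertex is the top of
  one, so E consists of the endomorphisms, the loop term and one defect for each chord.\<close>

lemma E_inv_model:
 "E_inv Q R N = int (dim_Hom Q N N) + d root * (p root False + p root True * (1 - p root False))
   + (\<Sum>x | x \<in> D \<and> encloses root x. defect x)"
proof -
 have all: "{x \<in> D. encloses root x} = D" using encloses_root by blast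
 have "(\<Sum>i\<in>verts Q. int (card (fibre i)) ^ 2) = (\<Sum>x\<in>D. int (card (fibre (cl x))) ^ 2)"
  unfolding verts using sum.reindex[OF cl_inj] by simp
 also have "\<dots> = (\<Sum>x\<in>D. d x ^ 2)" by (intro sum.cong refl) (simp only: card_fibre)
 finally have 1: "(\<Sum>i\<in>verts Q. int (card (fibre i)) ^ 2) = (\<Sum>x\<in>D. d x ^ 2)" .
 let ?g = "\<lambda>a. int (card (fibre (tail Q a))) * int (free_card a)"
 have "(\<Sum>a\<in>arcs Q. ?g a) = ?g ep + (\<Sum>x\<in>D. (if rgt x \<in> D then ?g (ar x (rgt x)) else 0)
   + (if lft x \<in> D then ?g (ar (lft x) x) else 0)
   + (if lft x \<in> D \<and> rgt x \<in> D then ?g (ar (rgt x) (lft x)) else 0))" by (rule sum_arcs)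
 also have "\<dots> = d root * (p root False + p root True * (1 - p root False)) + (\<Sum>x\<in>D. defect x + d x ^ 2)"
 proof (rule arg_cong2[of _ _ _ _ "(+)"])
  show "?g ep = d root * (p root False + p root True * (1 - p root False))"
   by (simp only: tail_ep card_fibre[OF root_mem] free_ep)
  show "(\<Sum>x\<in>D. (if rgt x \<in> D then ?g (ar x (rgt x)) else 0)
   + (if lft x \<in> D then ?g (ar (lft x) x) else 0)
   + (if lft x \<in> D \<and> rgt x \<in> D then ?g (ar (rgt x) (lft x)) else 0)) = (\<Sum>x\<in>D. defect x + d x ^ 2)"
  proof (rule sum.cong[OF refl])
   fix x assume x: "x \<in> D"
   have 1: "(if rgt x \<in> D then ?g (ar x (rgt x)) else 0)
    = d x * (p (rgt x) False * (1 - p (lft x) False) + p (rgt x) True * (1 - p (lft x) True))"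
   proof (cases "rgt x \<in> D")
    case True
    then show ?thesis using x by (simp only: tail_ar[OF edgesI(1)] card_fibre free_down if_True)
   next
    case False
    then show ?thesis using p_outside(1)[OF False] by simp
   qed
   have 2: "(if lft x \<in> D then ?g (ar (lft x) x) else 0)
    = d (lft x) * (p x False * (1 - p (rgt x) False) + p x True * (1 - p (rgt x) True))"
   proof (cases "lft x \<in> D")
    case True
    then show ?thesis using x by (simp only: tail_ar[OF edgesI(2)] card_fibre free_up if_True)
   next
    case False
    then show ?thesis using p_outside(2)[OF False] by simp
   qed
   have 3: "(if lft x \<in> D \<and> rgt x \<in> D then ?g (ar (rgt x) (lft x)) else 0)
    = d (rgt x) * (p (lft x) False * (1 - p x False) + p (lft x) True * (1 - p x True))"
   proof (cases "lft x \<in> D \<and> rgt x \<in> D")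
    case True
    then show ?thesis using x by (simp only: tail_ar[OF edgesI(3)] card_fibre free_across simp_thms if_True)
   next
    case False
    then have "d (rgt x) = 0 \<or> p (lft x) False = 0 \<and> p (lft x) True = 0" using p_outside by blast
    then show ?thesis using False by auto
   qed
   show "(if rgt x \<in> D then ?g (ar x (rgt x)) else 0)
   + (if lft x \<in> D then ?g (ar (lft x) x) else 0)
   + (if lft x \<in> D \<and> rgt x \<in> D then ?g (ar (rgt x) (lft x)) else 0) = defect x + d x ^ 2"
    unfolding 1 2 3 defect_def by simp
  qed
 qed
 finally have 2: "(\<Sum>a\<in>arcs Q. ?g a)
  = d root * (p root False + p root True * (1 - p root False)) + (\<Sum>x\<in>D. defect x) + (\<Sum>x\<in>D. d x ^ 2)"
  by (simp add: sum.distrib)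
 show ?thesis unfolding E_inv_eq 1 2 all by simp
qed

lemma commuting_identity: "commuting (\<lambda>k l. of_bool (k = l))" unfolding commuting_def
proof (intro ballI conjI allI impI)
 fix a k k' k2 l
 assume a: "a \<in> arcs Q" and k: "k \<in> fibre (tail Q a)" "act_on J a k = Some k'"
  and k2: "k2 \<in> fibre (tail Q a)" "act_on J a k2 = Some l"
 have "k' = l \<longleftrightarrow> k = k2" using k(2) k2(2) step_functional step_injective unfolding act_on_Some by blast
 then show "(of_bool (k' = l) :: complex) = of_bool (k = k2)" by simp
next
 fix a k k' l
 assume "a \<in> arcs Q" and "k \<in> fibre (tail Q a)" "act_on J a k = Some k'" "l \<in> fibre (head Q a)"
  "\<forall>k2\<in>fibre (tail Q a). act_on J a k2 \<noteq> Some l"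
 then show "(of_bool (k' = l) :: complex) = 0" by auto
next
 fix a k k2
 assume "act_on J a k = None" "act_on J a k2 \<noteq> None"
 then show "(of_bool (k = k2) :: complex) = 0" by auto
qed

lemma commuting_edge:
 assumes m: "commuting m" and e: "(u, v) \<in> edges"
  and J: "(u, c) \<in> J" "(v, c) \<in> J" "(u, c') \<in> J" "(v, c') \<in> J" shows "m (v, c) (v, c') = m (u, c) (u, c')"
proof -
 have "(u, c) \<in> fibre (tail Q (ar u v))" "(u, c') \<in> fibre (tail Q (ar u v))" using J tail_ar[OF e] by auto
 moreover have "act_on J (ar u v) (u, c) = Some (v, c)" "act_on J (ar u v) (u, c') = Some (v, c')"
  using J by (simp_all add: act_on_Some step_ar[OF e])
 ultimately show ?thesis using m ar_arcs[OF e] unfolding commuting_def by blast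
qed

lemma commuting_edge_not_image:
 assumes m: "commuting m" and e: "(u, v) \<in> edges"
  and J: "(u, c) \<in> J" "(v, c) \<in> J" "(v, c') \<in> J" "(u, c') \<notin> J" shows "m (v, c) (v, c') = 0"
proof -
 have "(u, c) \<in> fibre (tail Q (ar u v))" "(v, c') \<in> fibre (head Q (ar u v))"
  using J tail_ar[OF e] head_ar[OF e] by auto
 moreover have "act_on J (ar u v) (u, c) = Some (v, c)" using J by (simp add: act_on_Some step_ar[OF e])
 moreover have "\<forall>k2\<in>fibre (tail Q (ar u v)). act_on J (ar u v) k2 \<noteq> Some (v, c')"
 proof (intro ballI notI)
  fix k2 assume k2: "k2 \<in> fibre (tail Q (ar u v))" "act_on J (ar u v) k2 = Some (v, c')"
  then have "k2 = (u, c')" by (simp add: act_on_Some step_ar[OF e] prod_eq_iff)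
  then show False using k2(1) J(4) by simp
 qed
 ultimately show ?thesis using m ar_arcs[OF e] unfolding commuting_def by blast
qed

lemma commuting_edge_killed:
 assumes m: "commuting m" and e: "(u, v) \<in> edges"
  and J: "(u, c) \<in> J" "(v, c) \<notin> J" "(u, c') \<in> J" "(v, c') \<in> J" shows "m (u, c) (u, c') = 0"
proof -
 have "(u, c) \<in> fibre (tail Q (ar u v))" "(u, c') \<in> fibre (tail Q (ar u v))" using J tail_ar[OF e] by auto
 moreover have "act_on J (ar u v) (u, c) = None" "act_on J (ar u v) (u, c') \<noteq> None"
  using J act_on_ar_None[OF e, of "(u, c)"] act_on_ar_None[OF e, of "(u, c')"] by simp_all
 ultimately show ?thesis using m ar_arcs[OF e] unfolding commuting_def by blast
qed

lemma commuting_ep: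
 assumes m: "commuting m" and J: "(root, True) \<in> J" "(root, False) \<in> J"
 shows "m (root, False) (root, False) = m (root, True) (root, True)" "m (root, False) (root, True) = 0"
proof -
 have f: "(root, True) \<in> fibre (tail Q ep)" "(root, True) \<in> fibre (head Q ep)"
   "(root, False) \<in> fibre (tail Q ep)" using J tail_ep head_ep by auto
 have s: "act_on J ep (root, True) = Some (root, False)" using J by (simp add: act_on_Some step_ep)
 show "m (root, False) (root, False) = m (root, True) (root, True)"
  using m ep_arcs f s unfolding commuting_def by blast
 have "\<forall>k2\<in>fibre (tail Q ep). act_on J ep k2 \<noteq> Some (root, True)" by (auto simp: act_on_Some step_ep)
 then show "m (root, False) (root, True) = 0" using m ep_arcs f s unfolding commuting_def by blast
qed

text \<open>With a single colour each fibre over a chord has at most one element, so an endomorphism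
  is a scalar at each chord of the string; \<open>conn\<close> makes these scalars equal.\<close>

lemma dim_Hom_scalar:
 assumes J: "J \<subseteq> D \<times> {False}" "(x0, False) \<in> J"
  and conn: "\<And>m x. commuting m \<Longrightarrow> (x, False) \<in> J \<Longrightarrow> m (x, False) (x, False) = m (x0, False) (x0, False)"
 shows "dim_Hom Q N N = 1"
proof -
 have "dim_Hom Q N N = card {()}"
 proof (rule dim_Hom_eq[of "{()}" "\<lambda>_ k l. of_bool (k = l)"])
  show "commuting (\<lambda>k l. of_bool (k = l))" by (rule commuting_identity)
 next
  fix c :: "unit \<Rightarrow> complex"
  assume "\<And>k l. k \<in> J \<Longrightarrow> l \<in> J \<Longrightarrow> (cl \<circ> fst) k = (cl \<circ> fst) l \<Longrightarrow> (\<Sum>s\<in>{()}. c s * of_bool (k = l)) = 0"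
  from this[OF J(2) J(2)] show "\<forall>s\<in>{()}. c s = 0" by simp
 next
  fix m assume m: "commuting m"
  have "m k l = (\<Sum>s\<in>{()}. m (x0, False) (x0, False) * of_bool (k = l))"
   if kl: "k \<in> J" "l \<in> J" "(cl \<circ> fst) k = (cl \<circ> fst) l" for k l
  proof -
   have "k = (fst k, False)" "l = (fst l, False)" "fst k \<in> D" "fst l \<in> D" using J(1) kl(1,2) by auto
   moreover from this have "fst k = fst l" using kl(3) cl_eq by simp
   ultimately obtain x where x: "k = (x, False)" "l = (x, False)" by metis
   show ?thesis using conn[OF m, of x] kl(1) unfolding x by simp
  qed
  then show "\<exists>c. \<forall>k\<in>J. \<forall>l\<in>J. (cl \<circ> fst) k = (cl \<circ> fst) l \<longrightarrow> m k l = (\<Sum>s\<in>{()}. c s * of_bool (k = l))"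
   by (intro exI[of _ "\<lambda>_. m (x0, False) (x0, False)"]) blast
 qed simp
 then show ?thesis by simp
qed

end

section \<open>Endomorphisms and E for the two kinds of strings\<close>

context polygon_triangulation
begin

text \<open>The diagonals crossed by a curve that runs from vertex k out of the polygon through the
  root.\<close>

definition strand :: "int \<Rightarrow> bool \<Rightarrow> (chord \<times> bool) set" where
 "strand k c = {(x, c) |x. x \<in> D \<and> fst x < k \<and> k < snd x}"

definition crosses :: "int \<Rightarrow> int \<Rightarrow> chord \<Rightarrow> bool" where
 "crosses k l x \<longleftrightarrow> fst x < k \<and> k < snd x \<and> snd x < l \<or> k < fst x \<and> fst x < l \<and> l < snd x"

definition crossing_strand :: "int \<Rightarrow> int \<Rightarrow> (chord \<times> bool) set" where
 "crossing_strand k l = {(x, False) |x. x \<in> D \<and> crosses k l x}"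

lemma lft_mem: "x \<in> D \<Longrightarrow> fst x < k \<Longrightarrow> k < apex x \<Longrightarrow> lft x \<in> D"
 and rgt_mem: "x \<in> D \<Longrightarrow> apex x < k \<Longrightarrow> k < snd x \<Longrightarrow> rgt x \<in> D" using apex(3,4)[of x] by auto

end

context tree_model
begin

lemma p_strand:
 assumes J: "J = strand k False \<union> strand l True" and x: "x \<in> D"
 shows "p x False = of_bool (fst x < k \<and> k < snd x)" "p x True = of_bool (fst x < l \<and> l < snd x)"
  "p (lft x) False = of_bool (fst x < k \<and> k < apex x)" "p (lft x) True = of_bool (fst x < l \<and> l < apex x)"
  "p (rgt x) False = of_bool (apex x < k \<and> k < snd x)" "p (rgt x) True = of_bool (apex x < l \<and> l < snd x)"
proof -
 have F: "(y, False) \<in> J \<longleftrightarrow> y \<in> D \<and> fst y < k \<and> k < snd y" for y unfolding J strand_def by blast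
 have T: "(y, True) \<in> J \<longleftrightarrow> y \<in> D \<and> fst y < l \<and> l < snd y" for y unfolding J strand_def by blast
 show "p x False = of_bool (fst x < k \<and> k < snd x)" "p x True = of_bool (fst x < l \<and> l < snd x)"
  "p (lft x) False = of_bool (fst x < k \<and> k < apex x)" "p (lft x) True = of_bool (fst x < l \<and> l < apex x)"
  "p (rgt x) False = of_bool (apex x < k \<and> k < snd x)" "p (rgt x) True = of_bool (apex x < l \<and> l < snd x)"
  unfolding p_def F T using x lft_mem[OF x, of k] rgt_mem[OF x, of k] lft_mem[OF x, of l] rgt_mem[OF x, of l]
  by auto
qed

text \<open>With h for the negative of the right-hand side,
  \<open>defect x = h (lft x) + h (rgt x) - h x\<close> is a finite check over the positions of k
  and l relative to the ends and the apex of x; so the sum telescopes.\<close>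

lemma sum_defect_strand:
 assumes J: "J = strand k False \<union> strand l True" and x: "x \<in> D"
 defines "u \<equiv> \<lambda>x. of_bool (fst x < k \<and> k < snd x) :: int" and "v \<equiv> \<lambda>x. of_bool (fst x < l \<and> l < snd x) :: int"
 shows "(\<Sum>y | y \<in> D \<and> encloses x y. defect y) = - (u x + v x + (1 + of_bool (k = l)) * (u x * v x))" using x
proof (induction x rule: chord_induct)
 case (chord x)
 let ?h = "\<lambda>x. u x + v x + (1 + of_bool (k = l)) * (u x * v x)"
 note pp = p_strand[OF J chord(1)] and ap = apex(1,2)[OF chord(1)]
 \<comment> \<open>A child outside D is a side of the polygon; no integer lies strictly between its
   ends, so the closed form vanishes on it.\<close>
 have L: "(if lft x \<in> D then \<Sum>y | y \<in> D \<and> encloses (lft x) y. defect y else 0) = - ?h (lft x)"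
 proof (cases "lft x \<in> D")
  case False
  then have "apex x = fst x + 1" using apex(3)[OF chord(1)] by simp
  then show ?thesis using False by (simp add: u_def v_def)
 qed (use chord in simp)
 have R: "(if rgt x \<in> D then \<Sum>y | y \<in> D \<and> encloses (rgt x) y. defect y else 0) = - ?h (rgt x)"
 proof (cases "rgt x \<in> D")
  case False
  then have "snd x = apex x + 1" using apex(4)[OF chord(1)] by simp
  then show ?thesis using False by (simp add: u_def v_def)
 qed (use chord in simp)
 have "k \<le> fst x \<or> snd x \<le> k \<or> fst x < k \<and> k < apex x \<or> k = apex x \<or> apex x < k \<and> k < snd x"
  using ap by linarith
 moreover have "l \<le> fst x \<or> snd x \<le> l \<or> fst x < l \<and> l < apex x \<or> l = apex x \<or> apex x < l \<and> l < snd x"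
  using ap by linarith
 ultimately have "defect x - ?h (lft x) - ?h (rgt x) = - ?h x"
  unfolding defect_def d_def pp u_def v_def fst_lft snd_lft fst_rgt snd_rgt
  using ap by (elim disjE) (auto simp: power2_eq_square)
 then show ?case unfolding sum_enclosed[OF chord(1)] L R by simp
qed

end

context tree_model
begin

lemma strand_mem:
 assumes "J = strand k False \<union> strand l True"
 shows "(x, c) \<in> J \<longleftrightarrow> x \<in> D \<and> fst x < (if c then l else k) \<and> (if c then l else k) < snd x"
 unfolding assms strand_def by (cases c) auto

text \<open>If both vectors are present at x, both are present at every chord on the path from the
  root to x, and the arrows along this path carry the matrix entry unchanged.\<close>

lemma commuting_strand:
 assumes J: "J = strand k False \<union> strand l True" and m: "commuting m" and x: "(x, c) \<in> J" "(x, c') \<in> J"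
 shows "m (x, c) (x, c') = m (root, c) (root, c')"
proof -
 note mem = strand_mem[OF J]
 have xD: "x \<in> D" using x mem by blast
 have up: "(z, c) \<in> J \<and> (z, c') \<in> J" if "z \<in> D" "encloses z x" for z
  using that x unfolding mem encloses_def by (auto split: if_splits)
 show ?thesis
 proof (rule descend_encloses[of root x "\<lambda>z. m (z, c) (z, c') = m (root, c) (root, c')"])
  fix z assume z: "z \<in> D" "encloses z x" "m (z, c) (z, c') = m (root, c) (root, c')"
  show "m (lft z, c) (lft z, c') = m (root, c) (root, c')" if "lft z \<in> D" "encloses (lft z) x"
   using commuting_edge[OF m edgesI(2)[OF z(1) that(1)]] up[OF z(1,2)] up[OF that] z(3) by simp
  show "m (rgt z, c) (rgt z, c') = m (root, c) (root, c')" if "rgt z \<in> D" "encloses (rgt z) x"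
   using commuting_edge[OF m edgesI(1)[OF z(1) that(1)]] up[OF z(1,2)] up[OF that] z(3) by simp
 qed (use xD root_mem encloses_root in auto)
qed

text \<open>The loop kills the only vector at the root and contributes 1, while the scalar
  endomorphisms and the triangles cancel: 1 - 1.\<close>

lemma E_inv_single_strand:
 assumes J: "J = strand k False \<union> strand l True" and k: "lo < k" "k < hi" and l: "l \<le> lo \<or> hi \<le> l"
 shows "E_inv Q R N = 1"
proof -
 note mem = strand_mem[OF J]
 have T: "(x, True) \<notin> J" for x using l chord_bounds[of x] unfolding mem by auto
 have "dim_Hom Q N N = 1"
 proof (rule dim_Hom_scalar[of root])
  show "J \<subseteq> D \<times> {False}"
  proof
   fix z assume z: "z \<in> J"
   then have "snd z = False" using T[of "fst z"] by (cases z) auto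
   then show "z \<in> D \<times> {False}" using z J_D by (auto simp: mem_Times_iff)
  qed
  show "(root, False) \<in> J" using root_mem k mem by simp
  show "m (x, False) (x, False) = m (root, False) (root, False)" if "commuting m" "(x, False) \<in> J" for m x
   using commuting_strand[OF J that(1)] that(2) by blast
 qed
 moreover have "p root False = 1" "p root True = 0" unfolding p_strand(1,2)[OF J root_mem] using k l by auto
 moreover have "(\<Sum>y | y \<in> D \<and> encloses root y. defect y) = -1"
  using sum_defect_strand[OF J root_mem] k l by auto
 ultimately show ?thesis unfolding E_inv_model d_def by simp
qed

text \<open>Going down, the strands part at a triangle whose apex lies between l and k. There either
  only the True vector is in the image of the left child, or only the False vector survives to the
  right child. Images must go to images and kernels to kernels, so an entry from True to False is
  impossible.\<close>

lemma commuting_strand_zero: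
 assumes J: "J = strand k False \<union> strand l True" and kl: "l < k" and m: "commuting m"
  and x: "x \<in> D" "fst x < l" "k < snd x" shows "m (x, True) (x, False) = 0" using x
proof (induction x rule: chord_induct)
 case (chord x)
 note mem = strand_mem[OF J] and ap = apex(1,2)[OF chord(1)]
 have xJ: "(x, True) \<in> J" "(x, False) \<in> J" using chord kl by (simp_all add: mem)
 consider "k < apex x" | "apex x < l" | "l < apex x" "apex x \<le> k" | "l = apex x" by linarith
 then show ?case
 proof cases
  case 1
  then have L: "lft x \<in> D" using lft_mem[OF chord(1), of k] chord kl by simp
  then have "m (lft x, True) (lft x, False) = 0" using chord 1 by simp
  moreover have "(lft x, True) \<in> J" "(lft x, False) \<in> J" using L chord 1 kl by (simp_all add: mem)
  ultimately show ?thesis using commuting_edge[OF m edgesI(2)[OF chord(1) L]] xJ by simp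
 next
  case 2
  then have R: "rgt x \<in> D" using rgt_mem[OF chord(1), of l] chord kl by simp
  then have "m (rgt x, True) (rgt x, False) = 0" using chord 2 by simp
  moreover have "(rgt x, True) \<in> J" "(rgt x, False) \<in> J" using R chord 2 kl by (simp_all add: mem)
  ultimately show ?thesis using commuting_edge[OF m edgesI(1)[OF chord(1) R]] xJ by simp
 next
  case 3
  then have L: "lft x \<in> D" using lft_mem[OF chord(1), of l] chord by simp
  have "(lft x, True) \<in> J" "(lft x, False) \<notin> J" using L chord 3 by (simp_all add: mem)
  then show ?thesis using commuting_edge_not_image[OF m edgesI(2)[OF chord(1) L]] xJ by simp
 next
  case 4
  then have R: "rgt x \<in> D" using rgt_mem[OF chord(1), of k] chord kl by simp
  have "(rgt x, True) \<notin> J" "(rgt x, False) \<in> J" using R chord 4 kl by (simp_all add: mem)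
  then show ?thesis using commuting_edge_killed[OF m edgesI(1)[OF chord(1) R]] xJ by simp
 qed
qed

text \<open>The nilpotent endomorphism moving colour \<open>True\<close> to colour \<open>False\<close>.\<close>

definition shift :: "chord \<times> bool \<Rightarrow> chord \<times> bool \<Rightarrow> complex" where
 "shift k l = of_bool (fst k = fst l \<and> snd k \<and> \<not> snd l)"

text \<open>A failure would need a triangle in which the True strand goes into the left child and
  the False strand does not, or the False strand goes into the right child and the True strand does
  not. Either way l would be smaller than k.\<close>

lemma commuting_shift:
 assumes J: "J = strand k False \<union> strand l True" and kl: "k \<le> l" shows "commuting shift"
 unfolding commuting_def
proof (intro ballI conjI allI impI)
 note mem = strand_mem[OF J]
 fix a s t
 assume a: "a \<in> arcs Q" and s: "s \<in> fibre (tail Q a)" "act_on J a s = Some t"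
 have st: "t \<in> J" "step a s t" "s \<in> J" using s by (auto simp: act_on_Some)
 {
  fix s2 t2 assume s2: "s2 \<in> fibre (tail Q a)" "act_on J a s2 = Some t2"
  then have "step a s2 t2" by (auto simp: act_on_Some)
  then show "shift t t2 = shift s s2" using a st(2)
  proof (cases rule: arcs_cases[OF a])
   case 1
   then show ?thesis using \<open>step a s2 t2\<close> st(2) by (auto simp: step_ep shift_def)
  next
   case (2 u v)
   then show ?thesis using \<open>step a s2 t2\<close> st(2) by (auto simp: step_ar shift_def)
  qed
 }
 fix t2
 assume t2: "t2 \<in> fibre (head Q a)" and no: "\<forall>s2\<in>fibre (tail Q a). act_on J a s2 \<noteq> Some t2"
 show "shift t t2 = 0"
 proof (cases rule: arcs_cases[OF a])
  case 1
  then show ?thesis using st(2) by (auto simp: step_ep shift_def)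
 next
  case (2 u v)
  show ?thesis
  proof (rule ccontr)
   assume "shift t t2 \<noteq> 0"
   then have c: "fst t = fst t2" "snd t" "\<not> snd t2" by (auto simp: shift_def split: if_splits)
   have e: "fst s = u" "fst t = v" "snd s = snd t" using st(2) 2 by (auto simp: step_ar)
   have t2e: "t2 = (v, False)" using c e by (simp add: prod_eq_iff)
   have "(u, False) \<notin> J"
   proof
    assume "(u, False) \<in> J"
    then have "(u, False) \<in> fibre (tail Q a)" using tail_ar[OF 2(2)] 2(1) by simp
    moreover have "act_on J a (u, False) = Some t2" using t2 t2e 2 by (simp add: act_on_Some step_ar)
    ultimately show False using no by blast
   qed
   moreover have "(v, False) \<in> J" "(v, True) \<in> J" "(u, True) \<in> J"
    using t2 t2e st c e by (auto simp: prod_eq_iff) (metis (full_types) prod.collapse)+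
   ultimately have uv: "\<not> (fst u < k \<and> k < snd u)" "fst v < k" "k < snd v" "fst v < l" "l < snd v"
     "fst u < l" "l < snd u" using 2(3) by (simp_all add: mem)
   from 2(2) show False
   proof (cases rule: edges_cases)
    case down
    then show False using uv apex[of u] by simp
   next
    case up
    then show False using uv apex[of v] kl by simp
   next
    case (across x)
    then show False using uv apex[of x] by simp
   qed
  qed
 qed
next
 note mem = strand_mem[OF J]
 fix a s s2
 assume a: "a \<in> arcs Q" and s: "s \<in> fibre (tail Q a)" "act_on J a s = None"
  and s2: "s2 \<in> fibre (tail Q a)" "act_on J a s2 \<noteq> None"
 obtain t2 where t2: "t2 \<in> J" "step a s2 t2" using s2(2) by (auto simp: act_on_None)
 show "shift s s2 = 0"
 proof (cases rule: arcs_cases[OF a])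
  case 1
  then show ?thesis using t2(2) by (auto simp: step_ep shift_def)
 next
  case (2 u v)
  show ?thesis
  proof (rule ccontr)
   assume "shift s s2 \<noteq> 0"
   then have c: "fst s = fst s2" "snd s" "\<not> snd s2" by (auto simp: shift_def split: if_splits)
   have e: "fst s2 = u" "fst t2 = v" "snd s2 = snd t2" using t2(2) 2 by (auto simp: step_ar)
   have se: "s = (u, True)" "s2 = (u, False)" "t2 = (v, False)" using c e by (simp_all add: prod_eq_iff)
   have "(v, True) \<notin> J" using s(2) se act_on_ar_None[OF 2(2), of s] 2(1) by simp
   moreover have "(u, True) \<in> J" "(u, False) \<in> J" "(v, False) \<in> J" using s s2 t2 se by auto
   ultimately have uv: "\<not> (fst v < l \<and> l < snd v)" "fst u < k" "k < snd u" "fst v < k" "k < snd v"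
     "fst u < l" "l < snd u" using 2(4) by (simp_all add: mem)
   from 2(2) show False
   proof (cases rule: edges_cases)
    case down
    then show False using uv apex[of u] kl by simp
   next
    case up
    then show False using uv apex[of v] by simp
   next
    case (across x)
    then show False using uv apex[of x] by simp
   qed
  qed
 qed
qed

text \<open>Every entry equals the corresponding one at the root, so the 2 by 2 matrix there
  decides. Commuting with \<open>ep\<close> leaves the identity and the shift, and the shift is an
  endomorphism exactly for k \<le> l.\<close>

lemma dim_Hom_double_strand:
 assumes J: "J = strand k False \<union> strand l True" and k: "lo < k" "k < hi" and l: "lo < l" "l < hi"
 shows "dim_Hom Q N N = 1 + of_bool (k \<le> l)"
proof -
 note mem = strand_mem[OF J]
 have rJ: "(root, c) \<in> J" for c using k l root_mem by (simp add: mem)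
 let ?S = "if k \<le> l then {False, True} else {False}"
 let ?\<mu> = "\<lambda>s. if s then shift else (\<lambda>k l. of_bool (k = l))"
 have expand: "(\<Sum>s\<in>?S. c s * ?\<mu> s s' t') = c False * of_bool (s' = t') + (if k \<le> l then c True * shift s' t' else 0)" for c s' t'
  by simp
 have "dim_Hom Q N N = card ?S"
 proof (rule dim_Hom_eq[of ?S ?\<mu>])
  show "finite ?S" by simp
  show "commuting (?\<mu> s)" if "s \<in> ?S" for s
   using that commuting_identity commuting_shift[OF J] by (auto split: if_splits)
 next
  fix c :: "bool \<Rightarrow> complex"
  assume z: "\<And>s t. s \<in> J \<Longrightarrow> t \<in> J \<Longrightarrow> (cl \<circ> fst) s = (cl \<circ> fst) t \<Longrightarrow> (\<Sum>r\<in>?S. c r * ?\<mu> r s t) = 0"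
  have "c False = 0"
   using z[OF rJ rJ, of False False] unfolding expand by (simp add: shift_def split: if_splits)
  moreover have "c True = 0" if "k \<le> l"
   using z[OF rJ rJ, of True False] that unfolding expand by (simp add: shift_def)
  ultimately show "\<forall>s\<in>?S. c s = 0" by simp
 next
  fix m assume m: "commuting m"
  let ?c = "\<lambda>s. if s then m (root, True) (root, False) else m (root, False) (root, False)"
  have "m s t = (\<Sum>r\<in>?S. ?c r * ?\<mu> r s t)" if st: "s \<in> J" "t \<in> J" "(cl \<circ> fst) s = (cl \<circ> fst) t" for s t
  proof -
   obtain x c c' where x: "s = (x, c)" "t = (x, c')" "x \<in> D"
    using st J_D cl_eq[of "fst s" "fst t"] by (metis comp_apply mem_Sigma_iff prod.collapse subsetD)
   have mr: "m s t = m (root, c) (root, c')" using commuting_strand[OF J m] st x by simp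
   note ep = commuting_ep[OF m rJ rJ]
   have zero: "m (root, True) (root, False) = 0" if "\<not> k \<le> l"
    by (rule commuting_strand_zero[OF J _ m root_mem]) (use that k l in auto)
   show ?thesis unfolding expand mr using ep zero by (cases c; cases c') (auto simp: x shift_def)
  qed
  then show "\<exists>c. \<forall>s\<in>J. \<forall>t\<in>J. (cl \<circ> fst) s = (cl \<circ> fst) t \<longrightarrow> m s t = (\<Sum>r\<in>?S. c r * ?\<mu> r s t)"
   by (intro exI[of _ ?c]) blast
 qed
 then show ?thesis by simp
qed

text \<open>The endomorphisms give 1 + [k \<le> l], the loop gives 2 and the triangles give -(3 +
  [k = l]); the sum is [k < l].\<close>

lemma E_inv_double_strand:
 assumes J: "J = strand k False \<union> strand l True" and k: "lo < k" "k < hi" and l: "lo < l" "l < hi"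
 shows "E_inv Q R N = of_bool (k < l)"
proof -
 have "p root False = 1" "p root True = 1" unfolding p_strand(1,2)[OF J root_mem] using k l by auto
 moreover have "(\<Sum>y | y \<in> D \<and> encloses root y. defect y) = - (3 + of_bool (k = l))"
  using sum_defect_strand[OF J root_mem] k l by auto
 ultimately show ?thesis unfolding E_inv_model d_def dim_Hom_double_strand[OF assms] by auto
qed

lemma p_crossing:
 assumes J: "J = crossing_strand k l" and x: "x \<in> D"
 shows "p x False = of_bool (crosses k l x)" "p y True = 0"
  "p (lft x) False = of_bool (crosses k l (lft x))" "p (rgt x) False = of_bool (crosses k l (rgt x))"
proof -
 have F: "(y, False) \<in> J \<longleftrightarrow> y \<in> D \<and> crosses k l y" for y unfolding J crossing_strand_def by blast
 have T: "(y, True) \<notin> J" for y unfolding J crossing_strand_def by blast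
 have "lft x \<in> D" if "crosses k l (lft x)"
  using that lft_mem[OF x, of k] lft_mem[OF x, of l] apex[OF x] by (auto simp: crosses_def)
 moreover have "rgt x \<in> D" if "crosses k l (rgt x)"
  using that rgt_mem[OF x, of k] rgt_mem[OF x, of l] apex[OF x] by (auto simp: crosses_def)
 ultimately show "p x False = of_bool (crosses k l x)" "p y True = 0"
  "p (lft x) False = of_bool (crosses k l (lft x))" "p (rgt x) False = of_bool (crosses k l (rgt x))"
  using F T x by (auto simp: p_def)
qed

text \<open>The same telescoping, with the indicator of the chords that cross or enclose (k, l). The
  local identity fails only at the chord (k, l) itself, which is excluded by hypothesis.\<close>

lemma sum_defect_crossing:
 assumes J: "J = crossing_strand k l" and x: "x \<in> D" and kl: "k + 2 \<le> l" "(k, l) \<notin> D"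
 shows "(\<Sum>y | y \<in> D \<and> encloses x y. defect y) = - of_bool (crosses k l x \<or> fst x \<le> k \<and> l \<le> snd x)" using x
proof (induction x rule: chord_induct)
 case (chord x)
 let ?h = "\<lambda>x. of_bool (crosses k l x \<or> fst x \<le> k \<and> l \<le> snd x) :: int"
 note pp = p_crossing[OF J chord(1)] and ap = apex(1,2)[OF chord(1)]
 have ne: "\<not> (fst x = k \<and> snd x = l)" using chord(1) kl by (metis prod.collapse)
 have L: "(if lft x \<in> D then \<Sum>y | y \<in> D \<and> encloses (lft x) y. defect y else 0) = - ?h (lft x)"
 proof (cases "lft x \<in> D")
  case False
  then have "apex x = fst x + 1" using apex(3)[OF chord(1)] by simp
  then show ?thesis using False kl by (simp add: crosses_def)
 qed (use chord in simp)
 have R: "(if rgt x \<in> D then \<Sum>y | y \<in> D \<and> encloses (rgt x) y. defect y else 0) = - ?h (rgt x)"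
 proof (cases "rgt x \<in> D")
  case False
  then have "snd x = apex x + 1" using apex(4)[OF chord(1)] by simp
  then show ?thesis using False kl by (simp add: crosses_def)
 qed (use chord in simp)
 have "k < fst x \<or> k = fst x \<or> fst x < k \<and> k < apex x \<or> k = apex x \<or> apex x < k \<and> k < snd x \<or> k = snd x \<or> snd x < k"
  using ap by linarith
 moreover have "l < fst x \<or> l = fst x \<or> fst x < l \<and> l < apex x \<or> l = apex x \<or> apex x < l \<and> l < snd x \<or> l = snd x \<or> snd x < l"
  using ap by linarith
 ultimately have "defect x - ?h (lft x) - ?h (rgt x) = - ?h x"
  unfolding defect_def d_def pp fst_lft snd_lft fst_rgt snd_rgt crosses_def
  using ap kl(1) ne by (elim disjE) (auto simp: power2_eq_square)
 then show ?case unfolding sum_enclosed[OF chord(1)] L R by simp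
qed

text \<open>Connectedness of the string. Below a crossing chord, the crossing chords are reached
  through children that cross as well. Below a chord spanning (k, l) they lie in one subtree, or in
  both; in the latter case both children cross and the arrow between them links the two
  parts.\<close>

lemma commuting_crossing:
 assumes J: "J = crossing_strand k l" and kl: "k < l" and m: "commuting m"
 defines "\<mu> \<equiv> \<lambda>x. m (x, False) (x, False)"
 shows crossing_below: "x \<in> D \<Longrightarrow> crosses k l x \<Longrightarrow> y \<in> D \<Longrightarrow> encloses x y \<Longrightarrow> crosses k l y \<Longrightarrow> \<mu> y = \<mu> x"
  and crossing_inside: "x \<in> D \<Longrightarrow> fst x \<le> k \<Longrightarrow> l \<le> snd x \<Longrightarrow> y \<in> D \<Longrightarrow> encloses x y \<Longrightarrow> crosses k l y \<Longrightarrow>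
   z \<in> D \<Longrightarrow> encloses x z \<Longrightarrow> crosses k l z \<Longrightarrow> \<mu> y = \<mu> z"
proof -
 have F: "(y, False) \<in> J \<longleftrightarrow> y \<in> D \<and> crosses k l y" for y unfolding J crossing_strand_def by blast
 have edge: "\<mu> v = \<mu> u" if "(u, v) \<in> edges" "crosses k l u" "crosses k l v" for u v
  unfolding \<mu>_def by (rule commuting_edge[OF m that(1)]) (use that edges_mem[OF that(1)] in \<open>simp_all add: F\<close>)
 show below: "\<mu> y = \<mu> x" if "x \<in> D" "crosses k l x" "y \<in> D" "encloses x y" "crosses k l y" for x y using that
 proof (induction x rule: chord_induct)
  case (chord x)
  from chord(1,5,6) show ?case
  proof (cases rule: encloses_cases)
   case 2
   then have "crosses k l (lft x)"
    using chord(4,7) apex(1,2)[OF chord(1)] chord_bounds[OF chord(5)] by (auto simp: crosses_def encloses_def)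
   then show ?thesis using edge[OF edgesI(2)[OF chord(1) 2(1)]] chord 2 by simp
  next
   case 3
   then have "crosses k l (rgt x)"
    using chord(4,7) apex(1,2)[OF chord(1)] chord_bounds[OF chord(5)] by (auto simp: crosses_def encloses_def)
   then show ?thesis using edge[OF edgesI(1)[OF chord(1) 3(1)]] chord 3 by simp
  qed simp
 qed
 show "\<mu> y = \<mu> z" if "x \<in> D" "fst x \<le> k" "l \<le> snd x" "y \<in> D" "encloses x y" "crosses k l y"
   "z \<in> D" "encloses x z" "crosses k l z" for x y z using that
 proof (induction x rule: chord_induct)
  case (chord x)
  have nx: "\<not> crosses k l x" using chord by (auto simp: crosses_def)
  have L: "lft x \<in> D \<and> encloses (lft x) t \<or> rgt x \<in> D \<and> encloses (rgt x) t"
   if "t \<in> D" "encloses x t" "crosses k l t" for t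
   using chord(1) that(1,2) by (cases rule: encloses_cases) (use that(3) nx in auto)
  have Lc: "crosses k l (lft x) \<or> fst (lft x) \<le> k \<and> l \<le> snd (lft x)"
   if "t \<in> D" "encloses (lft x) t" "crosses k l t" for t
   using that chord(4,5) kl chord_bounds[OF that(1)] by (auto simp: crosses_def encloses_def)
  have Rc: "crosses k l (rgt x) \<or> fst (rgt x) \<le> k \<and> l \<le> snd (rgt x)"
   if "t \<in> D" "encloses (rgt x) t" "crosses k l t" for t
   using that chord(4,5) kl chord_bounds[OF that(1)] by (auto simp: crosses_def encloses_def)
  have both: "crosses k l (lft x) \<and> crosses k l (rgt x)"
   if "t \<in> D" "encloses (lft x) t" "crosses k l t" "s \<in> D" "encloses (rgt x) s" "crosses k l s" for t s
   using that chord(4,5) kl chord_bounds[OF that(1)] chord_bounds[OF that(4)] apex(1,2)[OF chord(1)]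
   by (auto simp: crosses_def encloses_def)
  have mixed: "\<mu> t = \<mu> s" if "lft x \<in> D" "rgt x \<in> D"
   "t \<in> D" "encloses (lft x) t" "crosses k l t" "s \<in> D" "encloses (rgt x) s" "crosses k l s" for t s
  proof -
   note c = both[OF that(3-8)]
   have "\<mu> t = \<mu> (lft x)" "\<mu> s = \<mu> (rgt x)" using below that c by blast+
   moreover have "\<mu> (lft x) = \<mu> (rgt x)" using edge[OF edgesI(3)[OF chord(1) that(1,2)]] c by blast
   ultimately show ?thesis by simp
  qed
  consider "lft x \<in> D" "encloses (lft x) y" "encloses (lft x) z"
   | "rgt x \<in> D" "encloses (rgt x) y" "encloses (rgt x) z"
   | "lft x \<in> D" "rgt x \<in> D" "encloses (lft x) y" "encloses (rgt x) z"
   | "lft x \<in> D" "rgt x \<in> D" "encloses (lft x) z" "encloses (rgt x) y"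
   using L[OF chord(6-8)] L[OF chord(9-11)] by blast
  then show ?case
  proof cases
   case 1
   from Lc[OF chord(6) 1(2) chord(8)] show ?thesis
   proof
    assume c: "crosses k l (lft x)"
    show ?thesis
     using below[OF 1(1) c chord(6) 1(2) chord(8)] below[OF 1(1) c chord(9) 1(3) chord(11)] by simp
   next
    assume "fst (lft x) \<le> k \<and> l \<le> snd (lft x)"
    then show ?thesis using chord(2)[OF 1(1) _ _ chord(6) 1(2) chord(8,9) 1(3) chord(11)] by blast
   qed
  next
   case 2
   from Rc[OF chord(6) 2(2) chord(8)] show ?thesis
   proof
    assume c: "crosses k l (rgt x)"
    show ?thesis
     using below[OF 2(1) c chord(6) 2(2) chord(8)] below[OF 2(1) c chord(9) 2(3) chord(11)] by simp
   next
    assume "fst (rgt x) \<le> k \<and> l \<le> snd (rgt x)"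
    then show ?thesis using chord(3)[OF 2(1) _ _ chord(6) 2(2) chord(8,9) 2(3) chord(11)] by blast
   qed
  next
   case 3
   then show ?thesis using mixed[OF 3(1,2) chord(6) 3(3) chord(8,9) 3(4) chord(11)] by simp
  next
   case 4
   then show ?thesis using mixed[OF 4(1,2) chord(9) 4(3) chord(11,6) 4(4) chord(8)] by simp
  qed
 qed
qed

lemma E_inv_crossing:
 assumes J: "J = crossing_strand k l" and kl: "k + 2 \<le> l" "(k, l) \<notin> D" "lo \<le> k" "l \<le> hi"
 shows "E_inv Q R N = 0"
proof -
 have F: "(y, False) \<in> J \<longleftrightarrow> y \<in> D \<and> crosses k l y" for y unfolding J crossing_strand_def by blast
 have sum: "(\<Sum>y | y \<in> D \<and> encloses root y. defect y) = -1"
  using sum_defect_crossing[OF J root_mem kl(1,2)] kl by simp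
 \<comment> \<open>An empty string would have all defects 0, against their sum -1.\<close>
 have "\<exists>x0. (x0, False) \<in> J"
 proof (rule ccontr)
  assume "\<nexists>x0. (x0, False) \<in> J"
  then have "p x False = 0" "p x True = 0" for x using p_crossing(2)[OF J root_mem] by (auto simp: p_def)
  then have "defect x = 0" for x by (simp add: defect_def d_def)
  then show False using sum by simp
 qed
 then obtain x0 where x0: "(x0, False) \<in> J" by blast
 have "dim_Hom Q N N = 1"
 proof (rule dim_Hom_scalar[OF _ x0])
  show "J \<subseteq> D \<times> {False}" unfolding J crossing_strand_def by blast
  show "m (x, False) (x, False) = m (x0, False) (x0, False)" if "commuting m" "(x, False) \<in> J" for m x
   by (rule crossing_inside[OF J _ that(1) root_mem]) (use kl x0 that(2) encloses_root F in auto)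
 qed
 moreover have "p root False = 0" "p root True = 0"
  using p_crossing(1)[OF J root_mem] p_crossing(2)[OF J root_mem] kl by (simp_all add: crosses_def)
 ultimately show ?thesis unfolding E_inv_model d_def sum by simp
qed

end

subsection \<open>Classification of the indecomposable representations\<close>

context polygon_triangulation
begin

abbreviation straddles :: "int \<Rightarrow> chord \<Rightarrow> bool" where
 "straddles t x \<equiv> fst x < t \<and> t < snd x"

lemma enclosed_parent_lft:
 assumes "y \<in> D" "z \<in> D" "lft y \<in> D" "encloses z (lft y)" "lft y \<noteq> z" shows "encloses z y"
proof (rule ccontr)
 assume n: "\<not> encloses z y"
 note a = apex(1,2)[OF assms(1)]
 have j: "snd z < snd y" "fst z \<le> fst y" "apex y \<le> snd z" using n assms(4) by (auto simp: encloses_def)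
 have "fst z = fst y" using noncross'[of z y] j a assms(1,2) by fastforce
 then have "encloses y z" using j by (simp add: encloses_def)
 with assms(1,2) show False
 proof (cases rule: encloses_cases)
  case 1
  then show False using j by simp
 next
  case 2
  then have "z = lft y" using j \<open>fst z = fst y\<close> by (simp add: encloses_def prod_eq_iff)
  then show False using assms(5) by simp
 next
  case 3
  then show False using j a \<open>fst z = fst y\<close> by (simp add: encloses_def)
 qed
qed

lemma enclosed_parent_rgt:
 assumes "y \<in> D" "z \<in> D" "rgt y \<in> D" "encloses z (rgt y)" "rgt y \<noteq> z" shows "encloses z y"
proof (rule ccontr)
 assume n: "\<not> encloses z y"
 note a = apex(1,2)[OF assms(1)]
 have j: "fst y < fst z" "snd y \<le> snd z" "fst z \<le> apex y" using n assms(4) by (auto simp: encloses_def)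
 have "snd z = snd y" using noncross'[of y z] j a assms(1,2) by fastforce
 then have "encloses y z" using j by (simp add: encloses_def)
 with assms(1,2) show False
 proof (cases rule: encloses_cases)
  case 1
  then show False using j by simp
 next
  case 2
  then show False using j a \<open>snd z = snd y\<close> by (simp add: encloses_def)
 next
  case 3
  then have "z = rgt y" using j \<open>snd z = snd y\<close> by (simp add: encloses_def prod_eq_iff)
  then show False using assms(5) by simp
 qed
qed

text \<open>The triangle of an arrow cannot reach across z, so the subtree below z is linked to the
  rest of the tree only through z.\<close>

lemma edge_enclosed:
 assumes "z \<in> D" "(u, v) \<in> edges" "encloses z u \<and> u \<noteq> z \<or> encloses z v \<and> v \<noteq> z"
 shows "encloses z u" "encloses z v"
proof -
 have "encloses z u \<and> encloses z v" using assms(2)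
 proof (cases rule: edges_cases)
  case down
  then show ?thesis using enclosed_parent_rgt[of u z] assms encloses_trans[OF _ encloses_rgt[of u], of z] by auto
 next
  case up
  then show ?thesis using enclosed_parent_lft[of v z] assms encloses_trans[OF _ encloses_lft[of v], of z] by auto
 next
  case (across x)
  then have "encloses z x" using enclosed_parent_rgt[of x z] enclosed_parent_lft[of x z] assms by auto
  then show ?thesis using across encloses_trans[of z x] by auto
 qed
 then show "encloses z u" "encloses z v" by auto
qed

lemma parent_exists:
 assumes "x \<in> D" "x \<noteq> root" shows "\<exists>z\<in>D. x = lft z \<or> x = rgt z"
proof -
 have "x = root \<or> (\<exists>z\<in>D. x = lft z \<or> x = rgt z)"
  by (rule descend_encloses[of root x "\<lambda>x. x = root \<or> (\<exists>z\<in>D. x = lft z \<or> x = rgt z)"])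
   (use assms root_mem encloses_root in auto)
 then show ?thesis using assms by blast
qed

end

locale tree_rep = tree_quiver D lo hi Q R cl ar ep + complex_vector_space "scl N"
 for D :: "chord set" and lo hi :: int and Q :: "('i, 'e) quiver" and R cl ar ep
  and N :: "('i, 'e, 'v::ab_group_add) rep" +
 assumes rep: "is_rep Q R N"
begin

lemma spc_subspace: "x \<in> D \<Longrightarrow> subspace (spc N (cl x))" using rep verts by (auto simp: is_rep_def)

lemma mp_lb: "a \<in> arcs Q \<Longrightarrow> linear_between (scl N) (scl N) (spc N (tail Q a)) (spc N (head Q a)) (mp N a)"
 using rep by (simp add: is_rep_def)

lemma mp_rel: "(c, a) \<in> R \<Longrightarrow> x \<in> spc N (tail Q a) \<Longrightarrow> mp N c (mp N a x) = 0"
 using rep unfolding is_rep_def by blast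

lemma mp_extension:
 assumes "a \<in> arcs Q"
 shows "\<exists>g. Vector_Spaces.linear (scl N) (scl N) g \<and> (\<forall>x\<in>spc N (tail Q a). g x = mp N a x)"
proof -
 have "subspace (spc N (tail Q a))" using tails[OF assms] verts spc_subspace by auto
 then show ?thesis
  using linear_between_extend[OF complex_vector_space_axioms complex_vector_space_axioms _ mp_lb[OF assms]] by blast
qed

definition string_basis :: "(chord \<Rightarrow> 'v set) \<Rightarrow> bool" where
 "string_basis B \<longleftrightarrow> (\<forall>x\<in>D. independent (B x) \<and> span (B x) = spc N (cl x)) \<and>
   (\<forall>u v. (u, v) \<in> edges \<longrightarrow> matches (mp N (ar u v)) (B u) (B v)) \<and> matches (mp N ep) (B root) (B root)"

lemma matches_cong:
 assumes "\<And>x. x \<in> X \<Longrightarrow> f x = g x" shows "matches f X Y \<longleftrightarrow> matches g X Y"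
proof -
 have "f ` X = g ` X" using assms by (intro image_cong) auto
 moreover have "{x \<in> X. f x \<noteq> 0} = {x \<in> X. g x \<noteq> 0}" using assms by auto
 moreover have "inj_on f {x \<in> X. g x \<noteq> 0} \<longleftrightarrow> inj_on g {x \<in> X. g x \<noteq> 0}"
  by (rule inj_on_cong) (use assms in auto)
 ultimately show ?thesis by (simp add: matches_def)
qed

lemma string_basis_ex: "\<exists>B. string_basis B"
proof -
 \<comment> \<open>The normal forms for triangles and loops are about maps that are linear on the
   whole ambient space, whereas \<open>mp N a\<close> is controlled only on the space at its
   tail.\<close>
 define G where "G = (\<lambda>a. SOME g. Vector_Spaces.linear (scl N) (scl N) g \<and> (\<forall>x\<in>spc N (tail Q a). g x = mp N a x))"
 have G: "Vector_Spaces.linear (scl N) (scl N) (G a) \<and> (\<forall>x\<in>spc N (tail Q a). G a x = mp N a x)"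
  if "a \<in> arcs Q" for a unfolding G_def by (rule someI_ex[OF mp_extension[OF that]])
 have mem: "G a x \<in> spc N (head Q a)" if "a \<in> arcs Q" "x \<in> spc N (tail Q a)" for a x
  using G[OF that(1)] that mp_lb[OF that(1)] by (simp add: linear_between_def)
 have zero: "G c (G a x) = 0" if ca: "(c, a) \<in> R" and x: "x \<in> spc N (tail Q a)" for c a x
 proof -
  note rc = rels_composable[OF ca]
  have "G c (G a x) = mp N c (mp N a x)" using G[of a] G[of c] rc x mem[of a x] by simp
  then show ?thesis using mp_rel[OF ca x] by simp
 qed
 interpret pr: polygon_representation D lo hi "scl N" "\<lambda>x. spc N (cl x)" "\<lambda>u v. G (ar u v)"
 proof (intro polygon_representation.intro polygon_representation_axioms.intro
   polygon_triangulation_axioms complex_vector_space_axioms)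
  show "subspace (spc N (cl x))" if "x \<in> D" for x using spc_subspace[OF that] .
  show "Vector_Spaces.linear (scl N) (scl N) (G (ar u v))" if "(u, v) \<in> edges" for u v
   using G ar_arcs[OF that] by blast
  show "G (ar u v) ` spc N (cl u) \<subseteq> spc N (cl v)" if "(u, v) \<in> edges" for u v
   using mem[OF ar_arcs[OF that]] tail_ar[OF that] head_ar[OF that] by auto
  show "G (ar (rgt x) (lft x)) (G (ar x (rgt x)) \<xi>) = 0"
   if "x \<in> D" "lft x \<in> D" "rgt x \<in> D" "\<xi> \<in> spc N (cl x)" for x \<xi>
   by (rule zero) (use that next_down tail_ar[OF edgesI(1)] in auto)
  show "G (ar (lft x) x) (G (ar (rgt x) (lft x)) \<xi>) = 0"
   if "x \<in> D" "lft x \<in> D" "rgt x \<in> D" "\<xi> \<in> spc N (cl (rgt x))" for x \<xi>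
   by (rule zero) (use that next_across tail_ar[OF edgesI(3)] in auto)
  show "G (ar x (rgt x)) (G (ar (lft x) x) \<xi>) = 0"
   if "x \<in> D" "lft x \<in> D" "rgt x \<in> D" "\<xi> \<in> spc N (cl (lft x))" for x \<xi>
   by (rule zero) (use that next_up tail_ar[OF edgesI(2)] in auto)
 qed
 have "Vector_Spaces.linear (scl N) (scl N) (G ep)" using G ep_arcs by blast
 moreover have "G ep ` spc N (cl root) \<subseteq> spc N (cl root)" using mem[OF ep_arcs] tail_ep head_ep by auto
 moreover have "\<And>\<xi>. \<xi> \<in> spc N (cl root) \<Longrightarrow> G ep (G ep \<xi>) = 0" using zero[of ep ep] next_ep tail_ep by auto
 ultimately obtain B where B: "\<And>y. y \<in> D \<Longrightarrow> independent (B y)" "\<And>y. y \<in> D \<Longrightarrow> span (B y) = spc N (cl y)"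
  "\<And>u v. (u, v) \<in> edges \<Longrightarrow> matches (G (ar u v)) (B u) (B v)" "matches (G ep) (B root) (B root)"
  using pr.string_basis_exists by blast
 have "string_basis B" unfolding string_basis_def
 proof (intro conjI ballI allI impI)
  fix u v assume e: "(u, v) \<in> edges"
  have "G (ar u v) x = mp N (ar u v) x" if "x \<in> B u" for x
   using G[OF ar_arcs[OF e]] that B(2)[of u] edges_mem[OF e] span_base[of x "B u"] tail_ar[OF e] by simp
  then show "matches (mp N (ar u v)) (B u) (B v)" using B(3)[OF e] matches_cong by blast
 next
  have "G ep x = mp N ep x" if "x \<in> B root" for x
   using G[OF ep_arcs] that B(2)[OF root_mem] span_base[of x "B root"] tail_ep by simp
  then show "matches (mp N ep) (B root) (B root)" using B(4) matches_cong by blast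
 qed (use B(1,2) in auto)
 then show ?thesis by blast
qed

context
 fixes B assumes B: "string_basis B"
begin

lemma B_independent: "x \<in> D \<Longrightarrow> independent (B x)" and B_span: "x \<in> D \<Longrightarrow> span (B x) = spc N (cl x)"
 using B by (auto simp: string_basis_def)

lemma B_mem: "x \<in> D \<Longrightarrow> \<beta> \<in> B x \<Longrightarrow> \<beta> \<in> spc N (cl x)" using B_span span_base by blast

lemma B_nonzero: "x \<in> D \<Longrightarrow> \<beta> \<in> B x \<Longrightarrow> \<beta> \<noteq> 0" using B_independent dependent_zero by blast

lemma B_finite: "x \<in> D \<Longrightarrow> finite (B x)"
proof -
 assume x: "x \<in> D"
 obtain C where "finite C" "spc N (cl x) = span C" using rep x verts by (auto simp: is_rep_def)
 then show "finite (B x)" using independent_span_bound[of C "B x"] B_independent[OF x] B_mem[OF x] by blast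
qed

lemma B_edge:
 assumes "(u, v) \<in> edges" shows "\<beta> \<in> B u \<Longrightarrow> mp N (ar u v) \<beta> = 0 \<or> mp N (ar u v) \<beta> \<in> B v"
  "\<beta> \<in> B u \<Longrightarrow> \<beta>' \<in> B u \<Longrightarrow> mp N (ar u v) \<beta> = mp N (ar u v) \<beta>' \<Longrightarrow> mp N (ar u v) \<beta> \<noteq> 0 \<Longrightarrow> \<beta> = \<beta>'"
proof -
 have m: "matches (mp N (ar u v)) (B u) (B v)" using B assms by (simp add: string_basis_def)
 show "\<beta> \<in> B u \<Longrightarrow> mp N (ar u v) \<beta> = 0 \<or> mp N (ar u v) \<beta> \<in> B v" using m by (auto simp: matches_def)
 show "\<beta> \<in> B u \<Longrightarrow> \<beta>' \<in> B u \<Longrightarrow> mp N (ar u v) \<beta> = mp N (ar u v) \<beta>' \<Longrightarrow> mp N (ar u v) \<beta> \<noteq> 0 \<Longrightarrow> \<beta> = \<beta>'"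
  using m by (auto simp: matches_def inj_on_def)
qed

lemma B_ep: shows "\<beta> \<in> B root \<Longrightarrow> mp N ep \<beta> = 0 \<or> mp N ep \<beta> \<in> B root"
  "\<beta> \<in> B root \<Longrightarrow> \<beta>' \<in> B root \<Longrightarrow> mp N ep \<beta> = mp N ep \<beta>' \<Longrightarrow> mp N ep \<beta> \<noteq> 0 \<Longrightarrow> \<beta> = \<beta>'"
proof -
 have m: "matches (mp N ep) (B root) (B root)" using B by (simp add: string_basis_def)
 show "\<beta> \<in> B root \<Longrightarrow> mp N ep \<beta> = 0 \<or> mp N ep \<beta> \<in> B root" using m by (auto simp: matches_def)
 show "\<beta> \<in> B root \<Longrightarrow> \<beta>' \<in> B root \<Longrightarrow> mp N ep \<beta> = mp N ep \<beta>' \<Longrightarrow> mp N ep \<beta> \<noteq> 0 \<Longrightarrow> \<beta> = \<beta>'"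
  using m by (auto simp: matches_def inj_on_def)
qed

lemma B_zero:
 assumes "x \<in> D"
 shows "lft x \<in> D \<Longrightarrow> rgt x \<in> D \<Longrightarrow> \<beta> \<in> B x \<Longrightarrow> mp N (ar (rgt x) (lft x)) (mp N (ar x (rgt x)) \<beta>) = 0"
  "lft x \<in> D \<Longrightarrow> rgt x \<in> D \<Longrightarrow> \<beta> \<in> B (rgt x) \<Longrightarrow> mp N (ar (lft x) x) (mp N (ar (rgt x) (lft x)) \<beta>) = 0"
  "lft x \<in> D \<Longrightarrow> rgt x \<in> D \<Longrightarrow> \<beta> \<in> B (lft x) \<Longrightarrow> mp N (ar x (rgt x)) (mp N (ar (lft x) x) \<beta>) = 0"
 by (rule mp_rel; use assms next_down next_across next_up tail_ar edgesI B_mem in auto)+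

lemma B_ep_zero: "\<beta> \<in> B root \<Longrightarrow> mp N ep (mp N ep \<beta>) = 0"
 by (rule mp_rel) (use next_ep tail_ep B_mem root_mem in auto)

text \<open>
  The basis vectors reached from \<open>\<delta> x\<close> through the triangles below \<open>x\<close>; the walk ends at a triangle with
  apex \<open>t\<close>.
\<close>

definition walk :: "chord \<Rightarrow> int \<Rightarrow> (chord \<Rightarrow> 'v) \<Rightarrow> bool" where
 "walk x t \<delta> \<longleftrightarrow> x \<in> D \<and> straddles t x \<and>
   (\<forall>y\<in>D. encloses x y \<and> straddles t y \<longrightarrow> \<delta> y \<in> B y) \<and>
   (\<forall>u v. (u, v) \<in> edges \<and> encloses x u \<and> encloses x v \<longrightarrow>
    (straddles t u \<longrightarrow> mp N (ar u v) (\<delta> u) = (if straddles t v then \<delta> v else 0)) \<and>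
    (straddles t v \<and> \<not> straddles t u \<longrightarrow> \<delta> v \<notin> mp N (ar u v) ` B u))"

lemma walkD:
 assumes "walk x t \<delta>"
 shows "x \<in> D" "fst x < t" "t < snd x" "y \<in> D \<Longrightarrow> encloses x y \<Longrightarrow> straddles t y \<Longrightarrow> \<delta> y \<in> B y"
  "(u, v) \<in> edges \<Longrightarrow> encloses x u \<Longrightarrow> encloses x v \<Longrightarrow> straddles t u \<Longrightarrow>
    mp N (ar u v) (\<delta> u) = (if straddles t v then \<delta> v else 0)"
  "(u, v) \<in> edges \<Longrightarrow> encloses x u \<Longrightarrow> encloses x v \<Longrightarrow> straddles t v \<Longrightarrow> \<not> straddles t u \<Longrightarrow>
    \<delta> v \<notin> mp N (ar u v) ` B u" using assms unfolding walk_def by blast+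

lemma walkI_edges:
 assumes x: "x \<in> D" and t: "straddles t x" and mem: "\<And>y. y \<in> D \<Longrightarrow> encloses x y \<Longrightarrow> straddles t y \<Longrightarrow> \<delta> y \<in> B y"
  and e: "\<And>u v. (u, v) \<in> edges \<Longrightarrow> encloses x u \<Longrightarrow> encloses x v \<Longrightarrow>
    (straddles t u \<longrightarrow> mp N (ar u v) (\<delta> u) = (if straddles t v then \<delta> v else 0)) \<and>
    (straddles t v \<and> \<not> straddles t u \<longrightarrow> \<delta> v \<notin> mp N (ar u v) ` B u)" shows "walk x t \<delta>"
 unfolding walk_def using assms by blast

text \<open>The walk goes left if \<beta> is the image of a basis vector at \<open>lft x\<close>,
  right if \<beta> survives to \<open>rgt x\<close>, and stops at the apex otherwise. The relation
  from \<open>lft x\<close> through x to \<open>rgt x\<close> excludes that both happen, and the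
  other two relations keep the arrow between the children from continuing the walk.\<close>

lemma walk_exists:
 assumes "x \<in> D" "\<beta> \<in> B x" shows "\<exists>t \<delta>. walk x t \<delta> \<and> \<delta> x = \<beta>" using assms
proof (induction x arbitrary: \<beta> rule: chord_induct)
 case (chord x)
 note x = chord(1) and ap = apex(1,2)[OF chord(1)]
 consider (L) \<gamma> where "lft x \<in> D" "\<gamma> \<in> B (lft x)" "mp N (ar (lft x) x) \<gamma> = \<beta>"
  | (R) "rgt x \<in> D" "mp N (ar x (rgt x)) \<beta> \<noteq> 0"
  | (E) "lft x \<in> D \<Longrightarrow> \<beta> \<notin> mp N (ar (lft x) x) ` B (lft x)" "rgt x \<in> D \<Longrightarrow> mp N (ar x (rgt x)) \<beta> = 0" by blast
 then show ?case
 proof cases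
  case L
  obtain t \<delta> where w: "walk (lft x) t \<delta>" "\<delta> (lft x) = \<gamma>" using chord(2)[OF L(1,2)] by blast
  note w' = walkD[OF w(1)]
  define \<delta>' where "\<delta>' = \<delta>(x := \<beta>)"
  have \<delta>': "\<delta>' x = \<beta>" "\<And>y. y \<noteq> x \<Longrightarrow> \<delta>' y = \<delta> y" by (simp_all add: \<delta>'_def)
  have nel: "y \<noteq> x" if "encloses (lft x) y" for y using that not_encloses_lft[OF x] by blast
  have t: "fst x < t" "t < apex x" using w'(2,3) by simp_all
  have tx: "straddles t x" "straddles t (lft x)" "\<not> straddles t (rgt x)" using t ap by simp_all
  have "walk x t \<delta>'"
  proof (rule walkI_edges[OF x tx(1)])
   fix y assume y: "y \<in> D" "encloses x y" "straddles t y"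
   from x y(1,2) show "\<delta>' y \<in> B y"
   proof (cases rule: encloses_cases)
    case 1
    then show ?thesis using \<delta>' chord by simp
   next
    case 2
    then show ?thesis using w'(4) y \<delta>' nel by simp
   next
    case 3
    then show ?thesis using t y by (simp add: encloses_def)
   qed
  next
   fix u v assume e: "(u, v) \<in> edges" "encloses x u" "encloses x v"
   from x e show "(straddles t u \<longrightarrow> mp N (ar u v) (\<delta>' u) = (if straddles t v then \<delta>' v else 0)) \<and>
    (straddles t v \<and> \<not> straddles t u \<longrightarrow> \<delta>' v \<notin> mp N (ar u v) ` B u)"
   proof (cases rule: edges_encloses_cases)
    case 1
    then show ?thesis using tx \<delta>'(1) B_zero(3)[OF x L(1) 1(1) L(2)] L(3) by simp
   next
    case 2
    then show ?thesis using tx \<delta>' nel[of "lft x"] w(2) L(3) by simp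
   next
    case 3
    have "\<gamma> \<noteq> mp N (ar (rgt x) (lft x)) \<gamma>'" if "\<gamma>' \<in> B (rgt x)" for \<gamma>'
     using B_zero(2)[OF x 3(1,2) that] L(3) B_nonzero[OF x chord(4)] by auto
    then show ?thesis using tx 3 \<delta>'(2) nel[of "lft x"] w(2) by auto
   next
    case 4
    then show ?thesis using w'(5,6)[OF e(1) 4(2,3)] \<delta>'(2) nel by auto
   next
    case 5
    then show ?thesis using t by (simp add: encloses_def)
   qed
  qed
  then show ?thesis using \<delta>'(1) by blast
 next
  case R
  let ?\<gamma> = "mp N (ar x (rgt x)) \<beta>"
  have \<gamma>: "?\<gamma> \<in> B (rgt x)" using B_edge(1)[OF edgesI(1)[OF x R(1)] chord(4)] R(2) by blast
  obtain t \<delta> where w: "walk (rgt x) t \<delta>" "\<delta> (rgt x) = ?\<gamma>" using chord(3)[OF R(1) \<gamma>] by blast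
  note w' = walkD[OF w(1)]
  define \<delta>' where "\<delta>' = \<delta>(x := \<beta>)"
  have \<delta>': "\<delta>' x = \<beta>" "\<And>y. y \<noteq> x \<Longrightarrow> \<delta>' y = \<delta> y" by (simp_all add: \<delta>'_def)
  have nel: "y \<noteq> x" if "encloses (rgt x) y" for y using that not_encloses_rgt[OF x] by blast
  have t: "apex x < t" "t < snd x" using w'(2,3) by simp_all
  have tx: "straddles t x" "straddles t (rgt x)" "\<not> straddles t (lft x)" using t ap by simp_all
  have "walk x t \<delta>'"
  proof (rule walkI_edges[OF x tx(1)])
   fix y assume y: "y \<in> D" "encloses x y" "straddles t y"
   from x y(1,2) show "\<delta>' y \<in> B y"
   proof (cases rule: encloses_cases)
    case 1
    then show ?thesis using \<delta>' chord by simp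
   next
    case 2
    then show ?thesis using t y by (simp add: encloses_def)
   next
    case 3
    then show ?thesis using w'(4) y \<delta>' nel by simp
   qed
  next
   fix u v assume e: "(u, v) \<in> edges" "encloses x u" "encloses x v"
   from x e show "(straddles t u \<longrightarrow> mp N (ar u v) (\<delta>' u) = (if straddles t v then \<delta>' v else 0)) \<and>
    (straddles t v \<and> \<not> straddles t u \<longrightarrow> \<delta>' v \<notin> mp N (ar u v) ` B u)"
   proof (cases rule: edges_encloses_cases)
    case 1
    then show ?thesis using tx \<delta>' nel[of "rgt x"] w(2) by simp
   next
    case 2
    have "\<beta> \<noteq> mp N (ar (lft x) x) \<gamma>'" if "\<gamma>' \<in> B (lft x)" for \<gamma>'
     using B_zero(3)[OF x 2(1) R(1) that] R(2) by auto
    then show ?thesis using tx 2 \<delta>'(1) by auto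
   next
    case 3
    then show ?thesis using tx \<delta>'(2) nel[of "rgt x"] w(2) B_zero(1)[OF x 3(1,2) chord(4)] by simp
   next
    case 4
    then show ?thesis using t by (simp add: encloses_def)
   next
    case 5
    then show ?thesis using w'(5,6)[OF e(1) 5(2,3)] \<delta>'(2) nel by auto
   qed
  qed
  then show ?thesis using \<delta>'(1) by blast
 next
  case E
  let ?t = "apex x" and ?\<delta> = "\<lambda>_. \<beta>"
  have tx: "straddles ?t x" "\<not> straddles ?t (lft x)" "\<not> straddles ?t (rgt x)" using ap by simp_all
  have "walk x ?t ?\<delta>"
  proof (rule walkI_edges[OF x tx(1)])
   fix y assume y: "y \<in> D" "encloses x y" "straddles ?t y"
   from x y(1,2) show "\<beta> \<in> B y" by (cases rule: encloses_cases) (use y chord in \<open>auto simp: encloses_def\<close>)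
  next
   fix u v assume e: "(u, v) \<in> edges" "encloses x u" "encloses x v"
   from x e show "(straddles ?t u \<longrightarrow> mp N (ar u v) \<beta> = (if straddles ?t v then \<beta> else 0)) \<and>
    (straddles ?t v \<and> \<not> straddles ?t u \<longrightarrow> \<beta> \<notin> mp N (ar u v) ` B u)"
    by (cases rule: edges_encloses_cases) (use tx E in \<open>auto simp: encloses_def\<close>)
  qed
  then show ?thesis by blast
 qed
qed

end

end

section \<open>Splitting off connected sets of basis vectors\<close>

context tree_rep
begin

context
 fixes B assumes B: "string_basis B"
begin

text \<open>U consists of pairs because the spaces at all vertices share one ambient space, so that
  a vector does not determine its vertex.\<close>

definition spanned :: "(chord \<times> 'v) set \<Rightarrow> 'i \<Rightarrow> 'v set" where
 "spanned U i = span {\<beta>. \<exists>x. cl x = i \<and> (x, \<beta>) \<in> U}"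

lemma spanned_cl:
 assumes "U \<subseteq> Sigma D B" "x \<in> D" shows "spanned U (cl x) = span {\<beta>. (x, \<beta>) \<in> U}"
proof -
 have "y = x" if "cl y = cl x" "(y, \<beta>) \<in> U" for y \<beta> using cl_eq[of y x] that assms by blast
 then have "{\<beta>. \<exists>y. cl y = cl x \<and> (y, \<beta>) \<in> U} = {\<beta>. (x, \<beta>) \<in> U}" by blast
 then show ?thesis by (simp add: spanned_def)
qed

lemma subrep_spanned:
 assumes U: "U \<subseteq> Sigma D B"
  and e: "\<And>u v \<beta>. (u, v) \<in> edges \<Longrightarrow> (u, \<beta>) \<in> U \<Longrightarrow> mp N (ar u v) \<beta> \<noteq> 0 \<Longrightarrow> (v, mp N (ar u v) \<beta>) \<in> U"
  and ep: "\<And>\<beta>. (root, \<beta>) \<in> U \<Longrightarrow> mp N ep \<beta> \<noteq> 0 \<Longrightarrow> (root, mp N ep \<beta>) \<in> U"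
 shows "subrep Q R (N\<lparr>spc := spanned U\<rparr>) N"
proof -
 let ?N = "N\<lparr>spc := spanned U\<rparr>"
 have sub: "spanned U (cl x) \<subseteq> spc N (cl x)" if "x \<in> D" for x
  unfolding spanned_cl[OF U that] B_span[OF B that, symmetric] using U by (intro span_mono) auto
 have maps: "mp N a \<xi> \<in> spanned U (cl y)"
  if a: "a \<in> arcs Q" "tail Q a = cl x" "head Q a = cl y" "x \<in> D" "y \<in> D"
   and gen: "\<And>\<beta>. (x, \<beta>) \<in> U \<Longrightarrow> mp N a \<beta> \<noteq> 0 \<Longrightarrow> (y, mp N a \<beta>) \<in> U" and \<xi>: "\<xi> \<in> spanned U (cl x)" for a x y \<xi>
 proof -
  obtain g where g: "Vector_Spaces.linear (scl N) (scl N) g" "\<forall>x\<in>spc N (tail Q a). g x = mp N a x"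
   using mp_extension[OF a(1)] by blast
  interpret g: Vector_Spaces.linear "scl N" "scl N" g by fact
  have "g ` {\<beta>. (x, \<beta>) \<in> U} \<subseteq> span {\<beta>. (y, \<beta>) \<in> U}"
  proof clarify
   fix \<beta> assume \<beta>: "(x, \<beta>) \<in> U"
   then have "\<beta> \<in> B x" using U by blast
   then have "g \<beta> = mp N a \<beta>" using g(2) a(2) B_mem[OF B a(4), of \<beta>] by simp
   then show "g \<beta> \<in> span {\<beta>. (y, \<beta>) \<in> U}"
    using gen[OF \<beta>] by (cases "mp N a \<beta> = 0") (auto intro: span_base span_zero)
  qed
  then have "span (g ` {\<beta>. (x, \<beta>) \<in> U}) \<subseteq> span {\<beta>. (y, \<beta>) \<in> U}" by (rule span_minimal) simp
  then have "g \<xi> \<in> spanned U (cl y)"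
   using \<xi> unfolding g.span_image spanned_cl[OF U a(4)] spanned_cl[OF U a(5)] by blast
  then show ?thesis using g(2) sub[OF a(4)] \<xi> a(2) by auto
 qed
 have mapsto: "mp N a \<xi> \<in> spanned U (head Q a)" if a: "a \<in> arcs Q" and \<xi>: "\<xi> \<in> spanned U (tail Q a)" for a \<xi>
  using a
 proof (cases rule: arcs_cases)
  case 1
  then show ?thesis using maps[OF a _ _ root_mem root_mem, of \<xi>] ep \<xi> by (simp add: tail_ep head_ep)
 next
  case (2 u v)
  then show ?thesis using maps[OF a _ _ 2(3,4), of \<xi>] e[OF 2(2)] \<xi> by (simp add: tail_ar head_ar)
 qed
 have sub': "spanned U i \<subseteq> spc N i" if "i \<in> verts Q" for i using that sub verts by auto
 have fin: "\<exists>C. finite C \<and> spanned U i = span C" if i: "i \<in> verts Q" for i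
 proof -
  obtain x where x: "x \<in> D" "i = cl x" using i verts by auto
  have "{\<beta>. (x, \<beta>) \<in> U} \<subseteq> B x" using U by auto
  then have "finite {\<beta>. (x, \<beta>) \<in> U}" using B_finite[OF B x(1)] finite_subset by blast
  then show ?thesis using spanned_cl[OF U x(1)] x(2) by blast
 qed
 have lb: "linear_between (scl N) (scl N) (spanned U (tail Q a)) (spanned U (head Q a)) (mp N a)"
  if a: "a \<in> arcs Q" for a
  using mp_lb[OF a] mapsto[OF a] sub'[OF tails[OF a]] unfolding linear_between_def by blast
 have rel: "mp N c (mp N a \<xi>) = 0" if "(c, a) \<in> R" "\<xi> \<in> spanned U (tail Q a)" for c a \<xi>
  using mp_rel[OF that(1)] that(2) sub' rels_composable[OF that(1)] tails by blast
 have "is_rep Q R ?N" unfolding is_rep_def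
 proof (intro conjI ballI)
  show "vector_space (scl ?N)" using vector_space_axioms by simp
  fix i assume i: "i \<in> verts Q"
  show "module.subspace (scl ?N) (spc ?N i)" by (simp add: spanned_def)
  show "\<exists>B. finite B \<and> spc ?N i = module.span (scl ?N) B" using fin[OF i] by simp
 next
  fix a assume "a \<in> arcs Q"
  then show "linear_between (scl ?N) (scl ?N) (spc ?N (tail Q a)) (spc ?N (head Q a)) (mp ?N a)"
   using lb by simp
 next
  fix ca assume "ca \<in> R"
  then show "case ca of (b, a) \<Rightarrow> \<forall>x\<in>spc ?N (tail Q a). mp ?N b (mp ?N a x) = 0" using rel by (cases ca) simp
 qed
 then show ?thesis unfolding subrep_def using sub' by auto
qed

text \<open>If no arrow links U to the rest of the basis, both parts span subrepresentations and N
  is their direct sum; one summand has to vanish, and U is not empty.\<close>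

lemma indecomposable_connected:
 assumes ind: "indecomposable Q R N" and U: "U \<subseteq> Sigma D B" "U \<noteq> {}"
  and e: "\<And>u v \<beta>. (u, v) \<in> edges \<Longrightarrow> \<beta> \<in> B u \<Longrightarrow> mp N (ar u v) \<beta> \<noteq> 0 \<Longrightarrow>
    (u, \<beta>) \<in> U \<longleftrightarrow> (v, mp N (ar u v) \<beta>) \<in> U"
  and ep: "\<And>\<beta>. \<beta> \<in> B root \<Longrightarrow> mp N ep \<beta> \<noteq> 0 \<Longrightarrow> (root, \<beta>) \<in> U \<longleftrightarrow> (root, mp N ep \<beta>) \<in> U" shows "U = Sigma D B"
proof -
 let ?W = "Sigma D B - U"
 have W: "?W \<subseteq> Sigma D B" by blast
 have sU: "subrep Q R (N\<lparr>spc := spanned U\<rparr>) N"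
 proof (rule subrep_spanned[OF U(1)])
  show "(v, mp N (ar u v) \<beta>) \<in> U" if "(u, v) \<in> edges" "(u, \<beta>) \<in> U" "mp N (ar u v) \<beta> \<noteq> 0" for u v \<beta>
   using e[OF that(1) _ that(3)] that(2) U(1) by blast
  show "(root, mp N ep \<beta>) \<in> U" if "(root, \<beta>) \<in> U" "mp N ep \<beta> \<noteq> 0" for \<beta>
   using ep[OF _ that(2)] that(1) U(1) by blast
 qed
 have sW: "subrep Q R (N\<lparr>spc := spanned ?W\<rparr>) N"
 proof (rule subrep_spanned[OF W])
  show "(v, mp N (ar u v) \<beta>) \<in> ?W" if "(u, v) \<in> edges" "(u, \<beta>) \<in> ?W" "mp N (ar u v) \<beta> \<noteq> 0" for u v \<beta>
   using e[OF that(1) _ that(3)] that(2,3) B_edge(1)[OF B that(1), of \<beta>] edges_mem[OF that(1)] by blast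
  show "(root, mp N ep \<beta>) \<in> ?W" if "(root, \<beta>) \<in> ?W" "mp N ep \<beta> \<noteq> 0" for \<beta>
   using ep[OF _ that(2)] that B_ep(1)[OF B, of \<beta>] root_mem by blast
 qed
 have dec: "spc N i = {u + w |u w. u \<in> spanned U i \<and> w \<in> spanned ?W i} \<and> spanned U i \<inter> spanned ?W i = {0}"
  if "i \<in> verts Q" for i
 proof -
  obtain x where x: "x \<in> D" "i = cl x" using \<open>i \<in> verts Q\<close> verts by auto
  let ?X = "{\<beta>. (x, \<beta>) \<in> U}" and ?Y = "{\<beta>. (x, \<beta>) \<in> ?W}"
  have un: "B x = ?X \<union> ?Y" using U(1) x(1) by auto
  have "spc N i = {u + w |u w. u \<in> span ?X \<and> w \<in> span ?Y}"
   unfolding x(2) B_span[OF B x(1), symmetric] un span_Un by blast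
  moreover have "span ?X \<inter> span ?Y = {0}"
  proof -
   have "z = 0" if "z \<in> span ?X" "z \<in> span ?Y" for z
    by (rule disjoint_spans[OF B_independent[OF B x(1)] _ _ _ that]) (use un in auto)
   then show ?thesis using span_zero by blast
  qed
  ultimately show ?thesis unfolding x(2) spanned_cl[OF U(1) x(1)] spanned_cl[OF W x(1)] by blast
 qed
 have "zero_rep Q (N\<lparr>spc := spanned U\<rparr>) \<or> zero_rep Q (N\<lparr>spc := spanned ?W\<rparr>)"
  using ind sU sW dec unfolding indecomposable_def by simp
 moreover have False if "zero_rep Q (N\<lparr>spc := spanned X\<rparr>)" "(x, \<beta>) \<in> X" "X \<subseteq> Sigma D B" for X x \<beta>
 proof -
  have x: "x \<in> D" "\<beta> \<in> B x" using that by auto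
  then have "spanned X (cl x) = {0}" using that(1) verts by (simp add: zero_rep_def)
  moreover have "\<beta> \<in> spanned X (cl x)"
   unfolding spanned_cl[OF that(3) x(1)] using that(2) by (intro span_base) simp
  ultimately show False using B_nonzero[OF B x] by simp
 qed
 ultimately have "?W = {}" using U W by (metis equals0I surj_pair)
 then show ?thesis using U(1) by blast
qed

text \<open>The vectors b form a set closed under arrows in both directions, so by connectedness
  they are the whole basis. The assumptions \<open>e'\<close> and \<open>ep'\<close> are the
  backward half: no basis vector from outside maps into the string.\<close>

lemma modelled_if_closed:
 assumes ind: "indecomposable Q R N" and J: "J \<subseteq> D \<times> UNIV" "J \<noteq> {}"
  and mem: "\<And>y c. (y, c) \<in> J \<Longrightarrow> b (y, c) \<in> B y"
  and dist: "\<And>y. (y, False) \<in> J \<Longrightarrow> (y, True) \<in> J \<Longrightarrow> b (y, False) \<noteq> b (y, True)"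
  and e: "\<And>u v c. (u, v) \<in> edges \<Longrightarrow> (u, c) \<in> J \<Longrightarrow>
    mp N (ar u v) (b (u, c)) = (if (v, c) \<in> J then b (v, c) else 0)"
  and e': "\<And>u v c. (u, v) \<in> edges \<Longrightarrow> (v, c) \<in> J \<Longrightarrow> (u, c) \<notin> J \<Longrightarrow> b (v, c) \<notin> mp N (ar u v) ` B u"
  and ep: "(root, False) \<in> J \<Longrightarrow> mp N ep (b (root, False)) = 0"
   "(root, True) \<in> J \<Longrightarrow> mp N ep (b (root, True)) = (if (root, False) \<in> J then b (root, False) else 0)"
  and ep': "\<And>\<beta>. (root, False) \<in> J \<Longrightarrow> \<beta> \<in> B root \<Longrightarrow> mp N ep \<beta> = b (root, False) \<Longrightarrow>
    (root, True) \<in> J \<and> \<beta> = b (root, True)"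
   "(root, True) \<in> J \<Longrightarrow> b (root, True) \<notin> mp N ep ` B root" shows "modelled N J"
proof -
 define U where "U = {(y, b (y, c)) |y c. (y, c) \<in> J}"
 have U_mem: "(y, \<beta>) \<in> U \<longleftrightarrow> (\<exists>c. (y, c) \<in> J \<and> \<beta> = b (y, c))" for y \<beta> unfolding U_def by blast
 have J_D: "y \<in> D" if "(y, c) \<in> J" for y c using J that by auto
 have nz: "b (y, c) \<noteq> 0" if "(y, c) \<in> J" for y c using B_nonzero[OF B J_D[OF that] mem[OF that]] .
 have "U = Sigma D B"
 proof (rule indecomposable_connected[OF ind])
  show "U \<subseteq> Sigma D B" using mem J_D by (auto simp: U_def)
  show "U \<noteq> {}" using J(2) by (auto simp: U_def)
 next
  fix u v \<beta> assume uv: "(u, v) \<in> edges" "\<beta> \<in> B u" "mp N (ar u v) \<beta> \<noteq> 0"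
  show "(u, \<beta>) \<in> U \<longleftrightarrow> (v, mp N (ar u v) \<beta>) \<in> U"
  proof
   assume "(u, \<beta>) \<in> U"
   then obtain c where c: "(u, c) \<in> J" "\<beta> = b (u, c)" unfolding U_mem by blast
   then have "(v, c) \<in> J" "mp N (ar u v) \<beta> = b (v, c)"
    using e[OF uv(1) c(1)] uv(3) by (simp_all split: if_splits)
   then show "(v, mp N (ar u v) \<beta>) \<in> U" unfolding U_mem by blast
  next
   assume "(v, mp N (ar u v) \<beta>) \<in> U"
   then obtain c where c: "(v, c) \<in> J" "mp N (ar u v) \<beta> = b (v, c)" unfolding U_mem by blast
   have uc: "(u, c) \<in> J"
   proof (rule ccontr)
    assume "(u, c) \<notin> J"
    from e'[OF uv(1) c(1) this] show False using c(2) uv(2) by (metis imageI)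
   qed
   then have "mp N (ar u v) (b (u, c)) = mp N (ar u v) \<beta>" using e[OF uv(1) uc] c by simp
   then have "\<beta> = b (u, c)" by (intro B_edge(2)[OF B uv(1,2) mem[OF uc] sym uv(3)])
   then show "(u, \<beta>) \<in> U" unfolding U_mem using uc by blast
  qed
 next
  fix \<beta> assume \<beta>: "\<beta> \<in> B root" "mp N ep \<beta> \<noteq> 0"
  show "(root, \<beta>) \<in> U \<longleftrightarrow> (root, mp N ep \<beta>) \<in> U"
  proof
   assume "(root, \<beta>) \<in> U"
   then obtain c where c: "(root, c) \<in> J" "\<beta> = b (root, c)" unfolding U_mem by blast
   then have "c" using ep(1) \<beta>(2) by (cases c) auto
   then have "(root, False) \<in> J" "mp N ep \<beta> = b (root, False)"
    using ep(2) c \<beta>(2) by (auto split: if_splits)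
   then show "(root, mp N ep \<beta>) \<in> U" unfolding U_mem by blast
  next
   assume "(root, mp N ep \<beta>) \<in> U"
   then obtain c where c: "(root, c) \<in> J" "mp N ep \<beta> = b (root, c)" unfolding U_mem by blast
   have "\<not> c"
   proof
    assume "c"
    then show False using ep'(2) c \<beta>(1) by (metis (full_types) imageI)
   qed
   then have "(root, True) \<in> J \<and> \<beta> = b (root, True)" using ep'(1) c \<beta>(1) by simp
   then show "(root, \<beta>) \<in> U" unfolding U_mem by blast
  qed
 qed
 then have Beq: "B y = b ` {k \<in> J. fst k = y}" if "y \<in> D" for y using that U_mem[of y] by force
 have fib: "{k \<in> J. (cl \<circ> fst) k = cl y} = {k \<in> J. fst k = y}" if "y \<in> D" for y
 proof -
  have "(cl \<circ> fst) k = cl y \<longleftrightarrow> fst k = y" if "k \<in> J" for k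
   using cl_eq[of "fst k" y] J_D[of "fst k" "snd k"] that \<open>y \<in> D\<close> by simp
  then show ?thesis by blast
 qed
 have fin: "finite J"
 proof (rule finite_subset[OF J(1)])
  show "finite (D \<times> (UNIV :: bool set))" using finite_D by simp
 qed
 have actJ: "mp N a (b k) = (case act_on J a k of None \<Rightarrow> 0 | Some l \<Rightarrow> b l)"
  if a: "a \<in> arcs Q" and k: "k \<in> J" "(cl \<circ> fst) k = tail Q a" for a k using a
 proof (cases rule: arcs_cases)
  case 1
  then have "cl (fst k) = cl root" using k(2) tail_ep by simp
  then have r: "fst k = root" using cl_eq[OF J_D[of "fst k" "snd k"] root_mem] k(1) by simp
  show ?thesis
  proof (cases "snd k \<and> (root, False) \<in> J")
   case True
   then have "k = (root, True)" using r by (simp add: prod_eq_iff)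
   then have "act_on J a k = Some (root, False)" using True 1 by (simp add: act_on_Some step_ep)
   then show ?thesis using ep(2) True 1 k(1) \<open>k = (root, True)\<close> by simp
  next
   case False
   then have "act_on J a k = None" using 1 by (auto simp: act_on_None step_ep)
   moreover have "mp N ep (b k) = 0"
   proof -
    obtain c where "k = (root, c)" using r by (metis prod.collapse)
    then show ?thesis using ep k(1) False by (cases c) (auto split: if_splits)
   qed
   ultimately show ?thesis using 1 by simp
  qed
 next
  case (2 u v)
  then have "cl (fst k) = cl u" using k(2) tail_ar by simp
  then have r: "fst k = u" using cl_eq[OF J_D[of "fst k" "snd k"] 2(3)] k(1) by simp
  then obtain c where c: "k = (u, c)" by (metis prod.collapse)
  show ?thesis
  proof (cases "(v, c) \<in> J")
   case True
   then have "act_on J a k = Some (v, c)" using 2 c by (simp add: act_on_Some step_ar)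
   then show ?thesis using e[OF 2(2), of c] True k(1) c 2(1) by simp
  next
   case False
   then have "act_on J a k = None" using act_on_ar_None[OF 2(2), of "(u, c)" J] 2(1) c by simp
   then show ?thesis using e[OF 2(2), of c] False k(1) c 2(1) by simp
  qed
 qed
 have "string_model Q N J (cl \<circ> fst) (act_on J) b"
 proof (unfold_locales, goal_cases)
  case 1 then show ?case by (rule fin)
 next
  case (2 k) then show ?case using J_D[of "fst k" "snd k"] verts by simp
 next
  case (3 i)
  then obtain y where y: "y \<in> D" "i = cl y" using verts by auto
  show ?case unfolding y(2) fib[OF y(1)]
  proof (rule inj_onI)
   fix k l assume k: "k \<in> {k \<in> J. fst k = y}" and l: "l \<in> {k \<in> J. fst k = y}" and bb: "b k = b l"
   obtain c c' where kl: "k = (y, c)" "l = (y, c')" using k l by (metis (mono_tags) mem_Collect_eq prod.collapse)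
   then show "k = l" using k l bb dist[of y] by (cases c; cases c') auto
  qed
 next
  case (4 i)
  then obtain y where y: "y \<in> D" "i = cl y" using verts by auto
  show ?case unfolding y(2) fib[OF y(1)] Beq[OF y(1), symmetric] by (rule B_independent[OF B y(1)])
 next
  case (5 i)
  then obtain y where y: "y \<in> D" "i = cl y" using verts by auto
  show ?case unfolding y(2) fib[OF y(1)] Beq[OF y(1), symmetric] by (rule B_span[OF B y(1)])
 next
  case (6 a k) then show ?case by (rule actJ)
 next
  case (7 a k l)
  then have l: "l \<in> J" "step a k l" by (simp_all add: act_on_Some)
  from 7(1) have "(cl \<circ> fst) l = head Q a"
   by (cases rule: arcs_cases) (use l in \<open>auto simp: step_ar step_ep head_ar head_ep\<close>)
  then show ?case using l by blast
 next
  case (8 a k k' l)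
  then show ?case using step_injective by (simp add: act_on_Some) blast
 qed
 then show ?thesis unfolding modelled_def using J(1) by blast
qed

end

end

section \<open>Recognising the string of an indecomposable representation\<close>

context tree_rep
begin

context
 fixes B assumes B: "string_basis B"
begin

lemma strand_iff: "(x, c) \<in> strand k False \<union> strand l True \<longleftrightarrow> x \<in> D \<and> straddles (if c then l else k) x"
 unfolding strand_def by (cases c) auto

text \<open>The two walks start at vectors linked by the loop and never share a vector: they differ
  at the root, where \<open>ep\<close> kills one and not the other, and this persists downwards
  because arrows are maps and are injective on the basis vectors that they do not kill.\<close>

lemma modelled_double_strand:
 assumes ind: "indecomposable Q R N" and wk: "walk B root k \<delta>" and wl: "walk B root l \<epsilon>"
  and ep: "mp N ep (\<epsilon> root) = \<delta> root" shows "modelled N (strand k False \<union> strand l True)"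
proof -
 let ?J = "strand k False \<union> strand l True"
 define b where "b = (\<lambda>(y, c). if c then \<epsilon> y else \<delta> y)"
 have b: "b (y, False) = \<delta> y" "b (y, True) = \<epsilon> y" for y by (simp_all add: b_def)
 note wk' = walkD[OF B wk] and wl' = walkD[OF B wl]
 have rB: "\<delta> root \<in> B root" "\<epsilon> root \<in> B root"
  using wk'(4)[OF root_mem] wl'(4)[OF root_mem] wk'(2,3) wl'(2,3) by simp_all
 have ed: "mp N ep (\<delta> root) = 0" using B_ep_zero[OF B rB(2)] ep by simp
 have dn: "\<delta> root \<noteq> 0" using B_nonzero[OF B root_mem rB(1)] .
 have enc: "encloses root u" "encloses root v" if "(u, v) \<in> edges" for u v
  using edges_mem[OF that] encloses_root by blast+
 show ?thesis
 proof (rule modelled_if_closed[OF B ind, of ?J b])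
  show "?J \<subseteq> D \<times> UNIV" unfolding strand_def by blast
  have "(root, False) \<in> ?J" unfolding strand_iff using root_mem wk'(2,3) by simp
  then show "?J \<noteq> {}" by blast
 next
  fix y c assume "(y, c) \<in> ?J"
  then have y: "y \<in> D" "straddles (if c then l else k) y" unfolding strand_iff by auto
  show "b (y, c) \<in> B y"
   using wk'(4)[OF y(1) encloses_root[OF y(1)]] wl'(4)[OF y(1) encloses_root[OF y(1)]] y(2) b by (cases c) auto
 next
  fix y assume "(y, False) \<in> ?J" "(y, True) \<in> ?J"
  then have y: "y \<in> D" "straddles k y" "straddles l y" unfolding strand_iff by auto
  have up: "straddles k z" "straddles l z" if "encloses z y" for z
   using that y(2,3) unfolding encloses_def by auto
  have "\<delta> y \<noteq> \<epsilon> y"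
  proof (rule descend_encloses[of root y "\<lambda>z. \<delta> z \<noteq> \<epsilon> z"])
   show "\<delta> root \<noteq> \<epsilon> root" using ep ed dn by metis
  next
   fix z assume z: "z \<in> D" "encloses z y" "\<delta> z \<noteq> \<epsilon> z" and l: "lft z \<in> D" "encloses (lft z) y"
   note e = edgesI(2)[OF z(1) l(1)]
   have "mp N (ar (lft z) z) (\<delta> (lft z)) = \<delta> z" "mp N (ar (lft z) z) (\<epsilon> (lft z)) = \<epsilon> z"
    using wk'(5)[OF e enc[OF e]] wl'(5)[OF e enc[OF e]] up[OF z(2)] up[OF l(2)] by simp_all
   then show "\<delta> (lft z) \<noteq> \<epsilon> (lft z)" using z(3) by metis
  next
   fix z assume z: "z \<in> D" "encloses z y" "\<delta> z \<noteq> \<epsilon> z" and r: "rgt z \<in> D" "encloses (rgt z) y"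
   note e = edgesI(1)[OF z(1) r(1)]
   have m: "mp N (ar z (rgt z)) (\<delta> z) = \<delta> (rgt z)" "mp N (ar z (rgt z)) (\<epsilon> z) = \<epsilon> (rgt z)"
    using wk'(5)[OF e enc[OF e]] wl'(5)[OF e enc[OF e]] up[OF z(2)] up[OF r(2)] by simp_all
   have zB: "\<delta> z \<in> B z" "\<epsilon> z \<in> B z" "\<delta> (rgt z) \<in> B (rgt z)"
    using wk'(4)[OF z(1) encloses_root[OF z(1)]] wl'(4)[OF z(1) encloses_root[OF z(1)]] up[OF z(2)]
     wk'(4)[OF r(1) encloses_root[OF r(1)]] up[OF r(2)] by simp_all
   show "\<delta> (rgt z) \<noteq> \<epsilon> (rgt z)" using B_edge(2)[OF B e zB(1,2)] m z(3) B_nonzero[OF B r(1) zB(3)] by metis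
  qed (use y root_mem encloses_root in auto)
  then show "b (y, False) \<noteq> b (y, True)" by (simp add: b)
 next
  fix u v c assume e: "(u, v) \<in> edges" and c: "(u, c) \<in> ?J"
  show "mp N (ar u v) (b (u, c)) = (if (v, c) \<in> ?J then b (v, c) else 0)"
   using wk'(5)[OF e enc[OF e]] wl'(5)[OF e enc[OF e]] c edges_mem[OF e] unfolding strand_iff
   by (cases c) (simp_all add: b)
 next
  fix u v c assume e: "(u, v) \<in> edges" and c: "(v, c) \<in> ?J" "(u, c) \<notin> ?J"
  show "b (v, c) \<notin> mp N (ar u v) ` B u"
   using wk'(6)[OF e enc[OF e]] wl'(6)[OF e enc[OF e]] c edges_mem[OF e] unfolding strand_iff
   by (cases c) (simp_all add: b)
 next
  show "mp N ep (b (root, False)) = 0" using ed by (simp add: b)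
  show "mp N ep (b (root, True)) = (if (root, False) \<in> ?J then b (root, False) else 0)"
   unfolding strand_iff using root_mem wk'(2,3) ep by (simp add: b)
 next
  fix \<beta> assume \<beta>: "\<beta> \<in> B root" "mp N ep \<beta> = b (root, False)"
  have "mp N ep \<beta> = mp N ep (\<epsilon> root)" "mp N ep \<beta> \<noteq> 0" using \<beta>(2) ep dn by (simp_all add: b)
  then have "\<beta> = \<epsilon> root" using B_ep(2)[OF B \<beta>(1) rB(2)] by blast
  then show "(root, True) \<in> ?J \<and> \<beta> = b (root, True)"
   unfolding strand_iff using root_mem wl'(2,3) by (simp add: b)
 next
  show "b (root, True) \<notin> mp N ep ` B root"
  proof
   assume "b (root, True) \<in> mp N ep ` B root"
   then obtain \<beta> where "\<beta> \<in> B root" "\<epsilon> root = mp N ep \<beta>" by (auto simp: b)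
   then show False using B_ep_zero[OF B, of \<beta>] ep dn by simp
  qed
 qed
qed

text \<open>No chord straddles the vertex lo, so the second strand is empty; writing it down gives
  the cases with one and two strands the same form.\<close>

lemma modelled_single_strand:
 assumes ind: "indecomposable Q R N" and wk: "walk B root k \<delta>"
  and ep: "mp N ep (\<delta> root) = 0" "\<delta> root \<notin> mp N ep ` B root"
 shows "modelled N (strand k False \<union> strand lo True)"
proof -
 let ?J = "strand k False \<union> strand lo True"
 have J: "(y, c) \<in> ?J \<longleftrightarrow> y \<in> D \<and> \<not> c \<and> straddles k y" for y c
  unfolding strand_iff using chord_bounds[of y] by (cases c) auto
 note wk' = walkD[OF B wk]
 have enc: "encloses root u" "encloses root v" if "(u, v) \<in> edges" for u v
  using edges_mem[OF that] encloses_root by blast+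
 show ?thesis
 proof (rule modelled_if_closed[OF B ind, of ?J "\<lambda>(y, c). \<delta> y"])
  show "?J \<subseteq> D \<times> UNIV" unfolding strand_def by blast
  have "(root, False) \<in> ?J" unfolding J using root_mem wk'(2,3) by simp
  then show "?J \<noteq> {}" by blast
  show "(case (y, c) of (y, c) \<Rightarrow> \<delta> y) \<in> B y" if "(y, c) \<in> ?J" for y c
   using that wk'(4)[of y] encloses_root[of y] unfolding J by simp
  show "mp N (ar u v) (case (u, c) of (y, c) \<Rightarrow> \<delta> y) = (if (v, c) \<in> ?J then case (v, c) of (y, c) \<Rightarrow> \<delta> y else 0)"
   if "(u, v) \<in> edges" "(u, c) \<in> ?J" for u v c
   using wk'(5)[OF that(1) enc[OF that(1)]] that(2) edges_mem[OF that(1)] unfolding J by simp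
  show "(case (v, c) of (y, c) \<Rightarrow> \<delta> y) \<notin> mp N (ar u v) ` B u"
   if "(u, v) \<in> edges" "(v, c) \<in> ?J" "(u, c) \<notin> ?J" for u v c
   using wk'(6)[OF that(1) enc[OF that(1)]] that(2,3) edges_mem[OF that(1)] unfolding J by simp
  show "mp N ep (case (root, False) of (y, c) \<Rightarrow> \<delta> y) = 0" using ep by simp
  show "(root, True) \<in> ?J \<and> \<beta> = (case (root, True) of (y, c) \<Rightarrow> \<delta> y)"
   if "\<beta> \<in> B root" "mp N ep \<beta> = (case (root, False) of (y, c) \<Rightarrow> \<delta> y)" for \<beta>
   using ep(2) that by (simp add: image_iff) metis
 qed (simp_all add: J del: Un_iff)
qed

text \<open>The string turns in the triangle below z: it descends to k on the left and to l on the
  right, and the two parts are joined by the arrow between the children of z. The values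
  \<open>k = fst z\<close> and \<open>l = snd z\<close> stand for a missing part; \<open>up\<close>
  and \<open>down\<close> say that the string does not continue through z.\<close>

lemma modelled_crossing:
 assumes ind: "indecomposable Q R N" and z: "z \<in> D"
  and kl: "fst z \<le> k" "k < apex z" "apex z < l" "l \<le> snd z" "fst z < k \<or> l < snd z"
  and wk: "fst z < k \<Longrightarrow> walk B (lft z) k \<delta>" and wl: "l < snd z \<Longrightarrow> walk B (rgt z) l \<epsilon>"
  and up: "fst z < k \<Longrightarrow> mp N (ar (lft z) z) (\<delta> (lft z)) = 0"
  and down: "l < snd z \<Longrightarrow> \<epsilon> (rgt z) \<notin> mp N (ar z (rgt z)) ` B z"
  and across: "fst z < k \<Longrightarrow> l < snd z \<Longrightarrow> mp N (ar (rgt z) (lft z)) (\<epsilon> (rgt z)) = \<delta> (lft z)"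
   "fst z < k \<Longrightarrow> \<not> l < snd z \<Longrightarrow> rgt z \<in> D \<Longrightarrow> \<delta> (lft z) \<notin> mp N (ar (rgt z) (lft z)) ` B (rgt z)"
   "\<not> fst z < k \<Longrightarrow> l < snd z \<Longrightarrow> lft z \<in> D \<Longrightarrow> mp N (ar (rgt z) (lft z)) (\<epsilon> (rgt z)) = 0"
 shows "modelled N (crossing_strand k l)"
proof -
 let ?J = "crossing_strand k l"
 have Lz: "lft z \<in> D" if "fst z < k" using lft_mem[OF z that kl(2)] .
 have Rz: "rgt z \<in> D" if "l < snd z" using rgt_mem[OF z kl(3) that] .
 \<comment> \<open>A chord that crosses (k, l) cannot cross z, which confines it to one of the two
   subtrees below z.\<close>
 have J: "(y, c) \<in> ?J \<longleftrightarrow> y \<in> D \<and> \<not> c \<and> (encloses (lft z) y \<and> straddles k y \<or> encloses (rgt z) y \<and> straddles l y)" for y c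
 proof -
  have "crosses k l y \<longleftrightarrow> encloses (lft z) y \<and> straddles k y \<or> encloses (rgt z) y \<and> straddles l y" if y: "y \<in> D"
  proof
   assume c: "crosses k l y"
   have "encloses z y"
   proof -
    from c consider "fst y < k" "k < snd y" "snd y < l" | "k < fst y" "fst y < l" "l < snd y"
     unfolding crosses_def by blast
    then show ?thesis
    proof cases
     case 1
     have "fst z \<le> fst y"
     proof (rule ccontr)
      assume "\<not> fst z \<le> fst y"
      then show False using noncross'[OF y z] 1 kl by simp
     qed
     then show ?thesis using 1 kl by (simp add: encloses_def)
    next
     case 2
     have "snd y \<le> snd z"
     proof (rule ccontr)
      assume "\<not> snd y \<le> snd z"
      then show False using noncross'[OF z y] 2 kl by simp
     qed
     then show ?thesis using 2 kl by (simp add: encloses_def)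
    qed
   qed
   with z y show "encloses (lft z) y \<and> straddles k y \<or> encloses (rgt z) y \<and> straddles l y"
   proof (cases rule: encloses_cases)
    case 1
    then show ?thesis using c kl unfolding crosses_def by auto
   next
    case 2
    then show ?thesis using c kl unfolding crosses_def by (auto simp: encloses_def)
   next
    case 3
    then show ?thesis using c kl unfolding crosses_def by (auto simp: encloses_def)
   qed
  next
   assume "encloses (lft z) y \<and> straddles k y \<or> encloses (rgt z) y \<and> straddles l y"
   then show "crosses k l y" using kl unfolding crosses_def by (auto simp: encloses_def)
  qed
  then show ?thesis unfolding crossing_strand_def by blast
 qed
 have Jenc: "encloses z y" "y \<noteq> z" if "(y, c) \<in> ?J" for y c
 proof -
  have "encloses (lft z) y \<or> encloses (rgt z) y" using that unfolding J by blast
  then show "encloses z y" "y \<noteq> z"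
   using encloses_trans[OF encloses_lft[OF z]] encloses_trans[OF encloses_rgt[OF z]]
    not_encloses_lft[OF z] not_encloses_rgt[OF z] by blast+
 qed
 have left: "fst z < k" if "encloses (lft z) y" "straddles k y" for y using that by (simp add: encloses_def)
 have right: "l < snd z" if "encloses (rgt z) y" "straddles l y" for y using that by (simp add: encloses_def)
 have notboth: "\<not> encloses (rgt z) y" if "encloses (lft z) y" "y \<in> D" for y
  using encloses_lft_rgt_False[OF that(2,1)] by blast
 define b where "b = (\<lambda>(y, c :: bool). if encloses (lft z) y then \<delta> y else \<epsilon> y)"
 have bl: "b (y, c) = \<delta> y" if "encloses (lft z) y" for y c using that by (simp add: b_def)
 have br: "b (y, c) = \<epsilon> y" if "encloses (rgt z) y" "y \<in> D" for y c
  using that encloses_lft_rgt_False[of y z] by (auto simp: b_def)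
 have Jl: "(y, c) \<in> ?J \<longleftrightarrow> \<not> c \<and> straddles k y" if "y \<in> D" "encloses (lft z) y" for y c
  unfolding J using that notboth by blast
 have Jr: "(y, c) \<in> ?J \<longleftrightarrow> \<not> c \<and> straddles l y" if "y \<in> D" "encloses (rgt z) y" for y c
  unfolding J using that notboth by blast
 have Jz: "(z, c) \<notin> ?J" for c using Jenc(2) by blast
 have root: "(root, c) \<notin> ?J" for c
  using Jenc[of root c] encloses_root[OF z] by (auto simp: encloses_def prod_eq_iff)
 have edge: "((u, c) \<in> ?J \<longrightarrow> mp N (ar u v) (b (u, c)) = (if (v, c) \<in> ?J then b (v, c) else 0)) \<and>
   ((v, c) \<in> ?J \<and> (u, c) \<notin> ?J \<longrightarrow> b (v, c) \<notin> mp N (ar u v) ` B u)" if e: "(u, v) \<in> edges" for u v c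
 proof (cases "(u, c) \<in> ?J \<or> (v, c) \<in> ?J")
  case False
  then show ?thesis by simp
 next
  case True
  have enc: "encloses z u" "encloses z v" using edge_enclosed[OF z e] True Jenc by blast+
  have c: "\<not> c" using True unfolding J by blast
  note uv = edges_mem[OF e]
  from z e enc show ?thesis
  proof (cases rule: edges_encloses_cases)
   case 1
   then have "straddles l (rgt z)" using True Jz Jr[of "rgt z" c] by simp
   then have "l < snd z" by simp
   then show ?thesis using 1 Jz down br[of "rgt z"] by simp
  next
   case 2
   then have "straddles k (lft z)" using True Jz Jl[of "lft z" c] by simp
   then have "fst z < k" by simp
   then show ?thesis using 2 Jz up bl[of "lft z"] by simp
  next
   case 3
   have l: "(lft z, c) \<in> ?J \<longleftrightarrow> fst z < k" using Jl[of "lft z" c] 3 c kl by simp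
   have r: "(rgt z, c) \<in> ?J \<longleftrightarrow> l < snd z" using Jr[of "rgt z" c] 3 c kl by simp
   show ?thesis unfolding 3(3,4) l r using across 3(1,2) bl[of "lft z" c] br[of "rgt z" c] by auto
  next
   case 4
   then have "straddles k u \<or> straddles k v" using True Jl uv by blast
   then have k: "fst z < k" using left 4 by blast
   note w = walkD[OF B wk[OF k]]
   show ?thesis using w(5,6)[OF e 4(2,3)] Jl uv 4 bl c by simp
  next
   case 5
   then have "straddles l u \<or> straddles l v" using True Jr uv by blast
   then have k: "l < snd z" using right 5 by blast
   note w = walkD[OF B wl[OF k]]
   show ?thesis using w(5,6)[OF e 5(2,3)] Jr uv 5 br c by simp
  qed
 qed
 show ?thesis
 proof (rule modelled_if_closed[OF B ind, of ?J b])
  show "?J \<subseteq> D \<times> UNIV" unfolding crossing_strand_def by blast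
  show "?J \<noteq> {}"
  proof (cases "fst z < k")
   case True
   then have "(lft z, False) \<in> ?J" using Jl[OF Lz[OF True]] kl by simp
   then show ?thesis by blast
  next
   case False
   then have r: "l < snd z" using kl(5) by blast
   then have "(rgt z, False) \<in> ?J" using Jr[OF Rz[OF r]] kl by simp
   then show ?thesis by blast
  qed
  show "b (y, c) \<in> B y" if "(y, c) \<in> ?J" for y c
  proof -
   from that have y: "y \<in> D" "encloses (lft z) y \<and> straddles k y \<or> encloses (rgt z) y \<and> straddles l y"
    unfolding J by blast+
   from y(2) show ?thesis
   proof
    assume a: "encloses (lft z) y \<and> straddles k y"
    then have k: "fst z < k" using left by blast
    show ?thesis using walkD(4)[OF B wk[OF k] y(1)] a bl by simp
   next
    assume a: "encloses (rgt z) y \<and> straddles l y"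
    then have k: "l < snd z" using right by blast
    show ?thesis using walkD(4)[OF B wl[OF k] y(1)] a br[OF _ y(1)] by simp
   qed
  qed
  show "mp N (ar u v) (b (u, c)) = (if (v, c) \<in> ?J then b (v, c) else 0)" if "(u, v) \<in> edges" "(u, c) \<in> ?J" for u v c
   using edge[OF that(1), of c] that(2) by blast
  show "b (v, c) \<notin> mp N (ar u v) ` B u" if "(u, v) \<in> edges" "(v, c) \<in> ?J" "(u, c) \<notin> ?J" for u v c
   using edge[OF that(1), of c] that(2,3) by blast
  show "b (y, False) \<noteq> b (y, True)" if "(y, False) \<in> ?J" "(y, True) \<in> ?J" for y
   using that(2) unfolding J by blast
 qed (use root in simp_all)
qed

text \<open>A longest chord that carries a basis vector marks the top of the string. If it is the
  root, the string passes the loop or stops there. Otherwise its parent z is longer and carries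
  nothing, so the string turns in the triangle below z, and k and l are the places where its two
  walks stop.\<close>

theorem classification_aux:
 assumes ind: "indecomposable Q R N"
 shows "(\<exists>k l. lo \<le> k \<and> k + 2 \<le> l \<and> l \<le> hi \<and> (k, l) \<notin> D \<and> modelled N (crossing_strand k l)) \<or>
  (\<exists>k l. lo < k \<and> k < hi \<and> lo \<le> l \<and> l < hi \<and> modelled N (strand k False \<union> strand l True))"
proof -
 let ?\<Omega> = "Sigma D B"
 have ne: "?\<Omega> \<noteq> {}"
 proof
  assume e: "?\<Omega> = {}"
  have "spc N i = {0}" if i: "i \<in> verts Q" for i
  proof -
   obtain x where x: "x \<in> D" "i = cl x" using i verts by blast
   then have "B x = {}" using e by blast
   then show ?thesis using B_span[OF B x(1)] x(2) by simp
  qed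
  then show False using ind by (simp add: indecomposable_def zero_rep_def)
 qed
 have fin: "finite ?\<Omega>" using finite_D B_finite[OF B] by blast
 obtain x \<beta> where x: "x \<in> D" "\<beta> \<in> B x" and top: "\<And>y. y \<in> D \<Longrightarrow> snd x - fst x < snd y - fst y \<Longrightarrow> B y = {}"
 proof -
  let ?len = "\<lambda>p :: chord \<times> 'v. snd (fst p) - fst (fst p)"
  have "Max (?len ` ?\<Omega>) \<in> ?len ` ?\<Omega>" using fin ne by (intro Max_in) auto
  then obtain p where p: "Max (?len ` ?\<Omega>) = ?len p" "p \<in> ?\<Omega>" by (rule imageE)
  have max: "?len q \<le> ?len p" if "q \<in> ?\<Omega>" for q
   unfolding p(1)[symmetric] by (rule Max_ge) (use fin that in auto)
  show thesis
  proof (rule that[of "fst p" "snd p"])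
   show "fst p \<in> D" "snd p \<in> B (fst p)" using p(2) by (cases p; simp)+
   show "B y = {}" if y: "y \<in> D" "snd (fst p) - fst (fst p) < snd y - fst y" for y
   proof (rule ccontr)
    assume "B y \<noteq> {}"
    then obtain \<gamma> where "(y, \<gamma>) \<in> ?\<Omega>" using y(1) by blast
    from max[OF this] show False using y(2) by simp
   qed
  qed
 qed
 show ?thesis
 proof (cases "x = root")
  case True
  have \<beta>: "\<beta> \<in> B root" using x True by simp
  have double: ?thesis if eB: "\<epsilon> \<in> B root" "mp N ep \<epsilon> \<noteq> 0" for \<epsilon>
  proof -
   have dB: "mp N ep \<epsilon> \<in> B root" using B_ep(1)[OF B eB(1)] eB(2) by blast
   obtain l e where e: "walk B root l e" "e root = \<epsilon>" using walk_exists[OF B root_mem eB(1)] by blast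
   obtain k d where d: "walk B root k d" "d root = mp N ep \<epsilon>" using walk_exists[OF B root_mem dB] by blast
   have "modelled N (strand k False \<union> strand l True)"
    by (rule modelled_double_strand[OF ind d(1) e(1)]) (simp add: d e)
   then show ?thesis using walkD(2,3)[OF B d(1)] walkD(2,3)[OF B e(1)]
    by (intro disjI2 exI[of _ k] exI[of _ l]) simp
  qed
  show ?thesis
  proof (cases "\<exists>\<epsilon>\<in>B root. mp N ep \<epsilon> \<noteq> 0")
   case True
   then show ?thesis using double by blast
  next
   case False
   obtain k d where d: "walk B root k d" "d root = \<beta>" using walk_exists[OF B root_mem \<beta>] by blast
   have "modelled N (strand k False \<union> strand lo True)"
    by (rule modelled_single_strand[OF ind d(1)]) (use d False \<beta> B_nonzero[OF B root_mem \<beta>] in auto)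
   then show ?thesis using walkD(2,3)[OF B d(1)] by (intro disjI2 exI[of _ k] exI[of _ lo]) simp
  qed
 next
  case False
  then obtain z where z: "z \<in> D" "x = lft z \<or> x = rgt z" using parent_exists[OF x(1)] by blast
  note ap = apex(1,2)[OF z(1)]
  have Bz: "B z = {}" by (rule top[OF z(1)]) (use z(2) ap in auto)
  have fin: ?thesis if "modelled N (crossing_strand k l)" "fst z \<le> k" "k < apex z" "apex z < l" "l \<le> snd z"
    "fst z < k \<or> l < snd z" for k l
  proof -
   \<comment> \<open>A chord below z with these ends would straddle the apex of z and thus be z
     itself, which the last condition rules out.\<close>
   have "(k, l) \<notin> D"
   proof
    assume D: "(k, l) \<in> D"
    have "encloses z (k, l)" using that by (simp add: encloses_def)
    with z(1) D show False
     by (cases rule: encloses_cases) (use that in \<open>auto simp: encloses_def prod_eq_iff\<close>)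
   qed
   then show ?thesis using that chord_bounds[OF z(1)] by (intro disjI1 exI[of _ k] exI[of _ l]) auto
  qed
  from z(2) show ?thesis
  proof
   assume L: "x = lft z"
   then have lD: "lft z \<in> D" and \<beta>: "\<beta> \<in> B (lft z)" using x by simp_all
   obtain k d where d: "walk B (lft z) k d" "d (lft z) = \<beta>" using walk_exists[OF B lD \<beta>] by blast
   note k = walkD(2,3)[OF B d(1)]
   have up: "mp N (ar (lft z) z) (d (lft z)) = 0"
    using B_edge(1)[OF B edgesI(2)[OF z(1) lD] \<beta>] Bz d(2) by blast
   show ?thesis
   proof (cases "rgt z \<in> D \<and> (\<exists>\<gamma>\<in>B (rgt z). mp N (ar (rgt z) (lft z)) \<gamma> = \<beta>)")
    case True
    then obtain \<gamma> where \<gamma>: "rgt z \<in> D" "\<gamma> \<in> B (rgt z)" "mp N (ar (rgt z) (lft z)) \<gamma> = \<beta>" by blast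
    obtain l e where e: "walk B (rgt z) l e" "e (rgt z) = \<gamma>" using walk_exists[OF B \<gamma>(1,2)] by blast
    note l = walkD(2,3)[OF B e(1)]
    have "modelled N (crossing_strand k l)"
     by (rule modelled_crossing[OF ind z(1), where \<delta> = d and \<epsilon> = e])
      (use k l d e up Bz \<gamma> in auto)
    then show ?thesis using fin k l by simp
   next
    case False
    have "modelled N (crossing_strand k (snd z))" by (rule modelled_crossing[OF ind z(1), where \<delta> = d])
      (use k d up ap False in auto)
    then show ?thesis using fin k ap by simp
   qed
  next
   assume r: "x = rgt z"
   then have rD: "rgt z \<in> D" and \<beta>: "\<beta> \<in> B (rgt z)" using x by simp_all
   obtain l e where e: "walk B (rgt z) l e" "e (rgt z) = \<beta>" using walk_exists[OF B rD \<beta>] by blast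
   note l = walkD(2,3)[OF B e(1)]
   show ?thesis
   proof (cases "lft z \<in> D \<and> mp N (ar (rgt z) (lft z)) \<beta> \<noteq> 0")
    case True
    let ?\<gamma> = "mp N (ar (rgt z) (lft z)) \<beta>"
    have \<gamma>: "?\<gamma> \<in> B (lft z)" using B_edge(1)[OF B edgesI(3)[OF z(1) _ rD] \<beta>] True by blast
    have lD: "lft z \<in> D" using True by blast
    obtain k d where d: "walk B (lft z) k d" "d (lft z) = ?\<gamma>" using walk_exists[OF B lD \<gamma>] by blast
    note k = walkD(2,3)[OF B d(1)]
    have up: "mp N (ar (lft z) z) (d (lft z)) = 0"
     using B_edge(1)[OF B edgesI(2)[OF z(1) lD] \<gamma>] Bz d(2) by auto
    have "modelled N (crossing_strand k l)"
     by (rule modelled_crossing[OF ind z(1), where \<delta> = d and \<epsilon> = e])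
      (use k l d e up Bz in auto)
    then show ?thesis using fin k l by simp
   next
    case False
    have "modelled N (crossing_strand (fst z) l)" by (rule modelled_crossing[OF ind z(1), where \<epsilon> = e])
      (use l e ap False Bz in auto)
    then show ?thesis using fin l ap by simp
   qed
  qed
 qed
qed

end

theorem classification:
 assumes "indecomposable Q R N"
 shows "(\<exists>k l. lo \<le> k \<and> k + 2 \<le> l \<and> l \<le> hi \<and> (k, l) \<notin> D \<and> modelled N (crossing_strand k l)) \<or>
  (\<exists>k l. lo < k \<and> k < hi \<and> lo \<le> l \<and> l < hi \<and> modelled N (strand k False \<union> strand l True))"
 using string_basis_ex classification_aux[OF _ assms] by blast

end

context tree_quiver
begin

text \<open>The value \<open>l = lo\<close> stands for an empty second strand, where E is 1; this
  accounts for the condition \<open>lo < l\<close>.\<close>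

lemma E_rigid_modelled:
 assumes "is_rep Q R N" "modelled N J"
 shows "J = crossing_strand k l \<Longrightarrow> k + 2 \<le> l \<Longrightarrow> (k, l) \<notin> D \<Longrightarrow> lo \<le> k \<Longrightarrow> l \<le> hi \<Longrightarrow> E_rigid Q R N"
  and "J = strand k False \<union> strand l True \<Longrightarrow> lo < k \<Longrightarrow> k < hi \<Longrightarrow> lo \<le> l \<Longrightarrow> l < hi \<Longrightarrow>
   E_rigid Q R N \<longleftrightarrow> lo < l \<and> l \<le> k"
proof -
 obtain b where J: "J \<subseteq> D \<times> UNIV" and b: "string_model Q N J (cl \<circ> fst) (act_on J) b"
  using assms(2) unfolding modelled_def by blast
 interpret m: string_model Q N J "cl \<circ> fst" "act_on J" b by fact
 interpret tree_model D lo hi Q R cl ar ep N J b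
  by unfold_locales (use assms(1) finite_verts finite_arcs tails heads rels_composable J in auto)
 show "J = crossing_strand k l \<Longrightarrow> k + 2 \<le> l \<Longrightarrow> (k, l) \<notin> D \<Longrightarrow> lo \<le> k \<Longrightarrow> l \<le> hi \<Longrightarrow> E_rigid Q R N"
  using E_inv_crossing by (simp add: E_rigid_def)
 show "J = strand k False \<union> strand l True \<Longrightarrow> lo < k \<Longrightarrow> k < hi \<Longrightarrow> lo \<le> l \<Longrightarrow> l < hi \<Longrightarrow>
   E_rigid Q R N \<longleftrightarrow> lo < l \<and> l \<le> k"
  using E_inv_single_strand[of k l] E_inv_double_strand[of k l] by (cases "lo < l") (auto simp: E_rigid_def)
qed

end

subsection \<open>Lifting curves to the universal cover of the punctured disk\<close>

text \<open>The logarithms of the marked points: integers number the marked points on the universal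
  cover of the boundary circle, and adding n + 1 is one full turn.\<close>

definition ang :: "nat \<Rightarrow> int \<Rightarrow> complex" where
 "ang n a = \<i> * of_real (2 * pi * of_int a / (real n + 1))"

lemma Re_ang [simp]: "Re (ang n a) = 0" and Im_ang: "Im (ang n a) = 2 * pi * of_int a / (real n + 1)"
 by (simp_all add: ang_def)

lemma Im_ang_less: "Im (ang n a) < Im (ang n b) \<longleftrightarrow> a < b" by (simp add: Im_ang divide_less_cancel)

lemma ang_eq: "ang n a = ang n b \<longleftrightarrow> a = b" by (simp add: complex_eq_iff Im_ang)

lemma ang_shift: "ang n (a + c * (int n + 1)) = ang n a + of_int (2 * c) * (of_real pi * \<i>)"
 by (simp add: complex_eq_iff Im_ang field_simps)

text \<open>
  A curve lifts along \<open>exp\<close> to a path in the half-plane of non-positive real part; \<open>a\<close> and \<open>b\<close>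
  record the end points of the lift.
\<close>

definition turn :: "nat \<Rightarrow> (real \<Rightarrow> complex) \<Rightarrow> int \<Rightarrow> int \<Rightarrow> bool" where
 "turn n p a b \<longleftrightarrow> (\<exists>L. continuous_on {0..1} L \<and> (\<forall>t\<in>{0..1}. p t = exp (L t)) \<and>
   L 0 = ang n a \<and> L 1 = ang n b)"

text \<open>The conditions that \<open>isotopic\<close> puts on a path apart from its end points.
  Simplicity is left out because the projection of a chord may cross itself.\<close>

definition tame :: "nat \<Rightarrow> (real \<Rightarrow> complex) \<Rightarrow> bool" where
 "tame n p \<longleftrightarrow> (\<forall>t\<in>{0..1}. norm (p t) \<le> 1) \<and> (\<forall>t\<in>{0<..<1}. p t \<notin> marked n \<and> p t \<noteq> 0)"

lemma marked_norm: "z \<in> marked n \<Longrightarrow> norm z = 1"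
proof -
 assume "z \<in> marked n"
 then have "norm (z ^ (n + 1)) = norm (1 :: complex)" unfolding marked_def mem_Collect_eq by (rule arg_cong)
 then have "norm z ^ (n + 1) = 1 ^ (n + 1)" by (simp only: norm_power norm_one power_one)
 then show "norm z = 1" by (rule power_eq_imp_eq_base[OF _ norm_ge_zero zero_le_one]) linarith
qed

lemma exp_ang_marked: "exp (ang n a) \<in> marked n"
proof -
 have "exp (ang n a) ^ (n + 1) = exp (of_nat (n + 1) * ang n a)" by (rule exp_of_nat_mult[symmetric])
 also have "of_nat (n + 1) * ang n a = of_int (2 * a) * (of_real pi * \<i>)"
  by (simp add: complex_eq_iff ang_def field_simps)
 also have "exp \<dots> = 1" by (subst exp_eq_1) (auto simp: field_simps)
 finally show ?thesis by (simp add: marked_def)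
qed

lemma marked_exp_ang:
 assumes "exp w \<in> marked n"
 obtains a where "w = ang n a"
proof -
 have "exp (of_nat (n + 1) * w) = 1" using assms unfolding marked_def mem_Collect_eq exp_of_nat_mult .
 then obtain k :: int where k: "Re (of_nat (n + 1) * w) = 0" "Im (of_nat (n + 1) * w) = of_int (2 * k) * pi"
  unfolding exp_eq_1 by blast
 have "w = ang n k"
 proof (rule complex_eqI)
  have "(real n + 1) * Re w = 0" using k(1) by (simp add: algebra_simps)
  then show "Re w = Re (ang n k)" by (simp add: add_nonneg_eq_0_iff)
  have "(real n + 1) * Im w = 2 * k * pi" using k(2) by (simp add: algebra_simps)
  then show "Im w = Im (ang n k)" by (simp add: Im_ang field_simps)
 qed
 then show thesis by (rule that)
qed

lemma unit_interval_cases: "t \<in> {0..1} \<Longrightarrow> t = 0 \<or> t = 1 \<or> t \<in> {0<..<1 :: real}" by auto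

lemma curve_tame: "curve n p \<Longrightarrow> tame n p" by (auto simp: curve_def tame_def path_image_def image_subset_iff)

lemma curve_turn:
 assumes "curve n p"
 obtains a b where "turn n p a b"
proof -
 have c: "continuous_on {0..1} p" using assms by (auto simp: curve_def simple_path_def path_def)
 have nz: "p t \<noteq> 0" if t: "t \<in> {0..1}" for t
 proof -
  consider "t = 0" | "t = 1" | "t \<in> {0<..<1}" using unit_interval_cases[OF t] by blast
  then show ?thesis using assms marked_norm by cases (force simp: curve_def pathstart_def pathfinish_def)+
 qed
 obtain L where L: "continuous_on {0..1} L" "\<And>t. t \<in> {0..1} \<Longrightarrow> p t = exp (L t)"
  using continuous_logarithm_on_contractible[OF c _ nz] convex_imp_contractible[of "{0..1::real}"] by auto
 have "exp (L 0) \<in> marked n" "exp (L 1) \<in> marked n"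
  using assms L(2)[of 0] L(2)[of 1] by (auto simp: curve_def pathstart_def pathfinish_def)
 then obtain a b where "L 0 = ang n a" "L 1 = ang n b" using marked_exp_ang by metis
 then show thesis using that L by (auto simp: turn_def)
qed

lemma turn_nonzero: "turn n p a b \<Longrightarrow> t \<in> {0..1} \<Longrightarrow> p t \<noteq> 0" by (auto simp: turn_def)

lemma turn_ends: "turn n p a b \<Longrightarrow> p 0 = exp (ang n a)" "turn n p a b \<Longrightarrow> p 1 = exp (ang n b)"
 by (auto simp: turn_def)

text \<open>Two logarithms of the same value differ by a multiple of 2 pi i. Such multiples are
  isolated, so a continuous difference is constant on a connected set.\<close>

lemma exp_lifts_constant:
 assumes "connected S" "continuous_on S f" "continuous_on S g"
  and "\<And>x. x \<in> S \<Longrightarrow> exp (f x) = exp (g x)" "x \<in> S" "y \<in> S" shows "f x - g x = f y - (g y :: complex)"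
proof -
 have e: "exp (f x - g x) = 1" if "x \<in> S" for x using assms(4)[OF that] by (simp add: exp_diff)
 have "(\<lambda>x. f x - g x) constant_on S"
 proof (rule continuous_discrete_range_constant[OF assms(1)])
  show "continuous_on S (\<lambda>x. f x - g x)" using assms by (intro continuous_intros)
  fix x assume x: "x \<in> S"
  have "1 \<le> norm ((f y - g y) - (f x - g x))" if y: "y \<in> S" "f y - g y \<noteq> f x - g x" for y
  proof -
   obtain k where k: "Re (f x - g x) = 0" "Im (f x - g x) = of_int (2 * k) * pi"
    using e[OF x] unfolding exp_eq_1 by blast
   obtain l where l: "Re (f y - g y) = 0" "Im (f y - g y) = of_int (2 * l) * pi"
    using e[OF y(1)] unfolding exp_eq_1 by blast
   have "k \<noteq> l" using y(2) k l by (auto simp: complex_eq_iff)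
   then have "1 \<le> \<bar>l - k\<bar>" by simp
   then have "(1::real) \<le> of_int \<bar>l - k\<bar>" by linarith
   then have "1 * 1 \<le> of_int \<bar>l - k\<bar> * (2 * pi)" using pi_ge_two by (intro mult_mono) auto
   also have "\<dots> = \<bar>Im ((f y - g y) - (f x - g x))\<bar>"
   proof -
    have "Im ((f y - g y) - (f x - g x)) = of_int (l - k) * (2 * pi)"
     using k l by (simp add: algebra_simps)
    then show ?thesis by (simp only: abs_mult of_int_abs) simp
   qed
   also have "\<dots> \<le> norm ((f y - g y) - (f x - g x))" by (rule abs_Im_le_cmod)
   finally show ?thesis by simp
  qed
  then show "\<exists>e>0. \<forall>y. y \<in> S \<and> f y - g y \<noteq> f x - g x \<longrightarrow> e \<le> norm ((f y - g y) - (f x - g x))"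
   by (intro exI[of _ 1]) auto
 qed
 then show ?thesis using assms(5,6) by (auto simp: constant_on_def)
qed

text \<open>Two lifts of a path differ by a deck transformation of \<open>exp\<close>, which moves
  both end points by the same multiple of n + 1.\<close>

lemma turn_unique:
 assumes "turn n p a b" "turn n p a' b'"
 obtains c where "a' = a + c * (int n + 1)" "b' = b + c * (int n + 1)"
proof -
 obtain L where L: "continuous_on {0..1} L" "\<forall>t\<in>{0..1}. p t = exp (L t)" "L 0 = ang n a" "L 1 = ang n b"
  using assms(1) unfolding turn_def by blast
 obtain M where M: "continuous_on {0..1} M" "\<forall>t\<in>{0..1}. p t = exp (M t)" "M 0 = ang n a'" "M 1 = ang n b'"
  using assms(2) unfolding turn_def by blast
 have eq: "M 0 - L 0 = M 1 - L 1" by (rule exp_lifts_constant[of "{0..1::real}"]) (use L M in auto)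
 have "exp (ang n a' - ang n a) = 1"
  using L(2,3) M(2,3) by (simp add: exp_diff) (metis L(3) M(3) atLeastAtMost_iff order_refl zero_le_one)
 then obtain c where c: "Im (ang n a' - ang n a) = of_int (2 * c) * pi" unfolding exp_eq_1 by blast
 have "(of_int a' - of_int a) * 2 * pi / (real n + 1) = of_int c * 2 * pi"
  using c by (simp add: Im_ang algebra_simps diff_divide_distrib)
 then have "(of_int a' - of_int a) * (2 * pi) = of_int c * (real n + 1) * (2 * pi)"
  by (simp add: field_simps)
 then have "of_int a' - of_int a = of_int c * (real n + 1)" by (subst (asm) mult_cancel_right) simp
 then have "real_of_int (a' - a) = real_of_int (c * (int n + 1))" by simp
 then have a': "a' = a + c * (int n + 1)" by linarith
 have "ang n b' = ang n b + (ang n a' - ang n a)" using eq L M by (simp add: algebra_simps)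
 also have "\<dots> = ang n (b + c * (int n + 1))" unfolding a' ang_shift by simp
 finally have "b' = b + c * (int n + 1)" unfolding ang_eq .
 then show thesis using that a' by blast
qed

lemma turn_shift:
 assumes "turn n p a b" shows "turn n p (a + c * (int n + 1)) (b + c * (int n + 1))"
proof -
 obtain L where L: "continuous_on {0..1} L" "\<forall>t\<in>{0..1}. p t = exp (L t)" "L 0 = ang n a" "L 1 = ang n b"
  using assms(1) unfolding turn_def by blast
 have e: "exp (of_int (2 * c) * (of_real pi * \<i>)) = (1 :: complex)"
  by (subst exp_eq_1) (auto simp: field_simps)
 show ?thesis unfolding turn_def
 proof (intro exI[of _ "\<lambda>t. L t + of_int (2 * c) * (of_real pi * \<i>)"] conjI ballI)
  show "continuous_on {0..1} (\<lambda>t. L t + of_int (2 * c) * (of_real pi * \<i>))"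
   using L(1) by (intro continuous_intros)
  show "p t = exp (L t + of_int (2 * c) * (of_real pi * \<i>))" if "t \<in> {0..1}" for t
   using L(2) that unfolding exp_add e by simp
 qed (simp_all only: L ang_shift)
qed

lemma turn_reversepath:
 assumes "turn n p a b" shows "turn n (reversepath p) b a"
proof -
 obtain L where L: "continuous_on {0..1} L" "\<forall>t\<in>{0..1}. p t = exp (L t)" "L 0 = ang n a" "L 1 = ang n b"
  using assms(1) unfolding turn_def by blast
 show ?thesis unfolding turn_def
 proof (intro exI[of _ "\<lambda>t. L (1 - t)"] conjI ballI)
  show "continuous_on {0..1} (\<lambda>t. L (1 - t))"
   by (rule continuous_on_compose2[OF L(1)]) (auto intro!: continuous_intros)
 qed (use L in \<open>auto simp: reversepath_def\<close>)
qed

lemma curve_reversepath: "curve n p \<Longrightarrow> curve n (reversepath p)"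
 by (simp add: curve_def simple_path_reversepath) (simp add: reversepath_def)

text \<open>The homotopy itself lifts along \<open>exp\<close>. Its end points are fixed, so those
  of the lift move within a discrete set and stay where they are.\<close>

lemma isotopic_turn:
 assumes iso: "isotopic n p q" and p: "turn n p a b" shows "turn n q a b"
proof -
 obtain h where h: "continuous_map (prod_topology (top_of_set {0..1::real}) (top_of_set {0..1::real})) (top_of_set (cball 0 1)) h"
  "\<And>x. h (0, x) = p x" "\<And>x. h (1, x) = q x"
  and P: "\<And>s. s \<in> {0..1} \<Longrightarrow> h (s, 0) = p 0 \<and> h (s, 1) = p 1 \<and> (\<forall>t\<in>{0<..<1}. h (s, t) \<noteq> 0)"
  using iso unfolding isotopic_def homotopic_with_def pathstart_def pathfinish_def by blast
 have ch: "continuous_on ({0..1} \<times> {0..1}) h"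
  using h(1) by (simp add: continuous_map_in_subtopology flip: subtopology_Times)
 have nz: "h z \<noteq> 0" if z: "z \<in> {0..1} \<times> {0..1}" for z
 proof -
  obtain s t where st: "z = (s, t)" "s \<in> {0..1}" "t \<in> {0..1}" using z by blast
  consider "t = 0" | "t = 1" | "t \<in> {0<..<1}" using unit_interval_cases[OF st(3)] by blast
  then show ?thesis using P[OF st(2)] turn_nonzero[OF p, of 0] turn_nonzero[OF p, of 1] st(1) by cases auto
 qed
 have "contractible ({0..1::real} \<times> {0..1::real})" by (intro convex_imp_contractible convex_Times) auto
 then obtain G where G: "continuous_on ({0..1} \<times> {0..1}) G" "\<And>z. z \<in> {0..1} \<times> {0..1} \<Longrightarrow> h z = exp (G z)"
  using continuous_logarithm_on_contractible[OF ch _ nz] by blast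
 obtain L where L: "continuous_on {0..1} L" "\<forall>t\<in>{0..1}. p t = exp (L t)" "L 0 = ang n a" "L 1 = ang n b"
  using p unfolding turn_def by blast
 have G0: "continuous_on {0..1} (\<lambda>t. G (0, t))" and G1: "continuous_on {0..1} (\<lambda>t. G (1, t))"
  and GL: "continuous_on {0..1} (\<lambda>s. G (s, 0))" and GR: "continuous_on {0..1} (\<lambda>s. G (s, 1))"
  by (rule continuous_on_compose2[OF G(1)]; force intro!: continuous_intros)+
 have left: "G (1, 0) = G (0, 0)"
  using exp_lifts_constant[of "{0..1::real}" "\<lambda>s. G (s, 0)" "\<lambda>_. G (0, 0)" 1 0] GL P
  by (auto simp flip: G(2))
 have right: "G (1, 1) = G (0, 1)"
  using exp_lifts_constant[of "{0..1::real}" "\<lambda>s. G (s, 1)" "\<lambda>_. G (0, 1)" 1 0] GR P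
  by (auto simp flip: G(2))
 have bottom: "G (0, 0) - L 0 = G (0, 1) - L 1"
  by (rule exp_lifts_constant[of "{0..1::real}"]) (use G0 L h(2) in \<open>auto simp flip: G(2)\<close>)
 \<comment> \<open>The lift of the homotopy is corrected by a whole number of turns so that it
   begins with L.\<close>
 define c where "c = G (0, 0) - L 0"
 have ec: "exp c = 1"
  using L(2)[rule_format, of 0] G(2)[of "(0, 0)"] h(2)[of 0] by (simp add: c_def exp_diff)
 show ?thesis unfolding turn_def
 proof (intro exI[of _ "\<lambda>t. G (1, t) - c"] conjI ballI)
  show "continuous_on {0..1} (\<lambda>t. G (1, t) - c)" using G1 by (intro continuous_intros)
  show "q t = exp (G (1, t) - c)" if "t \<in> {0..1}" for t
   using that ec h(3) by (simp add: exp_diff flip: G(2))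
  show "G (1, 0) - c = ang n a" using left L(3) by (simp add: c_def)
  show "G (1, 1) - c = ang n b" using right bottom L(4) by (simp add: c_def)
 qed
qed

text \<open>The two lifts have the same end points and can be joined by straight lines in the
  half-plane; after applying \<open>exp\<close> the centre is never met.\<close>

lemma turn_isotopic:
 assumes p: "tame n p" "turn n p a b" and q: "tame n q" "turn n q a b" shows "isotopic n p q"
proof -
 obtain L where L: "continuous_on {0..1} L" "\<And>t. t \<in> {0..1} \<Longrightarrow> p t = exp (L t)" "L 0 = ang n a" "L 1 = ang n b"
  using p(2) unfolding turn_def by blast
 obtain M where M: "continuous_on {0..1} M" "\<And>t. t \<in> {0..1} \<Longrightarrow> q t = exp (M t)" "M 0 = ang n a" "M 1 = ang n b"
  using q(2) unfolding turn_def by blast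
 have ReL: "Re (L t) \<le> 0" and ReM: "Re (M t) \<le> 0" if "t \<in> {0..1}" for t
  using p(1) q(1) that L(2) M(2) by (auto simp: tame_def)
 \<comment> \<open>The subtracted term vanishes on the boundary of the square and is positive
   inside. It pushes the intermediate paths strictly into the left half-plane; without it a convex
   combination of points on the imaginary axis could hit a marked point.\<close>
 define H where "H = (\<lambda>(s :: real, t :: real). of_real (1 - s) * L t + of_real s * M t - of_real (s * (1 - s) * t * (1 - t)))"
 let ?h = "\<lambda>z. exp (H z)"
 have cont: "continuous_on ({0..1} \<times> {0..1}) ?h" unfolding H_def case_prod_beta
  by (intro continuous_intros continuous_on_compose2[OF L(1)] continuous_on_compose2[OF M(1)]) auto
 have ReH: "Re (H (s, t)) = (1 - s) * Re (L t) + s * Re (M t) - s * (1 - s) * t * (1 - t)" for s t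
  by (simp add: H_def)
 have le: "Re (H (s, t)) \<le> 0" if "s \<in> {0..1}" "t \<in> {0..1}" for s t
 proof -
  have "0 \<le> s * (1 - s) * t * (1 - t)" using that by auto
  moreover have "(1 - s) * Re (L t) \<le> 0" "s * Re (M t) \<le> 0"
   using that ReL[OF that(2)] ReM[OF that(2)] by (auto simp: mult_nonneg_nonpos)
  ultimately show ?thesis unfolding ReH by linarith
 qed
 have lt: "Re (H (s, t)) < 0" if "s \<in> {0<..<1}" "t \<in> {0<..<1}" for s t
 proof -
  have "0 < s * (1 - s) * t * (1 - t)" using that by simp
  moreover have "(1 - s) * Re (L t) \<le> 0" "s * Re (M t) \<le> 0"
   using that ReL[of t] ReM[of t] by (auto simp: mult_nonneg_nonpos)
  ultimately show ?thesis unfolding ReH by linarith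
 qed
 have "homotopic_with_canon
    (\<lambda>\<eta>. pathstart \<eta> = pathstart p \<and> pathfinish \<eta> = pathfinish p \<and>
      (\<forall>t\<in>{0<..<1}. \<eta> t \<notin> marked n \<and> \<eta> t \<noteq> 0))
    {0..1} (cball 0 1) p q"
 proof (subst homotopic_with)
  show "(pathstart h = pathstart p \<and> pathfinish h = pathfinish p \<and> (\<forall>t\<in>{0<..<1}. h t \<notin> marked n \<and> h t \<noteq> 0)) =
     (pathstart k = pathstart p \<and> pathfinish k = pathfinish p \<and> (\<forall>t\<in>{0<..<1}. k t \<notin> marked n \<and> k t \<noteq> 0))"
   if "\<And>x. x \<in> topspace (top_of_set {0..1}) \<Longrightarrow> h x = k x" for h k :: "real \<Rightarrow> complex"
   using that by (auto simp: pathstart_def pathfinish_def)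
  show "\<exists>h. continuous_map (prod_topology (top_of_set {0..1 :: real}) (top_of_set {0..1})) (top_of_set (cball 0 1)) h \<and>
    (\<forall>x\<in>topspace (top_of_set {0..1}). h (0, x) = p x) \<and>
    (\<forall>x\<in>topspace (top_of_set {0..1}). h (1, x) = q x) \<and>
    (\<forall>t\<in>{0..1}. pathstart (\<lambda>x. h (t, x)) = pathstart p \<and> pathfinish (\<lambda>x. h (t, x)) = pathfinish p \<and>
       (\<forall>ta\<in>{0<..<1}. h (t, ta) \<notin> marked n \<and> h (t, ta) \<noteq> 0))"
  proof (intro exI[of _ ?h] conjI ballI)
   have "?h ` ({0..1} \<times> {0..1}) \<subseteq> cball 0 1" using le by auto
   then show "continuous_map (prod_topology (top_of_set {0..1}) (top_of_set {0..1})) (top_of_set (cball 0 1)) ?h"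
    using cont by (simp add: continuous_map_in_subtopology continuous_map_subtopology_eu
      flip: subtopology_Times) auto
  next
   fix s t :: real assume s: "s \<in> {0..1}" and t: "t \<in> {0<..<1}"
   consider "s = 0" | "s = 1" | "s \<in> {0<..<1}" using unit_interval_cases[OF s] by blast
   then show "?h (s, t) \<notin> marked n"
   proof cases
    case 1
    then have "?h (s, t) = p t" using L(2)[of t] t by (simp add: H_def)
    then show ?thesis using p(1) t by (simp add: tame_def)
   next
    case 2
    then have "?h (s, t) = q t" using M(2)[of t] t by (simp add: H_def)
    then show ?thesis using q(1) t by (simp add: tame_def)
   next
    case 3
    then show ?thesis using lt[OF 3 t] marked_norm[of "?h (s, t)" n] by auto
   qed
  qed (use L M in \<open>auto simp: pathstart_def pathfinish_def H_def algebra_simps simp flip: of_real_add\<close>)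
 qed
 then show ?thesis unfolding isotopic_def .
qed

lemma isotopic_iff_turn:
 assumes "tame n p" "turn n p a b" "tame n q" shows "isotopic n p q \<longleftrightarrow> turn n q a b"
 using assms isotopic_turn turn_isotopic by blast

text \<open>The interlacing form of the Fashoda meet theorem, with the boundary line of the
  half-plane as one side of a large box around both paths.\<close>

lemma half_plane_paths_meet:
 fixes L M :: "real \<Rightarrow> complex"
 assumes "continuous_on {0..1} L" "continuous_on {0..1} M"
  and "\<And>t. t \<in> {0..1} \<Longrightarrow> Re (L t) \<le> 0" "\<And>t. t \<in> {0..1} \<Longrightarrow> Re (M t) \<le> 0"
  and "Re (L 0) = 0" "Re (L 1) = 0" "Re (M 0) = 0" "Re (M 1) = 0"
  and "Im (L 0) < Im (M 0)" "Im (M 0) < Im (L 1)" "Im (L 1) < Im (M 1)"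
 obtains s t where "s \<in> {0..1}" "t \<in> {0..1}" "L s = M t"
proof -
 \<comment> \<open>The left half-plane becomes the upper one: Im is the abscissa and -Re the
   height.\<close>
 define V :: "complex \<Rightarrow> real^2" where "V = (\<lambda>z. \<chi> i. if i = 1 then Im z else - Re z)"
 have V: "V z $ 1 = Im z" "V z $ 2 = - Re z" for z by (simp_all add: V_def)
 have cV: "continuous_on S V" for S unfolding V_def
 proof (rule continuous_on_vec_lambda)
  show "continuous_on S (\<lambda>z. if i = 1 then Im z else - Re z)" for i :: 2
   by (cases "i = 1") (auto intro!: continuous_intros)
 qed
 have "compact (L ` {0..1} \<union> M ` {0..1})"
  using assms(1,2) by (intro compact_Un compact_continuous_image) auto
 then obtain B where B: "\<And>z. z \<in> L ` {0..1} \<union> M ` {0..1} \<Longrightarrow> norm z \<le> B"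
  using compact_imp_bounded bounded_iff by metis
 have box: "V z \<in> cbox (vector [- B, 0]) (vector [B, B])" if "norm z \<le> B" "Re z \<le> 0" for z
  using that order_trans[OF abs_Im_le_cmod that(1)] order_trans[OF abs_Re_le_cmod that(1)]
  by (simp add: mem_box_cart forall_2 V vector_2 abs_le_iff)
 obtain z where z: "z \<in> path_image (V \<circ> L)" "z \<in> path_image (V \<circ> M)"
 proof (rule fashoda_interlace[of "V \<circ> L" "V \<circ> M" "vector [- B, 0]" "vector [B, B]"])
  show "path (V \<circ> L)" "path (V \<circ> M)"
   unfolding path_def using assms(1,2) cV by (blast intro: continuous_on_compose)+
  show "path_image (V \<circ> L) \<subseteq> cbox (vector [- B, 0]) (vector [B, B])"
   "path_image (V \<circ> M) \<subseteq> cbox (vector [- B, 0]) (vector [B, B])"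
   using box B assms(3,4) by (auto simp: path_image_def)
 qed (use assms in \<open>simp_all add: pathstart_def pathfinish_def V vector_2\<close>)
 then obtain s t where st: "s \<in> {0..1}" "t \<in> {0..1}" "V (L s) = V (M t)" by (auto simp: path_image_def)
 have "L s = M t" using arg_cong[OF st(3), of "\<lambda>v. v $ 1"] arg_cong[OF st(3), of "\<lambda>v. v $ 2"]
  by (simp add: V complex_eq_iff)
 then show thesis using that st by blast
qed

lemma turn_lift:
 assumes "tame n p" "turn n p a b"
 obtains L where "continuous_on {0..1} L" "\<And>t. t \<in> {0..1} \<Longrightarrow> p t = exp (L t)"
  "L 0 = ang n a" "L 1 = ang n b" "\<And>t. t \<in> {0..1} \<Longrightarrow> Re (L t) \<le> 0"
proof -
 obtain L where L: "continuous_on {0..1} L" "\<forall>t\<in>{0..1}. p t = exp (L t)" "L 0 = ang n a" "L 1 = ang n b"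
  using assms(2) unfolding turn_def by blast
 have "Re (L t) \<le> 0" if "t \<in> {0..1}" for t
 proof -
  have "norm (exp (L t)) \<le> 1" using assms(1) L(2) that unfolding tame_def by metis
  then show ?thesis by simp
 qed
 then show thesis using that L by blast
qed

lemma curve_interior: "curve n p \<Longrightarrow> t \<in> {0..1} \<Longrightarrow> p t \<in> marked n \<Longrightarrow> t = 0 \<or> t = 1"
 using unit_interval_cases[of t] by (auto simp: curve_def)

text \<open>A lift spanning more than one full turn would interlace with its own translate by 2 pi i
  and meet it; the curve would then pass through one point at two parameters other than its two
  ends.\<close>

lemma turn_le:
 assumes "curve n p" "turn n p a b" shows "b - a \<le> int n + 1"
proof (rule ccontr)
 assume long: "\<not> b - a \<le> int n + 1"
 obtain L where L: "continuous_on {0..1} L" "\<And>t. t \<in> {0..1} \<Longrightarrow> p t = exp (L t)"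
  "L 0 = ang n a" "L 1 = ang n b" "\<And>t. t \<in> {0..1} \<Longrightarrow> Re (L t) \<le> 0"
  using turn_lift[OF curve_tame[OF assms(1)] assms(2)] by blast
 define w :: complex where "w = of_int (2 * 1) * (of_real pi * \<i>)"
 have w: "ang n (x + 1 * (int n + 1)) = ang n x + w" for x unfolding w_def by (rule ang_shift)
 have ew: "exp w = 1" unfolding w_def by (subst exp_eq_1) auto
 obtain s t where st: "s \<in> {0..1}" "t \<in> {0..1}" "L s = L t + w"
 proof (rule half_plane_paths_meet[of L "\<lambda>t. L t + w"])
  show "continuous_on {0..1} (\<lambda>t. L t + w)" using L(1) by (intro continuous_intros)
  show "Re (L t + w) \<le> 0" if "t \<in> {0..1}" for t using L(5)[OF that] by (simp add: w_def)
  show "Im (L 0) < Im (L 0 + w)" "Im (L 0 + w) < Im (L 1)" "Im (L 1) < Im (L 1 + w)"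
   unfolding L(3,4) w[symmetric] Im_ang_less using long by auto
 qed (use L in \<open>auto simp: w_def\<close>)
 have "p s = p t" using st L(2) ew by (simp add: exp_add)
 moreover have "s \<noteq> t" using st(3) by (auto simp: w_def)
 ultimately have "s = 0 \<and> t = 1 \<or> s = 1 \<and> t = 0"
  using assms(1) st(1,2) unfolding curve_def simple_path_def loop_free_def by blast
 then show False
 proof (elim disjE conjE)
  assume "s = 0" "t = 1"
  then have "ang n a = ang n (b + 1 * (int n + 1))" using st(3) L(3,4) unfolding w by simp
  then show False using long unfolding ang_eq by simp
 next
  assume "s = 1" "t = 0"
  then have "ang n b = ang n (a + 1 * (int n + 1))" using st(3) L(3,4) unfolding w by simp
  then show False using long unfolding ang_eq by simp
 qed
qed

text \<open>Interlaced lifts meet, and they cannot meet over a marked point, since their four end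
  points are distinct.\<close>

lemma turns_not_interlaced:
 assumes p: "curve n p" "turn n p a b" and q: "curve n q" "turn n q c d"
  and disj: "path_image p \<inter> path_image q \<subseteq> marked n" shows "\<not> (a < c \<and> c < b \<and> b < d)"
proof
 assume lt: "a < c \<and> c < b \<and> b < d"
 obtain L where L: "continuous_on {0..1} L" "\<And>t. t \<in> {0..1} \<Longrightarrow> p t = exp (L t)"
  "L 0 = ang n a" "L 1 = ang n b" "\<And>t. t \<in> {0..1} \<Longrightarrow> Re (L t) \<le> 0"
  using turn_lift[OF curve_tame[OF p(1)] p(2)] by blast
 obtain M where M: "continuous_on {0..1} M" "\<And>t. t \<in> {0..1} \<Longrightarrow> q t = exp (M t)"
  "M 0 = ang n c" "M 1 = ang n d" "\<And>t. t \<in> {0..1} \<Longrightarrow> Re (M t) \<le> 0"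
  using turn_lift[OF curve_tame[OF q(1)] q(2)] by blast
 obtain s t where st: "s \<in> {0..1}" "t \<in> {0..1}" "L s = M t"
  by (rule half_plane_paths_meet[of L M]) (use L M lt in \<open>auto simp: Im_ang_less\<close>)
 have eq: "p s = q t" using L(2)[OF st(1)] M(2)[OF st(2)] st(3) by simp
 have "p s \<in> path_image p" "q t \<in> path_image q" using st by (auto simp: path_image_def)
 then have "p s \<in> path_image p \<inter> path_image q" using eq by simp
 then have "p s \<in> marked n" using disj by blast
 then have "s = 0 \<or> s = 1" "t = 0 \<or> t = 1"
  using curve_interior[OF p(1) st(1)] curve_interior[OF q(1) st(2)] eq by auto
 moreover have "a \<noteq> c" "a \<noteq> d" "b \<noteq> c" "b \<noteq> d" using lt by auto
 ultimately show False using st(3) L(3,4) M(3,4) by (auto simp: ang_eq)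
qed

lemma tame_boundary_segment: "tame n (boundary_segment n k)" 
 and turn_boundary_segment: "turn n (boundary_segment n k) (int k) (int k + 1)"
proof -
 show turn: "turn n (boundary_segment n k) (int k) (int k + 1)" unfolding turn_def
  by (intro exI[of _ "\<lambda>t. \<i> * of_real (2 * pi * (real k + t) / (real n + 1))"] conjI ballI continuous_intros)
   (simp_all add: boundary_segment_def cis_conv_exp ang_def add.commute)
 have "boundary_segment n k t \<notin> marked n" if t: "t \<in> {0<..<1}" for t
 proof
  assume m: "boundary_segment n k t \<in> marked n"
  have e: "boundary_segment n k t = exp (\<i> * of_real (2 * pi * (real k + t) / (real n + 1)))"
   by (simp add: boundary_segment_def cis_conv_exp)
  obtain a where "\<i> * of_real (2 * pi * (real k + t) / (real n + 1)) = ang n a"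
   using marked_exp_ang m unfolding e by blast
  then have "2 * pi * (real k + t) / (real n + 1) = 2 * pi * of_int a / (real n + 1)"
   unfolding ang_def by (simp only: mult_cancel_left of_real_eq_iff) simp
  then have "(2 * pi) * (real k + t) = (2 * pi) * of_int a" by (simp add: field_simps)
  then have "real k + t = of_int a" by (subst (asm) mult_cancel_left) simp
  then have "of_int (a - int k) = t" by simp
  then have "0 < real_of_int (a - int k)" "real_of_int (a - int k) < 1" using t by auto
  then have "0 < a - int k \<and> a - int k < 1" by (simp only: of_int_0_less_iff of_int_less_1_iff)
  then show False by linarith
 qed
 then show "tame n (boundary_segment n k)" by (auto simp: tame_def boundary_segment_def norm_cis)
qed

text \<open>The winding number around 0 is the change of the logarithm divided by 2 pi i; for a
  simple closed curve it is 0 outside and 1 or -1 inside.\<close>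

lemma turn_0_outside:
 assumes "curve n p" "turn n p a b" "pathstart p = pathfinish p" shows "0 \<in> inside (path_image p) \<longleftrightarrow> a \<noteq> b"
proof -
 obtain L where L: "continuous_on {0..1} L" "\<And>t. t \<in> {0..1} \<Longrightarrow> p t = exp (L t)"
  "L 0 = ang n a" "L 1 = ang n b" using turn_lift[OF curve_tame[OF assms(1)] assms(2)] by metis
 have "winding_number p 0 = winding_number (exp \<circ> L) 0" by (rule winding_number_cong) (use L in auto)
 also have "\<dots> = (ang n b - ang n a) / (2 * of_real pi * \<i>)"
  using winding_number_compose_exp[of L] L by (simp add: path_def pathstart_def pathfinish_def)
 finally have wn: "winding_number p 0 = 0 \<longleftrightarrow> a = b" by (auto simp: ang_eq)
 have sp: "simple_path p" using assms(1) by (simp add: curve_def)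
 have 0: "0 \<notin> path_image p" using turn_nonzero[OF assms(2)] by (auto simp: path_image_def)
 show ?thesis
 proof
  assume "0 \<in> inside (path_image p)"
  then show "a \<noteq> b"
   using simple_closed_path_winding_number_inside[OF sp] wn by (metis zero_neq_neg_one zero_neq_one)
 next
  assume "a \<noteq> b"
  then have "0 \<notin> outside (path_image p)"
   using winding_number_zero_in_outside[of p 0] sp assms(3) wn by (metis simple_path_imp_path)
  then show "0 \<in> inside (path_image p)" using 0 inside_Un_outside[of "path_image p"] by blast
 qed
qed

text \<open>The differences 1 and -1 belong to the curves isotopic to boundary segments, and the
  difference 0 to the closed curves whose monogon misses the orbifold point. These are the
  exclusions in \<open>is_arc\<close>.\<close>

lemma is_arc_iff:
 assumes "curve n p" "turn n p a b" "n \<ge> 2" shows "is_arc n p \<longleftrightarrow> 2 \<le> \<bar>b - a\<bar>"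
proof -
 have seg: "(\<exists>k. isotopic n (boundary_segment n k) p) \<longleftrightarrow> b = a + 1" if p: "curve n p" "turn n p a b" for p a b
 proof
  assume "\<exists>k. isotopic n (boundary_segment n k) p"
  then obtain k where "turn n p (int k) (int k + 1)" using isotopic_turn turn_boundary_segment by blast
  then show "b = a + 1" using turn_unique[OF p(2)] by (metis add.assoc add.commute add_left_cancel)
 next
  assume b: "b = a + 1"
  \<comment> \<open>\<open>boundary_segment\<close> is indexed by natural numbers, so a is first
    moved into the range from 0 to n.\<close>
  define c where "c = a div (int n + 1)"
  have a: "a = int (nat (a mod (int n + 1))) + c * (int n + 1)" by (simp add: c_def mod_div_mult_eq)
  have "turn n p (a + (- c) * (int n + 1)) (b + (- c) * (int n + 1))" by (rule turn_shift[OF p(2)])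
  moreover have "a + (- c) * (int n + 1) = int (nat (a mod (int n + 1)))" using a by simp
  moreover have "b + (- c) * (int n + 1) = int (nat (a mod (int n + 1))) + 1" using a b by simp
  ultimately have "turn n p (int (nat (a mod (int n + 1)))) (int (nat (a mod (int n + 1))) + 1)" by simp
  then show "\<exists>k. isotopic n (boundary_segment n k) p"
   using turn_isotopic[OF tame_boundary_segment turn_boundary_segment curve_tame[OF p(1)]] by blast
 qed
 have closed: "a \<noteq> b" if "pathstart p = pathfinish p \<longrightarrow> 0 \<in> inside (path_image p)"
 proof (cases "pathstart p = pathfinish p")
  case True
  then show ?thesis using turn_0_outside[OF assms(1,2)] that by blast
 next
  case False
  then show ?thesis using turn_ends[OF assms(2)] by (auto simp: pathstart_def pathfinish_def)
 qed
 have inside: "0 \<in> inside (path_image p)" if "pathstart p = pathfinish p" "a \<noteq> b"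
  using turn_0_outside[OF assms(1,2)] that by blast
 have "(\<exists>k. isotopic n (boundary_segment n k) p) \<longleftrightarrow> b = a + 1"
  "(\<exists>k. isotopic n (boundary_segment n k) (reversepath p)) \<longleftrightarrow> a = b + 1"
  using seg[OF assms(1,2)] seg[OF curve_reversepath[OF assms(1)] turn_reversepath[OF assms(2)]] by auto
 moreover have "2 \<le> \<bar>b - a\<bar> \<longleftrightarrow> b \<noteq> a + 1 \<and> a \<noteq> b + 1 \<and> a \<noteq> b" by auto
 ultimately show ?thesis using assms(1) closed inside unfolding is_arc_def by blast
qed

definition cls :: "nat \<Rightarrow> int \<Rightarrow> int \<Rightarrow> arc_class" where
 "cls n a b = {q. curve n q \<and> (turn n q a b \<or> turn n q b a)}"

lemma class_of_eq:
 assumes "curve n p" "turn n p a b" shows "class_of n p = cls n a b"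
proof -
 have "curve n q \<Longrightarrow> isotopic n p q \<longleftrightarrow> turn n q a b"
  "curve n q \<Longrightarrow> isotopic n (reversepath p) q \<longleftrightarrow> turn n q b a" for q
  using isotopic_iff_turn[OF curve_tame[OF assms(1)] assms(2) curve_tame]
   isotopic_iff_turn[OF curve_tame[OF curve_reversepath[OF assms(1)]] turn_reversepath[OF assms(2)] curve_tame]
  by auto
 then show ?thesis unfolding class_of_def cls_def by blast
qed

lemma cls_commute: "cls n a b = cls n b a" by (auto simp: cls_def)

lemma cls_shift: "cls n (a + c * (int n + 1)) (b + c * (int n + 1)) = cls n a b"
proof -
 have "turn n q (a + c * (int n + 1)) (b + c * (int n + 1)) \<longleftrightarrow> turn n q a b" for q a b
  using turn_shift[of n q a b c] turn_shift[of n q "a + c * (int n + 1)" "b + c * (int n + 1)" "- c"] by auto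
 then show ?thesis unfolding cls_def by simp
qed

lemma arc_classes_subset:
 assumes "n \<ge> 2" "A \<in> arc_classes n"
 obtains a b where "2 \<le> b - a" "b - a \<le> int n + 1" "A = cls n a b"
proof -
 obtain p where p: "is_arc n p" "A = class_of n p" using assms(2) unfolding arc_classes_def by blast
 have c: "curve n p" using p(1) unfolding is_arc_def by blast
 obtain a b where ab: "turn n p a b" using curve_turn[OF c] by blast
 have A: "A = cls n a b" using class_of_eq[OF c ab] p(2) by simp
 have two: "2 \<le> \<bar>b - a\<bar>" using is_arc_iff[OF c ab assms(1)] p(1) by blast
 have le: "b - a \<le> int n + 1" "a - b \<le> int n + 1"
  using turn_le[OF c ab] turn_le[OF curve_reversepath[OF c] turn_reversepath[OF ab]] by auto
 show thesis
 proof (cases "a \<le> b")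
  case True
  then show thesis using that[of b a] two le A by auto
 next
  case False
  then show thesis using that[of a b] two le A cls_commute[of n a b] by auto
 qed
qed

lemma cls_noncrossing:
 assumes "noncrossing n (cls n a b) (cls n c d)" "a < b" "c < d" shows "\<not> (a < c \<and> c < b \<and> b < d)"
proof -
 have *: "\<exists>q. curve n q \<and> turn n q a b \<and> path_image q = path_image p" if "p \<in> cls n a b" for p a b
 proof (cases "turn n p a b")
  case True
  then show ?thesis using that unfolding cls_def by blast
 next
  case False
  then have "curve n p" "turn n p b a" using that unfolding cls_def by auto
  then show ?thesis by (intro exI[of _ "reversepath p"]) (simp add: curve_reversepath turn_reversepath)
 qed
 obtain p q where "p \<in> cls n a b" "q \<in> cls n c d" "path_image p \<inter> path_image q \<subseteq> marked n"
  using assms(1) unfolding noncrossing_def by blast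
 then show ?thesis using *[of p a b] *[of q c d] turns_not_interlaced by metis
qed

subsection \<open>Arcs as chords of the covering polygon\<close>

definition vtx :: "nat \<Rightarrow> int \<Rightarrow> complex" where
 "vtx n a = cis (2 * pi * of_int a / (3 * real n + 3))"

lemma vtx_exp: "vtx n a = exp (ang (3 * n + 2) a)" by (simp add: vtx_def ang_def cis_conv_exp add.commute)

text \<open>With 3 n + 2 in place of n, the marked points are the vertices of the covering polygon;
  so the facts about \<open>marked\<close> and \<open>ang\<close> apply to them.\<close>

lemma vertices_vtx: "z \<in> vertices n \<longleftrightarrow> (\<exists>a. z = vtx n a)"
proof -
 have eq: "vertices n = marked (3 * n + 2)" by (simp add: vertices_def marked_def eval_nat_numeral)
 show ?thesis
 proof
  assume z: "z \<in> vertices n"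
  have "z \<noteq> 0" using z by (auto simp: vertices_def power_0_left)
  then have "exp (Ln z) \<in> marked (3 * n + 2)" using z eq by simp
  then obtain a where "Ln z = ang (3 * n + 2) a" using marked_exp_ang by blast
  then have "z = vtx n a" using \<open>z \<noteq> 0\<close> unfolding vtx_exp by (metis exp_Ln)
  then show "\<exists>a. z = vtx n a" by blast
 next
  assume "\<exists>a. z = vtx n a"
  then show "z \<in> vertices n" unfolding eq vtx_exp using exp_ang_marked by blast
 qed
qed

lemma vtx_mem [simp]: "vtx n a \<in> vertices n" using vertices_vtx by blast

lemma vtx_add: "vtx n (a + b) = vtx n a * vtx n b"
 by (simp add: vtx_def cis_mult add_divide_distrib algebra_simps)

lemma vtx_1: "vtx n 1 = cis (2 * pi / (3 * real n + 3))" by (simp add: vtx_def)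

lemma vtx_eq_1: "vtx n a = 1 \<longleftrightarrow> (\<exists>k. a = k * (3 * int n + 3))"
proof -
 have "vtx n a = 1 \<longleftrightarrow> (\<exists>k::int. 2 * pi * of_int a / (3 * real n + 3) = of_int (2 * k) * pi)"
  unfolding vtx_def cis_conv_exp exp_eq_1 by simp
 also have "\<dots> \<longleftrightarrow> (\<exists>k::int. real_of_int a = of_int k * (3 * real n + 3))"
 proof (intro ex_cong1)
  fix k :: int
  have "2 * pi * of_int a / (3 * real n + 3) = of_int (2 * k) * pi \<longleftrightarrow>
   (2 * pi) * of_int a = (2 * pi) * (of_int k * (3 * real n + 3))"
   by (subst nonzero_divide_eq_eq) (auto simp: algebra_simps)
  then show "2 * pi * of_int a / (3 * real n + 3) = of_int (2 * k) * pi \<longleftrightarrow>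
   real_of_int a = of_int k * (3 * real n + 3)" by (simp only: mult_cancel_left) simp
 qed
 also have "\<dots> \<longleftrightarrow> (\<exists>k. a = k * (3 * int n + 3))"
 proof (intro ex_cong1)
  fix k :: int
  have "real_of_int k * (3 * real n + 3) = of_int (k * (3 * int n + 3))" by simp
  then show "real_of_int a = of_int k * (3 * real n + 3) \<longleftrightarrow> a = k * (3 * int n + 3)"
   by (simp only: of_int_eq_iff)
 qed
 finally show ?thesis .
qed

lemma vtx_nonzero [simp]: "vtx n a \<noteq> 0" by (simp add: vtx_def)

lemma vtx_eq: "vtx n a = vtx n b \<longleftrightarrow> (\<exists>k. b = a + k * (3 * int n + 3))"
proof -
 have "vtx n b = vtx n a * vtx n (b - a)" by (simp flip: vtx_add)
 then have "vtx n a = vtx n b \<longleftrightarrow> vtx n (b - a) = 1" by auto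
 then show ?thesis unfolding vtx_eq_1 by (simp add: algebra_simps)
qed

lemma vtx_period [simp]: "vtx n (a + k * (3 * int n + 3)) = vtx n a" using vtx_eq by metis

lemma vtx_cube: "vtx n a ^ 3 = exp (ang n a)"
proof -
 have "vtx n a ^ 3 = exp (3 * ang (3 * n + 2) a)" unfolding vtx_exp by (metis exp_of_nat_mult of_nat_numeral)
 also have "3 * ang (3 * n + 2) a = ang n a" by (simp add: complex_eq_iff Im_ang ang_def field_simps)
 finally show ?thesis .
qed

text \<open>The group of the covering acts on the numbers of the vertices by shifts of n +
  1.\<close>

lemma cube_root_vtx:
 assumes "g ^ 3 = 1"
 obtains t where "g = vtx n (t * (int n + 1))"
proof -
 have "g \<in> vertices n" using assms by (simp add: vertices_def power_mult power_add flip: mult.assoc)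
 then obtain a where a: "g = vtx n a" using vertices_vtx by blast
 have "exp (ang n a) = exp (ang n 0)" using assms unfolding a vtx_cube by (simp add: ang_def)
 then obtain c :: int where "ang n a = ang n 0 + of_int (2 * c) * (of_real pi * \<i>)" unfolding exp_eq by auto
 then have "ang n a = ang n (0 + c * (int n + 1))" unfolding ang_shift .
 then have "a = c * (int n + 1)" unfolding ang_eq by simp
 then show thesis using that a by blast
qed

lemma vtx_third: "vtx n (t * (int n + 1)) ^ 3 = 1"
proof -
 have "ang n (0 + t * (int n + 1)) = ang n 0 + of_int (2 * t) * (of_real pi * \<i>)" by (rule ang_shift)
 then have "ang n (t * (int n + 1)) = of_int (2 * t) * (of_real pi * \<i>)" by (simp add: ang_def)
 then have "exp (ang n (t * (int n + 1))) = 1" by (subst exp_eq_1) auto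
 then show ?thesis unfolding vtx_cube .
qed

lemma vtx_distinct: "a < b \<Longrightarrow> b < a + (3 * int n + 3) \<Longrightarrow> vtx n a \<noteq> vtx n b"
proof
 assume ab: "a < b" "b < a + (3 * int n + 3)" "vtx n a = vtx n b"
 then obtain k where k: "b = a + k * (3 * int n + 3)" unfolding vtx_eq by blast
 then have "0 < k * (3 * int n + 3)" "k * (3 * int n + 3) < 1 * (3 * int n + 3)" using ab by auto
 then have "0 < k" "k < 1" by (simp_all add: zero_less_mult_iff mult_less_cancel_right)
 then show False by simp
qed

abbreviation chord_path :: "nat \<Rightarrow> int \<Rightarrow> int \<Rightarrow> real \<Rightarrow> complex" where
 "chord_path n a b \<equiv> (\<lambda>t. linepath (vtx n a) (vtx n b) t ^ 3)"

text \<open>The polar angle is increasing along a chord that passes the centre on its left.\<close>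

lemma chord_lift:
 assumes "a < b" "2 * (b - a) < 3 * int n + 3"
 obtains L where "continuous_on {0..1} L" "\<And>t. chord_path n a b t = exp (L t)"
  "L 0 = ang n a" "L 1 = ang n b"
  "\<And>s t. s \<in> {0..1} \<Longrightarrow> t \<in> {0..1} \<Longrightarrow> s < t \<Longrightarrow> Im (L s) < Im (L t)"
  "\<And>t. t \<in> {0<..<1} \<Longrightarrow> norm (chord_path n a b t) < 1"
proof -
 define m where "m = 3 * real n + 3"
 \<comment> \<open>\<theta> is half the angle subtended by the chord and \<mu> its middle direction.
   Rotated by -\<mu>, the chord is the vertical segment with real part cos \<theta>, which is
   positive because \<theta> < pi / 2; there \<open>Ln\<close> is continuous and the angle is an
   arctangent.\<close>
 define \<theta> where "\<theta> = pi * of_int (b - a) / m"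
 define \<mu> where "\<mu> = pi * of_int (a + b) / m"
 have m: "m > 0" by (simp add: m_def)
 have "0 < real_of_int (b - a)" using assms(1) by simp
 moreover have "real_of_int (2 * (b - a)) < real_of_int (3 * int n + 3)" using assms(2) by (simp only: of_int_less_iff)
 ultimately have "0 < pi * of_int (b - a)" "pi * (2 * of_int (b - a)) < pi * m"
  by (auto simp: m_def intro!: mult_strict_left_mono)
 then have "0 < \<theta>" "\<theta> < pi / 2" using m unfolding \<theta>_def by (auto simp: field_simps)
 then have cos: "cos \<theta> > 0" and sin: "sin \<theta> > 0" by (auto intro: cos_gt_zero sin_gt_zero)
 have va: "vtx n a = cis \<mu> * cis (- \<theta>)" and vb: "vtx n b = cis \<mu> * cis \<theta>"
  using m unfolding cis_mult vtx_def m_def[symmetric] \<theta>_def \<mu>_def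
  by (auto intro!: arg_cong[of _ _ cis] simp: field_simps)
 define Z where "Z = (\<lambda>t. Complex (cos \<theta>) ((2 * t - 1) * sin \<theta>))"
 have lp: "linepath (vtx n a) (vtx n b) t = cis \<mu> * Z t" for t
 proof -
  have "linepath (vtx n a) (vtx n b) t = cis \<mu> * ((1 - t) *\<^sub>R cis (- \<theta>) + t *\<^sub>R cis \<theta>)"
   unfolding linepath_def va vb by (simp add: algebra_simps)
  also have "(1 - t) *\<^sub>R cis (- \<theta>) + t *\<^sub>R cis \<theta> = Z t" by (simp add: Z_def complex_eq_iff algebra_simps)
  finally show ?thesis .
 qed
 \<comment> \<open>The factor 3 comes from the cube in \<open>chord_path\<close>.\<close>
 define L where "L = (\<lambda>t. 3 * (\<i> * of_real \<mu> + Ln (Z t)))"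
 have Znz: "Z t \<noteq> 0" and Zneg: "Z t \<notin> \<real>\<^sub>\<le>\<^sub>0" for t using cos by (auto simp: Z_def complex_eq_iff complex_nonpos_Reals_iff)
 have cZ: "continuous_on S Z" for S unfolding Z_def Complex_eq by (intro continuous_intros)
 have ImZ: "Im (Ln (Z t)) = arctan ((2 * t - 1) * sin \<theta> / cos \<theta>)" for t
  using Im_Ln_eq[OF Znz[of t]] cos by (simp add: Z_def)
 show thesis
 proof (rule that[of L])
  show "continuous_on {0..1} L" unfolding L_def using cZ Zneg by (intro continuous_intros) auto
  show "chord_path n a b t = exp (L t)" for t
  proof -
   have "exp (L t) = exp (\<i> * of_real \<mu> + Ln (Z t)) ^ 3"
    unfolding L_def by (metis exp_of_nat_mult of_nat_numeral)
   also have "exp (\<i> * of_real \<mu> + Ln (Z t)) = cis \<mu> * Z t" using Znz by (simp add: exp_add cis_conv_exp)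
   finally show ?thesis by (simp add: lp)
  qed
  have Z01: "Z 0 = exp (- (\<i> * of_real \<theta>))" "Z 1 = exp (\<i> * of_real \<theta>)"
   by (simp_all add: Z_def complex_eq_iff Re_exp Im_exp)
  have ln: "Ln (Z 0) = - (\<i> * of_real \<theta>)" "Ln (Z 1) = \<i> * of_real \<theta>"
   unfolding Z01 using \<open>0 < \<theta>\<close> \<open>\<theta> < pi / 2\<close> by (auto intro!: Ln_exp)
  have "\<mu> - \<theta> = 2 * pi * of_int a / m" "\<mu> + \<theta> = 2 * pi * of_int b / m"
   using m by (auto simp: \<theta>_def \<mu>_def field_simps)
  moreover have "L 0 = \<i> * of_real (3 * (\<mu> - \<theta>))" "L 1 = \<i> * of_real (3 * (\<mu> + \<theta>))"
   unfolding L_def ln by (simp_all add: algebra_simps)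
  ultimately have L01: "L 0 = \<i> * of_real (3 * (2 * pi * of_int a / m))" "L 1 = \<i> * of_real (3 * (2 * pi * of_int b / m))"
   by simp_all
  have 3: "3 * (2 * pi * x / m) = 2 * pi * x / (real n + 1)" for x by (simp add: m_def field_simps)
  show "L 0 = ang n a" "L 1 = ang n b" using L01 unfolding 3 ang_def .
  show "Im (L s) < Im (L t)" if "s < t" for s t
   using that sin cos unfolding L_def by (simp add: ImZ arctan_less_iff divide_strict_right_mono)
  show "norm (chord_path n a b t) < 1" if t: "t \<in> {0<..<1}" for t
  proof -
   have "(2 * t - 1)\<^sup>2 < 1" using t by (subst abs_square_less_1) auto
   then have "(2 * t - 1)\<^sup>2 * (sin \<theta>)\<^sup>2 < 1 * (sin \<theta>)\<^sup>2" using sin by (intro mult_strict_right_mono) auto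
   then have "(cos \<theta>)\<^sup>2 + ((2 * t - 1) * sin \<theta>)\<^sup>2 < 1" by (simp add: power_mult_distrib cos_squared_eq)
   then have "norm (Z t) < 1" by (simp add: Z_def cmod_def)
   then have "norm (Z t) ^ 3 < 1" by (simp add: power_less_one_iff)
   then show ?thesis unfolding lp by (simp add: norm_mult norm_power)
  qed
 qed
qed

lemma chord_turn: "a < b \<Longrightarrow> 2 * (b - a) < 3 * int n + 3 \<Longrightarrow> turn n (chord_path n a b) a b"
 using chord_lift unfolding turn_def by metis

lemma chord_tame:
 assumes "a < b" "2 * (b - a) < 3 * int n + 3" shows "tame n (chord_path n a b)"
proof -
 obtain L where L: "\<And>t. chord_path n a b t = exp (L t)"
  "\<And>t. t \<in> {0<..<1} \<Longrightarrow> norm (chord_path n a b t) < 1"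
  "L 0 = ang n a" "L 1 = ang n b" using chord_lift[OF assms] by metis
 have le: "norm (chord_path n a b t) \<le> 1" if t: "t \<in> {0..1}" for t
 proof -
  consider "t = 0" | "t = 1" | "t \<in> {0<..<1}" using unit_interval_cases[OF t] by blast
  then show ?thesis by cases (use L in \<open>force simp: ang_def\<close>)+
 qed
 show ?thesis unfolding tame_def
 proof (intro conjI ballI)
  fix t :: real assume t: "t \<in> {0<..<1}"
  show "chord_path n a b t \<notin> marked n" using L(2)[OF t] marked_norm by fastforce
  show "chord_path n a b t \<noteq> 0" unfolding L(1) by simp
 qed (rule le)
qed

lemma chord_reverse: "chord_path n b a = reversepath (chord_path n a b)"
 by (simp add: fun_eq_iff reversepath_def linepath_def algebra_simps)

lemma tame_reversepath: "tame n p \<Longrightarrow> tame n (reversepath p)" by (auto simp: tame_def reversepath_def)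

text \<open>Along the cubed chord the angle increases strictly, and by at most 2 pi in total; so two
  parameters give the same point only if they are the two ends.\<close>

lemma chord_curve:
 assumes "a < b" "b - a \<le> int n + 1" shows "curve n (chord_path n a b)"
proof -
 have len: "2 * (b - a) < 3 * int n + 3" using assms by auto
 obtain L where L: "continuous_on {0..1} L" "\<And>t. chord_path n a b t = exp (L t)"
  "L 0 = ang n a" "L 1 = ang n b" and mono: "\<And>s t. s \<in> {0..1} \<Longrightarrow> t \<in> {0..1} \<Longrightarrow> s < t \<Longrightarrow> Im (L s) < Im (L t)"
  using chord_lift[OF assms(1) len] by metis
 have "(2 * pi) * of_int (b - a) \<le> (2 * pi) * (real n + 1)"
 proof (rule mult_left_mono)
  have "real_of_int (b - a) \<le> real_of_int (int n + 1)" using assms(2) by (simp only: of_int_le_iff)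
  then show "real_of_int (b - a) \<le> real n + 1" by simp
 qed simp
 then have range: "Im (L 1) - Im (L 0) \<le> 2 * pi"
  unfolding L Im_ang diff_divide_distrib[symmetric] by (simp add: pos_divide_le_eq right_diff_distrib)
 have mono': "Im (L s) \<le> Im (L t)" if "s \<in> {0..1}" "t \<in> {0..1}" "s \<le> t" for s t
  using mono[OF that(1,2)] that(3) by (cases "s = t") auto
 have inj: "s = 0 \<and> t = 1" if st: "s \<in> {0..1}" "t \<in> {0..1}" "s < t" "chord_path n a b s = chord_path n a b t" for s t
 proof -
  have "exp (L t) = exp (L s)" using st(4) unfolding L(2) by simp
  then obtain k :: int where "L t = L s + of_real (of_int (2 * k) * pi) * \<i>" unfolding exp_eq by blast
  then have k: "Im (L t) - Im (L s) = of_int k * (2 * pi)" by simp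
  then have "0 < of_int k * (2 * pi)" using mono[OF st(1-3)] by linarith
  then have "1 \<le> k" by (simp add: zero_less_mult_iff)
  then have "1 * (2 * pi) \<le> of_int k * (2 * pi)" by (intro mult_right_mono) auto
  then have ge: "2 * pi \<le> Im (L t) - Im (L s)" using k by simp
  show ?thesis
  proof (rule ccontr)
   assume "\<not> (s = 0 \<and> t = 1)"
   then consider "0 < s" | "t < 1" using st by fastforce
   then show False
   proof cases
    case 1
    then show False using mono[of 0 s] mono'[of t 1] st ge range by auto
   next
    case 2
    then show False using mono'[of 0 s] mono[of t 1] st ge range by auto
   qed
  qed
 qed
 have "simple_path (chord_path n a b)" unfolding simple_path_def loop_free_def
 proof (intro conjI ballI impI)
  show "path (chord_path n a b)" unfolding path_def by (intro continuous_intros)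
  fix s t :: real assume "s \<in> {0..1}" "t \<in> {0..1}" "chord_path n a b s = chord_path n a b t"
  then show "s = t \<or> s = 0 \<and> t = 1 \<or> s = 1 \<and> t = 0"
   using inj[of s t] inj[of t s] by (cases s t rule: linorder_cases) auto
 qed
 then show ?thesis using chord_tame[OF assms(1) len] vtx_cube[of n] exp_ang_marked[of n]
  by (auto simp: curve_def tame_def path_image_def pathstart_def pathfinish_def linepath_0' linepath_1')
qed

lemma project_short:
 assumes "a < b" "2 * (b - a) < 3 * int n + 3" shows "project n {vtx n a, vtx n b} = cls n a b"
proof -
 have "isotopic n (chord_path n a b) q \<longleftrightarrow> turn n q a b"
  "isotopic n (chord_path n b a) q \<longleftrightarrow> turn n q b a" if "curve n q" for q unfolding chord_reverse[of n b a]
  using isotopic_iff_turn[OF chord_tame[OF assms] chord_turn[OF assms] curve_tame[OF that]]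
   isotopic_iff_turn[OF tame_reversepath[OF chord_tame[OF assms]] turn_reversepath[OF chord_turn[OF assms]] curve_tame[OF that]]
  by auto
 moreover have "q \<in> project n {vtx n a, vtx n b} \<longleftrightarrow>
  curve n q \<and> (isotopic n (chord_path n a b) q \<or> isotopic n (chord_path n b a) q)" for q
  unfolding project_def mem_Collect_eq doubleton_eq_iff by blast
 ultimately show ?thesis unfolding cls_def by blast
qed

text \<open>Such a chord would have to be isotopic to a simple curve of more than one turn, against
  \<open>turn_le\<close>. A diameter runs through the centre, so it does not even satisfy the
  condition on paths in \<open>isotopic\<close>.\<close>

lemma project_long:
 assumes "int n + 1 < b - a" "2 * (b - a) \<le> 3 * int n + 3" shows "project n {vtx n a, vtx n b} = {}"
proof (cases "2 * (b - a) = 3 * int n + 3")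
 case False
 then have "project n {vtx n a, vtx n b} = cls n a b" using assms by (intro project_short) auto
 also have "cls n a b = {}"
 proof -
  have "\<not> turn n q a b" if "curve n q" for q using turn_le[OF that, of a b] assms by auto
  moreover have "\<not> turn n q b a" if "curve n q" for q
   using turn_reversepath[of n q b a] turn_le[OF curve_reversepath[OF that], of a b] assms by auto
  ultimately show ?thesis unfolding cls_def by blast
 qed
 finally show ?thesis .
next
 case True
 have "2 * pi * of_int (b - a) / (3 * real n + 3) = pi"
 proof -
  have "real_of_int (2 * (b - a)) = real_of_int (3 * int n + 3)" using True by (simp only:)
  then show ?thesis by (simp add: field_simps)
 qed
 then have "vtx n (b - a) = - 1" unfolding vtx_def by simp
 moreover have "vtx n b = vtx n a * vtx n (b - a)" by (simp flip: vtx_add)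
 ultimately have opp: "vtx n b = - vtx n a" by simp
 have no: "\<not> isotopic n (\<lambda>t. linepath z (- z) t ^ 3) q" for z q
 proof
  assume "isotopic n (\<lambda>t. linepath z (- z) t ^ 3) q"
  then have "\<forall>t\<in>{0<..<1}. linepath z (- z) t ^ 3 \<notin> marked n \<and> linepath z (- z) t ^ 3 \<noteq> 0"
   unfolding isotopic_def by (drule_tac homotopic_with_imp_property) (elim conjE)
  from bspec[OF this, of "1 / 2"] show False by (simp add: linepath_def)
 qed
 show ?thesis unfolding project_def doubleton_eq_iff opp using no[of "vtx n a"] no[of "- vtx n a"] by auto
qed

lemma cls_arc_classes:
 assumes "n \<ge> 2" "2 \<le> b - a" "b - a \<le> int n + 1" shows "cls n a b \<in> arc_classes n"
proof -
 have c: "curve n (chord_path n a b)" using chord_curve assms by auto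
 have t: "turn n (chord_path n a b) a b" using assms by (intro chord_turn) auto
 have "is_arc n (chord_path n a b)" using is_arc_iff[OF c t assms(1)] assms by auto
 then show ?thesis using class_of_eq[OF c t] unfolding arc_classes_def by blast
qed

lemma cls_eq:
 assumes "a < b" "b - a \<le> int n + 1" "c < d" "cls n a b = cls n c d"
 obtains k where "c = a + k * (int n + 1)" "d = b + k * (int n + 1)"
proof -
 have t: "turn n (chord_path n a b) a b" using assms by (intro chord_turn) auto
 have "chord_path n a b \<in> cls n a b" using t chord_curve assms unfolding cls_def by blast
 then have "turn n (chord_path n a b) c d \<or> turn n (chord_path n a b) d c"
  using assms(4) unfolding cls_def by blast
 then show thesis
 proof
  assume "turn n (chord_path n a b) d c"
  then obtain k where "d = a + k * (int n + 1)" "c = b + k * (int n + 1)" using turn_unique[OF t] by metis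
  then show thesis using assms by auto
 qed (use turn_unique[OF t] that in metis)
qed

lemma diagonal_project:
 assumes "n \<ge> 2" "d \<in> diagonals n" "project n d \<in> arc_classes n"
 obtains a b where "d = {vtx n a, vtx n b}" "2 \<le> b - a" "b - a \<le> int n + 1"
proof -
 obtain x y where xy: "d = {x, y}" "x \<in> vertices n" "y \<in> vertices n" "x \<noteq> y" "d \<notin> polygon_sides n"
  using assms(2) unfolding diagonals_def by blast
 obtain a b where ab: "x = vtx n a" "y = vtx n b" using xy(2,3) vertices_vtx by blast
 define m where "m = 3 * int n + 3"
 define b' where "b' = a + (b - a) mod m"
 have "b = b' + ((b - a) div m) * m" by (simp add: b'_def mod_div_mult_eq flip: add.assoc)
 then have y: "y = vtx n b'" using ab vtx_period[of n b' "(b - a) div m"] unfolding m_def by simp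
 have r: "0 \<le> b' - a" "b' - a < m" unfolding b'_def m_def by simp_all
 \<comment> \<open>Of the two boundary arcs between the ends the shorter one is taken; reading the
   diagonal from b' to a + m exchanges them.\<close>
 have "\<exists>a c. d = {vtx n a, vtx n c} \<and> 0 \<le> c - a \<and> 2 * (c - a) \<le> m"
 proof (cases "2 * (b' - a) \<le> m")
  case True
  then show ?thesis using xy(1) ab(1) y r by blast
 next
  case False
  have "x = vtx n (a + m)" using ab(1) vtx_period[of n a 1] by (simp add: m_def)
  then show ?thesis using xy(1) y r False by (intro exI[of _ b'] exI[of _ "a + m"]) auto
 qed
 then obtain a c where ac: "d = {vtx n a, vtx n c}" "0 \<le> c - a" "2 * (c - a) \<le> m" by blast
 have "c \<noteq> a" using ac(1) xy(1,4) by auto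
 moreover have "c \<noteq> a + 1"
 proof
  assume "c = a + 1"
  then have "vtx n c = vtx n a * cis (2 * pi / (3 * real n + 3))" unfolding vtx_1[symmetric] by (simp only: vtx_add)
  then have "d = {vtx n a, vtx n a * cis (2 * pi / (3 * real n + 3))}" using ac(1) by simp
  then have "d \<in> polygon_sides n" unfolding polygon_sides_def by (intro CollectI exI conjI) (assumption, rule vtx_mem)
  then show False using xy(5) by simp
 qed
 moreover have "c - a \<le> int n + 1"
 proof (rule ccontr)
  assume "\<not> c - a \<le> int n + 1"
  then have "project n d = {}" using project_long ac unfolding m_def by auto
  then obtain a b where "cls n a b = {}" "2 \<le> b - a" "b - a \<le> int n + 1"
   using arc_classes_subset[OF assms(1,3)] by metis
  moreover have "chord_path n a b \<in> cls n a b"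
   using calculation chord_curve[of a b n] chord_turn[of a b n] unfolding cls_def by auto
  ultimately show False by simp
 qed
 ultimately show thesis using that ac by auto
qed

lemma vtx_diagonal:
 assumes "2 \<le> b - a" "b - a \<le> int n + 1" shows "{vtx n a, vtx n b} \<in> diagonals n"
proof -
 have "vtx n a \<noteq> vtx n b" using assms by (intro vtx_distinct) auto
 moreover have "{vtx n a, vtx n b} \<notin> polygon_sides n"
 proof
  assume "{vtx n a, vtx n b} \<in> polygon_sides n"
  then obtain x where x: "x \<in> vertices n" "{vtx n a, vtx n b} = {x, x * cis (2 * pi / (3 * real n + 3))}"
   unfolding polygon_sides_def by blast
  obtain c where c: "x = vtx n c" using x(1) vertices_vtx[of x n] by blast
  have "vtx n (c + 1) = vtx n c * cis (2 * pi / (3 * real n + 3))"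
   unfolding vtx_1[symmetric] by (rule vtx_add)
  then have "{vtx n a, vtx n b} = {vtx n c, vtx n (c + 1)}" using x(2) c by simp
  then consider "vtx n a = vtx n c" "vtx n b = vtx n (c + 1)" | "vtx n b = vtx n c" "vtx n a = vtx n (c + 1)"
   unfolding doubleton_eq_iff by blast
  then show False
  proof cases
   case 1
   then have "vtx n (a + 1) = vtx n b" unfolding vtx_add by simp
   then show False using vtx_distinct[of "a + 1" b n] assms by auto
  next
   case 2
   then have "vtx n a = vtx n (b + 1)" unfolding vtx_add by simp
   then show False using vtx_distinct[of a "b + 1" n] assms by auto
  qed
 qed
 ultimately show ?thesis unfolding diagonals_def using vtx_mem by blast
qed

subsection \<open>Crossing chords of a regular polygon\<close>

text \<open>Twice the signed area of the triangle x, y, z: positive if z lies to the left of the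
  line from x to y.\<close>

definition side :: "complex \<Rightarrow> complex \<Rightarrow> complex \<Rightarrow> real" where
 "side x y z = Im (cnj (y - x) * (z - x))"

lemma ccw_side: "ccw x y z \<longleftrightarrow> side x y z > 0" by (simp add: ccw_def side_def)

lemma side_affine: "side x y ((1 - t) *\<^sub>R p + t *\<^sub>R q) = (1 - t) * side x y p + t * side x y q"
 by (simp add: side_def algebra_simps)

lemma side_linepath: "side x y (linepath p q t) = (1 - t) * side x y p + t * side x y q"
 by (simp add: linepath_def side_affine)

lemma side_end [simp]: "side x y x = 0" "side x y y = 0" by (simp_all add: side_def algebra_simps)

lemma side_swap: "side y x z = - side x y z" by (simp add: side_def algebra_simps)

lemma side_segment: "z \<in> closed_segment x y \<Longrightarrow> side x y z = 0" by (auto simp: closed_segment_def side_affine)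

text \<open>Half the signed length of a chord that spans k sides of the polygon.\<close>

definition gap :: "nat \<Rightarrow> int \<Rightarrow> real" where
 "gap n k = sin (pi * of_int k / (3 * real n + 3))"

lemma gap_pos:
 assumes "0 < k" "k < 3 * int n + 3" shows "gap n k > 0"
proof -
 have "0 < real_of_int k" "real_of_int k < real_of_int (3 * int n + 3)"
  using assms by (simp_all only: of_int_less_iff of_int_0_less_iff)
 then have "pi * of_int k < pi * (3 * real n + 3)" "0 < pi * of_int k" by auto
 then have "0 < pi * of_int k / (3 * real n + 3)" "pi * of_int k / (3 * real n + 3) < pi"
  by (auto simp: field_simps)
 then show ?thesis unfolding gap_def by (rule sin_gt_zero)
qed

lemma gap_minus: "gap n (- k) = - gap n k" by (simp add: gap_def)

text \<open>A signed form of the area formula abc / (4 R) for a triangle inscribed in the unit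
  circle. It reduces questions about the two sides of a chord to the signs of three sines.\<close>

lemma side_vtx: "side (vtx n a) (vtx n b) (vtx n c) = 4 * gap n (b - a) * gap n (c - b) * gap n (c - a)"
proof -
 define m where "m = 3 * real n + 3"
 define p q r where "p = pi * of_int a / m" and "q = pi * of_int b / m" and "r = pi * of_int c / m"
 have m: "m \<noteq> 0" unfolding m_def by simp
 have v: "vtx n a = cis (2 * p)" "vtx n b = cis (2 * q)" "vtx n c = cis (2 * r)"
  by (simp_all add: mult.assoc vtx_def p_def q_def r_def m_def)
 have g: "gap n (b - a) = sin (q - p)" "gap n (c - b) = sin (r - q)" "gap n (c - a) = sin (r - p)"
  by (simp_all add: gap_def p_def q_def r_def m_def diff_divide_distrib right_diff_distrib)
 define u w where "u = q - p" and "w = r - q"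
 have "side (vtx n a) (vtx n b) (vtx n c) = sin (2 * r - 2 * q) + sin (2 * q - 2 * p) - sin (2 * r - 2 * p)"
  unfolding v side_def by (simp add: sin_diff algebra_simps)
 also have "\<dots> = sin (2 * w) + sin (2 * u) - sin (2 * (u + w))" by (simp add: u_def w_def algebra_simps)
 also have "\<dots> = 4 * sin u * sin w * sin (u + w)"
 proof -
  have "sin (2 * w) + sin (2 * u) = 2 * sin (u + w) * cos (u - w)"
   using sin_plus_sin[of "2 * u" "2 * w"] by (simp add: add_divide_distrib diff_divide_distrib)
  moreover have "sin (2 * (u + w)) = 2 * sin (u + w) * cos (u + w)" by (rule sin_double)
  ultimately have "sin (2 * w) + sin (2 * u) - sin (2 * (u + w)) = 2 * sin (u + w) * (cos (u - w) - cos (u + w))"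
   by (simp add: algebra_simps)
  also have "cos (u - w) - cos (u + w) = 2 * sin u * sin w" by (simp add: cos_diff cos_add)
  finally show ?thesis by simp
 qed
 also have "u + w = r - p" by (simp add: u_def w_def)
 finally show ?thesis unfolding g u_def w_def .
qed

lemma side_vtx_pos: "a < b \<Longrightarrow> b < c \<Longrightarrow> c < a + (3 * int n + 3) \<Longrightarrow> side (vtx n a) (vtx n b) (vtx n c) > 0"
 unfolding side_vtx by (intro mult_pos_pos gap_pos) auto

lemma side_vtx_neg:
 assumes "a < c" "c < b" "b < a + (3 * int n + 3)" shows "side (vtx n a) (vtx n b) (vtx n c) < 0"
proof -
 have "gap n (c - b) = - gap n (b - c)" using gap_minus[of n "b - c"] by simp
 moreover have "0 < gap n (b - a) * gap n (b - c) * gap n (c - a)"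
  using assms by (intro mult_pos_pos gap_pos) auto
 ultimately show ?thesis unfolding side_vtx by simp
qed

lemma vtx_rep:
 obtains p' k where "p' = p + k * (3 * int n + 3)" "a \<le> p'" "p' < a + (3 * int n + 3)"
proof
 have eq: "p = (p - a) mod (3 * int n + 3) + (p - a) div (3 * int n + 3) * (3 * int n + 3) + a"
  by (simp add: mod_div_mult_eq)
 show "a + (p - a) mod (3 * int n + 3) = p + (- ((p - a) div (3 * int n + 3))) * (3 * int n + 3)"
  using eq by simp
qed simp_all

lemma side_vtx_zero:
 assumes "a < b" "b < a + (3 * int n + 3)" "side (vtx n a) (vtx n b) (vtx n c) = 0"
 shows "vtx n c = vtx n a \<or> vtx n c = vtx n b"
proof -
 obtain c' k where c': "c' = c + k * (3 * int n + 3)" "a \<le> c'" "c' < a + (3 * int n + 3)"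
  using vtx_rep[of c n a] by blast
 have v: "vtx n c = vtx n c'" unfolding c'(1) by simp
 then have "\<not> (a < c' \<and> c' < b)" "\<not> b < c'"
  using side_vtx_pos[of a b c' n] side_vtx_neg[of a c' b n] assms c' by force+
 then have "c' = a \<or> c' = b" using c' by linarith
 then show ?thesis using v by auto
qed

definition interlaced :: "int \<Rightarrow> int \<Rightarrow> int \<Rightarrow> int \<Rightarrow> bool" where
 "interlaced a b c d \<longleftrightarrow> a < c \<and> c < b \<and> b < d \<or> c < a \<and> a < d \<and> d < b"

lemma interlaced_side:
 assumes "interlaced a b c d" "d < a + (3 * int n + 3)" "b < c + (3 * int n + 3)" "a < b" "c < d"
 shows "side (vtx n a) (vtx n b) (vtx n c) * side (vtx n a) (vtx n b) (vtx n d) < 0"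
proof -
 consider "a < c" "c < b" "b < d" | "c < a" "a < d" "d < b" using assms(1) unfolding interlaced_def by blast
 then show ?thesis
 proof cases
  case 1
  then show ?thesis
   using side_vtx_neg[of a c b n] side_vtx_pos[of a b d n] assms by (intro mult_neg_pos) auto
 next
  case 2
  \<comment> \<open>c lies before a; one period later it is the same vertex and lies beyond
    b.\<close>
  have "side (vtx n a) (vtx n b) (vtx n (c + 1 * (3 * int n + 3))) > 0"
   using 2 assms by (intro side_vtx_pos) auto
  then show ?thesis using side_vtx_neg[of a d b n] 2 assms unfolding vtx_period by (intro mult_pos_neg) auto
 qed
qed

text \<open>The ends c and d are moved separately into the period starting at a, where one falls
  before b and the other after it. Since d - c is positive and less than a period, the two moves
  agree or differ by one period; in both cases a common move gives interlaced positions.\<close>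

lemma side_interlaced:
 assumes "a < b" "b < a + (3 * int n + 3)" "c < d" "d < c + (3 * int n + 3)"
  and neg: "side (vtx n a) (vtx n b) (vtx n c) * side (vtx n a) (vtx n b) (vtx n d) < 0"
 obtains k where "interlaced a b (c + k * (3 * int n + 3)) (d + k * (3 * int n + 3))"
proof -
 define m where "m = 3 * int n + 3"
 obtain c' k where c': "c' = c + k * m" "a \<le> c'" "c' < a + m" using vtx_rep[of c n a] unfolding m_def by blast
 obtain d' l where d': "d' = d + l * m" "a \<le> d'" "d' < a + m" using vtx_rep[of d n a] unfolding m_def by blast
 have v: "vtx n c = vtx n c'" "vtx n d = vtx n d'" unfolding c'(1) d'(1) m_def by simp_all
 have ne: "c' \<noteq> a" "c' \<noteq> b" "d' \<noteq> a" "d' \<noteq> b" using neg unfolding v by auto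
 have sgn: "x < b \<Longrightarrow> x \<noteq> a \<Longrightarrow> a \<le> x \<Longrightarrow> side (vtx n a) (vtx n b) (vtx n x) < 0"
  "b < x \<Longrightarrow> x < a + m \<Longrightarrow> side (vtx n a) (vtx n b) (vtx n x) > 0" for x
  using side_vtx_neg[of a x b n] side_vtx_pos[of a b x n] assms(1,2) unfolding m_def by auto
 have one: "x * m < m \<Longrightarrow> x < 1" "- m < x * m \<Longrightarrow> x > - 1" "0 < x * m \<Longrightarrow> x > 0" for x
  using mult_less_cancel_right[of x m 1] mult_less_cancel_right[of "- 1" m x] mult_less_cancel_right[of 0 m x]
  by (auto simp: m_def)
 have diff: "d' - c' = (d - c) + (l - k) * m" unfolding c'(1) d'(1) by (simp add: algebra_simps)
 consider "c' < b" "b < d'" | "d' < b" "b < c'"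
 proof -
  have "\<not> (c' < b \<and> d' < b)" using sgn(1)[of c'] sgn(1)[of d'] ne c' d' neg unfolding v by (auto simp: mult_less_0_iff)
  moreover have "\<not> (b < c' \<and> b < d')" using sgn(2)[of c'] sgn(2)[of d'] ne c' d' neg unfolding v by (auto simp: mult_less_0_iff)
  ultimately show thesis using that ne by linarith
 qed
 then show thesis
 proof cases
  case 1
  have "0 < d' - c'" "d' - c' < m" using 1 c' d' by auto
  then have "(l - k) * m < m" "- m < (l - k) * m" using diff assms(3,4) unfolding m_def by linarith+
  then have "l = k" using one(1)[of "l - k"] one(2)[of "l - k"] by auto
  then show thesis using that[of k] 1 c' d' ne unfolding interlaced_def m_def by auto
 next
  case 2
  have "- m < d' - c'" "d' - c' < 0" using 2 c' d' by auto
  then have "(l - k) * m < 0" "- 2 * m < (l - k) * m"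
   using diff assms(3) assms(4)[folded m_def] by linarith+
  then have "l - k < 0" "- 2 < l - k"
   by (simp_all only: mult_less_cancel_right mult_less_0_iff) (auto simp: m_def)
  then have "k = l + 1" by simp
  then show thesis using that[of l] 2 c' d' ne unfolding interlaced_def m_def by (auto simp: algebra_simps)
 qed
qed

text \<open>Each chord meets the line of the other in its interior. Both meeting points lie on both
  lines, which are not parallel, so they coincide.\<close>

lemma interlaced_meet:
 assumes "interlaced a b c d" "d < a + (3 * int n + 3)" "b < c + (3 * int n + 3)" "a < b" "c < d"
 obtains t where "t \<in> {0<..<1}" "linepath (vtx n a) (vtx n b) t \<in> closed_segment (vtx n c) (vtx n d)"
proof -
 let ?a = "vtx n a" and ?b = "vtx n b" and ?c = "vtx n c" and ?d = "vtx n d"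
 have il: "interlaced c d a b" using assms(1) unfolding interlaced_def by auto
 have neg: "side ?a ?b ?c * side ?a ?b ?d < 0" using interlaced_side assms by blast
 have neg': "side ?c ?d ?a * side ?c ?d ?b < 0" using interlaced_side[OF il] assms by blast
 have zero: "\<exists>t\<in>{0<..<1}. (1 - t) * p + t * q = 0" if "p * q < 0" for p q :: real
 proof (rule bexI[of _ "p / (p - q)"])
  have "p < 0 \<and> 0 < q \<or> 0 < p \<and> q < 0" using that by (auto simp: mult_less_0_iff)
  then show "p / (p - q) \<in> {0<..<1}" "(1 - p / (p - q)) * p + p / (p - q) * q = 0"
   by (auto simp: field_simps)
 qed
 obtain u where u: "u \<in> {0<..<1}" "(1 - u) * side ?a ?b ?c + u * side ?a ?b ?d = 0" using zero[OF neg] by blast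
 obtain t where t: "t \<in> {0<..<1}" "(1 - t) * side ?c ?d ?a + t * side ?c ?d ?b = 0" using zero[OF neg'] by blast
 define z where "z = linepath ?a ?b t"
 define w where "w = linepath ?c ?d u"
 have z: "side ?a ?b z = 0" "side ?c ?d z = 0" using t(2) by (simp_all add: z_def side_linepath)
 have w: "side ?a ?b w = 0" "side ?c ?d w = 0" using u(2) by (simp_all add: w_def side_linepath)
 have "z = w"
 proof (rule ccontr)
  assume "z \<noteq> w"
  have par: "side ?a ?b (?a + (z - w)) = 0" "side ?c ?d (?c + (z - w)) = 0"
   using z w by (simp_all add: side_def algebra_simps)
  define e where "e = z - w"
  have e: "e \<noteq> 0" using \<open>z \<noteq> w\<close> by (simp add: e_def)
  have e0: "Im (cnj (?b - ?a) * e) = 0" "Im (cnj (?d - ?c) * e) = 0"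
   using par by (simp_all add: side_def e_def)
  have "Im (cnj (?b - ?a) * (?d - ?c)) = 0"
  proof -
   \<comment> \<open>An identity between cross and scalar products: two vectors parallel to a
     nonzero e are parallel to each other.\<close>
   have "Im (cnj (?b - ?a) * (?d - ?c)) * (Re e * Re e + Im e * Im e) =
    Im (cnj (?b - ?a) * e) * (Re (?d - ?c) * Re e + Im (?d - ?c) * Im e) -
    Im (cnj (?d - ?c) * e) * (Re (?b - ?a) * Re e + Im (?b - ?a) * Im e)" by (simp add: algebra_simps)
   also have "\<dots> = 0" unfolding e0 by simp
   finally show ?thesis using e by (auto simp: complex_eq_iff add_nonneg_eq_0_iff)
  qed
  then have "side ?a ?b ?d = side ?a ?b ?c" by (simp add: side_def algebra_simps)
  then show False using neg by (simp add: not_less)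
 qed
 moreover have "w \<in> closed_segment ?c ?d" unfolding w_def using u(1) linepath_in_path[of u] by auto
 ultimately show thesis using that t(1) unfolding z_def by blast
qed

subsection \<open>Triangulations on the universal cover of the boundary circle\<close>

text \<open>Without interlacing, c and d lie on the same closed side of the line through a and b. A
  common point then has to be c or d, situated on that line, and the only vertices on it are a and
  b.\<close>

lemma chords_disjoint:
 assumes "a < b" "b < a + (3 * int n + 3)" "c < d" "d < c + (3 * int n + 3)"
  and no: "\<And>k. \<not> interlaced a b (c + k * (3 * int n + 3)) (d + k * (3 * int n + 3))"
  and ne: "{vtx n a, vtx n b} \<noteq> {vtx n c, vtx n d}"
  and z: "z \<in> closed_segment (vtx n a) (vtx n b)" "z \<in> closed_segment (vtx n c) (vtx n d)"
 shows "z = vtx n a \<or> z = vtx n b"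
proof -
 let ?f = "side (vtx n a) (vtx n b)"
 have nonneg: "?f (vtx n c) * ?f (vtx n d) \<ge> 0"
  using side_interlaced[of a b n c d] assms(1-4) no by (meson not_le)
 have zero: "x = vtx n a \<or> x = vtx n b" if "?f x = 0" "x = vtx n e" for x e
  using side_vtx_zero[OF assms(1,2)] that by blast
 have dist: "vtx n c \<noteq> vtx n d" using vtx_distinct assms(3,4) by blast
 have both: "\<not> (?f (vtx n c) = 0 \<and> ?f (vtx n d) = 0)"
  using zero[OF _ refl, of c] zero[OF _ refl, of d] dist ne by auto
 obtain t where t: "0 \<le> t" "t \<le> 1" "z = (1 - t) *\<^sub>R vtx n c + t *\<^sub>R vtx n d"
  using z(2) unfolding closed_segment_def by blast
 have eq: "(1 - t) * ?f (vtx n c) + t * ?f (vtx n d) = 0"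
  using side_segment[OF z(1)] unfolding t(3) side_affine .
 consider "?f (vtx n c) = 0" "?f (vtx n d) \<noteq> 0" | "?f (vtx n d) = 0" "?f (vtx n c) \<noteq> 0"
  | "?f (vtx n c) * ?f (vtx n d) > 0" using nonneg both by (metis less_eq_real_def mult_eq_0_iff)
 then show ?thesis
 proof cases
  case 1
  then have "z = vtx n c" using eq t(3) by simp
  then show ?thesis using zero 1(1) by blast
 next
  case 2
  then have "z = vtx n d" using eq t(3) by simp
  then show ?thesis using zero 2(1) by blast
 next
  case 3
  have "((1 - t) * ?f (vtx n c) + t * ?f (vtx n d)) * ?f (vtx n c) =
   (1 - t) * (?f (vtx n c))\<^sup>2 + t * (?f (vtx n c) * ?f (vtx n d))"
   by (simp add: algebra_simps power2_eq_square)
  moreover have "0 < (?f (vtx n c))\<^sup>2" using 3 by auto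
  then have "0 < (1 - t) * (?f (vtx n c))\<^sup>2 + t * (?f (vtx n c) * ?f (vtx n d))"
   using t(1,2) 3 by (cases "t = 1") (auto intro!: add_pos_nonneg)
  ultimately show ?thesis using eq by simp
 qed
qed

lemma noncrossing_commute: "noncrossing n A B \<longleftrightarrow> noncrossing n B A"
 unfolding noncrossing_def by (metis Int_commute)

lemma cls_noncrossing_interlaced:
 assumes "noncrossing n (cls n a b) (cls n c d)" "a < b" "c < d" shows "\<not> interlaced a b c d"
 using cls_noncrossing[OF assms] cls_noncrossing[of n c d a b] assms noncrossing_commute[of n]
 unfolding interlaced_def by blast

text \<open>A common point of the projections comes from points z and y with equal cubes, so z lies
  on a rotated copy of the second chord; this is why all shifts by n + 1 appear in the
  hypothesis.\<close>

lemma noncrossing_cls: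
 assumes "2 \<le> b - a" "b - a \<le> int n + 1" "2 \<le> d - c" "d - c \<le> int n + 1" and ne: "cls n a b \<noteq> cls n c d"
  and no: "\<And>k. \<not> interlaced a b (c + k * (int n + 1)) (d + k * (int n + 1))"
 shows "noncrossing n (cls n a b) (cls n c d)"
proof -
 have mem: "chord_path n a b \<in> cls n a b" "chord_path n c d \<in> cls n c d"
  using chord_curve[of a b n] chord_turn[of a b n] chord_curve[of c d n] chord_turn[of c d n] assms(1-4)
  unfolding cls_def by auto
 have "path_image (chord_path n a b) \<inter> path_image (chord_path n c d) \<subseteq> marked n"
 proof
  fix w assume "w \<in> path_image (chord_path n a b) \<inter> path_image (chord_path n c d)"
  then obtain s t where st: "s \<in> {0..1}" "t \<in> {0..1}" "w = chord_path n a b s" "w = chord_path n c d t"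
   unfolding path_image_def by blast
  define z where "z = linepath (vtx n a) (vtx n b) s"
  define y where "y = linepath (vtx n c) (vtx n d) t"
  have w: "w = z ^ 3" "w = y ^ 3" using st by (simp_all add: z_def y_def)
  have turn: "turn n (chord_path n a b) a b" using assms(1,2) by (intro chord_turn) auto
  have "w \<noteq> 0" using turn_nonzero[OF turn st(1)] st(3) by simp
  then have "y \<noteq> 0" using w by auto
  have "(z / y) ^ 3 = 1" using w \<open>w \<noteq> 0\<close> by (simp add: power_divide)
  then obtain k where k: "z / y = vtx n (k * (int n + 1))" by (rule cube_root_vtx)
  have "z = vtx n (k * (int n + 1)) * y" using k \<open>y \<noteq> 0\<close> by (simp add: field_simps)
  also have "\<dots> = linepath (vtx n (c + k * (int n + 1))) (vtx n (d + k * (int n + 1))) t"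
   unfolding y_def linepath_def vtx_add by (simp add: algebra_simps)
  finally have z2: "z \<in> closed_segment (vtx n (c + k * (int n + 1))) (vtx n (d + k * (int n + 1)))"
   using linepath_in_path[OF st(2)] by simp
  have z1: "z \<in> closed_segment (vtx n a) (vtx n b)" unfolding z_def by (rule linepath_in_path[OF st(1)])
  have "{vtx n a, vtx n b} \<noteq> {vtx n (c + k * (int n + 1)), vtx n (d + k * (int n + 1))}"
  proof
   assume "{vtx n a, vtx n b} = {vtx n (c + k * (int n + 1)), vtx n (d + k * (int n + 1))}"
   then have "cls n a b = cls n (c + k * (int n + 1)) (d + k * (int n + 1))"
    using project_short[of a b n] project_short[of "c + k * (int n + 1)" "d + k * (int n + 1)" n] assms(1-4)
    by simp
   then show False using ne unfolding cls_shift by simp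
  qed
  moreover have "\<not> interlaced a b (c + k * (int n + 1) + l * (3 * int n + 3)) (d + k * (int n + 1) + l * (3 * int n + 3))" for l
  proof -
   have "x + k * (int n + 1) + l * (3 * int n + 3) = x + (k + 3 * l) * (int n + 1)" for x
    by (simp add: algebra_simps)
   then show ?thesis using no[of "k + 3 * l"] by (simp only: not_False_eq_True)
  qed
  ultimately have "z = vtx n a \<or> z = vtx n b" using chords_disjoint[OF _ _ _ _ _ _ z1 z2] assms(1-4) by auto
  then show "w \<in> marked n" unfolding w(1) using vtx_cube[of n] exp_ang_marked[of n] by auto
 qed
 then show ?thesis unfolding noncrossing_def using mem by blast
qed

lemma bounded_maximum:
 assumes "P x" "\<And>y. P y \<Longrightarrow> y \<le> (u :: int)"
 obtains y where "P y" "\<And>z. P z \<Longrightarrow> z \<le> y"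
proof -
 obtain y where y: "P y" "\<forall>z. P z \<longrightarrow> nat (u - y) \<le> nat (u - z)"
  using ex_has_least_nat[of P x "\<lambda>y. nat (u - y)"] assms(1) by blast
 have "z \<le> y" if "P z" for z using y(2)[rule_format, OF that] assms(2)[OF that] assms(2)[OF y(1)] by linarith
 then show thesis using that y(1) by blast
qed

locale triangulated =
 fixes n :: nat and \<tau> :: "arc_class set"
 assumes n: "n \<ge> 2" and triangulation: "orbifold_triangulation n \<tau>"
begin

abbreviation h :: int where "h \<equiv> int n + 1"

abbreviation m :: int where "m \<equiv> 3 * int n + 3"

text \<open>The diagonals of the lifted triangulation, on the universal cover of the boundary circle.\<close>

definition I :: "(int \<times> int) set" where
 "I = {(a, b). 2 \<le> b - a \<and> b - a \<le> h \<and> cls n a b \<in> \<tau>}"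

lemma I_D: "(a, b) \<in> I \<Longrightarrow> 2 \<le> b - a" "(a, b) \<in> I \<Longrightarrow> b - a \<le> h" "(a, b) \<in> I \<Longrightarrow> cls n a b \<in> \<tau>"
 by (auto simp: I_def)

lemma I_shift: "(a + k * h, b + k * h) \<in> I \<longleftrightarrow> (a, b) \<in> I" by (simp add: I_def cls_shift)

lemma \<tau>_cases:
 assumes "A \<in> \<tau>"
 obtains a b where "(a, b) \<in> I" "A = cls n a b"
proof -
 have "A \<in> arc_classes n" using assms triangulation unfolding orbifold_triangulation_def by blast
 then obtain a b where "2 \<le> b - a" "b - a \<le> h" "A = cls n a b" using arc_classes_subset[OF n] by metis
 then show thesis using that assms unfolding I_def by blast
qed

lemma I_cls_eq:
 assumes "(a, b) \<in> I" "(c, d) \<in> I" "cls n a b = cls n c d"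
 obtains k where "c = a + k * h" "d = b + k * h"
 using cls_eq[of a b n c d] I_D[OF assms(1)] I_D[OF assms(2)] assms(3) by auto

text \<open>Interlacing with the own translate would need a nonzero multiple of h of absolute value
  less than h.\<close>

lemma self_not_interlaced:
 assumes "b - a \<le> h" shows "\<not> interlaced a b (a + k * h) (b + k * h)"
proof
 assume il: "interlaced a b (a + k * h) (b + k * h)"
 then have "0 < k * h \<and> k * h < 1 * h \<or> - 1 * h < k * h \<and> k * h < 0"
  using assms unfolding interlaced_def by auto
 then show False by (simp only: zero_less_mult_iff mult_less_cancel_right mult_less_0_iff) auto
qed

lemma I_not_interlaced:
 assumes "(a, b) \<in> I" "(c, d) \<in> I" shows "\<not> interlaced a b c d"
proof (cases "cls n a b = cls n c d")
 case True
 then obtain k where "c = a + k * h" "d = b + k * h" using I_cls_eq[OF assms] by blast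
 then show ?thesis using self_not_interlaced I_D(2)[OF assms(1)] by blast
next
 case False
 then have "noncrossing n (cls n a b) (cls n c d)"
  using triangulation I_D(3)[OF assms(1)] I_D(3)[OF assms(2)]
  unfolding orbifold_triangulation_def pairwise_def by blast
 then show ?thesis using cls_noncrossing_interlaced I_D(1)[OF assms(1)] I_D(1)[OF assms(2)] by auto
qed

text \<open>A chord that interlaces with no member of I is disjoint from all arcs of \<tau> after
  projection. All later uses of the maximality of \<tau> go through this form of it.\<close>

lemma I_maximal:
 assumes ab: "2 \<le> b - a" "b - a \<le> h" and no: "\<And>c d. (c, d) \<in> I \<Longrightarrow> \<not> interlaced a b c d" shows "(a, b) \<in> I"
proof -
 let ?A = "cls n a b"
 have nc: "noncrossing n ?A B" "noncrossing n B ?A" if B: "B \<in> \<tau>" "B \<noteq> ?A" for B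
 proof -
  obtain c d where cd: "(c, d) \<in> I" "B = cls n c d" using \<tau>_cases[OF B(1)] by blast
  show "noncrossing n ?A B" unfolding cd(2)
  proof (rule noncrossing_cls[OF ab I_D(1,2)[OF cd(1)]])
   show "cls n a b \<noteq> cls n c d" using B(2) cd(2) by simp
   show "\<not> interlaced a b (c + k * h) (d + k * h)" for k using no cd(1) by (simp add: I_shift)
  qed
  then show "noncrossing n B ?A" using noncrossing_commute[of n] by blast
 qed
 have "pairwise (noncrossing n) (insert ?A \<tau>)"
  unfolding pairwise_insert using triangulation nc unfolding orbifold_triangulation_def by auto
 moreover have "insert ?A \<tau> \<subseteq> arc_classes n"
  using triangulation cls_arc_classes[OF n ab] unfolding orbifold_triangulation_def by blast
 ultimately have "insert ?A \<tau> = \<tau>"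
  using triangulation subset_insertI[of \<tau> ?A] unfolding orbifold_triangulation_def by metis
 then show ?thesis using ab unfolding I_def by blast
qed

text \<open>Take a longest chord (a, b). If it is shorter than h, prolong it by the longest chord or
  side starting at b; the resulting (a, d) crosses nothing, so it belongs to I and is
  longer.\<close>

lemma pending_ex: "\<exists>a. (a, a + h) \<in> I"
proof -
 define P where "P = (\<lambda>l. \<exists>a. (a, a + l) \<in> I)"
 have bound: "l \<le> h" if "P l" for l using that I_D(2) unfolding P_def by force
 have "\<exists>l. P l"
 proof (rule ccontr)
  assume "\<nexists>l. P l"
  then have "(c, d) \<notin> I" for c d unfolding P_def by (metis add.commute diff_add_cancel)
  then have "(0, h) \<in> I" using I_maximal[of h 0] n by auto
  then show False using \<open>\<And>d c. (c, d) \<notin> I\<close> by blast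
 qed
 then obtain l where "P l" and max: "\<And>k. P k \<Longrightarrow> k \<le> l" using bounded_maximum[of P] bound by metis
 then obtain a where "(a, a + l) \<in> I" unfolding P_def by blast
 then obtain b where ab: "(a, b) \<in> I" "l = b - a" by (metis add_diff_cancel_left')
 have maxI: "d - c \<le> b - a" if "(c, d) \<in> I" for c d
 proof -
  have "P (d - c)" unfolding P_def using that by (intro exI[of _ c]) simp
  then show ?thesis using max ab(2) by simp
 qed
 have "b - a = h"
 proof (rule ccontr)
  assume "b - a \<noteq> h"
  then have lt: "b - a < h" using I_D(2)[OF ab(1)] by simp
  define R where "R = (\<lambda>d. (b, d) \<in> I \<or> d = b + 1)"
  have R_le: "d \<le> b + h" if "R d" for d using that I_D(2)[of b d] unfolding R_def by auto
  obtain d where d: "R d" and dmax: "\<And>k. R k \<Longrightarrow> k \<le> d"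
   using bounded_maximum[of R "b + 1" "b + h"] R_le unfolding R_def by blast
  have "b < d" using dmax[of "b + 1"] unfolding R_def by simp
  have shifted: "(a + h, b + h) \<in> I" using I_shift[of a 1 b] ab(1) by simp
  \<comment> \<open>Otherwise (b, d), which is no longer than (a, b), would cross the translate (a +
    h, b + h).\<close>
  have "d - a \<le> h"
  proof (rule ccontr)
   assume "\<not> d - a \<le> h"
   then have "(b, d) \<in> I" using d lt unfolding R_def by auto
   then have "\<not> interlaced b d (a + h) (b + h)" using I_not_interlaced shifted by blast
   then show False using maxI[OF \<open>(b, d) \<in> I\<close>] lt \<open>\<not> d - a \<le> h\<close> unfolding interlaced_def by auto
  qed
  have "(a, d) \<in> I"
  proof (rule I_maximal)
   show "2 \<le> d - a" "d - a \<le> h" using I_D(1)[OF ab(1)] \<open>b < d\<close> \<open>d - a \<le> h\<close> by auto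
   fix p q assume pq: "(p, q) \<in> I"
   have 1: "\<not> interlaced a b p q" using I_not_interlaced ab(1) pq by blast
   have 2: "\<not> interlaced b d p q" if "d \<noteq> b + 1" using I_not_interlaced pq d that unfolding R_def by blast
   have 3: "p = b \<Longrightarrow> q \<le> d" using dmax[of q] pq unfolding R_def by blast
   have 4: "q = b \<Longrightarrow> a \<le> p" using maxI[OF pq] by auto
   show "\<not> interlaced a d p q"
    using 1 2 3 4 I_D(1)[OF pq] \<open>b < d\<close> I_D(1)[OF ab(1)] unfolding interlaced_def by (cases "d = b + 1") auto
  qed
  then show False using maxI[of a d] \<open>b < d\<close> by simp
 qed
 then have "b = a + h" by simp
 then show ?thesis using ab(1) by blast
qed

definition lo :: int where "lo = (SOME a. (a, a + h) \<in> I)"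

lemma root_I: "(lo, lo + h) \<in> I" unfolding lo_def by (rule someI_ex) (rule pending_ex)

text \<open>The apex is the far end of the longest chord or side from i that stops before j; by this
  choice nothing crosses (k, j), which is then in I or a side.\<close>

lemma I_apex:
 assumes "(i, j) \<in> I"
 obtains k where "i < k" "k < j" "(i, k) \<in> I \<or> k = i + 1" "(k, j) \<in> I \<or> j = k + 1"
proof -
 define R where "R = (\<lambda>k. k < j \<and> ((i, k) \<in> I \<or> k = i + 1))"
 have ij: "i + 2 \<le> j" using I_D(1)[OF assms] by simp
 have "R (i + 1)" "\<And>k. R k \<Longrightarrow> k \<le> j" using ij unfolding R_def by auto
 then obtain k where k: "R k" and kmax: "\<And>l. R l \<Longrightarrow> l \<le> k" using bounded_maximum[of R "i + 1" j] by blast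
 have ik: "i < k" using kmax[OF \<open>R (i + 1)\<close>] by simp
 have kj: "k < j" using k unfolding R_def by simp
 have "(k, j) \<in> I" if "j \<noteq> k + 1"
 proof (rule I_maximal)
  show "2 \<le> j - k" "j - k \<le> h" using kj that ik I_D(2)[OF assms] by auto
  fix p q assume pq: "(p, q) \<in> I"
  have 1: "\<not> interlaced i j p q" using I_not_interlaced assms pq by blast
  have 2: "\<not> interlaced i k p q" if "k \<noteq> i + 1" using I_not_interlaced pq k that unfolding R_def by blast
  have 3: "p = i \<Longrightarrow> q < j \<Longrightarrow> q \<le> k" using kmax[of q] pq unfolding R_def by blast
  show "\<not> interlaced k j p q" using 1 2 3 ik kj unfolding interlaced_def by (cases "k = i + 1") auto
 qed
 then show thesis using that[of k] ik kj k unfolding R_def by blast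
qed

end

text \<open>Two vertices bound two complementary boundary arcs; the second alternative reads the
  same chord along the other arc.\<close>

lemma vtx_pair_eq:
 assumes "a < b" "b < a + (3 * int n + 3)" "c < d" "d < c + (3 * int n + 3)"
  and eq: "{vtx n a, vtx n b} = {vtx n c, vtx n d}"
 obtains k where "a = c + k * (3 * int n + 3)" "b = d + k * (3 * int n + 3)"
 | k where "b = c + k * (3 * int n + 3)" "a + (3 * int n + 3) = d + k * (3 * int n + 3)"
proof -
 define m where "m = 3 * int n + 3"
 have m: "m > 0" by (simp add: m_def)
 have between: "x = y" if "x * m < y * m + m" "y * m < x * m + m" for x y
 proof -
  have "x * m < (y + 1) * m" "y * m < (x + 1) * m" using that by (simp_all add: algebra_simps)
  then show ?thesis using m by (simp add: mult_less_cancel_right)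
 qed
 consider "vtx n c = vtx n a" "vtx n d = vtx n b" | "vtx n c = vtx n b" "vtx n d = vtx n a"
  using eq by (auto simp: doubleton_eq_iff)
 then show thesis
 proof cases
  case 1
  obtain k where k: "a = c + k * m" using 1(1) unfolding vtx_eq m_def by blast
  obtain l where l: "b = d + l * m" using 1(2) unfolding vtx_eq m_def by blast
  have "k = l" using between[of k l] assms(1-4)[folded m_def] k l by auto
  then show thesis using that(1)[of k] k l unfolding m_def by simp
 next
  case 2
  obtain k where k: "b = c + k * m" using 2(1) unfolding vtx_eq m_def by blast
  obtain l where l: "a = d + l * m" using 2(2) unfolding vtx_eq m_def by blast
  have e: "(l + 1) * m = l * m + m" by (simp add: algebra_simps)
  have "k = l + 1" using between[of k "l + 1"] assms(1-4)[folded m_def] k l unfolding e by linarith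
  then have "a + m = d + k * m" using l e by simp
  then show thesis using that(2)[of k] k unfolding m_def by simp
 qed
qed

definition lift :: "nat \<Rightarrow> chord \<Rightarrow> complex set" where
 "lift n x = {vtx n (fst x), vtx n (snd x)}"

definition shift :: "nat \<Rightarrow> int \<Rightarrow> chord \<Rightarrow> chord" where
 "shift n t x = (fst x + t * (int n + 1), snd x + t * (int n + 1))"

lemma fst_shift [simp]: "fst (shift n t x) = fst x + t * (int n + 1)"
 and snd_shift [simp]: "snd (shift n t x) = snd x + t * (int n + 1)" by (simp_all add: shift_def)

lemma shift_shift [simp]: "shift n s (shift n t x) = shift n (s + t) x" and shift_0 [simp]: "shift n 0 x = x"
 by (simp_all add: prod_eq_iff algebra_simps)

lemma lift_rotate: "(*) (vtx n (t * (int n + 1))) ` lift n x = lift n (shift n t x)"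
 by (simp add: lift_def vtx_add mult.commute)

lemma orbit_lift: "orbit (lift n x, lift n y) = {(lift n (shift n t x), lift n (shift n t y)) |t. True}"
proof -
 have roots: "{g :: complex. g ^ 3 = 1} = range (\<lambda>t. vtx n (t * (int n + 1)))"
  using vtx_third cube_root_vtx by (auto; metis rangeI)
 have "orbit (lift n x, lift n y) = (\<lambda>g. ((*) g ` lift n x, (*) g ` lift n y)) ` {g. g ^ 3 = 1}"
  unfolding orbit_def by auto
 then show ?thesis unfolding roots image_image lift_rotate by auto
qed

lemma orbit_shift: "orbit (lift n (shift n t x), lift n (shift n t y)) = orbit (lift n x, lift n y)"
proof -
 have "(\<exists>s. p = (lift n (shift n (s + t) x), lift n (shift n (s + t) y))) \<longleftrightarrow>
  (\<exists>s. p = (lift n (shift n s x), lift n (shift n s y)))" for p by (metis diff_add_cancel)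
 then show ?thesis unfolding orbit_lift by simp
qed

lemma vtx_thrice: "vtx n (a + k * (3 * int n + 3)) = vtx n (a + (3 * k) * (int n + 1))"
 by (simp add: algebra_simps)

lemma triangle_rotate: "triangle n \<tau> x y z \<Longrightarrow> triangle n \<tau> y z x"
proof -
 have "Im (cnj (y - x) * (z - x)) = Im (cnj (z - y) * (x - y))" by (simp add: algebra_simps)
 then show "triangle n \<tau> x y z \<Longrightarrow> triangle n \<tau> y z x" unfolding triangle_def ccw_def by auto
qed

context triangulated
begin

lemma I_mem: "(a, b) \<in> I \<Longrightarrow> b < a + m" "(a, b) \<in> I \<Longrightarrow> a < b" "(a, b) \<in> I \<Longrightarrow> 2 * (b - a) < m"
 using I_D[of a b] by auto

lemma shift_I: "shift n t x \<in> I \<longleftrightarrow> x \<in> I" using I_shift[of "fst x" t "snd x"] by (simp add: shift_def)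

lemma project_lift: "x \<in> I \<Longrightarrow> project n (lift n x) = cls n (fst x) (snd x)"
 using I_mem[of "fst x" "snd x"] by (simp add: lift_def project_short)

lemma lifted_eq: "lifted n \<tau> = lift n ` I"
proof
 show "lifted n \<tau> \<subseteq> lift n ` I"
 proof
  fix d assume d: "d \<in> lifted n \<tau>"
  then have "d \<in> diagonals n" "project n d \<in> arc_classes n"
   using triangulation unfolding lifted_def orbifold_triangulation_def by auto
  then obtain a b where ab: "d = {vtx n a, vtx n b}" "2 \<le> b - a" "b - a \<le> h"
   using diagonal_project[OF n] by blast
  then have "project n d = cls n a b" by (simp add: project_short)
  then have "(a, b) \<in> I" using d ab unfolding lifted_def I_def by auto
  then show "d \<in> lift n ` I" using ab(1) by (intro image_eqI[of _ _ "(a, b)"]) (simp_all add: lift_def)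
 qed
 show "lift n ` I \<subseteq> lifted n \<tau>"
 proof
  fix d assume "d \<in> lift n ` I"
  then obtain x where x: "x \<in> I" "d = lift n x" by blast
  have xI: "(fst x, snd x) \<in> I" using x(1) by simp
  show "d \<in> lifted n \<tau>" using vtx_diagonal[OF I_D(1,2)[OF xI]] project_lift[OF x(1)] I_D(3)[OF xI] x(2)
   unfolding lifted_def by (simp add: lift_def)
 qed
qed

definition segment :: "int \<Rightarrow> int \<Rightarrow> bool" where
 "segment a b \<longleftrightarrow> (a, b) \<in> I \<or> b = a + 1"

lemma segment_bounds: "segment a b \<Longrightarrow> a < b" "segment a b \<Longrightarrow> b \<le> a + h"
 using I_D[of a b] by (auto simp: segment_def)

lemma segment_shift: "segment (a + k * h) (b + k * h) \<longleftrightarrow> segment a b" unfolding segment_def I_shift by auto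

lemma segment_shift_m: "segment (a + k * m) (b + k * m) \<longleftrightarrow> segment a b"
proof -
 have "x + k * m = x + (3 * k) * h" for x by (simp add: algebra_simps)
 then show ?thesis by (simp only: segment_shift)
qed

lemma polygon_sides_vtx: "polygon_sides n = {{vtx n a, vtx n (a + 1)} |a. True}"
 unfolding polygon_sides_def vtx_1[symmetric] vtx_add[symmetric] using vertices_vtx[of _ n]
 by (auto simp: vtx_add)

lemma segment_iff:
 assumes "a < b" "b < a + m"
 shows "{vtx n a, vtx n b} \<in> lifted n \<tau> \<union> polygon_sides n \<longleftrightarrow> segment a b \<or> segment b (a + m)"
proof
 assume "{vtx n a, vtx n b} \<in> lifted n \<tau> \<union> polygon_sides n"
 then obtain c d where cd: "segment c d" "{vtx n a, vtx n b} = {vtx n c, vtx n d}"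
  unfolding lifted_eq polygon_sides_vtx lift_def segment_def by fastforce
 have cd': "c < d" "d < c + m" using segment_bounds[OF cd(1)] by auto
 from assms cd' cd(2) show "segment a b \<or> segment b (a + m)"
  by (rule vtx_pair_eq) (use cd(1) segment_shift_m in auto)
next
 have *: "{vtx n a, vtx n b} \<in> lifted n \<tau> \<union> polygon_sides n" if "segment a b" for a b
  using that unfolding segment_def lifted_eq polygon_sides_vtx
  by (auto intro!: image_eqI[of _ _ "(a, b)"] simp: lift_def)
 assume "segment a b \<or> segment b (a + m)"
 then show "{vtx n a, vtx n b} \<in> lifted n \<tau> \<union> polygon_sides n"
  using *[of a b] *[of b "a + m"] vtx_period[of n a 1] by (auto simp: insert_commute)
qed

lemma lifted_iff:
 assumes "a < b" "b \<le> a + h" shows "{vtx n a, vtx n b} \<in> lifted n \<tau> \<longleftrightarrow> (a, b) \<in> I"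
proof
 assume "{vtx n a, vtx n b} \<in> lifted n \<tau>"
 then obtain c d where cd: "(c, d) \<in> I" "{vtx n a, vtx n b} = {vtx n c, vtx n d}"
  unfolding lifted_eq lift_def by fastforce
 have ab: "b < a + m" using assms by auto
 from assms(1) ab I_mem(2,1)[OF cd(1)] cd(2) show "(a, b) \<in> I"
 proof (rule vtx_pair_eq)
  fix k assume k: "a = c + k * m" "b = d + k * m"
  have "(a, b) = shift n (3 * k) (c, d)" unfolding k by (simp add: prod_eq_iff algebra_simps)
  then show ?thesis using cd(1) by (simp only: shift_I)
 next
  fix k assume "b = c + k * m" "a + m = d + k * m"
  then have "d - c = a + m - b" by simp
  then show ?thesis using I_D(2)[OF cd(1)] assms by simp
 qed
next
 assume "(a, b) \<in> I"
 then show "{vtx n a, vtx n b} \<in> lifted n \<tau>"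
  unfolding lifted_eq by (intro image_eqI[of _ _ "(a, b)"]) (simp_all add: lift_def)
qed

text \<open>The shift by n + 1 is the rotation by a third of a turn, so in the polygon only
  multiples of three shifts act trivially.\<close>

lemma lift_eq:
 assumes "x \<in> I" "y \<in> I" "lift n x = lift n y"
 obtains k where "x = shift n (3 * k) y"
proof -
 have xI: "(fst x, snd x) \<in> I" and yI: "(fst y, snd y) \<in> I" using assms by simp_all
 from I_mem(2,1)[OF xI] I_mem(2,1)[OF yI] assms(3)[unfolded lift_def] show thesis
 proof (rule vtx_pair_eq)
  fix k assume "fst x = fst y + k * m" "snd x = snd y + k * m"
  then have "x = shift n (3 * k) y" by (simp add: prod_eq_iff algebra_simps)
  then show thesis by (rule that)
 next
  fix k assume "snd x = fst y + k * m" "fst x + m = snd y + k * m"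
  then have "snd y - fst y = fst x + m - snd x" by simp
  then show thesis using I_D(2)[OF xI] I_D(2)[OF yI] by simp
 qed
qed

lemma lift_shift_3: "lift n (shift n (3 * k) x) = lift n x"
 unfolding lift_def fst_shift snd_shift vtx_thrice[symmetric] by simp

definition tri :: "int \<Rightarrow> int \<Rightarrow> int \<Rightarrow> bool" where
 "tri i q j \<longleftrightarrow> (i, j) \<in> I \<and> segment i q \<and> segment q j"

lemma tri_triangle:
 assumes "tri i q j" shows "triangle n \<tau> (vtx n i) (vtx n q) (vtx n j)"
proof -
 have b: "i < q" "q < j" "j \<le> i + h" "segment i q" "segment q j" "segment i j"
  using assms segment_bounds I_D(2) unfolding tri_def segment_def by auto
 have "{vtx n i, vtx n q} \<in> lifted n \<tau> \<union> polygon_sides n" "{vtx n q, vtx n j} \<in> lifted n \<tau> \<union> polygon_sides n"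
  "{vtx n i, vtx n j} \<in> lifted n \<tau> \<union> polygon_sides n"
  using segment_iff[of i q] segment_iff[of q j] segment_iff[of i j] b by auto
 moreover have "ccw (vtx n i) (vtx n q) (vtx n j)" unfolding ccw_side using b by (intro side_vtx_pos) auto
 ultimately show ?thesis unfolding triangle_def by (simp add: insert_commute)
qed

lemma central_triangle:
 assumes "(i, i + h) \<in> I" shows "triangle n \<tau> (vtx n i) (vtx n (i + h)) (vtx n (i + 2 * h))"
proof -
 have I: "(i + h, i + 2 * h) \<in> I" "(i + 2 * h, i + m) \<in> I"
  using assms I_shift[of i 1 "i + h"] I_shift[of i 2 "i + h"] by (simp_all add: algebra_simps)
 have "{vtx n i, vtx n (i + h)} \<in> lifted n \<tau>" "{vtx n (i + h), vtx n (i + 2 * h)} \<in> lifted n \<tau>"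
  "{vtx n (i + 2 * h), vtx n (i + m)} \<in> lifted n \<tau>" using assms I by (simp_all add: lifted_iff)
 moreover have "vtx n (i + m) = vtx n i" using vtx_period[of n i 1] by simp
 moreover have "ccw (vtx n i) (vtx n (i + h)) (vtx n (i + 2 * h))"
  unfolding ccw_side using n by (intro side_vtx_pos) auto
 ultimately show ?thesis unfolding triangle_def by simp
qed

text \<open>Each side is a segment along one of its two boundary arcs. Either one side runs around
  the other two and the triangle lies below it, or all three run along their own arcs; these have
  length at most h and sum 3 h, so all are h and the triangle is central.\<close>

lemma triangle_cases:
 assumes "triangle n \<tau> x y z"
 obtains i q j where "tri i q j" "(x, y, z) \<in> {(vtx n i, vtx n q, vtx n j), (vtx n q, vtx n j, vtx n i), (vtx n j, vtx n i, vtx n q)}"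
 | i where "(i, i + h) \<in> I" "x = vtx n i" "y = vtx n (i + h)" "z = vtx n (i + 2 * h)"
proof -
 have t: "x \<in> vertices n" "y \<in> vertices n" "z \<in> vertices n" "side x y z > 0"
  "{x, y} \<in> lifted n \<tau> \<union> polygon_sides n" "{y, z} \<in> lifted n \<tau> \<union> polygon_sides n" "{x, z} \<in> lifted n \<tau> \<union> polygon_sides n"
  using assms unfolding triangle_def ccw_side by (auto simp: insert_commute)
 obtain i where i: "x = vtx n i" using t(1) vertices_vtx[of x n] by auto
 have rep: "\<exists>c. w = vtx n c \<and> i \<le> c \<and> c < i + m" if w: "w \<in> vertices n" for w
 proof -
  obtain c where c: "w = vtx n c" using w vertices_vtx[of w n] by auto
  obtain c' k where c': "c' = c + k * m" "i \<le> c'" "c' < i + m" using vtx_rep[of c n i] by blast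
  have "w = vtx n c'" using c vtx_period[of n c k] unfolding c'(1) by simp
  then show ?thesis using c'(2,3) by (intro exI[of _ c'] conjI)
 qed
 obtain q where q: "y = vtx n q" "i \<le> q" "q < i + m" using rep[OF t(2)] by blast
 obtain j where j: "z = vtx n j" "i \<le> j" "j < i + m" using rep[OF t(3)] by blast
 have "side x x z = 0" by (simp add: side_def)
 then have "q \<noteq> i" "j \<noteq> i" "j \<noteq> q" using t(4) i q(1) j(1) by auto
 moreover have "\<not> (i < j \<and> j < q)" using side_vtx_neg[of i j q n] t(4) q j i by auto
 ultimately have o: "i < q" "q < j" using q j by auto
 have im: "vtx n (i + m) = x" "vtx n (q + m) = y" using vtx_period[of n _ 1] i q by auto
 have s1: "segment i q \<or> segment q (i + m)" using segment_iff[of i q] t(5) i q o by auto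
 have s2: "segment q j \<or> segment j (q + m)" using segment_iff[of q j] t(6) j q o by auto
 have s3: "segment i j \<or> segment j (i + m)" using segment_iff[of i j] t(7) i j o by auto
 have I: "(a, b) \<in> I" if "segment a b" "a + 1 < b" for a b using that unfolding segment_def by auto
 show thesis
 proof (cases "segment i j")
  case True
  then have "\<not> segment q (i + m)" "\<not> segment j (q + m)"
   using segment_bounds(2) o by (auto dest!: segment_bounds(2))
  then have "tri i q j" unfolding tri_def using I[OF True] s1 s2 o by auto
  then show thesis using that(1) i q j by blast
 next
  case False
  then have s3: "segment j (i + m)" using s3 by simp
  show thesis
  proof (cases "segment q (i + m)")
   case True
   then have "\<not> segment j (q + m)" using o j(3) by (auto dest!: segment_bounds(2))
   then have "tri q j (i + m)" unfolding tri_def using I[OF True] s2 s3 o j by auto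
   then show thesis using that(1)[of q j "i + m"] im q j by blast
  next
   case False
   then have s1: "segment i q" using s1 by simp
   show thesis
   proof (cases "segment j (q + m)")
    case True
    then have "tri j (i + m) (q + m)"
     unfolding tri_def using I[OF True] s3 segment_shift_m[of i 1 q] s1 o j by auto
    then show thesis using that(1)[of j "i + m" "q + m"] im j by blast
   next
    case False
    then have "segment q j" using s2 by simp
    then have "q = i + h" "j = i + 2 * h"
     using segment_bounds(2)[OF s1] segment_bounds(2)[OF s3] segment_bounds(2)[of q j] by auto
    then show thesis using that(2)[of i] I[OF s1] n i q j by auto
   qed
  qed
 qed
qed

end

subsection \<open>The quiver of the orbifold\<close>

context triangulated
begin

text \<open>The chords below the chosen lift of the pending arc; they contain exactly one chord of I
  from each orbit of shifts.\<close>

definition D :: "chord set" where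
 "D = {x \<in> I. lo \<le> fst x \<and> snd x \<le> lo + h}"

lemma D_I: "x \<in> D \<Longrightarrow> x \<in> I" by (simp add: D_def)

lemma I_not_interlaced': "x \<in> I \<Longrightarrow> y \<in> I \<Longrightarrow> \<not> interlaced (fst x) (snd x) (fst y) (snd y)"
 using I_not_interlaced[of "fst x" "snd x" "fst y" "snd y"] by simp

lemma I_bounds: "x \<in> I \<Longrightarrow> fst x + 2 \<le> snd x" "x \<in> I \<Longrightarrow> snd x \<le> fst x + h" using I_D[of "fst x" "snd x"] by auto

lemma D_iff: "(i, j) \<in> D \<longleftrightarrow> (i, j) \<in> I \<and> lo \<le> i \<and> j \<le> lo + h" by (simp add: D_def)

end

sublocale triangulated \<subseteq> polygon_triangulation D lo "lo + int n + 1"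
proof
 have *: "lo + int n + 1 = lo + h" by simp
 show "(lo, lo + int n + 1) \<in> D" unfolding * D_iff using root_I by simp
 show "lo \<le> i \<and> i + 2 \<le> j \<and> j \<le> lo + int n + 1" if "(i, j) \<in> D" for i j
  using that I_D(1)[of i j] unfolding D_iff by auto
 show False if "(i, j) \<in> D" "(k, l) \<in> D" "i < k" "k < j" "j < l" for i j k l
  using that I_not_interlaced[of i j k l] unfolding D_iff interlaced_def by blast
 show "\<exists>k. i < k \<and> k < j \<and> ((i, k) \<in> D \<or> k = i + 1) \<and> ((k, j) \<in> D \<or> j = k + 1)" if ij: "(i, j) \<in> D" for i j
 proof -
  have "(i, j) \<in> I" using ij unfolding D_iff by blast
  then obtain k where "i < k" "k < j" "(i, k) \<in> I \<or> k = i + 1" "(k, j) \<in> I \<or> j = k + 1"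
   using I_apex by blast
  then show ?thesis using ij unfolding D_iff by (intro exI[of _ k]) auto
 qed
qed

context triangulated
begin

lemma D_bounds: "x \<in> D \<Longrightarrow> lo \<le> fst x" "x \<in> D \<Longrightarrow> snd x \<le> lo + h" "x \<in> D \<Longrightarrow> fst x < lo + h"
 using chord_bounds[of x] by auto

abbreviation chord_at :: "int \<Rightarrow> chord \<Rightarrow> complex set" where
 "chord_at t x \<equiv> lift n (shift n t x)"

abbreviation Q :: "(arc_class, lifted_arrow set) quiver" where "Q \<equiv> quiver_of n \<tau>"

abbreviation R :: "(lifted_arrow set \<times> lifted_arrow set) set" where "R \<equiv> jacobian_relations n \<tau>"

text \<open>The shifts of the root divide the boundary line into periods of length h, and no chord
  of I crosses them; so the left end decides the period.\<close>

lemma I_cases: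
 assumes "x \<in> I"
 obtains y t where "y \<in> D" "x = shift n t y"
proof -
 define t where "t = (fst x - lo) div h"
 define y where "y = shift n (- t) x"
 have x: "x = shift n t y" by (simp add: y_def)
 have yI: "y \<in> I" unfolding y_def using assms by (simp only: shift_I)
 have fst_x: "fst x - lo = t * h + (fst x - lo) mod h" unfolding t_def by (rule div_mult_mod_eq[symmetric])
 have "fst y = lo + (fst x - lo) mod h" using fst_x by (simp add: y_def)
 moreover have "0 \<le> (fst x - lo) mod h" "(fst x - lo) mod h < h" by (rule pos_mod_sign pos_mod_bound, simp)+
 ultimately have r: "lo \<le> fst y" "fst y < lo + h" by linarith+
 have "\<not> interlaced lo (lo + h) (fst y) (snd y)" using I_not_interlaced'[OF root_I yI] by simp
 then have "snd y \<le> lo + h" using r I_bounds[OF yI] unfolding interlaced_def by auto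
 then have "y \<in> D" using yI r by (simp add: D_def)
 then show thesis using that x by blast
qed

lemma shift_D_eq:
 assumes "x \<in> D" "y \<in> D" "shift n s x = shift n t y" shows "s = t" "x = y"
proof -
 have e: "fst x + s * h = fst y + t * h" "snd x + s * h = snd y + t * h"
  using assms(3) by (simp_all add: prod_eq_iff)
 have d: "(s - t) * h = fst y - fst x" using e(1) by (simp add: algebra_simps)
 have "(s - t) * h < 1 * h" "- 1 * h < (s - t) * h" unfolding d using D_bounds(1,3)[OF assms(1)] D_bounds(1,3)[OF assms(2)] by auto
 then have "s - t < 1" "- 1 < s - t" by (auto simp only: mult_less_cancel_right)
 then show "s = t" by simp
 then show "x = y" using e by (simp add: prod_eq_iff)
qed

lemma lft_I: "x \<in> D \<Longrightarrow> (fst x, apex x) \<in> I \<longleftrightarrow> lft x \<in> D" and rgt_I: "x \<in> D \<Longrightarrow> (apex x, snd x) \<in> I \<longleftrightarrow> rgt x \<in> D"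
 using apex(1,2)[of x] D_bounds[of x] by (simp_all add: lft_def rgt_def D_iff)

lemma segment_apex: "x \<in> D \<Longrightarrow> segment (fst x) (apex x)" "x \<in> D \<Longrightarrow> segment (apex x) (snd x)"
 using apex(3,4)[of x] lft_I[of x] rgt_I[of x] unfolding segment_def by auto

text \<open>Two candidates r < s would make the chords (fst x, s) and (r, snd x) cross.\<close>

lemma apex_unique:
 assumes x: "x \<in> D" and q: "segment (fst x) q" "segment q (snd x)" shows "q = apex x"
proof -
 have no: "\<not> r < s" if "segment (fst x) r" "segment r (snd x)" "segment (fst x) s" "segment s (snd x)" for r s
 proof
  assume "r < s"
  have b: "fst x < r" "s < snd x" using segment_bounds(1) that by auto
  then have "(fst x, s) \<in> I" "(r, snd x) \<in> I" using that \<open>r < s\<close> unfolding segment_def by auto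
  then show False using I_not_interlaced[of "fst x" s r "snd x"] b \<open>r < s\<close> unfolding interlaced_def by auto
 qed
 show ?thesis using no[OF q segment_apex[OF x]] no[OF segment_apex[OF x] q] by auto
qed

lemma tri_cases:
 assumes "tri i q j"
 obtains x t where "x \<in> D" "i = fst x + t * h" "q = apex x + t * h" "j = snd x + t * h"
proof -
 have ij: "(i, j) \<in> I" using assms by (simp add: tri_def)
 obtain x t where x: "x \<in> D" "(i, j) = shift n t x" by (rule I_cases[OF ij])
 have e: "i = fst x + t * h" "j = snd x + t * h" using x(2) by (simp_all add: shift_def)
 define p where "p = q - t * h"
 have q: "q = p + t * h" by (simp add: p_def)
 have "segment (fst x) p" "segment p (snd x)"
  using assms segment_shift[of "fst x" t p] segment_shift[of p t "snd x"] unfolding tri_def e q by blast+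
 then have "p = apex x" by (rule apex_unique[OF x(1)])
 then show thesis using that[OF x(1), of t] e q by simp
qed

lemma tri_apex: "x \<in> D \<Longrightarrow> tri (fst x) (apex x) (snd x)"
 using segment_apex[of x] D_I[of x] by (simp add: tri_def)

lemma tri_shift: "tri (i + t * h) (q + t * h) (j + t * h) \<longleftrightarrow> tri i q j"
 unfolding tri_def I_shift segment_shift ..

lemma central_cases:
 assumes "(i, i + h) \<in> I"
 obtains t where "i = lo + t * h"
proof -
 obtain x t where x: "x \<in> D" "(i, i + h) = shift n t x" by (rule I_cases[OF assms])
 then have "i = fst x + t * h" "i + h = snd x + t * h" by (simp_all add: shift_def)
 then have "fst x = lo" using D_bounds[OF x(1)] by linarith
 then show thesis using that[of t] \<open>i = fst x + t * h\<close> by simp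
qed

lemma vtx_pairs:
 "{vtx n (fst x + t * h), vtx n (snd x + t * h)} = chord_at t x"
 "{vtx n (snd x + t * h), vtx n (fst x + t * h)} = chord_at t x"
 "{vtx n (fst x + t * h), vtx n (apex x + t * h)} = chord_at t (lft x)"
 "{vtx n (apex x + t * h), vtx n (snd x + t * h)} = chord_at t (rgt x)"
 "{vtx n (apex x + t * h), vtx n (fst x + t * h)} = chord_at t (lft x)"
 "{vtx n (snd x + t * h), vtx n (apex x + t * h)} = chord_at t (rgt x)"
 by (simp_all add: lift_def insert_commute)

lemma central_pairs:
 "{vtx n (lo + t * h), vtx n (lo + t * h + h)} = chord_at t root"
 "{vtx n (lo + t * h + h), vtx n (lo + t * h + 2 * h)} = chord_at (t + 1) root"
 "{vtx n (lo + t * h + 2 * h), vtx n (lo + t * h)} = chord_at (t + 2) root"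
proof -
 have "vtx n (lo + t * h) = vtx n (lo + t * h + m)" using vtx_period[of n _ 1] by simp
 then show "{vtx n (lo + t * h + 2 * h), vtx n (lo + t * h)} = chord_at (t + 2) root"
  by (simp add: lift_def algebra_simps)
qed (simp_all add: lift_def algebra_simps)

lemma lift_lifted:
 assumes "x \<in> D" shows "chord_at t x \<in> lifted n \<tau>"
  "chord_at t (lft x) \<in> lifted n \<tau> \<longleftrightarrow> lft x \<in> D"
  "chord_at t (rgt x) \<in> lifted n \<tau> \<longleftrightarrow> rgt x \<in> D"
proof -
 have "shift n t x \<in> I" using D_I[OF assms] by (simp only: shift_I)
 then show "chord_at t x \<in> lifted n \<tau>" unfolding lifted_eq by blast
 have b: "fst x < apex x" "apex x < snd x" "snd x \<le> fst x + h"
  using apex(1,2)[OF assms] I_bounds(2)[OF D_I[OF assms]] by auto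
 show "chord_at t (lft x) \<in> lifted n \<tau> \<longleftrightarrow> lft x \<in> D"
  using lifted_iff[of "fst x + t * h" "apex x + t * h"] b lft_I[OF assms] I_shift[of "fst x" t "apex x"]
  by (simp add: lift_def)
 show "chord_at t (rgt x) \<in> lifted n \<tau> \<longleftrightarrow> rgt x \<in> D"
  using lifted_iff[of "apex x + t * h" "snd x + t * h"] b rgt_I[OF assms] I_shift[of "apex x" t "snd x"]
  by (simp add: lift_def)
qed

lemma triangle_sides:
 assumes "triangle n \<tau> x y z"
 obtains w t where "w \<in> D"
   "({x, y}, {y, z}, {z, x}) \<in> {(chord_at t (lft w), chord_at t (rgt w), chord_at t w),
     (chord_at t (rgt w), chord_at t w, chord_at t (lft w)),
     (chord_at t w, chord_at t (lft w), chord_at t (rgt w))}"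
 | t where "{x, y} = chord_at t root" "{y, z} = chord_at (t + 1) root"
   "{z, x} = chord_at (t + 2) root" using assms
proof (cases rule: triangle_cases)
 case (1 i q j)
 obtain w t where w: "w \<in> D" "i = fst w + t * h" "q = apex w + t * h" "j = snd w + t * h"
  by (rule tri_cases[OF 1(1)])
 consider "x = vtx n i" "y = vtx n q" "z = vtx n j" | "x = vtx n q" "y = vtx n j" "z = vtx n i"
  | "x = vtx n j" "y = vtx n i" "z = vtx n q" using 1(2) by auto
 then show thesis by cases (rule that(1)[OF w(1), of t], simp only: w vtx_pairs insertI1 insertI2)+
next
 case (2 i)
 obtain t where t: "i = lo + t * h" by (rule central_cases[OF 2(1)])
 show thesis by (rule that(2)[of t]) (simp_all only: 2(2-4) t central_pairs)
qed

lemma sides_triangle: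
 assumes "w \<in> D"
 obtains x y z where "triangle n \<tau> x y z" "{x, y} = chord_at t (lft w)"
  "{y, z} = chord_at t (rgt w)" "{z, x} = chord_at t w"
proof (rule that)
 show "triangle n \<tau> (vtx n (fst w + t * h)) (vtx n (apex w + t * h)) (vtx n (snd w + t * h))"
  by (rule tri_triangle) (simp only: tri_shift tri_apex[OF assms])
qed (simp_all only: vtx_pairs)

lemma sides_central:
 obtains x y z where "triangle n \<tau> x y z" "{x, y} = chord_at t root"
  "{y, z} = chord_at (t + 1) root" "{z, x} = chord_at (t + 2) root"
proof (rule that)
 have "(lo + t * h, lo + t * h + h) \<in> I" using root_I I_shift[of lo t "lo + h"] by (simp add: algebra_simps)
 then show "triangle n \<tau> (vtx n (lo + t * h)) (vtx n (lo + t * h + h)) (vtx n (lo + t * h + 2 * h))"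
  by (rule central_triangle)
qed (simp_all only: central_pairs)

lemma lifted_arrows_cases:
 assumes "(d, e) \<in> lifted_arrows n \<tau>"
 obtains u v t where "(u, v) \<in> edges" "d = chord_at t u" "e = chord_at t v"
 | t where "d = chord_at (t + 1) root" "e = chord_at t root"
proof -
 obtain x y z where xyz: "triangle n \<tau> x y z" "d = {y, z}" "e = {x, y}" "{y, z} \<in> lifted n \<tau>" "{x, y} \<in> lifted n \<tau>"
  using assms unfolding lifted_arrows_def by auto
 from xyz(1) show thesis
 proof (cases rule: triangle_sides)
  case (1 w t)
  then consider "{x, y} = chord_at t (lft w)" "{y, z} = chord_at t (rgt w)"
   | "{x, y} = chord_at t (rgt w)" "{y, z} = chord_at t w"
   | "{x, y} = chord_at t w" "{y, z} = chord_at t (lft w)"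
   unfolding insert_iff empty_iff prod.inject by argo
  then show thesis
  proof cases
   case a: 1
   then have "(rgt w, lft w) \<in> edges" using xyz lift_lifted[OF 1(1)] edgesI(3)[OF 1(1)] by simp
   then show thesis using that(1)[of "rgt w" "lft w" t] a xyz by simp
  next
   case a: 2
   then have "(w, rgt w) \<in> edges" using xyz lift_lifted[OF 1(1)] edgesI(1)[OF 1(1)] by simp
   then show thesis using that(1)[of w "rgt w" t] a xyz by simp
  next
   case a: 3
   then have "(lft w, w) \<in> edges" using xyz lift_lifted[OF 1(1)] edgesI(2)[OF 1(1)] by simp
   then show thesis using that(1)[of "lft w" w t] a xyz by simp
  qed
 next
  case (2 t)
  then show thesis using that(2)[of t] xyz by simp
 qed
qed

lemma lifted_arrowsI:
 "triangle n \<tau> x y z \<Longrightarrow> {y, z} \<in> lifted n \<tau> \<Longrightarrow> {x, y} \<in> lifted n \<tau> \<Longrightarrow> ({y, z}, {x, y}) \<in> lifted_arrows n \<tau>"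
 unfolding lifted_arrows_def by blast

lemma edge_lifted_arrow:
 assumes "(u, v) \<in> edges" shows "(chord_at t u, chord_at t v) \<in> lifted_arrows n \<tau>" using assms
proof (cases rule: edges_cases)
 case down
 obtain x y z where xyz: "triangle n \<tau> x y z" "{x, y} = chord_at t (lft u)"
  "{y, z} = chord_at t (rgt u)" "{z, x} = chord_at t u" by (rule sides_triangle[OF down(1)])
 show ?thesis
  using lifted_arrowsI[OF triangle_rotate[OF xyz(1)]] lift_lifted[OF down(1), of t] down xyz by simp
next
 case up
 obtain x y z where xyz: "triangle n \<tau> x y z" "{x, y} = chord_at t (lft v)"
  "{y, z} = chord_at t (rgt v)" "{z, x} = chord_at t v" by (rule sides_triangle[OF up(2)])
 show ?thesis
  using lifted_arrowsI[OF triangle_rotate[OF triangle_rotate[OF xyz(1)]]] lift_lifted[OF up(2), of t] up xyz by simp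
next
 case (across w)
 obtain x y z where xyz: "triangle n \<tau> x y z" "{x, y} = chord_at t (lft w)"
  "{y, z} = chord_at t (rgt w)" "{z, x} = chord_at t w" by (rule sides_triangle[OF across(1)])
 show ?thesis using lifted_arrowsI[OF xyz(1)] lift_lifted[OF across(1), of t] across xyz by simp
qed

lemma central_lifted_arrow: "(chord_at (t + 1) root, chord_at t root) \<in> lifted_arrows n \<tau>"
proof -
 obtain x y z where xyz: "triangle n \<tau> x y z" "{x, y} = chord_at t root"
  "{y, z} = chord_at (t + 1) root" "{z, x} = chord_at (t + 2) root" by (rule sides_central)
 show ?thesis using lifted_arrowsI[OF xyz(1)] lift_lifted(1)[OF root_mem] xyz by simp
qed

definition cl :: "chord \<Rightarrow> arc_class" where "cl x = cls n (fst x) (snd x)"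

definition ar :: "chord \<Rightarrow> chord \<Rightarrow> lifted_arrow set" where "ar u v = orbit (lift n u, lift n v)"

definition ep :: "lifted_arrow set" where "ep = orbit (chord_at 1 root, lift n root)"

lemma orbit_root: "orbit (chord_at (t + 1) root, chord_at t root) = ep"
 using orbit_shift[of n t "shift n 1 root" root] by (simp add: ep_def)

lemma project_cl: "x \<in> D \<Longrightarrow> project n (chord_at t x) = cl x"
 using project_lift[of "shift n t x"] D_I[of x] cls_shift[of n "fst x" t "snd x"]
 by (simp only: shift_I fst_shift snd_shift cl_def)

lemma tail_orbit:
 assumes "x \<in> D" "y \<in> D" shows "tail Q (orbit (chord_at s x, chord_at t y)) = cl x"
  "head Q (orbit (chord_at s x, chord_at t y)) = cl y"
proof -
 have o: "orbit (chord_at s x, chord_at t y) =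
  range (\<lambda>r. (chord_at (r + s) x, chord_at (r + t) y))" unfolding orbit_lift shift_shift by auto
 have "project n ` fst ` orbit (chord_at s x, chord_at t y) = {cl x}"
  "project n ` snd ` orbit (chord_at s x, chord_at t y) = {cl y}"
  unfolding o image_image fst_conv snd_conv project_cl[OF assms(1)] project_cl[OF assms(2)] by simp_all
 then show "tail Q (orbit (chord_at s x, chord_at t y)) = cl x"
  "head Q (orbit (chord_at s x, chord_at t y)) = cl y" by (simp_all add: quiver_of_def)
qed

lemma arcs_eq: "arcs Q = insert ep {ar u v |u v. (u, v) \<in> edges}"
proof -
 have "orbit ` lifted_arrows n \<tau> = insert ep {ar u v |u v. (u, v) \<in> edges}"
 proof (intro set_eqI iffI)
  fix a assume "a \<in> orbit ` lifted_arrows n \<tau>"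
  then obtain d e where de: "(d, e) \<in> lifted_arrows n \<tau>" "a = orbit (d, e)" by auto
  from de(1) show "a \<in> insert ep {ar u v |u v. (u, v) \<in> edges}"
  proof (cases rule: lifted_arrows_cases)
   case (1 u v t)
   then have "a = ar u v" using de(2) by (simp add: orbit_shift ar_def)
   then show ?thesis using 1(1) by blast
  next
   case (2 t)
   then have "a = ep" using de(2) orbit_root by simp
   then show ?thesis by simp
  qed
 next
  fix a assume "a \<in> insert ep {ar u v |u v. (u, v) \<in> edges}"
  then consider "a = ep" | u v where "a = ar u v" "(u, v) \<in> edges" by blast
  then show "a \<in> orbit ` lifted_arrows n \<tau>"
  proof cases
   case 1
   show ?thesis unfolding 1 ep_def using central_lifted_arrow[of 0] by simp
  next
   case 2
   show ?thesis unfolding 2(1) ar_def using edge_lifted_arrow[OF 2(2), of 0] by simp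
  qed
 qed
 then show ?thesis by (simp add: quiver_of_def)
qed

lemma cl_D: "\<tau> = cl ` D"
proof
 show "\<tau> \<subseteq> cl ` D"
 proof
  fix A assume "A \<in> \<tau>"
  then obtain a b where ab: "(a, b) \<in> I" "A = cls n a b" by (rule \<tau>_cases)
  obtain x t where x: "x \<in> D" "(a, b) = shift n t x" by (rule I_cases[OF ab(1)])
  have "a = fst x + t * (int n + 1)" "b = snd x + t * (int n + 1)" using x(2) by (simp_all add: shift_def)
  then have "A = cl x" using ab(2) by (simp only: cls_shift cl_def)
  then show "A \<in> cl ` D" using x(1) by blast
 qed
 show "cl ` D \<subseteq> \<tau>" using D_I I_D(3) by (auto simp: cl_def)
qed

lemma inj_cl: "inj_on cl D"
proof (rule inj_onI)
 fix x y assume xy: "x \<in> D" "y \<in> D" "cl x = cl y"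
 obtain k where k: "fst y = fst x + k * h" "snd y = snd x + k * h"
  by (rule I_cls_eq[of "fst x" "snd x" "fst y" "snd y"]) (use xy D_I in \<open>simp_all add: cl_def\<close>)
 then have "shift n 0 y = shift n k x" by (simp add: prod_eq_iff)
 then show "x = y" using shift_D_eq xy by metis
qed

lemma relations_eq: "R = insert (ep, ep)
  ({(ar (rgt x) (lft x), ar x (rgt x)) |x. x \<in> D \<and> lft x \<in> D \<and> rgt x \<in> D} \<union>
  {(ar (lft x) x, ar (rgt x) (lft x)) |x. x \<in> D \<and> lft x \<in> D \<and> rgt x \<in> D} \<union>
  {(ar x (rgt x), ar (lft x) x) |x. x \<in> D \<and> lft x \<in> D \<and> rgt x \<in> D})"
 (is "_ = ?R")
proof (intro set_eqI iffI)
 fix r assume "r \<in> R"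
 then obtain x y z where xyz: "triangle n \<tau> x y z" "{x, y} \<in> lifted n \<tau>" "{y, z} \<in> lifted n \<tau>" "{z, x} \<in> lifted n \<tau>"
  and r: "r = (orbit ({x, y}, {z, x}), orbit ({y, z}, {x, y}))" unfolding jacobian_relations_def by auto
 from xyz(1) show "r \<in> ?R"
 proof (cases rule: triangle_sides)
  case (1 w t)
  from 1(2) consider
    "{x, y} = chord_at t (lft w)" "{y, z} = chord_at t (rgt w)" "{z, x} = chord_at t w"
   | "{x, y} = chord_at t (rgt w)" "{y, z} = chord_at t w" "{z, x} = chord_at t (lft w)"
   | "{x, y} = chord_at t w" "{y, z} = chord_at t (lft w)" "{z, x} = chord_at t (rgt w)"
   unfolding insert_iff empty_iff prod.inject by argo
  then show ?thesis
  proof cases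
   case a: 1
   have "lft w \<in> D" "rgt w \<in> D" using a xyz lift_lifted[OF 1(1)] by simp_all
   moreover have "r = (ar (lft w) w, ar (rgt w) (lft w))" unfolding r a orbit_shift ar_def ..
   ultimately show ?thesis using 1(1) by blast
  next
   case a: 2
   have "lft w \<in> D" "rgt w \<in> D" using a xyz lift_lifted[OF 1(1)] by simp_all
   moreover have "r = (ar (rgt w) (lft w), ar w (rgt w))" unfolding r a orbit_shift ar_def ..
   ultimately show ?thesis using 1(1) by blast
  next
   case a: 3
   have "lft w \<in> D" "rgt w \<in> D" using a xyz lift_lifted[OF 1(1)] by simp_all
   moreover have "r = (ar w (rgt w), ar (lft w) w)" unfolding r a orbit_shift ar_def ..
   ultimately show ?thesis using 1(1) by blast
  qed
 next
  case (2 t)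
  \<comment> \<open>Three shifts are a full rotation of the polygon. So every arrow of the central
    triangle leads from one lift of the pending arc to the preceding one, and all of them lie in the
    orbit \<open>ep\<close>.\<close>
  have "chord_at (t + 2) root = chord_at (t - 1) root"
   using lift_shift_3[of 1 "shift n (t - 1) root"] by (simp add: add.commute)
  then have "r = (ep, ep)" using orbit_root[of t] orbit_root[of "t - 1"] unfolding r 2 by simp
  then show ?thesis by simp
 qed
next
 have rel: "(orbit ({x, y}, {z, x}), orbit ({y, z}, {x, y})) \<in> R"
  if "triangle n \<tau> x y z" "{x, y} \<in> lifted n \<tau>" "{y, z} \<in> lifted n \<tau>" "{z, x} \<in> lifted n \<tau>" for x y z
  unfolding jacobian_relations_def using that by blast
 have eps: "(ep, ep) \<in> R"
 proof -
  obtain x y z where xyz: "triangle n \<tau> x y z" "{x, y} = chord_at 0 root"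
   "{y, z} = chord_at (0 + 1) root" "{z, x} = chord_at (0 + 2) root" by (rule sides_central)
  have "chord_at (0 + 2) root = chord_at (0 - 1) root"
   using lift_shift_3[of 1 "shift n (0 - 1) root"] by simp
  then have "orbit ({x, y}, {z, x}) = ep" "orbit ({y, z}, {x, y}) = ep"
   using orbit_root[of 0] orbit_root[of "0 - 1"] unfolding xyz by simp_all
  then show ?thesis using rel[OF xyz(1)] lift_lifted(1)[OF root_mem] lift_lifted(1)[OF root_mem, of 0] unfolding xyz by simp
 qed
 have int: "(ar (lft w) w, ar (rgt w) (lft w)) \<in> R"
  "(ar (rgt w) (lft w), ar w (rgt w)) \<in> R"
  "(ar w (rgt w), ar (lft w) w) \<in> R" if w: "w \<in> D" "lft w \<in> D" "rgt w \<in> D" for w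
 proof -
  obtain x y z where xyz: "triangle n \<tau> x y z" "{x, y} = chord_at 0 (lft w)"
   "{y, z} = chord_at 0 (rgt w)" "{z, x} = chord_at 0 w" by (rule sides_triangle[OF w(1)])
  have l: "{x, y} \<in> lifted n \<tau>" "{y, z} \<in> lifted n \<tau>" "{z, x} \<in> lifted n \<tau>"
   unfolding xyz using lift_lifted[OF w(1)] w by blast+
  note t = xyz(1) triangle_rotate[OF xyz(1)] triangle_rotate[OF triangle_rotate[OF xyz(1)]]
  show "(ar (lft w) w, ar (rgt w) (lft w)) \<in> R"
   "(ar (rgt w) (lft w), ar w (rgt w)) \<in> R"
   "(ar w (rgt w), ar (lft w) w) \<in> R"
   using rel[OF t(1) l(1,2,3)] rel[OF t(2) l(2,3,1)] rel[OF t(3) l(3,1,2)] unfolding xyz(2-4) by (simp_all add: ar_def)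
 qed
 fix r assume "r \<in> ?R"
 then show "r \<in> R" using eps int by blast
qed

end

sublocale triangulated \<subseteq> tree_quiver D lo "lo + int n + 1" "quiver_of n \<tau>" "jacobian_relations n \<tau>" cl ar ep
proof
 have ends: "tail Q (ar u v) = cl u" "head Q (ar u v) = cl v" if "u \<in> D" "v \<in> D" for u v
  using tail_orbit[OF that, of 0 0] by (simp_all add: ar_def)
 show "tail Q (ar u v) = cl u" "head Q (ar u v) = cl v" if "(u, v) \<in> edges" for u v
  using ends edges_mem[OF that] by blast+
 show "tail Q ep = cl root" "head Q ep = cl root"
  using tail_orbit[OF root_mem root_mem, of 1 0] by (simp_all add: ep_def)
 show "verts Q = cl ` D" using cl_D by (simp add: quiver_of_def)
qed (rule inj_cl arcs_eq relations_eq)+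

subsection \<open>Diagonals crossed by a chord\<close>

lemma sum_fun_apply: "(\<Sum>j\<in>F. g j) k = (\<Sum>j\<in>F. g j k)" by (induction F rule: infinite_finite_induct) auto

lemma (in linorder) sorted_key_list_of_set_properties:
 assumes "inj_on f X" "finite X"
 shows "set (sorted_key_list_of_set f X) = X" "distinct (sorted_key_list_of_set f X)"
  "sorted_wrt (\<lambda>a b. f a < f b) (sorted_key_list_of_set f X)"
proof -
 interpret s: folding_insort_key less_eq less X f by unfold_locales (rule assms(1))
 have d: "distinct (map f (sorted_key_list_of_set f X))"
  by (rule s.distinct_sorted_key_list_of_set[OF subset_refl])
 have "sorted (map f (sorted_key_list_of_set f X))" by (rule s.sorted_sorted_key_list_of_set[OF subset_refl])
 then have "sorted_wrt (<) (map f (sorted_key_list_of_set f X))" using d unfolding strict_sorted_iff by blast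
 then show "sorted_wrt (\<lambda>a b. f a < f b) (sorted_key_list_of_set f X)" unfolding sorted_wrt_map .
 show "set (sorted_key_list_of_set f X) = X" by (rule s.set_sorted_key_list_of_set[OF subset_refl assms(2)])
 show "distinct (sorted_key_list_of_set f X)" using d unfolding distinct_map by blast
qed

context triangulated
begin

text \<open>Diagonals of the triangulation and sides of the polygon do not cross (c, d), so both
  ends lie on the same closed side of it.\<close>

lemma side_lifted_nonneg:
 assumes "(c, d) \<in> I" "{u, w} \<in> lifted n \<tau> \<union> polygon_sides n"
 shows "0 \<le> side (vtx n c) (vtx n d) u * side (vtx n c) (vtx n d) w"
proof (rule ccontr)
 obtain a b where ab: "segment a b" "{u, w} = {vtx n a, vtx n b}"
  using assms(2) unfolding lifted_eq polygon_sides_vtx lift_def segment_def by fastforce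
 assume "\<not> 0 \<le> side (vtx n c) (vtx n d) u * side (vtx n c) (vtx n d) w"
 then have neg: "side (vtx n c) (vtx n d) (vtx n a) * side (vtx n c) (vtx n d) (vtx n b) < 0"
  using ab(2) by (auto simp: doubleton_eq_iff mult.commute)
 have len: "a < b" "b < a + m" using segment_bounds[OF ab(1)] by auto
 obtain k where k: "interlaced c d (a + k * m) (b + k * m)"
  using side_interlaced[OF I_mem(2,1)[OF assms(1)] len neg] by blast
 have "segment (a + k * m) (b + k * m)" using ab(1) unfolding segment_shift_m .
 then show False using I_not_interlaced[OF assms(1)] k unfolding segment_def interlaced_def by auto
qed

end

locale crossing_chord = triangulated +
 fixes A B :: int
 assumes AB: "2 \<le> B - A" "B - A \<le> h" "(A, B) \<notin> I"
begin

definition crossed :: "complex set set" where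
 "crossed = lift n ` {y \<in> I. interlaced A B (fst y) (snd y)}"

lemma AB_vtx: "vtx n A \<noteq> vtx n B" using vtx_distinct[of A B n] AB by auto

lemma interlaced_bounds:
 assumes "y \<in> I" "interlaced A B (fst y) (snd y)"
 shows "snd y < A + m" "B < fst y + m" "A < B" "fst y < snd y" "A - h < fst y" "fst y < B"
 using assms(2) AB I_bounds[OF assms(1)] unfolding interlaced_def by auto

text \<open>Crossing in the plane against interlacing on the universal cover: a common inner point
  forces some lift of s to interlace, by \<open>chords_disjoint\<close>, and interlaced chords meet,
  by \<open>interlaced_meet\<close>.\<close>

lemma crossed_eq: "{s \<in> lifted n \<tau>. open_segment (vtx n A) (vtx n B) \<inter> convex hull s \<noteq> {}} = crossed"
proof (intro set_eqI iffI)
 fix s assume s: "s \<in> {s \<in> lifted n \<tau>. open_segment (vtx n A) (vtx n B) \<inter> convex hull s \<noteq> {}}"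
 then obtain y z where y: "y \<in> I" "s = lift n y" and z: "z \<in> open_segment (vtx n A) (vtx n B)" "z \<in> convex hull s"
  unfolding lifted_eq by blast
 have yI: "(fst y, snd y) \<in> I" using y(1) by simp
 have z2: "z \<in> closed_segment (vtx n (fst y)) (vtx n (snd y))"
  using z(2) y(2) by (simp add: lift_def segment_convex_hull)
 have z1: "z \<in> closed_segment (vtx n A) (vtx n B)" "z \<noteq> vtx n A" "z \<noteq> vtx n B"
  using z(1) unfolding open_segment_def by auto
 have "\<exists>k. interlaced A B (fst y + k * m) (snd y + k * m)"
 proof (rule ccontr)
  assume no: "\<nexists>k. interlaced A B (fst y + k * m) (snd y + k * m)"
  have "{vtx n A, vtx n B} \<noteq> {vtx n (fst y), vtx n (snd y)}"
  proof
   assume "{vtx n A, vtx n B} = {vtx n (fst y), vtx n (snd y)}"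
   then have "{vtx n A, vtx n B} \<in> lifted n \<tau>" using y s unfolding lift_def by auto
   then show False using lifted_iff[of A B] AB by auto
  qed
  then show False using chords_disjoint[OF _ _ _ _ _ _ z1(1) z2] z1 no AB I_mem[OF yI] by auto
 qed
 then obtain k where k: "interlaced A B (fst y + k * m) (snd y + k * m)" by blast
 have "shift n (3 * k) y \<in> I" "s = lift n (shift n (3 * k) y)"
  using y by (simp_all only: shift_I lift_shift_3)
 moreover have "interlaced A B (fst (shift n (3 * k) y)) (snd (shift n (3 * k) y))"
  using k by (simp add: algebra_simps)
 ultimately show "s \<in> crossed" unfolding crossed_def by blast
next
 fix s assume "s \<in> crossed"
 then obtain y where y: "y \<in> I" "interlaced A B (fst y) (snd y)" "s = lift n y" unfolding crossed_def by blast
 obtain t where t: "t \<in> {0<..<1}" "linepath (vtx n A) (vtx n B) t \<in> closed_segment (vtx n (fst y)) (vtx n (snd y))"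
  using interlaced_meet[OF y(2) interlaced_bounds(1-4)[OF y(1,2)]] by blast
 have "linepath (vtx n A) (vtx n B) t \<in> open_segment (vtx n A) (vtx n B)"
  using t(1) AB_vtx by (auto simp: in_segment linepath_def)
 moreover have "linepath (vtx n A) (vtx n B) t \<in> convex hull s"
  using t(2) y(3) by (simp add: lift_def segment_convex_hull)
 ultimately show "s \<in> {s \<in> lifted n \<tau>. open_segment (vtx n A) (vtx n B) \<inter> convex hull s \<noteq> {}}"
  using y lifted_eq by blast
qed

lemma finite_crossed: "finite crossed"
proof -
 have "{y \<in> I. interlaced A B (fst y) (snd y)} \<subseteq> {A - h..B} \<times> {A - h..B + h}"
 proof
  fix y assume y: "y \<in> {y \<in> I. interlaced A B (fst y) (snd y)}"
  then show "y \<in> {A - h..B} \<times> {A - h..B + h}"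
   using interlaced_bounds[of y] I_bounds[of y] by (auto simp: mem_Times_iff)
 qed
 then show ?thesis unfolding crossed_def by (intro finite_imageI) (rule finite_subset, auto)
qed

end

text \<open>\<open>arc_rep\<close> obtains its diagonal from a choice operator, so the orientation
  is unknown: x and y are the two ends in either order.\<close>

locale oriented_crossing_chord = crossing_chord +
 fixes x y :: complex
 assumes xy: "{x, y} = lift n (A, B)"
begin

lemma xy_cases: "x = vtx n A \<and> y = vtx n B \<or> x = vtx n B \<and> y = vtx n A"
 using xy by (auto simp: lift_def doubleton_eq_iff)

lemma open_segment_xy: "open_segment x y = open_segment (vtx n A) (vtx n B)"
 using xy_cases by (elim disjE conjE) (simp_all only: open_segment_commute)

lemma crossings_eq: "crossings n \<tau> x y = sorted_key_list_of_set (crossing_time x y) crossed"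
 unfolding crossings_def open_segment_xy crossed_eq ..

lemma crossed_side:
 assumes "s \<in> crossed"
 obtains c d where "(c, d) \<in> I" "interlaced A B c d" "s = {vtx n c, vtx n d}"
  "side (vtx n c) (vtx n d) x * side (vtx n c) (vtx n d) y < 0"
  "side x y (vtx n c) * side x y (vtx n d) < 0"
proof -
 obtain z where z: "z \<in> I" "interlaced A B (fst z) (snd z)" "s = lift n z"
  using assms unfolding crossed_def by blast
 have il: "interlaced (fst z) (snd z) A B" using z(2) unfolding interlaced_def by auto
 note b = interlaced_bounds(1-4)[OF z(1,2)]
 show thesis
 proof (rule that[of "fst z" "snd z"])
  show "side (vtx n (fst z)) (vtx n (snd z)) x * side (vtx n (fst z)) (vtx n (snd z)) y < 0"
   using interlaced_side[OF il b(2,1,4,3)] xy_cases by (auto simp: mult.commute)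
  show "side x y (vtx n (fst z)) * side x y (vtx n (snd z)) < 0"
   using interlaced_side[OF z(2) b(1,2,3,4)] xy_cases side_swap[of "vtx n A" "vtx n B"] by auto
 qed (use z in \<open>simp_all add: lift_def\<close>)
qed

lemma affine_zero:
 fixes p q :: real
 assumes "p * q < 0" "(1 - t) * p + t * q = 0" "(1 - s) * p + s * q = 0" shows "t = s"
proof -
 have "p \<noteq> q" using assms(1) by (auto simp: not_less)
 moreover have "(q - p) * (t - s) = 0" using assms(2,3) by (simp add: algebra_simps)
 ultimately show ?thesis by simp
qed

lemma crossing_time:
 assumes "s \<in> crossed"
 shows "crossing_time x y s \<in> {0<..<1}" "linepath x y (crossing_time x y s) \<in> convex hull s"
proof -
 obtain c d where cd: "s = {vtx n c, vtx n d}" "side (vtx n c) (vtx n d) x * side (vtx n c) (vtx n d) y < 0"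
  using crossed_side[OF assms] by metis
 have hull: "convex hull s = closed_segment (vtx n c) (vtx n d)" unfolding cd(1) by (simp add: segment_convex_hull)
 have "s \<in> {s \<in> lifted n \<tau>. open_segment (vtx n A) (vtx n B) \<inter> convex hull s \<noteq> {}}"
  using assms crossed_eq by simp
 then have "open_segment x y \<inter> convex hull s \<noteq> {}" unfolding open_segment_xy by blast
 then obtain z where z: "z \<in> open_segment x y" "z \<in> convex hull s" by blast
 then obtain t where t: "0 < t" "t < 1" "z = linepath x y t" unfolding in_segment linepath_def by blast
 have ex: "\<exists>!t. t \<in> {0<..<1} \<and> linepath x y t \<in> convex hull s"
 proof (rule ex1I[of _ t])
  show "t \<in> {0<..<1} \<and> linepath x y t \<in> convex hull s" using t z by simp
  fix u assume u: "u \<in> {0<..<1} \<and> linepath x y u \<in> convex hull s"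
  have "side (vtx n c) (vtx n d) (linepath x y u) = 0" "side (vtx n c) (vtx n d) (linepath x y t) = 0"
   using side_segment u t z unfolding hull by blast+
  then show "u = t" unfolding side_linepath using affine_zero[OF cd(2)] by blast
 qed
 from theI'[OF ex] show "crossing_time x y s \<in> {0<..<1}" "linepath x y (crossing_time x y s) \<in> convex hull s"
  unfolding crossing_time_def by blast+
qed

text \<open>A common point of two diagonals of the triangulation is an end point of them. But the
  ends of a crossed diagonal lie strictly on different sides of the line x y, so neither of them is
  a crossing point.\<close>

lemma crossing_time_inj: "inj_on (crossing_time x y) crossed"
proof (rule inj_onI, rule ccontr)
 fix s s' assume s: "s \<in> crossed" "s' \<in> crossed" "crossing_time x y s = crossing_time x y s'" "s \<noteq> s'"
 obtain c d where cd: "(c, d) \<in> I" "s = {vtx n c, vtx n d}" "side x y (vtx n c) * side x y (vtx n d) < 0"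
  using crossed_side[OF s(1)] by metis
 obtain c' d' where cd': "(c', d') \<in> I" "s' = {vtx n c', vtx n d'}" using crossed_side[OF s(2)] by metis
 define z where "z = linepath x y (crossing_time x y s)"
 have z: "z \<in> closed_segment (vtx n c) (vtx n d)" "z \<in> closed_segment (vtx n c') (vtx n d')"
  using crossing_time(2)[OF s(1)] crossing_time(2)[OF s(2)] s(3)
  unfolding z_def cd(2) cd'(2) by (simp_all add: segment_convex_hull)
 have no: "\<not> interlaced c d (c' + k * m) (d' + k * m)" for k
 proof -
  have "(c' + k * m, d' + k * m) = shift n (3 * k) (c', d')" by (simp add: prod_eq_iff algebra_simps)
  then have "(c' + k * m, d' + k * m) \<in> I" using cd'(1) by (simp only: shift_I)
  then show ?thesis using I_not_interlaced[OF cd(1)] by blast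
 qed
 have "z = vtx n c \<or> z = vtx n d"
  by (rule chords_disjoint[OF I_mem(2,1)[OF cd(1)] I_mem(2,1)[OF cd'(1)] no _ z])
   (use s(4) cd(2) cd'(2) in simp)
 moreover have "side x y z = 0" unfolding z_def side_linepath by simp
 ultimately show False using cd(3) by auto
qed

text \<open>
  The side function of a third diagonal does not change sign on a triangle of the triangulation,
  so this diagonal cannot meet \<open>xy\<close> between two sides of the triangle.
\<close>

lemma not_between:
 assumes arrow: "(s, s') \<in> lifted_arrows n \<tau>" and s: "s \<in> crossed" "s' \<in> crossed" "r \<in> crossed"
  and between: "0 < (crossing_time x y r - crossing_time x y s) * (crossing_time x y s' - crossing_time x y r)"
 shows False
proof -
 obtain u v w where uvw: "triangle n \<tau> u v w" "s = {v, w}" "s' = {u, v}"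
  using arrow unfolding lifted_arrows_def by auto
 obtain c d where cd: "(c, d) \<in> I" "r = {vtx n c, vtx n d}"
  "side (vtx n c) (vtx n d) x * side (vtx n c) (vtx n d) y < 0" using crossed_side[OF s(3)] by metis
 let ?g = "side (vtx n c) (vtx n d)"
 have nonneg: "0 \<le> ?g v * ?g w" "0 \<le> ?g u * ?g v" "0 \<le> ?g u * ?g w"
  using side_lifted_nonneg[OF cd(1), of v w] side_lifted_nonneg[OF cd(1), of u v]
   side_lifted_nonneg[OF cd(1), of w u] uvw(1) unfolding triangle_def by (auto simp: mult.commute)
 define t1 t2 t where "t1 = crossing_time x y s" and "t2 = crossing_time x y s'" and "t = crossing_time x y r"
 have seg: "linepath x y t1 \<in> closed_segment v w" "linepath x y t2 \<in> closed_segment u v"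
  "linepath x y t \<in> closed_segment (vtx n c) (vtx n d)"
  using crossing_time(2)[OF s(1)] crossing_time(2)[OF s(2)] crossing_time(2)[OF s(3)]
  unfolding uvw(2,3) cd(2) t1_def t2_def t_def by (simp_all add: segment_convex_hull)
 obtain a where a: "0 \<le> a" "a \<le> 1" "linepath x y t1 = (1 - a) *\<^sub>R v + a *\<^sub>R w"
  using seg(1) unfolding in_segment by blast
 obtain b where b: "0 \<le> b" "b \<le> 1" "linepath x y t2 = (1 - b) *\<^sub>R u + b *\<^sub>R v"
  using seg(2) unfolding in_segment by blast
 have t: "?g (linepath x y t) = 0" by (rule side_segment[OF seg(3)])
 define g1 g2 where "g1 = ?g (linepath x y t1)" and "g2 = ?g (linepath x y t2)"
 have "g1 * g2 = (1 - a) * (1 - b) * (?g u * ?g v) + (1 - a) * b * (?g v)\<^sup>2 +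
   a * (1 - b) * (?g u * ?g w) + a * b * (?g v * ?g w)"
  unfolding g1_def g2_def a(3) b(3) side_affine by (simp add: algebra_simps power2_eq_square)
 also have "\<dots> \<ge> 0"
 proof -
  have c: "0 \<le> (1 - a) * (1 - b)" "0 \<le> (1 - a) * b" "0 \<le> a * (1 - b)" "0 \<le> a * b" using a b by auto
  show ?thesis
   by (intro add_nonneg_nonneg mult_nonneg_nonneg[OF c(1) nonneg(2)] mult_nonneg_nonneg[OF c(2) zero_le_power2]
     mult_nonneg_nonneg[OF c(3) nonneg(3)] mult_nonneg_nonneg[OF c(4) nonneg(1)])
 qed
 finally have g12: "0 \<le> g1 * g2" .
 \<comment> \<open>The side function is affine along x y, so its zero at t is a combination of g1
   and g2 with weights of equal sign. As \<open>g1 * g2\<close> is not negative, g1 must vanish;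
   then t1 is a second zero, which an affine function with values of opposite sign at x and y cannot
   have.\<close>
 have "(t2 - t) * g1 + (t - t1) * g2 = (t2 - t1) * ?g (linepath x y t)"
  unfolding g1_def g2_def side_linepath by (simp add: algebra_simps)
 then have sum: "(t2 - t) * g1 + (t - t1) * g2 = 0" using t by simp
 have "0 = ((t2 - t) * g1 + (t - t1) * g2)\<^sup>2" using sum by simp
 also have "\<dots> = ((t2 - t) * g1)\<^sup>2 + ((t - t1) * g2)\<^sup>2 + 2 * ((t - t1) * (t2 - t)) * (g1 * g2)"
  by (simp add: power2_eq_square algebra_simps)
 finally have "((t2 - t) * g1)\<^sup>2 + ((t - t1) * g2)\<^sup>2 + 2 * ((t - t1) * (t2 - t)) * (g1 * g2) = 0" by simp
 moreover have "0 \<le> 2 * ((t - t1) * (t2 - t)) * (g1 * g2)"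
  using between[folded t1_def t2_def t_def] by (intro mult_nonneg_nonneg[OF _ g12]) simp
 ultimately have "((t2 - t) * g1)\<^sup>2 = 0"
  using zero_le_power2[of "(t2 - t) * g1"] zero_le_power2[of "(t - t1) * g2"] by linarith
 moreover have "t \<noteq> t2" "t \<noteq> t1" using between unfolding t1_def t2_def t_def by auto
 ultimately have "?g (linepath x y t1) = 0" unfolding g1_def by simp
 then have "t1 = t" using affine_zero[OF cd(3)] t unfolding side_linepath by blast
 then show False using \<open>t \<noteq> t1\<close> by simp
qed

lemma crossings_list:
 "set (crossings n \<tau> x y) = crossed" "distinct (crossings n \<tau> x y)"
 unfolding crossings_eq by (rule sorted_key_list_of_set_properties[OF crossing_time_inj finite_crossed])+

text \<open>\<open>string_rep\<close> lets only neighbours in the list act on each other; this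
  ensures that it misses no arrow between crossed diagonals.\<close>

lemma crossings_consecutive:
 defines "s \<equiv> crossings n \<tau> x y"
 assumes i: "i < length s" and k: "k < length s" and arrow: "(s ! i, s ! k) \<in> lifted_arrows n \<tau>" and "i \<noteq> k"
 shows "k = i + 1 \<or> i = k + 1"
proof (rule ccontr)
 have less: "crossing_time x y (s ! p) < crossing_time x y (s ! q)" if "p < q" "q < length s" for p q
  using that unfolding s_def crossings_eq
  by (rule sorted_wrt_nth_less[OF sorted_key_list_of_set_properties(3)[OF crossing_time_inj finite_crossed]])
 have mem: "s ! p \<in> crossed" if "p < length s" for p
  using that crossings_list(1) nth_mem unfolding s_def by blast
 assume no: "\<not> (k = i + 1 \<or> i = k + 1)"
 define l where "l = (if i < k then i + 1 else k + 1)"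
 have "i < l \<and> l < k \<or> k < l \<and> l < i" using no \<open>i \<noteq> k\<close> unfolding l_def by auto
 then have "0 < (crossing_time x y (s ! l) - crossing_time x y (s ! i)) * (crossing_time x y (s ! k) - crossing_time x y (s ! l))"
  and l: "l < length s"
  using less[of i l] less[of l k] less[of k l] less[of l i] i k by (auto simp: zero_less_mult_iff)
 then show False using not_between[OF arrow mem[OF i] mem[OF k] mem[OF l]] by blast
qed

end

subsection \<open>Arc representations as string modules\<close>

lemma if_sum_nonzero: "(if P then x else 0) + (if Q then y else 0) \<noteq> (0 :: 'a :: comm_monoid_add) \<Longrightarrow> P \<or> Q"
 by (auto split: if_splits)

context triangulated
begin

text \<open>A coloured chord as a chord on the universal cover: colour False stands for period r and
  colour True for the next one, so that \<open>ep\<close> links the two lifts of the root.\<close>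

definition place :: "int \<Rightarrow> chord \<times> bool \<Rightarrow> chord" where
 "place r j = shift n (r + of_bool (snd j)) (fst j)"

lemma place_eq: "place r (u, c) = shift n (r + of_bool c) u" by (simp add: place_def)

lemma lift_place_eq:
 assumes "u \<in> D" "v \<in> D" "lift n (place r (u, c)) = chord_at t v"
 obtains k where "u = v" "r + of_bool c = 3 * k + t"
proof -
 have "place r (u, c) \<in> I" "shift n t v \<in> I" unfolding place_eq using assms D_I by (simp_all only: shift_I)
 then obtain k where "place r (u, c) = shift n (3 * k) (shift n t v)" using lift_eq assms(3) by blast
 then have "shift n (r + of_bool c) u = shift n (3 * k + t) v" unfolding place_eq by simp
 then show thesis using shift_D_eq[OF assms(1,2)] that by blast
qed

text \<open>The periods r and r + 1 differ modulo 3, so the two colours have different lifts in the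
  polygon.\<close>

lemma inj_lift_place: "inj_on (\<lambda>j. lift n (place r j)) (D \<times> UNIV)"
proof (rule inj_onI)
 fix j l assume "j \<in> D \<times> (UNIV :: bool set)" "l \<in> D \<times> (UNIV :: bool set)" and eq: "lift n (place r j) = lift n (place r l)"
 then obtain u v c d where jl: "j = (u, c)" "l = (v, d)" "u \<in> D" "v \<in> D" by blast
 have "lift n (place r (u, c)) = chord_at (r + of_bool d) v" using eq unfolding jl(1,2) by (simp add: place_eq)
 then obtain k where "u = v" "r + of_bool c = 3 * k + (r + (of_bool d :: int))" by (rule lift_place_eq[OF jl(3,4)])
 moreover have "c = d" using calculation(2) by (cases c; cases d) (simp_all; presburger)+
 ultimately show "j = l" using jl by simp
qed

text \<open>Arrows join diagonals of the same period, or lifts of the root in neighbouring periods.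
  Since periods count modulo 3, the latter can only lead from colour True to colour False.\<close>

lemma lifted_arrow_step:
 assumes j: "j \<in> D \<times> UNIV" and l: "l \<in> D \<times> UNIV"
 shows "(lift n (place r j), lift n (place r l)) \<in> lifted_arrows n \<tau> \<and> a = orbit (lift n (place r j), lift n (place r l))
  \<longleftrightarrow> step a j l" (is "?L \<and> _ \<longleftrightarrow> _")
proof -
 obtain x c y d where jl: "j = (x, c)" "l = (y, d)" "x \<in> D" "y \<in> D" using j l by blast
 have no3: "c = d" if "r + of_bool c = 3 * k + t" "r + of_bool d = 3 * k' + (t :: int)" for k k' t
  using that by (cases c; cases d) (simp_all; presburger)+
 have one: "c \<and> \<not> d" if "r + of_bool c = 3 * k + (t + 1)" "r + of_bool d = 3 * k' + (t :: int)" for k k' t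
  using that by (cases c; cases d) (simp_all; presburger)+
 have a1: "orbit (lift n (place r (x, c)), lift n (place r (y, c))) = ar x y"
  unfolding place_eq orbit_shift ar_def ..
 have a2: "orbit (lift n (place r (root, True)), lift n (place r (root, False))) = ep"
  using orbit_root[of r] by (simp add: place_eq)
 show ?thesis
 proof
  assume L: "?L \<and> a = orbit (lift n (place r j), lift n (place r l))"
  then have "(lift n (place r (x, c)), lift n (place r (y, d))) \<in> lifted_arrows n \<tau>" using jl by simp
  then show "step a j l"
  proof (cases rule: lifted_arrows_cases)
   case (1 u v t)
   obtain k where k: "x = u" "r + of_bool c = 3 * k + t"
    by (rule lift_place_eq[OF jl(3) _ 1(2)]) (use edges_mem[OF 1(1)] in blast)
   obtain k' where k': "y = v" "r + of_bool d = 3 * k' + t"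
    by (rule lift_place_eq[OF jl(4) _ 1(3)]) (use edges_mem[OF 1(1)] in blast)
   have "c = d" using no3 k(2) k'(2) by blast
   then show ?thesis using 1(1) k(1) k'(1) L a1 unfolding step_def jl by simp
  next
   case (2 t)
   obtain k where k: "x = root" "r + of_bool c = 3 * k + (t + 1)" by (rule lift_place_eq[OF jl(3) root_mem 2(1)])
   obtain k' where k': "y = root" "r + of_bool d = 3 * k' + t" by (rule lift_place_eq[OF jl(4) root_mem 2(2)])
   have "c \<and> \<not> d" using one k(2) k'(2) by blast
   then show ?thesis using k(1) k'(1) L a2 unfolding step_def jl by simp
  qed
 next
  assume "step a j l"
  then consider "(x, y) \<in> edges" "a = ar x y" "c = d" | "a = ep" "j = (root, True)" "l = (root, False)"
   unfolding step_def jl by auto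
  then show "?L \<and> a = orbit (lift n (place r j), lift n (place r l))"
  proof cases
   case 1
   then show ?thesis using edge_lifted_arrow[of x y "r + of_bool c"] a1 unfolding jl by (simp add: place_eq)
  next
   case 2
   then show ?thesis using central_lifted_arrow[of r] a2 by (simp add: place_eq)
  qed
 qed
qed

lemma step_ends:
 assumes "step a j l" shows "tail Q a = cl (fst j)" "head Q a = cl (fst l)"
 using assms unfolding step_def by (elim disjE conjE; simp add: tail_ar head_ar tail_ep head_ep)+

lemma project_place: "j \<in> D \<times> UNIV \<Longrightarrow> project n (lift n (place r j)) = cl (fst j)"
 unfolding place_def by (rule project_cl) (simp add: mem_Times_iff)

lemma scl_string_rep: "complex_vector_space (scl (string_rep n \<tau> s))"
 unfolding string_rep_def by unfold_locales (simp_all add: fun_eq_iff algebra_simps)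

lemma string_rep_linear:
 assumes "set s \<subseteq> lift n ` I" "a \<in> arcs Q"
 shows "linear_between (scl (string_rep n \<tau> s)) (scl (string_rep n \<tau> s))
  (spc (string_rep n \<tau> s) (tail Q a)) (spc (string_rep n \<tau> s) (head Q a))
  (mp (string_rep n \<tau> s) a)"
proof -
 have head: "project n e = head Q (orbit (d, e))" if de: "(d, e) \<in> lifted_arrows n \<tau>" for d e using de
 proof (cases rule: lifted_arrows_cases)
  case (1 u v t)
  then show ?thesis using edges_mem[OF 1(1)] tail_orbit(2)[of u v t t] project_cl[of v t] by simp
 next
  case (2 t)
  then show ?thesis using tail_orbit(2)[OF root_mem root_mem, of "t + 1" t] project_cl[OF root_mem, of t] by simp
 qed
 let ?S = "string_rep n \<tau> s"
 have "mp ?S a f \<in> spc ?S (head Q a)" for f unfolding string_rep_def rep.simps mem_Collect_eq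
 proof (intro allI impI)
  fix k
  assume "(if 0 < k \<and> k < length s \<and> (s ! (k - 1), s ! k) \<in> lifted_arrows n \<tau> \<and> a = orbit (s ! (k - 1), s ! k)
     then f (k - 1) else 0) +
    (if k + 1 < length s \<and> (s ! (k + 1), s ! k) \<in> lifted_arrows n \<tau> \<and> a = orbit (s ! (k + 1), s ! k)
     then f (k + 1) else 0) \<noteq> 0"
  then have "k < length s \<and> (\<exists>d. (d, s ! k) \<in> lifted_arrows n \<tau> \<and> a = orbit (d, s ! k))"
   by (elim if_sum_nonzero[THEN disjE]) (elim conjE, intro conjI exI, simp, assumption, assumption)+
  then show "k < length s \<and> project n (s ! k) = head Q a" using head by blast
 qed
 moreover have "mp ?S a (f + g) = mp ?S a f + mp ?S a g" for f g
  unfolding string_rep_def rep.simps by (rule HOL.ext) simp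
 moreover have "mp ?S a (scl ?S c f) = scl ?S c (mp ?S a f)" for c f
  unfolding string_rep_def rep.simps by (rule HOL.ext) (simp add: distrib_left)
 ultimately show ?thesis unfolding linear_between_def by blast
qed

text \<open>The indicator functions of the list positions form the string basis. By
  \<open>consec\<close> an arrow between listed diagonals joins neighbours, so the rule in
  \<open>string_rep\<close> yields exactly the links of \<open>act_on J\<close>.\<close>

lemma string_rep_model:
 assumes J: "J \<subseteq> D \<times> UNIV" and set: "set s = (\<lambda>j. lift n (place r j)) ` J" and dist: "distinct s"
  and consec: "\<And>i k. i < length s \<Longrightarrow> k < length s \<Longrightarrow> i \<noteq> k \<Longrightarrow> (s ! i, s ! k) \<in> lifted_arrows n \<tau> \<Longrightarrow>
   k = i + 1 \<or> i = k + 1" shows "\<exists>b. string_model Q (string_rep n \<tau> s) J (cl \<circ> fst) (act_on J) b"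
proof -
 let ?S = "string_rep n \<tau> s"
 define \<pi> where "\<pi> = (\<lambda>j. lift n (place r j))"
 have inj: "inj_on \<pi> J" unfolding \<pi>_def by (rule inj_on_subset[OF inj_lift_place J])
 have fin: "finite J" using finite_D J by (rule_tac finite_subset[of J "D \<times> UNIV"]) auto
 define idx where "idx = (\<lambda>j. SOME i. i < length s \<and> s ! i = \<pi> j)"
 have idx: "idx j < length s" "s ! idx j = \<pi> j" if "j \<in> J" for j
 proof -
  have "\<pi> j \<in> set s" using that set unfolding \<pi>_def by blast
  then have "\<exists>i. i < length s \<and> s ! i = \<pi> j" by (simp add: in_set_conv_nth)
  from someI_ex[OF this] show "idx j < length s" "s ! idx j = \<pi> j" unfolding idx_def by blast+
 qed
 have idx_inj: "j = l" if "j \<in> J" "l \<in> J" "idx j = idx l" for j l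
  using idx(2)[OF that(1)] idx(2)[OF that(2)] that inj unfolding inj_on_def by metis
 have idx_surj: "\<exists>j\<in>J. idx j = i" if i: "i < length s" for i
 proof -
  have "s ! i \<in> \<pi> ` J" using nth_mem[OF i] set unfolding \<pi>_def by simp
  then obtain j where j: "j \<in> J" "s ! i = \<pi> j" by blast
  have "idx j = i" using idx[OF j(1)] j(2) i dist nth_eq_iff_index_eq by metis
  then show ?thesis using j(1) by blast
 qed
 have proj: "project n (s ! idx j) = cl (fst j)" if "j \<in> J" for j
  unfolding idx(2)[OF that] \<pi>_def by (rule project_place) (use J that in blast)
 define b :: "chord \<times> bool \<Rightarrow> nat \<Rightarrow> complex" where "b = (\<lambda>j k. if k = idx j then 1 else 0)"
 interpret complex_vector_space "scl ?S" by (rule scl_string_rep)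
 have scl: "scl ?S c f = (\<lambda>k. c * f k)" for c f by (simp add: string_rep_def)
 have coeff: "(\<Sum>j\<in>F. scl ?S (c j) (b j)) k = (if \<exists>j\<in>F. idx j = k then c (THE j. j \<in> F \<and> idx j = k) else 0)"
  if F: "F \<subseteq> J" for F c k
 proof (cases "\<exists>j\<in>F. idx j = k")
  case True
  then obtain l where l: "l \<in> F" "idx l = k" by blast
  have the: "(THE j. j \<in> F \<and> idx j = k) = l"
  proof (rule the_equality)
   show "j = l" if "j \<in> F \<and> idx j = k" for j using idx_inj[of j l] F l that by (metis subsetD)
  qed (use l in simp)
  have "(\<Sum>j\<in>F. scl ?S (c j) (b j)) k = (\<Sum>j\<in>F. c j * b j k)" unfolding sum_fun_apply scl ..
  also have "\<dots> = (\<Sum>j\<in>F. if j = l then c j else 0)"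
  proof (rule sum.cong[OF refl])
   fix j assume "j \<in> F"
   then show "c j * b j k = (if j = l then c j else 0)"
    using idx_inj[of j l] F l by (metis b_def mult.right_neutral mult_zero_right subsetD)
  qed
  also have "\<dots> = c l" using l(1) finite_subset[OF F fin] by simp
  finally show ?thesis using True the by simp
 next
  case False
  have "(\<Sum>j\<in>F. scl ?S (c j) (b j)) k = (\<Sum>j\<in>F. c j * b j k)" unfolding sum_fun_apply scl ..
  also have "\<dots> = 0" using False by (intro sum.neutral) (auto simp: b_def)
  finally show ?thesis using False by simp
 qed
 have coeff_idx: "(\<Sum>j\<in>F. scl ?S (c j) (b j)) (idx l) = c l" if "F \<subseteq> J" "l \<in> F" for F c l
 proof -
  have "(THE j. j \<in> F \<and> idx j = idx l) = l"
  proof (rule the_equality)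
   show "j = l" if "j \<in> F \<and> idx j = idx l" for j
    using idx_inj[of j l] \<open>F \<subseteq> J\<close> \<open>l \<in> F\<close> that by (metis subsetD)
  qed (use that in simp)
  then show ?thesis unfolding coeff[OF that(1)] using that(2) by auto
 qed
 let ?F = "\<lambda>i. {j \<in> J. (cl \<circ> fst) j = i}"
 have F: "finite (?F i)" "?F i \<subseteq> J" for i using fin by auto
 have indep: "inj_on b (?F i)" "independent (b ` ?F i)" for i
 proof -
  have zero: "\<forall>j\<in>?F i. c j = 0" if "(\<Sum>j\<in>?F i. scl ?S (c j) (b j)) = 0" for c
  proof
   fix j assume j: "j \<in> ?F i"
   show "c j = 0" using coeff_idx[OF F(2) j, of c] unfolding that by simp
  qed
  show "inj_on b (?F i)" "independent (b ` ?F i)" using family_independent[OF F(1), of b i] zero by blast+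
 qed
 have span: "span (b ` ?F i) = spc ?S i" for i
 proof -
  have spc: "spc ?S i = {f. \<forall>k. f k \<noteq> 0 \<longrightarrow> k < length s \<and> project n (s ! k) = i}" by (simp add: string_rep_def)
  have mem: "(\<Sum>j\<in>?F i. scl ?S (c j) (b j)) \<in> spc ?S i" for c
   unfolding spc mem_Collect_eq coeff[OF F(2)] using idx(1) proj by auto
  have eq: "f = (\<Sum>j\<in>?F i. scl ?S (f (idx j)) (b j))" if f: "f \<in> spc ?S i" for f
  proof
   fix k
   show "f k = (\<Sum>j\<in>?F i. scl ?S (f (idx j)) (b j)) k"
   proof (cases "\<exists>j\<in>?F i. idx j = k")
    case True
    then obtain l where l: "l \<in> ?F i" "idx l = k" by blast
    show ?thesis using coeff_idx[OF F(2) l(1), of "\<lambda>j. f (idx j)"] unfolding l(2) by simp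
   next
    case False
    have "f k = 0"
    proof (rule ccontr)
     assume "f k \<noteq> 0"
     then have k: "k < length s" "project n (s ! k) = i" using f unfolding spc by auto
     then obtain j where j: "j \<in> J" "idx j = k" using idx_surj by blast
     then have "j \<in> ?F i" using proj[OF j(1)] k(2) by simp
     then show False using False j(2) by blast
    qed
    then show ?thesis by (simp only: coeff[OF F(2)] False if_False)
   qed
  qed
  have "{\<Sum>j\<in>?F i. scl ?S (c j) (b j) |c. True} = spc ?S i"
  proof (intro subset_antisym subsetI)
   fix f assume "f \<in> {\<Sum>j\<in>?F i. scl ?S (c j) (b j) |c. True}"
   then obtain c where "f = (\<Sum>j\<in>?F i. scl ?S (c j) (b j))" by blast
   then show "f \<in> spc ?S i" using mem[of c] by simp
  next
   fix f assume "f \<in> spc ?S i"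
   then show "f \<in> {\<Sum>j\<in>?F i. scl ?S (c j) (b j) |c. True}" by (intro CollectI exI conjI) (rule eq, simp_all)
  qed
  then show ?thesis unfolding span_family[OF F(1) indep(1)] .
 qed
 have entry: "mp ?S a (b j) (idx l) = (if step a j l then 1 else 0)" if j: "j \<in> J" and l: "l \<in> J" for a j l
 proof -
  have step: "(s ! idx j, s ! idx l) \<in> lifted_arrows n \<tau> \<and> a = orbit (s ! idx j, s ! idx l) \<longleftrightarrow> step a j l"
   unfolding idx(2)[OF j] idx(2)[OF l] \<pi>_def using J j l by (intro lifted_arrow_step) auto
  have irrefl: "\<not> step a j j" using edges_irrefl unfolding step_def by auto
  have adj: "idx l = idx j + 1 \<or> idx j = idx l + 1" if "step a j l"
  proof (rule consec[OF idx(1)[OF j] idx(1)[OF l]])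
   show "idx j \<noteq> idx l" using idx_inj[OF j l] irrefl that by auto
  qed (use step that in blast)
  let ?step = "(s ! idx j, s ! idx l) \<in> lifted_arrows n \<tau> \<and> a = orbit (s ! idx j, s ! idx l)"
  note bounds = idx(1)[OF j] idx(1)[OF l]
  consider "idx l = idx j + 1" | "idx j = idx l + 1" | "idx l \<noteq> idx j + 1" "idx j \<noteq> idx l + 1" by blast
  then have "mp ?S a (b j) (idx l) = (if ?step then 1 else 0)"
  proof cases
   case 1
   then show ?thesis using bounds by (simp add: string_rep_def b_def)
  next
   case 2
   have e: "b j (idx l - 1) = 0" "b j (idx l + 1) = 1" "idx l + 1 < length s"
    using 2 bounds unfolding b_def by auto
   have "mp ?S a (b j) (idx l) = (if (s ! (idx l + 1), s ! idx l) \<in> lifted_arrows n \<tau> \<and>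
     a = orbit (s ! (idx l + 1), s ! idx l) then 1 else 0)"
    unfolding string_rep_def rep.simps e(1,2) using e(3) by simp
   then show ?thesis unfolding 2 .
  next
   case 3
   then have "b j (idx l + 1) = 0" "0 < idx l \<Longrightarrow> b j (idx l - 1) = 0" unfolding b_def by auto
   moreover have "\<not> ?step" using 3 adj step by blast
   ultimately show ?thesis by (simp only: string_rep_def rep.simps if_False) simp
  qed
  then show ?thesis unfolding step .
 qed
 have outside: "mp ?S a f k = 0" if "\<not> k < length s" for a f k using that by (simp add: string_rep_def)
 have act: "mp ?S a (b j) = (case act_on J a j of None \<Rightarrow> 0 | Some l \<Rightarrow> b l)" if j: "j \<in> J" for a j
 proof
  fix k
  show "mp ?S a (b j) k = (case act_on J a j of None \<Rightarrow> 0 | Some l \<Rightarrow> b l) k"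
  proof (cases "k < length s")
   case True
   then obtain l where l: "l \<in> J" "idx l = k" using idx_surj by blast
   show ?thesis
   proof (cases "act_on J a j")
    case None
    then have "\<not> step a j l" using l(1) act_on_None by blast
    then show ?thesis using entry[OF j l(1), of a] None l(2) by simp
   next
    case (Some l')
    then have l': "l' \<in> J" "step a j l'" unfolding act_on_Some by blast+
    then have "step a j l \<longleftrightarrow> l = l'" using step_functional by blast
    then show ?thesis using entry[OF j l(1), of a] Some l(2) idx_inj[OF l(1) l'(1)] by (auto simp: b_def)
   qed
  next
   case False
   then show ?thesis using outside[OF False] idx(1) act_on_Some by (auto simp: b_def split: option.split)
  qed
 qed
 have "string_model Q ?S J (cl \<circ> fst) (act_on J) b"
 proof (unfold_locales)
  show "finite J" by fact
  show "(cl \<circ> fst) k \<in> verts Q" if "k \<in> J" for k using that J verts by auto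
  show "inj_on b (?F i)" "independent (b ` ?F i)" "span (b ` ?F i) = spc ?S i" for i by (rule indep span)+
  show "mp ?S a (b k) = (case act_on J a k of None \<Rightarrow> 0 | Some l \<Rightarrow> b l)" if "k \<in> J" for a k
   by (rule act[OF that])
  show "l \<in> J \<and> (cl \<circ> fst) l = head Q a" if "act_on J a k = Some l" for a k l
   using that step_ends(2)[of a k l] unfolding act_on_Some by simp
  show "k = k'" if "act_on J a k = Some l" "act_on J a k' = Some l" for a k k' l
   using that step_injective unfolding act_on_Some by blast
 qed
 then show ?thesis by blast
qed

end

context triangulated
begin

text \<open>For A in the period of D: a chord (A, B) that stays in this period crosses chords of one
  colour only; otherwise it leaves through the root and ends in the next period, at the translate of
  the vertex B - h.\<close>

definition strands :: "int \<Rightarrow> int \<Rightarrow> (chord \<times> bool) set" where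
 "strands A B = (if B \<le> lo + h then crossing_strand A B else strand A False \<union> strand (B - h) True)"

lemma strands_subset: "strands A B \<subseteq> D \<times> UNIV" unfolding strands_def crossing_strand_def strand_def by auto

lemma strands_iff:
 assumes "x \<in> D" shows "(x, c) \<in> strands A B \<longleftrightarrow>
  (if B \<le> lo + h then \<not> c \<and> crosses A B x
   else if c then fst x < B - h \<and> B - h < snd x else fst x < A \<and> A < snd x)"
 using assms by (cases c) (simp_all add: strands_def crossing_strand_def strand_def)

text \<open>A chord of length at most h that starts in the period of D can cross only chords of this
  period and of the next one, which are the two colours.\<close>

lemma interlaced_shift_D:
 assumes "x \<in> D" "2 \<le> B - A" "B - A \<le> h" "lo \<le> A" "A < lo + h"
 shows "interlaced A B (fst x + r * h) (snd x + r * h) \<longleftrightarrow> (\<exists>c. r = of_bool c \<and> (x, c) \<in> strands A B)"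
proof -
 note b = D_bounds[OF assms(1)] chord_bounds[OF assms(1)]
 have r: "r = 0 \<or> r = 1" if il: "interlaced A B (fst x + r * h) (snd x + r * h)"
 proof -
  define q where "q = r * h"
  have "- 1 * h < q" "q < 2 * h" using il[folded q_def] b assms unfolding interlaced_def by auto
  then have "- 1 < r" "r < 2" unfolding q_def by (auto simp only: mult_less_cancel_right)
  then show ?thesis by auto
 qed
 have "interlaced A B (fst x) (snd x) \<longleftrightarrow> (x, False) \<in> strands A B"
  using b assms unfolding strands_iff[OF assms(1)] interlaced_def crosses_def by auto
 moreover have "interlaced A B (fst x + h) (snd x + h) \<longleftrightarrow> (x, True) \<in> strands A B"
  using b assms unfolding strands_iff[OF assms(1)] interlaced_def by auto
 ultimately show ?thesis using r by (cases "r = 0 \<or> r = 1") (auto simp: ex_bool_eq)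
qed

lemma crossed_strands:
 assumes "2 \<le> B - A" "B - A \<le> h" "lo \<le> A" "A < lo + h"
 shows "{y \<in> I. interlaced (A + t * h) (B + t * h) (fst y) (snd y)} = place t ` strands A B"
proof (intro set_eqI iffI)
 have il: "interlaced (A + t * h) (B + t * h) (fst (shift n s x)) (snd (shift n s x)) \<longleftrightarrow>
  (\<exists>c. s - t = of_bool c \<and> (x, c) \<in> strands A B)" if x: "x \<in> D" for s x
 proof -
  have "interlaced (A + t * h) (B + t * h) (fst (shift n s x)) (snd (shift n s x)) \<longleftrightarrow>
   interlaced A B (fst x + (s - t) * h) (snd x + (s - t) * h)"
   unfolding interlaced_def by (simp add: algebra_simps)
  then show ?thesis using interlaced_shift_D[OF x assms] by blast
 qed
 fix y
 show "y \<in> place t ` strands A B" if "y \<in> {y \<in> I. interlaced (A + t * h) (B + t * h) (fst y) (snd y)}"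
 proof -
  have y: "y \<in> I" "interlaced (A + t * h) (B + t * h) (fst y) (snd y)" using that by auto
  obtain x s where x: "x \<in> D" "y = shift n s x" by (rule I_cases[OF y(1)])
  obtain c where c: "s - t = of_bool c" "(x, c) \<in> strands A B" using y(2) il[OF x(1)] unfolding x(2) by blast
  have "y = place t (x, c)" unfolding place_eq x(2) c(1)[symmetric] by simp
  then show ?thesis using c(2) by blast
 qed
 show "y \<in> {y \<in> I. interlaced (A + t * h) (B + t * h) (fst y) (snd y)}" if yp: "y \<in> place t ` strands A B"
 proof -
  obtain j where j: "j \<in> strands A B" "y = place t j" using yp by blast
  obtain x c where jxc: "j = (x, c)" by (cases j)
  have xc: "(x, c) \<in> strands A B" "y = shift n (t + of_bool c) x" using j unfolding jxc place_eq .
  have x: "x \<in> D" using xc(1) strands_subset by blast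
  have "y \<in> I" unfolding xc(2) using D_I[OF x] by (simp only: shift_I)
  moreover have "interlaced (A + t * h) (B + t * h) (fst y) (snd y)"
   unfolding xc(2) il[OF x] using xc(1) by (intro exI[of _ c]) simp
  ultimately show ?thesis by blast
 qed
qed

text \<open>Whatever lift the choice operator in \<open>arc_rep\<close> returns, it has the same
  class as (A, B) and hence is a shift of it.\<close>

lemma arc_rep_not_mem:
 assumes "2 \<le> B - A" "B - A \<le> h" "(A, B) \<notin> I"
 obtains x y t where "arc_rep n \<tau> (cls n A B) = undecorated (string_rep n \<tau> (crossings n \<tau> x y))"
  "{x, y} = lift n (A + t * h, B + t * h)"
proof -
 let ?P = "\<lambda>(x, y). {x, y} \<in> diagonals n \<and> project n {x, y} = cls n A B"
 have "?P (vtx n A, vtx n B)" using vtx_diagonal project_short assms by simp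
 then have P: "?P (SOME p. ?P p)" by (rule someI)
 obtain x y where xy: "(SOME p. ?P p) = (x, y)" by (cases "SOME p. ?P p")
 have d: "{x, y} \<in> diagonals n" "project n {x, y} = cls n A B" using P unfolding xy by auto
 have nin: "cls n A B \<notin> \<tau>" using assms unfolding I_def by auto
 have "cls n A B \<in> arc_classes n" using cls_arc_classes[OF n] assms by blast
 then obtain a b where ab: "{x, y} = {vtx n a, vtx n b}" "2 \<le> b - a" "b - a \<le> h"
  using diagonal_project[OF n d(1)] d(2) by metis
 have "cls n A B = cls n a b" using d(2) project_short[of a b n] ab by simp
 then obtain t where t: "a = A + t * h" "b = B + t * h" using cls_eq[of A B n a b] assms ab(2,3) by auto
 have "arc_rep n \<tau> (cls n A B) = undecorated (string_rep n \<tau> (crossings n \<tau> x y))"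
  using nin xy unfolding arc_rep_def by simp
 moreover have "{x, y} = lift n (A + t * h, B + t * h)" using ab(1) t by (simp add: lift_def)
 ultimately show thesis by (rule that)
qed

lemma dec_iso_undecorated:
 assumes "vector_space (scl M)" "vector_space (scl N)"
 shows "dec_iso Q (undecorated M) (undecorated N) \<longleftrightarrow> rep_iso Q M N"
proof -
 interpret M: vector_space "scl M" by fact
 interpret N: vector_space "scl N" by fact
 have "linear_between (scl M) (scl N) {0} {0} (\<lambda>_. 0) \<and> bij_betw (\<lambda>_. 0) {0} {0}"
  by (simp add: linear_between_def bij_betw_def)
 then show ?thesis unfolding dec_iso_def undecorated_def by auto
qed

text \<open>The arc representation has a string basis indexed by \<open>strands A B\<close>; having
  a basis with the same combinatorics is equivalent to being isomorphic to it.\<close>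

lemma arc_rep_iso:
 assumes rep: "is_rep Q (R) N" and AB: "2 \<le> B - A" "B - A \<le> h" "(A, B) \<notin> I" "lo \<le> A" "A < lo + h"
 shows "dec_iso Q (undecorated N) (arc_rep n \<tau> (cls n A B)) \<longleftrightarrow> modelled N (strands A B)"
proof -
 obtain x y t where xy: "arc_rep n \<tau> (cls n A B) = undecorated (string_rep n \<tau> (crossings n \<tau> x y))"
  "{x, y} = lift n (A + t * h, B + t * h)" using arc_rep_not_mem[OF AB(1-3)] by blast
 interpret c: oriented_crossing_chord n \<tau> "A + t * h" "B + t * h" x y
  by unfold_locales (use AB xy(2) I_shift in simp_all)
 let ?s = "crossings n \<tau> x y"
 have set: "set ?s = (\<lambda>j. lift n (place t j)) ` strands A B"
  unfolding c.crossings_list(1) c.crossed_def crossed_strands[OF AB(1,2,4,5)] image_image ..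
 obtain b' where M: "string_model Q (string_rep n \<tau> ?s) (strands A B) (cl \<circ> fst) (act_on (strands A B)) b'"
  using string_rep_model[OF strands_subset set c.crossings_list(2) c.crossings_consecutive] by blast
 have "set ?s \<subseteq> lift n ` I" unfolding c.crossings_list(1) c.crossed_def by blast
 note M_linear = string_rep_linear[OF this]
 have N: "vector_space (scl N)" "\<And>i. i \<in> verts Q \<Longrightarrow> module.subspace (scl N) (spc N i)"
  and N_linear: "\<And>a. a \<in> arcs Q \<Longrightarrow> linear_between (scl N) (scl N)
   (spc N (tail Q a)) (spc N (head Q a)) (mp N a)" using rep unfolding is_rep_def by blast+
 have "rep_iso Q N (string_rep n \<tau> ?s) \<longleftrightarrow> modelled N (strands A B)"
 proof
  assume iso: "rep_iso Q N (string_rep n \<tau> ?s)"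
  have mem: "mp N a v \<in> spc N (head Q a)" if "a \<in> arcs Q" "v \<in> spc N (tail Q a)" for a v
   using N_linear[OF that(1)] that(2) unfolding linear_between_def by blast
  obtain b where "string_model Q N (strands A B) (cl \<circ> fst) (act_on (strands A B)) b"
   using string_model_transfer[OF iso M N mem tails heads] by blast
  then show "modelled N (strands A B)" unfolding modelled_def using strands_subset by blast
 next
  assume "modelled N (strands A B)"
  then obtain b where "string_model Q N (strands A B) (cl \<circ> fst) (act_on (strands A B)) b"
   unfolding modelled_def by blast
  then show "rep_iso Q N (string_rep n \<tau> ?s)"
   by (rule string_model_iso[OF _ M N_linear M_linear tails heads])
 qed
 moreover have "vector_space (scl (string_rep n \<tau> ?s))"
  using scl_string_rep by (simp add: complex_vector_space_def)
 ultimately show ?thesis unfolding xy(1) using dec_iso_undecorated N(1) by blast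
qed

theorem E_rigid_iff:
 assumes rep: "is_rep Q (R) N" and indec: "indecomposable Q (R) N" shows "E_rigid Q (R) N \<longleftrightarrow>
  (\<exists>j\<in>arc_classes n. dec_iso Q (undecorated N) (arc_rep n \<tau> j))" (is "_ \<longleftrightarrow> ?arc")
proof
 interpret tree_rep D lo "lo + int n + 1" "Q" "R" cl ar ep N
  by unfold_locales (use rep in \<open>auto simp: is_rep_def vector_space_def module_def\<close>)
 have iso: ?arc
  if "2 \<le> B - A" "B - A \<le> h" "(A, B) \<notin> I" "lo \<le> A" "A < lo + h" "modelled N (strands A B)" for A B
  using arc_rep_iso[OF rep that(1-5)] that(6) cls_arc_classes[OF n that(1,2)] by blast
 assume rigid: "E_rigid Q (R) N"
 from classification[OF indec]
 show ?arc
 proof (elim disjE exE conjE)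
  fix k l assume kl: "lo \<le> k" "k + 2 \<le> l" "l \<le> lo + int n + 1" "(k, l) \<notin> D" and mod: "modelled N (crossing_strand k l)"
  have s: "strands k l = crossing_strand k l" using kl by (simp add: strands_def)
  have "(k, l) \<notin> I" using kl by (simp add: D_iff)
  then show ?thesis using iso[of l k] kl mod unfolding s by simp
 next
  fix k l assume kl: "lo < k" "k < lo + int n + 1" "lo \<le> l" "l < lo + int n + 1"
   and mod: "modelled N (strand k False \<union> strand l True)"
  have "lo < l" "l \<le> k" using E_rigid_modelled(2)[OF rep mod refl kl] rigid by auto
  have s: "strands k (l + h) = strand k False \<union> strand l True" using \<open>lo < l\<close> by (simp add: strands_def)
  \<comment> \<open>This chord crosses the root. Its length is at most h because of
    \<open>l \<le> k\<close>, so it does define an arc.\<close>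
  have "(k, l + h) \<notin> I" using I_not_interlaced[OF root_I, of k "l + h"] kl \<open>lo < l\<close> unfolding interlaced_def by auto
  then show ?thesis using iso[of "l + h" k] kl mod \<open>lo < l\<close> \<open>l \<le> k\<close> unfolding s by simp
 qed
next
 assume ?arc
 then obtain j where j: "j \<in> arc_classes n" "dec_iso Q (undecorated N) (arc_rep n \<tau> j)" by blast
 \<comment> \<open>For j in \<tau> the underlying representation of the arc representation is zero,
   whereas an indecomposable representation is not.\<close>
 have "j \<notin> \<tau>"
 proof
  assume "j \<in> \<tau>"
  then have "rep_iso Q N (fst (negative_simple j))" using j(2) by (simp add: arc_rep_def dec_iso_def undecorated_def)
  then obtain \<phi> where "\<And>i. i \<in> verts Q \<Longrightarrow> bij_betw (\<phi> i) (spc N i) {0 :: nat \<Rightarrow> complex}"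
   unfolding rep_iso_def negative_simple_def by auto
  then have one: "is_singleton (spc N i)" if "i \<in> verts Q" for i
   using bij_betw_same_card[of "\<phi> i" "spc N i" "{0}"] that by (simp add: is_singleton_altdef)
  have "spc N i = {0}" if i: "i \<in> verts Q" for i
  proof -
   have "module.subspace (scl N) (spc N i)" "module (scl N)"
    using rep i unfolding is_rep_def vector_space_def by (auto simp: module_iff_vector_space vector_space_def)
   then have "0 \<in> spc N i" using module.subspace_0 by blast
   then show ?thesis using one[OF i] by (auto simp: is_singleton_def)
  qed
  then show False using indec unfolding indecomposable_def zero_rep_def by blast
 qed
 obtain a b where ab: "2 \<le> b - a" "b - a \<le> h" "j = cls n a b" using arc_classes_subset[OF n j(1)] by blast
 \<comment> \<open>The lift of j is moved so that it starts in the period of D.\<close>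
 define t where "t = (a - lo) div h"
 define A B where "A = a - t * h" and "B = b - t * h"
 have "a - lo = t * h + (a - lo) mod h" unfolding t_def by (rule div_mult_mod_eq[symmetric])
 moreover have "0 \<le> (a - lo) mod h" "(a - lo) mod h < h" by (rule pos_mod_sign pos_mod_bound, simp)+
 ultimately have A: "lo \<le> A" "A < lo + h" unfolding A_def by linarith+
 have B: "2 \<le> B - A" "B - A \<le> h" using ab unfolding A_def B_def by auto
 have jAB: "j = cls n A B" using cls_shift[of n A t B] ab(3) unfolding A_def B_def by simp
 have nin: "(A, B) \<notin> I" using I_D(3) jAB \<open>j \<notin> \<tau>\<close> by blast
 have mod: "modelled N (strands A B)" using arc_rep_iso[OF rep B nin A] j(2) jAB by simp
 show "E_rigid Q (R) N"
 proof (cases "B \<le> lo + h")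
  case True
  have s: "strands A B = crossing_strand A B" using True by (simp add: strands_def)
  have "(A, B) \<notin> D" using nin D_I by blast
  then show ?thesis using E_rigid_modelled(1)[OF rep mod s] A B True by simp
 next
  case False
  have s: "strands A B = strand A False \<union> strand (B - h) True" using False by (simp add: strands_def)
  show ?thesis using E_rigid_modelled(2)[OF rep mod s] A B False by simp
 qed
qed

end

theorem lemma10p5:
  fixes n :: nat and \<tau> :: "arc_class set"
    and N :: "(arc_class, lifted_arrow set, 'v::ab_group_add) rep"
  assumes "n \<ge> 2"
    and "orbifold_triangulation n \<tau>"
    and "is_rep (quiver_of n \<tau>) (jacobian_relations n \<tau>) N"
    and "indecomposable (quiver_of n \<tau>) (jacobian_relations n \<tau>) N"
  shows "E_rigid (quiver_of n \<tau>) (jacobian_relations n \<tau>) N \<longleftrightarrow>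
         (\<exists>j\<in>arc_classes n. dec_iso (quiver_of n \<tau>) (undecorated N) (arc_rep n \<tau> j))"
proof -
  interpret triangulated n \<tau> by unfold_locales (rule assms(1,2))+
  show ?thesis by (rule E_rigid_iff[OF assms(3,4)])
qed

end
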